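(* Let $d=1$, $T>0$, and let $B$ be a one-dimensional fractional Brownian motion with Hurst parameter $0<H<\frac16$, where $\frac1H$ is not an integer; let $\gamma<H$ with $\lfloor1/\gamma\rfloor=\lfloor1/H\rfloor$, and let $\mathbf{B}(\omega)\in\mathscr{C}^\gamma_g$ be the geometric rough path lift of $B(\omega)$. Assume $b\in L^\infty([0,T]\times\mathbb{R})\cap L^1(\mathbb{R};L^\infty([0,T]))$, and $u_0\in C^1(\mathbb{R})$ with $u_0'\in L^1(\mathbb{R})$. Then there exists a subset $\Omega^*\subset\Omega$ of full measure such that for every $\omega\in\Omega^*$ there exists a weak controlled solution of $$\partial_tu+b\,\nabla u+\nabla u\,d\mathbf{B}_t(\omega)=0,\qquad u|_{t=0}=u_0 .$$
   Context: **Fractional Brownian motion.** $B$ is a centered continuous Gaussian process with covariance $\frac12(t^{2H}+s^{2H}-|t-s|^{2H})$. In dimension one its geometric lift is $B^{(n)}_{st}=\frac{1}{n!}(B_t-B_s)^n$, $1\le n\le\lfloor1/H\rfloor$. **Rough paths** (here $d=1$). Let $p=\lfloor1/\gamma\rfloor$. A $\gamma$-rough path is a map $(s,t)\mapsto\mathbf{X}_{st}=(1,X^{(1)}_{st},\dots,X^{(p)}_{st})\in\bigoplus_{n=0}^p(\mathbb{R}^d)^{\otimes n}$, $0\le s<t\le T$, with $X^{(n)}_{st}=\sum_{k=0}^nX^{(n-k)}_{su}\otimes X^{(k)}_{ut}$ and $|X^{(n)}_{st}|\lesssim|t-s|^{n\gamma}$. $\mathscr{C}^\gamma_g$ is the closure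 of canonical lifts of $C^1$ paths (iterated integrals) in the metric $\varrho_\gamma(\mathbf{X},\tilde{\mathbf{X}})=\sum_{n=1}^p\sup_{s<t}|X^{(n)}_{st}-\tilde X^{(n)}_{st}|/|t-s|^{n\gamma}$. **Controlled paths and integral.** $\mathscr{D}^{p\gamma}_{\mathbf{X}}$ is the set of $\mathbf{Y}=(Y^{(1)},\dots,Y^{(p)}):[0,T]\to\bigoplus_{n=1}^p\mathcal{L}((\mathbb{R}^d)^{\otimes n})$ ($\mathcal{L}(V)$ = linear functionals on $V$) such that $Y^{(k)\sharp}_{st}:=Y^{(k)}_t-\sum_{n=k}^pY^{(n)}_sX^{(n-k)}_{st}$ satisfies $|Y^{(k)\sharp}_{st}|\lesssim|t-s|^{(p+1-k)\gamma}$, $k=1,\dots,p$. A path is controlled by $\mathbf{X}$ if it is the first component of such a $\mathbf{Y}$; its rough integral is $\int_s^t\mathbf{Y}_r\,d\mathbf{X}_r=\lim_{|\mathcal P|\to0}\sum_{[u,v]\in\mathcal P}\sum_{n=1}^pY^{(n)}_uX^{(n)}_{uv}$ over partitions $\mathcal P$ of $[s,t]$. **Weak controlled solution** (of $\partial_tu+b\cdot\nabla u+\nabla u\,d\mathbf{X}_t=0$, $u|_{t=0}=u_0$): a function $u:[0,T]\times\mathbb{R}^d\to\mathbb{R}$ with $u(t,\cdot)\in W^{1,2}(U)$ for all $t\in[0,T]$ and all open bounded $U\subset\mathbb{R}^d$, such that for all $\eta\in C_c^\infty(\mathbb{R}^d)$ the path $t\mapsto\int_{\mathbb{R}^d}\nabla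 u(t,x)\eta(x)\,dx$ is controlled by $\mathbf{X}$ and for all $t\in[0,T]$ $$\int u(t,x)\eta(x)dx+\int_0^t\!\int\nabla u(r,x)\cdot b(r,x)\eta(x)\,dx\,dr+\int_0^t\!\int\nabla u(r,x)\eta(x)\,dx\,d\mathbf{X}_r=\int u_0(x)\eta(x)\,dx .$$ *)

theory Defs
  imports "HOL-Probability.Probability"
begin

section \<open>Fractional Brownian motion\<close>

text \<open>A Gaussian random variable may be degenerate (variance zero), which has to be allowed
  for since \<^term>\<open>normal_density\<close> requires a positive standard deviation to be a density.\<close>

definition gaussian_rv :: "'a measure \<Rightarrow> ('a \<Rightarrow> real) \<Rightarrow> bool" where
  "gaussian_rv M Z \<longleftrightarrow> Z \<in> borel_measurable M \<and>
     (\<exists>\<mu> \<sigma>. (\<sigma> = 0 \<and> (AE \<omega> in M. Z \<omega> = \<mu>)) \<or>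
            (\<sigma> > 0 \<and> distributed M lborel Z (\<lambda>x. ennreal (normal_density \<mu> \<sigma> x))))"

definition gaussian_process :: "'a measure \<Rightarrow> real set \<Rightarrow> (real \<Rightarrow> 'a \<Rightarrow> real) \<Rightarrow> bool" where
  "gaussian_process M I Z \<longleftrightarrow>
     (\<forall>J c. finite J \<and> J \<subseteq> I \<longrightarrow> gaussian_rv M (\<lambda>\<omega>. \<Sum>t\<in>J. c t * Z t \<omega>))"

definition fractional_brownian_motion ::
  "'a measure \<Rightarrow> real \<Rightarrow> real \<Rightarrow> (real \<Rightarrow> 'a \<Rightarrow> real) \<Rightarrow> bool" where
  "fractional_brownian_motion M H T B \<longleftrightarrow>
     prob_space M \<and>
     gaussian_process M {0..T} B \<and>
     (\<forall>t\<in>{0..T}. prob_space.expectation M (B t) = 0) \<and>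
     (\<forall>s\<in>{0..T}. \<forall>t\<in>{0..T}. prob_space.expectation M (\<lambda>\<omega>. B s \<omega> * B t \<omega>) =
        (t powr (2 * H) + s powr (2 * H) - \<bar>t - s\<bar> powr (2 * H)) / 2) \<and>
     (AE \<omega> in M. continuous_on {0..T} (\<lambda>t. B t \<omega>))"


section \<open>Rough paths over the real line\<close>

text \<open>All tensor powers of \<open>\<real>\<close>, and the linear functionals on them, are identified with
  \<open>\<real>\<close>. A rough path is a family \<open>X n s t\<close>, where only the values with \<open>n \<le> \<lfloor>1/\<gamma>\<rfloor>\<close>
  and \<open>0 \<le> s < t \<le> T\<close> matter.\<close>

definition rough_level :: "real \<Rightarrow> nat" where
  "rough_level \<gamma> = nat \<lfloor>1 / \<gamma>\<rfloor>"

definition rough_path :: "real \<Rightarrow> real \<Rightarrow> (nat \<Rightarrow> real \<Rightarrow> real \<Rightarrow> real) \<Rightarrow> bool" where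
  "rough_path \<gamma> T X \<longleftrightarrow>
     (\<forall>s t. 0 \<le> s \<and> s < t \<and> t \<le> T \<longrightarrow> X 0 s t = 1) \<and>
     (\<forall>n \<le> rough_level \<gamma>. \<forall>s u t. 0 \<le> s \<and> s < u \<and> u < t \<and> t \<le> T \<longrightarrow>
        X n s t = (\<Sum>k\<le>n. X (n - k) s u * X k u t)) \<and>
     (\<forall>n\<in>{1..rough_level \<gamma>}. \<exists>C. \<forall>s t. 0 \<le> s \<and> s < t \<and> t \<le> T \<longrightarrow>
        \<bar>X n s t\<bar> \<le> C * (t - s) powr (real n * \<gamma>))"

definition rough_dist ::
  "real \<Rightarrow> real \<Rightarrow> (nat \<Rightarrow> real \<Rightarrow> real \<Rightarrow> real) \<Rightarrow> (nat \<Rightarrow> real \<Rightarrow> real \<Rightarrow> real) \<Rightarrow> ennreal" where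
  "rough_dist \<gamma> T X X' =
     (\<Sum>n=1..rough_level \<gamma>. SUP (s, t)\<in>{(s, t). 0 \<le> s \<and> s < t \<and> t \<le> T}.
        ennreal (\<bar>X n s t - X' n s t\<bar> / (t - s) powr (real n * \<gamma>)))"

text \<open>The canonical lift of a \<open>C\<^sup>1\<close> path: the \<open>n\<close>-fold iterated integrals
  over the simplex \<open>s < r\<^sub>1 < \<dots> < r\<^sub>n < t\<close>.\<close>

primrec canonical_lift :: "(real \<Rightarrow> real) \<Rightarrow> nat \<Rightarrow> real \<Rightarrow> real \<Rightarrow> real" where
  "canonical_lift x 0 s t = 1"
| "canonical_lift x (Suc n) s t = integral {s..t} (\<lambda>r. canonical_lift x n s r * deriv x r)"

text \<open>\<open>x C1_differentiable_on {0..T}\<close> uses two-sided derivatives at the end points; since every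
  \<open>C\<^sup>1\<close> path on \<open>[0,T]\<close> extends to a \<open>C\<^sup>1\<close> function on the line, no lift is lost.\<close>

definition geometric_rough_path :: "real \<Rightarrow> real \<Rightarrow> (nat \<Rightarrow> real \<Rightarrow> real \<Rightarrow> real) \<Rightarrow> bool" where
  "geometric_rough_path \<gamma> T X \<longleftrightarrow> rough_path \<gamma> T X \<and>
     (\<forall>\<epsilon>>0. \<exists>x. x C1_differentiable_on {0..T} \<and> rough_dist \<gamma> T X (canonical_lift x) < \<epsilon>)"

definition geometric_lift :: "(real \<Rightarrow> real) \<Rightarrow> nat \<Rightarrow> real \<Rightarrow> real \<Rightarrow> real" where
  "geometric_lift x n s t = (x t - x s) ^ n / fact n"


section \<open>Controlled paths and the rough integral\<close>

text \<open>A controlled path is a family \<open>Y n t\<close>, where only \<open>1 \<le> n \<le> \<lfloor>1/\<gamma>\<rfloor>\<close> matters.\<close>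

definition controlled_path ::
  "real \<Rightarrow> real \<Rightarrow> (nat \<Rightarrow> real \<Rightarrow> real \<Rightarrow> real) \<Rightarrow> (nat \<Rightarrow> real \<Rightarrow> real) \<Rightarrow> bool" where
  "controlled_path \<gamma> T X Y \<longleftrightarrow>
     (\<forall>k\<in>{1..rough_level \<gamma>}. \<exists>C. \<forall>s t. 0 \<le> s \<and> s < t \<and> t \<le> T \<longrightarrow>
        \<bar>Y k t - (\<Sum>n=k..rough_level \<gamma>. Y n s * X (n - k) s t)\<bar>
          \<le> C * (t - s) powr (real (rough_level \<gamma> + 1 - k) * \<gamma>))"

definition partition_of :: "real \<Rightarrow> real \<Rightarrow> real list \<Rightarrow> bool" where
  "partition_of s t ps \<longleftrightarrow> ps \<noteq> [] \<and> sorted_wrt (<) ps \<and> hd ps = s \<and> last ps = t"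

definition has_rough_integral ::
  "real \<Rightarrow> (nat \<Rightarrow> real \<Rightarrow> real \<Rightarrow> real) \<Rightarrow> (nat \<Rightarrow> real \<Rightarrow> real) \<Rightarrow> real \<Rightarrow> real \<Rightarrow> real \<Rightarrow> bool" where
  "has_rough_integral \<gamma> X Y s t I \<longleftrightarrow>
     (\<forall>\<epsilon>>0. \<exists>\<delta>>0. \<forall>ps. partition_of s t ps \<and>
        (\<forall>i < length ps - 1. ps ! Suc i - ps ! i < \<delta>) \<longrightarrow>
        \<bar>(\<Sum>i < length ps - 1. \<Sum>n=1..rough_level \<gamma>.
            Y n (ps ! i) * X n (ps ! i) (ps ! Suc i)) - I\<bar> < \<epsilon>)"


section \<open>Weak derivatives and Sobolev functions on the real line\<close>

text \<open>\<open>C\<^sub>c\<^sup>\<infinity>(U)\<close>, as functions on the whole line.\<close>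

definition test_function :: "real set \<Rightarrow> (real \<Rightarrow> real) \<Rightarrow> bool" where
  "test_function U \<eta> \<longleftrightarrow>
     (\<forall>n x. (deriv ^^ n) \<eta> differentiable (at x)) \<and>
     compact (closure {x. \<eta> x \<noteq> 0}) \<and> closure {x. \<eta> x \<noteq> 0} \<subseteq> U"

definition locally_integrable_on :: "real set \<Rightarrow> (real \<Rightarrow> real) \<Rightarrow> bool" where
  "locally_integrable_on U f \<longleftrightarrow> (\<forall>K. compact K \<and> K \<subseteq> U \<longrightarrow> f absolutely_integrable_on K)"

definition weak_derivative_on :: "real set \<Rightarrow> (real \<Rightarrow> real) \<Rightarrow> (real \<Rightarrow> real) \<Rightarrow> bool" where
  "weak_derivative_on U f g \<longleftrightarrow>
     locally_integrable_on U f \<and> locally_integrable_on U g \<and>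
     (\<forall>\<eta>. test_function U \<eta> \<longrightarrow>
        (LINT x|lebesgue_on U. f x * deriv \<eta> x) = - (LINT x|lebesgue_on U. g x * \<eta> x))"

definition square_integrable_on :: "real set \<Rightarrow> (real \<Rightarrow> real) \<Rightarrow> bool" where
  "square_integrable_on U f \<longleftrightarrow>
     f \<in> borel_measurable (lebesgue_on U) \<and> integrable (lebesgue_on U) (\<lambda>x. (f x)\<^sup>2)"

definition sobolev_W12 :: "real set \<Rightarrow> (real \<Rightarrow> real) \<Rightarrow> bool" where
  "sobolev_W12 U f \<longleftrightarrow> square_integrable_on U f \<and>
     (\<exists>g. weak_derivative_on U f g \<and> square_integrable_on U g)"


section \<open>The transport equation\<close>

text \<open>The membership \<open>b \<in> L\<^sup>\<infinity>([0,T] \<times> \<real>)\<close>, and the mixed norm condition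
  \<open>\<integral> ess sup\<^sub>t |b(t,x)| dx < \<infinity>\<close> for \<open>b \<in> L\<^sup>1(\<real>; L\<^sup>\<infinity>([0,T]))\<close>. Joint
  measurability is part of the first definition.\<close>

definition drift_Linf :: "real \<Rightarrow> (real \<Rightarrow> real \<Rightarrow> real) \<Rightarrow> bool" where
  "drift_Linf T b \<longleftrightarrow>
     (\<lambda>z. b (fst z) (snd z)) \<in> borel_measurable (lebesgue_on ({0..T} \<times> UNIV)) \<and>
     (\<exists>C. AE z in lebesgue_on ({0..T} \<times> UNIV). \<bar>b (fst z) (snd z)\<bar> \<le> C)"

definition drift_L1_Linf :: "real \<Rightarrow> (real \<Rightarrow> real \<Rightarrow> real) \<Rightarrow> bool" where
  "drift_L1_Linf T b \<longleftrightarrow>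
     (\<integral>\<^sup>+x. esssup (lebesgue_on {0..T}) (\<lambda>t. ennreal \<bar>b t x\<bar>) \<partial>lebesgue) < \<infinity>"

text \<open>\<open>Du t\<close> is the weak derivative \<open>\<nabla>u(t,\<cdot>)\<close>; it is unique up to null sets, so
  none of the integrals below depends on its choice. Since the Bochner integral of a
  non-integrable function is \<open>0\<close>, the integrability needed for the drift term to be
  meaningful is stated explicitly. The rough integral in the equation is that of one
  controlled path \<open>Y\<close>, the same for all \<open>t\<close>, with first component \<open>\<integral> \<nabla>u \<eta> dx\<close>.\<close>

definition weak_controlled_solution ::
  "real \<Rightarrow> real \<Rightarrow> (nat \<Rightarrow> real \<Rightarrow> real \<Rightarrow> real) \<Rightarrow> (real \<Rightarrow> real \<Rightarrow> real) \<Rightarrow> (real \<Rightarrow> real) \<Rightarrow>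
   (real \<Rightarrow> real \<Rightarrow> real) \<Rightarrow> bool" where
  "weak_controlled_solution \<gamma> T X b u0 u \<longleftrightarrow>
     (\<forall>t\<in>{0..T}. \<forall>U. open U \<and> bounded U \<longrightarrow> sobolev_W12 U (u t)) \<and>
     (\<exists>Du. (\<forall>t\<in>{0..T}. weak_derivative_on UNIV (u t) (Du t)) \<and>
       (\<forall>\<eta>. test_function UNIV \<eta> \<longrightarrow>
         (\<exists>Y. controlled_path \<gamma> T X Y \<and>
           (\<forall>t\<in>{0..T}. Y 1 t = (LINT x|lebesgue. Du t x * \<eta> x)) \<and>
           (AE r in lebesgue_on {0..T}. integrable lebesgue (\<lambda>x. Du r x * b r x * \<eta> x)) \<and>
           integrable (lebesgue_on {0..T}) (\<lambda>r. LINT x|lebesgue. Du r x * b r x * \<eta> x) \<and>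
           (\<forall>t\<in>{0..T}. \<exists>I. has_rough_integral \<gamma> X Y 0 t I \<and>
              (LINT x|lebesgue. u t x * \<eta> x)
                + (LINT r|lebesgue_on {0..t}. LINT x|lebesgue. Du r x * b r x * \<eta> x)
                + I
              = (LINT x|lebesgue. u0 x * \<eta> x)))))"

end

theory Submission
  imports Defs "HOL-Complex_Analysis.Great_Picard"
begin

text \<open>The noise enters through \<open>\<nabla>u d\<^bold>B\<close> only, so it is a random translation: if \<open>u\<close> solves the equation,
  then \<open>v(t, y) = u(t, y + B\<^sub>t)\<close> formally solves the ordinary transport equation \<open>\<partial>\<^sub>t v + c(t, y) \<partial>\<^sub>y v
  = 0\<close> with the drift \<open>c(t, y) = b(t, y + B\<^sub>t)\<close>, which is bounded but has no regularity in \<open>y\<close>. The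
  proof solves this equation with a \<open>v\<close> that is \<open>C\<^sup>1\<close> in \<open>y\<close> and translates back. Spatial regularity
  comes from the noise: \<open>B\<close> oscillates so fast that time integrals of \<open>b\<close> along \<open>B\<close> are smooth in the
  starting point.

  The quantitative form of this regularisation is \<open>energy_bound\<close>. Let \<open>b\<^sub>n\<close> be Gaussian mollifications
  of \<open>b\<close> in space. The second moment of \<open>y \<mapsto> \<integral> \<partial>\<^sup>j b\<^sub>n(r, y + B\<^sub>r) dr\<close> over an interval, integrated in
  \<open>y\<close>, is a double time integral of \<open>E \<integral> \<partial>\<^sup>j b\<^sub>n(r, x + B\<^sub>r) \<partial>\<^sup>j b\<^sub>n(q, x + B\<^sub>q) dx\<close>. By translation
  invariance in \<open>x\<close> only the increment \<open>B\<^sub>q - B\<^sub>r\<close> matters; its expectation is a convolution with a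
  Gaussian of variance \<open>\<bar>q - r\<bar>\<^sup>2\<^sup>H\<close>, which can carry all \<open>2j\<close> derivatives at the price \<open>\<bar>q - r\<bar>\<^sup>-\<^sup>2\<^sup>j\<^sup>H\<close>.
  For \<open>j = 1, 2\<close> this singularity is integrable because \<open>4H < 1\<close>. Summed over the dyadic intervals of
  length \<open>T/2\<^sup>m\<close> the bound decays geometrically in \<open>m\<close>, uniformly in \<open>n\<close>, and Fatou's lemma
  (\<open>energy_decay_subsequence\<close>) gives, for almost every path, a subsequence of mollifications for
  which the decay holds at all levels that matter.

  From here on the path is fixed. For the mollified drift the equation is solved by the dyadic
  Euler scheme, whose spatial derivative is, up to a small error, \<open>exp\<close> of minus a sum of integrals
  over dyadic cells of the spatial derivative of the drift, evaluated along the discrete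
  characteristic. By the bound for \<open>j = 2\<close> these integrals are \<open>1/2\<close>-Hoelder in space
  (\<open>sobolev_half_holder\<close>), and a discrete sewing argument (\<open>level_sum_step\<close>) compares the sums on
  consecutive dyadic levels by Cauchy-Schwarz. So the derivatives are bounded and equicontinuous
  uniformly in the mollification (\<open>slope_log_modulus\<close>), a subsequence of the schemes converges
  together with its derivatives, and the limit solves the weak equation because the drift
  converges weakly while everything it is multiplied with converges pointwise and boundedly
  (\<open>limit_solution\<close>).

  To translate back, put \<open>u(t, x) = v(t, x - B\<^sub>t)\<close> and \<open>Y\<^sup>(\<^sup>n\<^sup>)\<^sub>t = - \<integral> v(t, y) \<eta>\<^sup>(\<^sup>n\<^sup>)(y + B\<^sub>t) dy\<close>. Taylor's
  formula for \<open>\<eta>\<close> at \<open>y + B\<^sub>s\<close>, whose monomials are exactly the entries of the geometric lift, shows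
  that \<open>Y\<close> is controlled by \<open>\<^bold>B\<close>, and that \<open>\<Sum>\<^sub>n Y\<^sup>(\<^sup>n\<^sup>)\<^sub>s B\<^sup>(\<^sup>n\<^sup>)\<^sub>s\<^sub>t\<close> is an additive function of the
  interval up to \<open>\<bar>t - s\<bar>\<^sup>\<kappa>\<close> with \<open>\<kappa> = (\<lfloor>1/\<gamma>\<rfloor> + 1) \<gamma> > 1\<close>. Hence the partition sums telescope in the
  limit (\<open>Y_rough_integral\<close>) and the weak equation for \<open>v\<close> becomes the one for \<open>u\<close>. Finally \<open>\<^bold>B\<close> is
  geometric because almost every path is Hoelder with an exponent in \<open>(\<gamma>, H)\<close> and can be
  approximated by moving averages (\<open>holder_geometric_rough_path\<close>).\<close>

section \<open>Derivatives of Gaussian densities\<close>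

lemma has_real_derivative_lebesgue_integral:
  fixes f f' :: "real \<Rightarrow> 'b \<Rightarrow> real"
  assumes int: "\<And>x. integrable M (f x)"
    and deriv: "\<And>x r. ((\<lambda>x. f x r) has_real_derivative f' x r) (at x)"
    and bound: "\<And>x r. \<bar>f' x r\<bar> \<le> D r" and D: "integrable M D"
  shows "((\<lambda>x. \<integral>r. f x r \<partial>M) has_real_derivative (\<integral>r. f' x r \<partial>M)) (at x)"
    and "integrable M (f' x)"
proof -
  let ?q = "\<lambda>h r. (f (x + h) r - f x r) / h"
  have bq: "\<bar>?q h r\<bar> \<le> D r" if "h \<noteq> 0" for h r
  proof -
    have "\<exists>z. f (x + h) r - f x r = h * f' z r"
    proof (cases "h > 0")
      case True
      then obtain z where "f (x + h) r - f x r = (x + h - x) * f' z r"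
        using MVT2[of x "x + h" "\<lambda>x. f x r" "\<lambda>x. f' x r"] deriv True by force
      then have "f (x + h) r - f x r = h * f' z r" by simp
      then show ?thesis ..
    next
      case False
      then have "x + h < x" using that by simp
      then obtain z where "f x r - f (x + h) r = (x - (x + h)) * f' z r"
        using MVT2[of "x + h" x "\<lambda>x. f x r" "\<lambda>x. f' x r"] deriv by blast
      then have "f (x + h) r - f x r = h * f' z r" by (simp add: algebra_simps)
      then show ?thesis ..
    qed
    then obtain z where "f (x + h) r - f x r = h * f' z r" ..
    then show ?thesis using bound[of z r] that by simp
  qed
  have conv: "(\<lambda>n. ?q (X n) r) \<longlonglongrightarrow> f' x r" if "X \<longlonglongrightarrow> 0" "\<And>n. X n \<noteq> 0" for X :: "nat \<Rightarrow> real" and r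
  proof -
    have "((\<lambda>h. ?q h r) \<longlongrightarrow> f' x r) (at 0)"
      using deriv[of r x] by (simp add: DERIV_def)
    then show ?thesis
      by (rule filterlim_compose) (use that in \<open>auto simp: filterlim_at\<close>)
  qed
  let ?X = "\<lambda>n. inverse (real (Suc n))"
  have mf': "f' x \<in> borel_measurable M"
    by (rule borel_measurable_LIMSEQ_real[where u = "\<lambda>n r. ?q (?X n) r"])
       (use conv[OF LIMSEQ_inverse_real_of_nat] int in \<open>auto simp del: of_nat_Suc\<close>)
  show "integrable M (f' x)"
    by (rule Bochner_Integration.integrable_bound[OF D mf']) (use bound order_trans[OF bound abs_ge_self] in auto)
  show "((\<lambda>x. \<integral>r. f x r \<partial>M) has_real_derivative (\<integral>r. f' x r \<partial>M)) (at x)"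
    unfolding DERIV_def
  proof (subst tendsto_at_iff_sequentially, intro allI impI)
    fix X :: "nat \<Rightarrow> real" assume X: "\<forall>i. X i \<in> UNIV - {0}" "X \<longlonglongrightarrow> 0"
    have "(\<lambda>n. \<integral>r. ?q (X n) r \<partial>M) \<longlonglongrightarrow> (\<integral>r. f' x r \<partial>M)"
      by (rule integral_dominated_convergence[where w = D])
         (use X conv[of X] bq mf' int D in auto)
    then show "((\<lambda>h. ((\<integral>r. f (x + h) r \<partial>M) - (\<integral>r. f x r \<partial>M)) / h) \<circ> X) \<longlonglongrightarrow> (\<integral>r. f' x r \<partial>M)"
      by (simp add: o_def int)
  qed
qed

text \<open>Up to the sign \<open>(-1)\<^sup>j\<close> these are the probabilists' Hermite polynomials, so that the \<open>j\<close>-th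
  derivative of the standard normal density is \<open>hermite j\<close> times that density.\<close>

fun hermite :: "nat \<Rightarrow> real poly" where
  "hermite 0 = 1"
| "hermite (Suc j) = pderiv (hermite j) - [:0, 1:] * hermite j"

text \<open>The \<open>j\<close>-th derivative of the centred normal density with standard deviation \<open>s\<close>; see \<open>gauss_0\<close> and
  \<open>gauss_has_deriv\<close>.\<close>

definition gauss :: "nat \<Rightarrow> real \<Rightarrow> real \<Rightarrow> real" where
  "gauss j s x = poly (hermite j) (x / s) * std_normal_density (x / s) / s ^ Suc j"

lemma gauss_0: "s > 0 \<Longrightarrow> gauss 0 s = normal_density 0 s"
proof
  fix x assume "s > 0"
  then have "sqrt (2 * pi * s\<^sup>2) = sqrt (2 * pi) * s"
    by (simp only: real_sqrt_mult real_sqrt_abs abs_of_pos)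
  then show "gauss 0 s x = normal_density 0 s x"
    by (simp add: gauss_def normal_density_def power_divide)
qed

lemma std_normal_density_deriv:
  "(std_normal_density has_real_derivative - x * std_normal_density x) (at x)"
  unfolding std_normal_density_def
  by (auto intro!: derivative_eq_intros simp: field_simps power2_eq_square)

lemma gauss_has_deriv:
  assumes "s > 0"
  shows "(gauss j s has_real_derivative gauss (Suc j) s x) (at x)"
proof -
  have "((\<lambda>y. poly (hermite j) y * std_normal_density y) has_real_derivative
     poly (hermite (Suc j)) y * std_normal_density y) (at y)" for y
    by (auto intro!: derivative_eq_intros std_normal_density_deriv simp: algebra_simps)
  then have "((\<lambda>x. poly (hermite j) (x / s) * std_normal_density (x / s)) has_real_derivative
     poly (hermite (Suc j)) (x / s) * std_normal_density (x / s) * (1 / s)) (at x)"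
    by (rule DERIV_chain2[where g = "\<lambda>x. x / s"]) (use assms in \<open>auto intro!: derivative_eq_intros\<close>)
  from DERIV_cdivide[OF this, of "s ^ Suc j"] show ?thesis
    unfolding gauss_def by (simp add: field_simps del: hermite.simps)
qed

lemma gauss_measurable [measurable]: "gauss j s \<in> borel_measurable borel"
proof -
  have "poly (hermite j) \<in> borel_measurable borel"
    by (intro borel_measurable_continuous_onI continuous_intros)
  note [measurable] = this
  show ?thesis unfolding gauss_def by measurable
qed

lemma hermite_parity: "poly (hermite j) (- x) = (-1) ^ j * poly (hermite j) x"
proof (induction j arbitrary: x)
  case (Suc j)
  have "((\<lambda>x. poly (hermite j) (- x)) has_real_derivative - poly (pderiv (hermite j)) (- x)) (at x)" for x
    using DERIV_chain2[OF poly_DERIV, of "\<lambda>x. - x" "-1" x UNIV "hermite j"]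
    by (auto intro!: derivative_eq_intros)
  moreover have "((\<lambda>x. (-1) ^ j * poly (hermite j) x) has_real_derivative (-1)^j * poly (pderiv (hermite j)) x) (at x)" for x
    by (auto intro!: derivative_eq_intros)
  ultimately have "- poly (pderiv (hermite j)) (- x) = (-1)^j * poly (pderiv (hermite j)) x"
    unfolding Suc by (rule DERIV_unique)
  then show ?case using Suc[of x] by (simp add: algebra_simps)
qed simp

lemma gauss_parity: "gauss j s (- x) = (-1) ^ j * gauss j s x"
  by (simp add: gauss_def hermite_parity[of j "x / s"] normal_density_def)

text \<open>One term of the exponential series bounds the power by \<open>k! e\<^sup>\<bar>\<^sup>x\<^sup>\<bar>\<close>, which the Gaussian absorbs.\<close>

lemma power_std_normal_bound: "\<bar>x\<bar> ^ k * std_normal_density x \<le> fact k * exp 1"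
proof -
  have "(\<Sum>n\<in>{k}. inverse (fact n) * \<bar>x\<bar> ^ n) \<le> (\<Sum>n. inverse (fact n) * \<bar>x\<bar> ^ n)"
    by (rule sum_le_suminf) (use summable_exp[of "\<bar>x\<bar>"] in auto)
  then have *: "\<bar>x\<bar> ^ k \<le> fact k * exp \<bar>x\<bar>"
    by (simp add: exp_def inverse_eq_divide divide_le_eq mult.commute)
  have "0 \<le> (\<bar>x\<bar> - 1)\<^sup>2" by simp
  then have "\<bar>x\<bar> \<le> 1 + x\<^sup>2 / 2"
    unfolding power2_diff power2_abs by simp
  then have "\<bar>x\<bar> + - x\<^sup>2 / 2 \<le> 1"
    by simp
  then have "exp \<bar>x\<bar> * exp (- x\<^sup>2 / 2) \<le> exp 1"
    unfolding mult_exp_exp exp_le_cancel_iff .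
  moreover have "std_normal_density x \<le> exp (- x\<^sup>2 / 2)"
  proof -
    have "1 \<le> sqrt (2 * pi)"
      using pi_gt3 by (intro real_le_rsqrt) (simp add: power2_eq_square)
    then have "1 / sqrt (2 * pi) \<le> 1" by simp
    then have "1 / sqrt (2 * pi) * exp (- x\<^sup>2 / 2) \<le> 1 * exp (- x\<^sup>2 / 2)"
      by (rule mult_right_mono) simp
    then show ?thesis unfolding std_normal_density_def mult_1 .
  qed
  then have "exp \<bar>x\<bar> * std_normal_density x \<le> exp \<bar>x\<bar> * exp (- x\<^sup>2 / 2)"
    by (intro mult_left_mono) auto
  ultimately have "exp \<bar>x\<bar> * std_normal_density x \<le> exp 1"
    by (rule order_trans[rotated])
  then show ?thesis
  proof -
    have "fact k * (exp \<bar>x\<bar> * std_normal_density x) \<le> fact k * exp 1"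
      using \<open>exp \<bar>x\<bar> * std_normal_density x \<le> exp 1\<close> by (intro mult_left_mono) auto
    moreover have "\<bar>x\<bar> ^ k * std_normal_density x \<le> fact k * (exp \<bar>x\<bar> * std_normal_density x)"
      using mult_right_mono[OF *, of "std_normal_density x"] by (simp add: mult.assoc)
    ultimately show ?thesis by linarith
  qed
qed

lemma poly_std_normal:
  fixes p :: "real poly"
  shows "\<exists>C. \<forall>x. \<bar>poly p x\<bar> * std_normal_density x \<le> C"
    and "integrable lborel (\<lambda>x. poly p x * std_normal_density x)"
proof -
  have eq: "poly p x * std_normal_density x =
     (\<Sum>i\<le>degree p. coeff p i * (std_normal_density x * x ^ i))" for x
    by (simp add: poly_altdef sum_distrib_left mult.commute mult.left_commute)
  show "integrable lborel (\<lambda>x. poly p x * std_normal_density x)"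
    unfolding eq by (intro Bochner_Integration.integrable_sum Bochner_Integration.integrable_mult_right
        integrable_std_normal_moment)
  have "\<bar>poly p x\<bar> * std_normal_density x \<le> (\<Sum>i\<le>degree p. \<bar>coeff p i\<bar> * (fact i * exp 1))" for x
  proof -
    have "\<bar>poly p x\<bar> * std_normal_density x = \<bar>poly p x * std_normal_density x\<bar>"
      by (simp add: abs_mult)
    also have "\<dots> \<le> (\<Sum>i\<le>degree p. \<bar>coeff p i\<bar> * (\<bar>x\<bar> ^ i * std_normal_density x))"
      unfolding eq by (rule order_trans[OF sum_abs]) (simp add: abs_mult power_abs mult_ac)
    also have "\<dots> \<le> (\<Sum>i\<le>degree p. \<bar>coeff p i\<bar> * (fact i * exp 1))"
      by (intro sum_mono mult_left_mono power_std_normal_bound) auto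
    finally show ?thesis .
  qed
  then show "\<exists>C. \<forall>x. \<bar>poly p x\<bar> * std_normal_density x \<le> C" by blast
qed

lemma gauss_bounded: "\<exists>C\<ge>0. \<forall>x. \<bar>gauss j s x\<bar> \<le> C"
proof -
  obtain C where C: "\<And>x. \<bar>poly (hermite j) x\<bar> * std_normal_density x \<le> C"
    using poly_std_normal(1) by blast
  have "0 \<le> \<bar>poly (hermite j) 0\<bar> * std_normal_density 0"
    by (intro mult_nonneg_nonneg) auto
  also have "\<dots> \<le> C" by (rule C)
  finally have "0 \<le> C" .
  moreover have "\<bar>gauss j s x\<bar> \<le> C / \<bar>s ^ Suc j\<bar>" for x
    using divide_right_mono[OF C[of "x / s"], of "\<bar>s ^ Suc j\<bar>"] unfolding gauss_def abs_divide abs_mult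
    by simp
  moreover have "0 \<le> C / \<bar>s ^ Suc j\<bar>" using \<open>0 \<le> C\<close> by (intro divide_nonneg_nonneg) auto
  ultimately show ?thesis by blast
qed

definition gauss_mass :: "nat \<Rightarrow> real" where
  "gauss_mass j = (\<integral>x. \<bar>gauss j 1 x\<bar> \<partial>lborel)"

lemma gauss_scale: "gauss j s x = gauss j 1 (x / s) / s ^ Suc j"
  by (simp add: gauss_def)

text \<open>Scaling: each derivative of a Gaussian of width \<open>s\<close> costs a factor \<open>1/s\<close> in \<open>L\<^sup>1\<close>. With \<open>s = \<bar>q - r\<bar>\<^sup>H\<close>
  this is the source of all the powers of \<open>\<bar>q - r\<bar>\<close> below.\<close>

lemma gauss_L1:
  assumes "s > 0"
  shows "integrable lborel (gauss j s)" "(\<integral>x. \<bar>gauss j s x\<bar> \<partial>lborel) = gauss_mass j / s ^ j"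
proof -
  have i: "integrable lborel (gauss j 1)"
    unfolding gauss_def using poly_std_normal(2) by simp
  have "integrable lborel (\<lambda>x. gauss j 1 (0 + (1 / s) * x))"
    by (subst lborel_integrable_real_affine_iff) (use i assms in auto)
  then have "integrable lborel (\<lambda>x. gauss j 1 (x / s) / s ^ Suc j)"
    by (intro integrable_divide_zero) simp
  then show "integrable lborel (gauss j s)"
    by (simp add: gauss_scale[of j s, abs_def])
  have "(\<integral>x. \<bar>gauss j s x\<bar> \<partial>lborel) = (\<integral>x. \<bar>gauss j 1 (x / s)\<bar> \<partial>lborel) / s ^ Suc j"
    by (subst gauss_scale) (use assms in \<open>simp add: abs_mult abs_divide\<close>)
  also have "(\<integral>x. \<bar>gauss j 1 (x / s)\<bar> \<partial>lborel) = s * gauss_mass j"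
    unfolding gauss_mass_def
    using lborel_integral_real_affine[of "1 / s" "\<lambda>x. \<bar>gauss j 1 x\<bar>" 0] assms by simp
  finally show "(\<integral>x. \<bar>gauss j s x\<bar> \<partial>lborel) = gauss_mass j / s ^ j"
    using assms by simp
qed

lemma gauss_mass_nonneg: "gauss_mass j \<ge> 0"
  by (simp add: gauss_mass_def)

lemma conv_integrable:
  fixes f g :: "real \<Rightarrow> real"
  assumes "integrable lborel g" "f \<in> borel_measurable borel" "\<And>x. \<bar>f x\<bar> \<le> C"
  shows "integrable lborel (\<lambda>y. f (u - y) * g y)"
proof (rule Bochner_Integration.integrable_bound[OF Bochner_Integration.integrable_mult_right[OF assms(1), of C]])
  show "(\<lambda>y. f (u - y) * g y) \<in> borel_measurable lborel" using assms by measurable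
  show "AE x in lborel. norm (f (u - x) * g x) \<le> norm (C * g x)"
    using assms(3) by (auto simp: abs_mult intro!: mult_right_mono order_trans[OF assms(3) abs_ge_self])
qed

lemma conv_has_deriv:
  fixes f f' g :: "real \<Rightarrow> real"
  assumes "integrable lborel g" "\<And>x. (f has_real_derivative f' x) (at x)"
    and f: "f \<in> borel_measurable borel" "\<And>x. \<bar>f x\<bar> \<le> C" and f': "\<And>x. \<bar>f' x\<bar> \<le> C'"
  shows "((\<lambda>u. \<integral>y. f (u - y) * g y \<partial>lborel) has_real_derivative (\<integral>y. f' (u - y) * g y \<partial>lborel)) (at u)"
proof (rule has_real_derivative_lebesgue_integral(1)[where D = "\<lambda>y. C' * \<bar>g y\<bar>"])
  show "((\<lambda>x. f (x - r) * g r) has_real_derivative f' (x - r) * g r) (at x)" for x r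
    by (auto intro!: derivative_eq_intros DERIV_chain2[OF assms(2)])
qed (use conv_integrable[OF assms(1) f] assms(1) f' in \<open>auto simp: abs_mult intro!: mult_right_mono\<close>)

lemma conv_commute:
  fixes f g :: "real \<Rightarrow> real"
  shows "(\<integral>y. f (u - y) * g y \<partial>lborel) = (\<integral>y. g (u - y) * f y \<partial>lborel)"
  using lborel_integral_real_affine[of "-1" "\<lambda>y. f (u - y) * g y" u] by (simp add: mult.commute)

text \<open>The semigroup property of the normal densities, differentiated \<open>i + j\<close> times: derivatives can be
  moved between the two factors of a convolution, so the case \<open>i = j = 0\<close> of the densities
  themselves suffices.\<close>

lemma gauss_conv:
  assumes "s > 0" "t > 0"
  shows "(\<integral>y. gauss i s (u - y) * gauss j t y \<partial>lborel) = gauss (i + j) (sqrt (s\<^sup>2 + t\<^sup>2)) u"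
proof -
  have r: "sqrt (s\<^sup>2 + t\<^sup>2) > 0" if "s > 0" for s t :: real
    using that by (simp add: add_pos_nonneg)
  have step: "(\<integral>y. gauss (Suc i) s (u - y) * gauss j t y \<partial>lborel) = gauss (Suc i + j) (sqrt (s\<^sup>2 + t\<^sup>2)) u"
    if "s > 0" "t > 0" and *: "\<And>u. (\<integral>y. gauss i s (u - y) * gauss j t y \<partial>lborel) = gauss (i + j) (sqrt (s\<^sup>2 + t\<^sup>2)) u"
    for i j s t u
  proof -
    obtain C where C: "\<And>x. \<bar>gauss i s x\<bar> \<le> C" using gauss_bounded[of i s] by auto
    obtain C' where C': "\<And>x. \<bar>gauss (Suc i) s x\<bar> \<le> C'" using gauss_bounded[of "Suc i" s] by auto
    have "((\<lambda>u. \<integral>y. gauss i s (u - y) * gauss j t y \<partial>lborel) has_real_derivative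
        (\<integral>y. gauss (Suc i) s (u - y) * gauss j t y \<partial>lborel)) (at u)"
      by (rule conv_has_deriv) (use C C' that gauss_L1 gauss_has_deriv in auto)
    moreover have "((\<lambda>u. \<integral>y. gauss i s (u - y) * gauss j t y \<partial>lborel) has_real_derivative
        gauss (Suc i + j) (sqrt (s\<^sup>2 + t\<^sup>2)) u) (at u)"
      unfolding * using gauss_has_deriv[OF r[OF that(1), of t], of "i + j" u] by simp
    ultimately show ?thesis by (rule DERIV_unique)
  qed
  have "(\<integral>y. gauss 0 s (u - y) * gauss 0 t y \<partial>lborel) = gauss 0 (sqrt (s\<^sup>2 + t\<^sup>2)) u"
    if "s > 0" "t > 0" for s t u
  proof -
    have "(\<integral>y. gauss 0 s (u - y) * gauss 0 t y \<partial>lborel)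
       = enn2real (\<integral>\<^sup>+y. ennreal (normal_density 0 s (u - y) * normal_density 0 t y) \<partial>lborel)"
      unfolding gauss_0[OF that(1)] gauss_0[OF that(2)]
      by (rule integral_eq_nn_integral) auto
    also have "\<dots> = normal_density 0 (sqrt (s\<^sup>2 + t\<^sup>2)) u"
      by (subst conv_normal_density_zero_mean[OF that, THEN fun_cong]) simp
    finally show ?thesis using gauss_0[OF r[OF that(1), of t]] by simp
  qed
  then have A: "(\<integral>y. gauss i s (u - y) * gauss 0 t y \<partial>lborel) = gauss i (sqrt (s\<^sup>2 + t\<^sup>2)) u"
    if "s > 0" "t > 0" for i s t u
    using that step[of s t _ 0] by (induction i arbitrary: u) auto
  have B: "(\<integral>y. gauss 0 s (u - y) * gauss j t y \<partial>lborel) = gauss j (sqrt (s\<^sup>2 + t\<^sup>2)) u"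
    if "s > 0" "t > 0" for s t u
    by (subst conv_commute) (simp add: A[OF that(2,1)] add.commute)
  show ?thesis
    using assms B step[of s t _ j] by (induction i arbitrary: u) auto
qed

section \<open>Gaussian mollification\<close>

definition gauss_smooth :: "nat \<Rightarrow> real \<Rightarrow> (real \<Rightarrow> real) \<Rightarrow> real \<Rightarrow> real" where
  "gauss_smooth j s f x = (\<integral>z. gauss j s (x - z) * f z \<partial>lborel)"

lemma gauss_smooth_integrand_integrable:
  assumes "s > 0" "f \<in> borel_measurable borel" "\<And>x. \<bar>f x\<bar> \<le> C"
  shows "integrable lborel (\<lambda>z. gauss j s (x - z) * f z)"
proof -
  have "integrable lborel (\<lambda>z. gauss j s (x + (-1) * z))"
    by (subst lborel_integrable_real_affine_iff) (use gauss_L1[OF assms(1)] in auto)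
  then have "integrable lborel (\<lambda>z. C * gauss j s (x - z))" by simp
  then show ?thesis
  proof (rule Bochner_Integration.integrable_bound)
    show "(\<lambda>z. gauss j s (x - z) * f z) \<in> borel_measurable lborel" using assms by measurable
    show "AE z in lborel. norm (gauss j s (x - z) * f z) \<le> norm (C * gauss j s (x - z))"
      using assms(3) by (auto simp: abs_mult mult.commute intro!: mult_right_mono order_trans[OF assms(3) abs_ge_self])
  qed
qed

lemma gauss_smooth_abs_bound:
  assumes "s > 0" "f \<in> borel_measurable borel" "\<And>x. \<bar>f x\<bar> \<le> C"
  shows "(\<integral>z. \<bar>gauss j s (x - z) * f z\<bar> \<partial>lborel) \<le> C * gauss_mass j / s ^ j"
proof -
  have i: "integrable lborel (\<lambda>z. \<bar>gauss j s (x + (-1) * z)\<bar>)"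
    by (rule integrable_abs, subst lborel_integrable_real_affine_iff) (use gauss_L1[OF assms(1)] in auto)
  have "(\<integral>z. \<bar>gauss j s (x - z) * f z\<bar> \<partial>lborel) \<le> (\<integral>z. C * \<bar>gauss j s (x + (-1) * z)\<bar> \<partial>lborel)"
  proof (rule integral_mono)
    show "integrable lborel (\<lambda>z. \<bar>gauss j s (x - z) * f z\<bar>)"
      by (rule integrable_abs[OF gauss_smooth_integrand_integrable[OF assms]])
    show "\<bar>gauss j s (x - z) * f z\<bar> \<le> C * \<bar>gauss j s (x + (-1) * z)\<bar>" for z
      using mult_right_mono[OF assms(3)[of z], of "\<bar>gauss j s (x - z)\<bar>"] by (simp add: abs_mult mult.commute)
  qed (use i in simp)
  also have "\<dots> = C * (\<integral>z. \<bar>gauss j s z\<bar> \<partial>lborel)"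
    using lborel_integral_real_affine[of "-1" "\<lambda>z. \<bar>gauss j s z\<bar>" x] by simp
  finally show ?thesis by (simp add: gauss_L1(2)[OF assms(1)])
qed

lemma gauss_smooth_bound:
  assumes "s > 0" "f \<in> borel_measurable borel" "\<And>x. \<bar>f x\<bar> \<le> C"
  shows "\<bar>gauss_smooth j s f x\<bar> \<le> C * gauss_mass j / s ^ j"
  unfolding gauss_smooth_def using integral_abs_bound gauss_smooth_abs_bound[OF assms] by (rule order_trans)

lemma gauss_smooth_measurable:
  assumes [measurable]: "case_prod b \<in> borel_measurable (N \<Otimes>\<^sub>M borel)"
    and [measurable]: "h \<in> measurable L N" "g \<in> borel_measurable L"
  shows "(\<lambda>w. gauss_smooth j s (b (h w)) (g w)) \<in> borel_measurable L"
proof -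
  have [measurable]: "(\<lambda>(w, z). b (h w) z) \<in> borel_measurable (L \<Otimes>\<^sub>M lborel)"
    by measurable
  show ?thesis unfolding gauss_smooth_def by measurable
qed

lemma gauss_smooth_measurable':
  assumes "f \<in> borel_measurable borel"
  shows "gauss_smooth j s f \<in> borel_measurable borel"
proof -
  note assms [measurable]
  show ?thesis unfolding gauss_smooth_def[abs_def] by measurable
qed

lemma gauss_smooth_has_deriv:
  assumes "s > 0" "integrable lborel f"
  shows "(gauss_smooth j s f has_real_derivative gauss_smooth (Suc j) s f x) (at x)"
proof -
  obtain C where C: "\<And>x. \<bar>gauss j s x\<bar> \<le> C" using gauss_bounded[of j s] by auto
  obtain C' where C': "\<And>x. \<bar>gauss (Suc j) s x\<bar> \<le> C'" using gauss_bounded[of "Suc j" s] by auto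
  have "((\<lambda>x. \<integral>z. gauss j s (x - z) * f z \<partial>lborel) has_real_derivative
      (\<integral>z. gauss (Suc j) s (x - z) * f z \<partial>lborel)) (at x)"
    by (rule conv_has_deriv[OF assms(2) gauss_has_deriv[OF assms(1)] gauss_measurable C C'])
  then show ?thesis by (simp only: gauss_smooth_def[abs_def])
qed

lemma gauss_smooth_gauss_conv:
  assumes "s > 0" "t > 0" and [measurable]: "f \<in> borel_measurable borel" and C: "\<And>x. \<bar>f x\<bar> \<le> C"
  shows "(\<integral>y. gauss i s (x - y) * gauss_smooth j t f y \<partial>lborel) = gauss_smooth (i + j) (sqrt (s\<^sup>2 + t\<^sup>2)) f x"
proof -
  let ?F = "\<lambda>y z. gauss i s (x - y) * (gauss j t (y - z) * f z)"
  have int: "integrable (lborel \<Otimes>\<^sub>M lborel) (case_prod ?F)"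
  proof (rule lborel_pair.Fubini_integrable)
    show "case_prod ?F \<in> borel_measurable (lborel \<Otimes>\<^sub>M lborel)" by measurable
    have n: "(\<integral>z. norm (?F y z) \<partial>lborel) = \<bar>gauss i s (x - y)\<bar> * (\<integral>z. \<bar>gauss j t (y - z) * f z\<bar> \<partial>lborel)" for y
      by (simp add: abs_mult)
    have le: "(\<integral>z. \<bar>gauss j t (y - z) * f z\<bar> \<partial>lborel) \<le> C * gauss_mass j / t ^ j" for y
      by (rule gauss_smooth_abs_bound[OF assms(2,3) C])
    have ii: "integrable lborel (\<lambda>y. C * gauss_mass j / t ^ j * gauss i s (x + (-1) * y))"
      by (rule integrable_mult_right, subst lborel_integrable_real_affine_iff) (use gauss_L1[OF assms(1)] in auto)
    show "integrable lborel (\<lambda>y. \<integral>z. norm (case_prod ?F (y, z)) \<partial>lborel)"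
    proof (rule Bochner_Integration.integrable_bound[OF ii])
      show "AE y in lborel. norm (\<integral>z. norm (case_prod ?F (y, z)) \<partial>lborel)
          \<le> norm (C * gauss_mass j / t ^ j * gauss i s (x + (-1) * y))"
      proof (rule AE_I2)
        fix y
        have "\<bar>gauss i s (x - y)\<bar> * (\<integral>z. \<bar>gauss j t (y - z) * f z\<bar> \<partial>lborel)
          \<le> \<bar>gauss i s (x - y)\<bar> * \<bar>C * gauss_mass j / t ^ j\<bar>"
          using order_trans[OF le[of y] abs_ge_self] by (intro mult_left_mono) simp_all
        moreover have "0 \<le> (\<integral>z. \<bar>gauss j t (y - z) * f z\<bar> \<partial>lborel)" by simp
        ultimately show "norm (\<integral>z. norm (case_prod ?F (y, z)) \<partial>lborel)
          \<le> norm (C * gauss_mass j / t ^ j * gauss i s (x + (-1) * y))"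
          unfolding split n by (simp add: abs_mult mult.commute)
      qed
    qed measurable
    show "AE y in lborel. integrable lborel (\<lambda>z. case_prod ?F (y, z))"
      using gauss_smooth_integrand_integrable[OF assms(2,3) C] by simp
  qed
  have "(\<integral>y. gauss i s (x - y) * gauss_smooth j t f y \<partial>lborel) = (\<integral>y. (\<integral>z. ?F y z \<partial>lborel) \<partial>lborel)"
    unfolding gauss_smooth_def by simp
  also have "\<dots> = (\<integral>z. (\<integral>y. ?F y z \<partial>lborel) \<partial>lborel)"
    by (rule lborel_pair.Fubini_integral[OF int, symmetric])
  also have "\<dots> = (\<integral>z. gauss (i + j) (sqrt (s\<^sup>2 + t\<^sup>2)) (x - z) * f z \<partial>lborel)"
  proof (rule Bochner_Integration.integral_cong[OF refl])
    fix z
    have "(\<integral>y. ?F y z \<partial>lborel) = (\<integral>y. gauss i s (x - y) * gauss j t (y - z) \<partial>lborel) * f z"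
      by (simp only: mult.assoc[symmetric] integral_mult_left_zero)
    also have "(\<integral>y. gauss i s (x - y) * gauss j t (y - z) \<partial>lborel)
        = (\<integral>y. gauss i s ((x - z) - y) * gauss j t y \<partial>lborel)"
      using lborel_integral_real_affine[of 1 "\<lambda>y. gauss i s (x - y) * gauss j t (y - z)" z]
      by (simp add: algebra_simps)
    finally show "(\<integral>y. ?F y z \<partial>lborel) = gauss (i + j) (sqrt (s\<^sup>2 + t\<^sup>2)) (x - z) * f z"
      by (simp add: gauss_conv[OF assms(1,2)])
  qed
  finally show ?thesis unfolding gauss_smooth_def .
qed

lemma gauss_smooth_L1:
  assumes "s > 0" "integrable lborel f"
  shows "integrable lborel (gauss_smooth j s f)"
    and "(\<integral>x. \<bar>gauss_smooth j s f x\<bar> \<partial>lborel) \<le> gauss_mass j / s ^ j * (\<integral>x. \<bar>f x\<bar> \<partial>lborel)"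
    and "integrable (lborel \<Otimes>\<^sub>M lborel) (\<lambda>(z, x). gauss j s (x - z) * f z)"
proof -
  have [measurable]: "f \<in> borel_measurable borel" using assms(2) by auto
  let ?F = "\<lambda>z x. gauss j s (x - z) * f z"
  have n: "(\<integral>x. \<bar>?F z x\<bar> \<partial>lborel) = gauss_mass j / s ^ j * \<bar>f z\<bar>" for z
    using lborel_integral_real_affine[of 1 "\<lambda>x. \<bar>gauss j s (x - z)\<bar>" z]
    by (simp add: abs_mult gauss_L1(2)[OF assms(1)])
  show int: "integrable (lborel \<Otimes>\<^sub>M lborel) (case_prod ?F)"
  proof (rule lborel_pair.Fubini_integrable)
    show "AE z in lborel. integrable lborel (\<lambda>x. case_prod ?F (z, x))"
    proof (rule AE_I2)
      fix z
      have "integrable lborel (\<lambda>x. gauss j s (- z + 1 * x))"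
        by (subst lborel_integrable_real_affine_iff) (use gauss_L1[OF assms(1)] in auto)
      then show "integrable lborel (\<lambda>x. case_prod ?F (z, x))" by simp
    qed
    show "integrable lborel (\<lambda>z. \<integral>x. norm (case_prod ?F (z, x)) \<partial>lborel)"
      using n assms(2) by simp
  qed measurable
  show "integrable lborel (gauss_smooth j s f)"
    using lborel_pair.integrable_snd[OF int] unfolding gauss_smooth_def by simp
  have "(\<integral>x. \<bar>gauss_smooth j s f x\<bar> \<partial>lborel) \<le> (\<integral>x. (\<integral>z. \<bar>?F z x\<bar> \<partial>lborel) \<partial>lborel)"
  proof (rule integral_mono)
    show "integrable lborel (\<lambda>x. \<bar>gauss_smooth j s f x\<bar>)"
      using \<open>integrable lborel (gauss_smooth j s f)\<close> by simp
    show "integrable lborel (\<lambda>x. \<integral>z. \<bar>?F z x\<bar> \<partial>lborel)"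
      using lborel_pair.integrable_snd[of "\<lambda>z x. \<bar>?F z x\<bar>"] integrable_abs[OF int]
      by (simp add: split_beta')
  qed (simp add: gauss_smooth_def integral_abs_bound)
  also have "\<dots> = (\<integral>z. (\<integral>x. \<bar>?F z x\<bar> \<partial>lborel) \<partial>lborel)"
    using lborel_pair.Fubini_integral[of "\<lambda>z x. \<bar>?F z x\<bar>"] integrable_abs[OF int]
    by (simp add: split_beta')
  also have "\<dots> = gauss_mass j / s ^ j * (\<integral>x. \<bar>f x\<bar> \<partial>lborel)"
    unfolding n by simp
  finally show "(\<integral>x. \<bar>gauss_smooth j s f x\<bar> \<partial>lborel) \<le> gauss_mass j / s ^ j * (\<integral>x. \<bar>f x\<bar> \<partial>lborel)" .
qed

text \<open>Both sides are \<open>f\<close> paired with a triple convolution. Parity of \<open>gauss j\<close> turns the first mollifier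
  into a convolution acting on \<open>g\<close>, and \<open>gauss_conv\<close> merges the two Gaussians, so that all \<open>2j\<close>
  derivatives sit on one wider Gaussian.\<close>

lemma gauss_smooth_pairing:
  assumes "s > 0" "t > 0" "integrable lborel f"
    and [measurable]: "g \<in> borel_measurable borel" and C: "\<And>x. \<bar>g x\<bar> \<le> C"
  shows "(\<integral>x. gauss_smooth j s f x * gauss_smooth j t g x \<partial>lborel)
       = (-1) ^ j * (\<integral>z. f z * gauss_smooth (j + j) (sqrt (s\<^sup>2 + t\<^sup>2)) g z \<partial>lborel)"
proof -
  have [measurable]: "f \<in> borel_measurable borel" using assms(3) by auto
  have gm [measurable]: "gauss_smooth j t g \<in> borel_measurable borel"
    by (rule gauss_smooth_measurable') measurable
  let ?K = "C * gauss_mass j / t ^ j"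
  let ?F = "\<lambda>z x. gauss j s (x - z) * f z * gauss_smooth j t g x"
  have int: "integrable (lborel \<Otimes>\<^sub>M lborel) (case_prod ?F)"
  proof (rule Bochner_Integration.integrable_bound[OF integrable_mult_right[OF gauss_smooth_L1(3)[OF assms(1,3), of j], of ?K]])
    show "AE p in lborel \<Otimes>\<^sub>M lborel. norm (case_prod ?F p) \<le> norm (?K * (case p of (z, x) \<Rightarrow> gauss j s (x - z) * f z))"
    proof (rule AE_I2, clarify)
      fix z x
      have "\<bar>gauss_smooth j t g x\<bar> \<le> \<bar>?K\<bar>"
        by (rule order_trans[OF gauss_smooth_bound[OF assms(2,4) C] abs_ge_self])
      then show "norm (?F z x) \<le> norm (?K * (gauss j s (x - z) * f z))"
        using mult_left_mono[of "\<bar>gauss_smooth j t g x\<bar>" "\<bar>?K\<bar>" "\<bar>gauss j s (x - z) * f z\<bar>"]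
        by (simp only: real_norm_def abs_mult[of _ "gauss_smooth j t g x"] abs_mult[of ?K] abs_ge_zero
            mult.commute[of "\<bar>?K\<bar>"])
    qed
  qed measurable
  have 1: "(\<integral>x. gauss_smooth j s f x * gauss_smooth j t g x \<partial>lborel)
      = (\<integral>x. (\<integral>z. ?F z x \<partial>lborel) \<partial>lborel)"
    unfolding gauss_smooth_def[of j s f] by simp
  have 2: "(\<integral>x. (\<integral>z. ?F z x \<partial>lborel) \<partial>lborel) = (\<integral>z. (\<integral>x. ?F z x \<partial>lborel) \<partial>lborel)"
    by (rule lborel_pair.Fubini_integral[OF int])
  have 3: "(\<integral>z. (\<integral>x. ?F z x \<partial>lborel) \<partial>lborel) = (\<integral>z. (-1) ^ j * (f z * gauss_smooth (j + j) (sqrt (s\<^sup>2 + t\<^sup>2)) g z) \<partial>lborel)"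
  proof (rule Bochner_Integration.integral_cong[OF refl])
    fix z
    have eq: "gauss j s (x - z) = (-1) ^ j * gauss j s (z - x)" for x
      using gauss_parity[of j s "z - x"] by simp
    have "(\<integral>x. ?F z x \<partial>lborel) = (\<integral>x. ((-1)^j * f z) * (gauss j s (z - x) * gauss_smooth j t g x) \<partial>lborel)"
      unfolding eq by (simp only: mult_ac)
    also have "\<dots> = ((-1)^j * f z) * gauss_smooth (j + j) (sqrt (s\<^sup>2 + t\<^sup>2)) g z"
      by (simp only: integral_mult_right_zero gauss_smooth_gauss_conv[OF assms(1,2,4) C])
    finally show "(\<integral>x. ?F z x \<partial>lborel) = (-1) ^ j * (f z * gauss_smooth (j + j) (sqrt (s\<^sup>2 + t\<^sup>2)) g z)"
      unfolding mult.assoc .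
  qed
  show ?thesis
    by (rule trans[OF 1 trans[OF 2 trans[OF 3 integral_mult_right_zero]]])
qed

section \<open>Averages of the drift along the noise\<close>

locale measurable_process = prob_space M for M :: "'a measure" +
  fixes B :: "real \<Rightarrow> 'a \<Rightarrow> real"
  assumes B_measurable [measurable]: "case_prod B \<in> borel_measurable (borel \<Otimes>\<^sub>M M)"
begin

text \<open>The square of a time integral is a double time integral, and Fubini moves expectation and the
  space integral inside. Together with the bound \<open>D\<close>, the bound \<open>\<beta>\<close> on the \<open>L\<^sup>1\<close> norms makes the
  fourfold integral absolutely convergent.\<close>

lemma second_moment_exchange:
  fixes f :: "real \<Rightarrow> real \<Rightarrow> real" and N :: "real measure"
  assumes "finite_measure N" and sets_N [measurable_cong]: "sets N = sets borel"
    and f_meas [measurable]: "case_prod f \<in> borel_measurable (borel \<Otimes>\<^sub>M borel)"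
    and D: "\<And>r x. \<bar>f r x\<bar> \<le> D"
    and f_int: "\<And>r. integrable lborel (f r)"
    and \<beta>: "\<And>r. (\<integral>x. \<bar>f r x\<bar> \<partial>lborel) \<le> \<beta> r" "integrable N \<beta>"
  shows "(\<integral>\<^sup>+\<omega>. (\<integral>\<^sup>+x. ennreal ((\<integral>r. f r (x + B r \<omega>) \<partial>N)\<^sup>2) \<partial>lborel) \<partial>M)
     = ennreal (\<integral>r. (\<integral>q. (\<integral>\<omega>. (\<integral>x. f r (x + B r \<omega>) * f q (x + B q \<omega>) \<partial>lborel) \<partial>M) \<partial>N) \<partial>N)"
    and "integrable N (\<lambda>r. (\<integral>q. (\<integral>\<omega>. (\<integral>x. f r (x + B r \<omega>) * f q (x + B q \<omega>) \<partial>lborel) \<partial>M) \<partial>N))"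
    and "AE r in N. integrable N (\<lambda>q. (\<integral>\<omega>. (\<integral>x. f r (x + B r \<omega>) * f q (x + B q \<omega>) \<partial>lborel) \<partial>M))"
proof -
  interpret N: finite_measure N by fact
  interpret NN: pair_sigma_finite N N ..
  interpret NNf: finite_measure "N \<Otimes>\<^sub>M N" by (rule finite_measure_pair_measure) unfold_locales
  interpret xp: pair_sigma_finite "N \<Otimes>\<^sub>M N" lborel ..
  interpret px: pair_sigma_finite lborel "N \<Otimes>\<^sub>M N" ..
  interpret wp: pair_sigma_finite M "N \<Otimes>\<^sub>M N" ..
  define F where "F \<omega> p x = f (fst p) (x + B (fst p) \<omega>) * f (snd p) (x + B (snd p) \<omega>)" for \<omega> p x
  have F_meas [measurable]: "(\<lambda>((\<omega>, p), x). F \<omega> p x) \<in> borel_measurable ((M \<Otimes>\<^sub>M (N \<Otimes>\<^sub>M N)) \<Otimes>\<^sub>M lborel)"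
    unfolding F_def split_beta' by measurable
  have F_meas' [measurable]: "(\<lambda>(p, x). F \<omega> p x) \<in> borel_measurable ((N \<Otimes>\<^sub>M N) \<Otimes>\<^sub>M lborel)" if "\<omega> \<in> space M" for \<omega>
    unfolding F_def using that by measurable
  have f1: "(\<lambda>x. f r x) \<in> borel_measurable borel" for r by measurable
  have D0: "0 \<le> D" using D[of 0 0] by linarith
  have shift: "integrable lborel (\<lambda>x. f r (x + a))" "(\<integral>x. \<bar>f r (x + a)\<bar> \<partial>lborel) = (\<integral>x. \<bar>f r x\<bar> \<partial>lborel)" for r a
    using lborel_integrable_real_affine[OF f_int[of r], of 1 a]
      lborel_integral_real_affine[of 1 "\<lambda>x. \<bar>f r x\<bar>" a] by (simp_all add: add.commute)
  have F_le: "\<bar>F \<omega> p x\<bar> \<le> D * \<bar>f (fst p) (x + B (fst p) \<omega>)\<bar>" for \<omega> p x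
    unfolding F_def abs_mult by (subst mult.commute) (intro mult_right_mono D abs_ge_zero)
  have Fint: "integrable lborel (\<lambda>x. F \<omega> p x)" for \<omega> p
  proof (rule Bochner_Integration.integrable_bound[OF integrable_mult_right[OF integrable_abs[OF shift(1)[of "fst p" "B (fst p) \<omega>"]], of D]])
    show "(\<lambda>x. F \<omega> p x) \<in> borel_measurable lborel" unfolding F_def by measurable
    show "AE x in lborel. norm (F \<omega> p x) \<le> norm (D * \<bar>f (fst p) (x + B (fst p) \<omega>)\<bar>)"
      by (rule AE_I2, unfold real_norm_def, rule order_trans[OF F_le abs_ge_self])
  qed
  have Fabs: "(\<integral>x. \<bar>F \<omega> p x\<bar> \<partial>lborel) \<le> D * \<beta> (fst p)" for \<omega> p
  proof -
    have "(\<integral>x. \<bar>F \<omega> p x\<bar> \<partial>lborel) \<le> (\<integral>x. D * \<bar>f (fst p) (x + B (fst p) \<omega>)\<bar> \<partial>lborel)"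
      by (rule integral_mono[OF integrable_abs[OF Fint] integrable_mult_right[OF integrable_abs[OF shift(1)]] F_le])
    also have "\<dots> \<le> D * \<beta> (fst p)"
      using mult_left_mono[OF \<beta>(1)[of "fst p"] D0] by (simp add: shift(2))
    finally show ?thesis .
  qed
  have \<beta>_meas [measurable]: "\<beta> \<in> borel_measurable N" using \<beta>(2) by auto
  have \<beta>0: "0 \<le> \<beta> r" for r
    by (rule order_trans[OF _ \<beta>(1)]) simp
  have \<beta>NN: "integrable (N \<Otimes>\<^sub>M N) (\<lambda>p. \<beta> (fst p))"
  proof -
    have "integrable (N \<Otimes>\<^sub>M N) (\<lambda>(x, y). \<beta> x)"
      by (rule NN.Fubini_integrable) (use \<beta> in auto)
    then show ?thesis by (simp add: split_beta')
  qed
  have int1: "integrable ((N \<Otimes>\<^sub>M N) \<Otimes>\<^sub>M lborel) (\<lambda>(p, x). F \<omega> p x)" if w: "\<omega> \<in> space M" for \<omega>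
  proof (rule xp.Fubini_integrable)
    note F_meas'[OF w, measurable]
    show "(\<lambda>(p, x). F \<omega> p x) \<in> borel_measurable ((N \<Otimes>\<^sub>M N) \<Otimes>\<^sub>M lborel)" by measurable
    show "integrable (N \<Otimes>\<^sub>M N) (\<lambda>p. \<integral>x. norm (case (p, x) of (p, x) \<Rightarrow> F \<omega> p x) \<partial>lborel)"
    proof (rule Bochner_Integration.integrable_bound[OF integrable_mult_right[OF \<beta>NN, of D]])
      show "AE p in N \<Otimes>\<^sub>M N. norm (\<integral>x. norm (case (p, x) of (p, x) \<Rightarrow> F \<omega> p x) \<partial>lborel) \<le> norm (D * \<beta> (fst p))"
        using Fabs order_trans[OF Fabs abs_ge_self] by simp
    qed measurable
    show "AE p in N \<Otimes>\<^sub>M N. integrable lborel (\<lambda>x. case (p, x) of (p, x) \<Rightarrow> F \<omega> p x)"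
      using Fint by simp
  qed
  have sq: "(\<integral>r. f r (x + B r \<omega>) \<partial>N)\<^sup>2 = (\<integral>p. F \<omega> p x \<partial>(N \<Otimes>\<^sub>M N))" if w: "\<omega> \<in> space M" for x \<omega>
  proof -
    have [measurable]: "(\<lambda>r. f r (x + B r \<omega>)) \<in> borel_measurable N" using w by measurable
    have i: "integrable N (\<lambda>r. f r (x + B r \<omega>))"
      by (rule N.integrable_const_bound[of _ D]) (use D in auto)
    have "integrable (N \<Otimes>\<^sub>M N) (\<lambda>(r, q). f r (x + B r \<omega>) * f q (x + B q \<omega>))"
    proof (rule NNf.integrable_const_bound[of _ "D * D"])
      show "AE p in N \<Otimes>\<^sub>M N. norm (case p of (r, q) \<Rightarrow> f r (x + B r \<omega>) * f q (x + B q \<omega>)) \<le> D * D"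
        by (rule AE_I2) (use D D0 in \<open>simp add: split_beta' abs_mult mult_mono\<close>)
    qed (use w in measurable)
    from NN.integral_fst[OF this] show ?thesis
      by (simp add: F_def split_beta' power2_eq_square)
  qed
  define h where "h \<omega> p = (\<integral>x. F \<omega> p x \<partial>lborel)" for \<omega> p
  have h_meas [measurable]: "(\<lambda>(\<omega>, p). h \<omega> p) \<in> borel_measurable (M \<Otimes>\<^sub>M (N \<Otimes>\<^sub>M N))"
  proof -
    have [measurable]: "(\<lambda>w. F (fst (fst w)) (snd (fst w)) (snd w)) \<in> borel_measurable ((M \<Otimes>\<^sub>M (N \<Otimes>\<^sub>M N)) \<Otimes>\<^sub>M lborel)"
      using F_meas by (simp only: split_beta')
    show ?thesis unfolding h_def by measurable
  qed
  have h_le: "\<bar>h \<omega> p\<bar> \<le> D * \<beta> (fst p)" for \<omega> p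
    unfolding h_def by (rule order_trans[OF integral_abs_bound Fabs])
  have inner: "(\<integral>\<^sup>+x. ennreal ((\<integral>r. f r (x + B r \<omega>) \<partial>N)\<^sup>2) \<partial>lborel) = ennreal (\<integral>p. h \<omega> p \<partial>(N \<Otimes>\<^sub>M N))"
    and inner0: "0 \<le> (\<integral>p. h \<omega> p \<partial>(N \<Otimes>\<^sub>M N))"
    if w: "\<omega> \<in> space M" for \<omega>
  proof -
    have e: "(\<integral>x. (\<integral>r. f r (x + B r \<omega>) \<partial>N)\<^sup>2 \<partial>lborel) = (\<integral>p. h \<omega> p \<partial>(N \<Otimes>\<^sub>M N))"
      unfolding sq[OF w] h_def by (rule xp.Fubini_integral[OF int1[OF w]])
    have i: "integrable lborel (\<lambda>x. (\<integral>r. f r (x + B r \<omega>) \<partial>N)\<^sup>2)"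
      unfolding sq[OF w] by (rule xp.integrable_snd[OF int1[OF w]])
    show "0 \<le> (\<integral>p. h \<omega> p \<partial>(N \<Otimes>\<^sub>M N))"
      unfolding e[symmetric] by simp
    show "(\<integral>\<^sup>+x. ennreal ((\<integral>r. f r (x + B r \<omega>) \<partial>N)\<^sup>2) \<partial>lborel) = ennreal (\<integral>p. h \<omega> p \<partial>(N \<Otimes>\<^sub>M N))"
      unfolding e[symmetric] by (rule nn_integral_eq_integral[OF i]) simp
  qed
  have int2: "integrable (M \<Otimes>\<^sub>M (N \<Otimes>\<^sub>M N)) (\<lambda>(\<omega>, p). h \<omega> p)"
  proof (rule wp.Fubini_integrable)
    have i: "integrable (N \<Otimes>\<^sub>M N) (h \<omega>)" if "\<omega> \<in> space M" for \<omega>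
    proof (rule Bochner_Integration.integrable_bound[OF integrable_mult_right[OF \<beta>NN, of D]])
      show "h \<omega> \<in> borel_measurable (N \<Otimes>\<^sub>M N)" using that by measurable
    qed (use order_trans[OF h_le abs_ge_self] in simp)
    show "AE \<omega> in M. integrable (N \<Otimes>\<^sub>M N) (\<lambda>p. case (\<omega>, p) of (\<omega>, p) \<Rightarrow> h \<omega> p)"
      using i by (auto intro!: AE_I2)
    show "integrable M (\<lambda>\<omega>. \<integral>p. norm (case (\<omega>, p) of (\<omega>, p) \<Rightarrow> h \<omega> p) \<partial>(N \<Otimes>\<^sub>M N))"
    proof (rule integrable_const_bound[of _ "\<integral>p. D * \<beta> (fst p) \<partial>(N \<Otimes>\<^sub>M N)"])
      show "AE \<omega> in M. norm (\<integral>p. norm (case (\<omega>, p) of (\<omega>, p) \<Rightarrow> h \<omega> p) \<partial>(N \<Otimes>\<^sub>M N)) \<le> (\<integral>p. D * \<beta> (fst p) \<partial>(N \<Otimes>\<^sub>M N))"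
      proof (rule AE_I2)
        fix \<omega> assume w: "\<omega> \<in> space M"
        have "(\<integral>p. \<bar>h \<omega> p\<bar> \<partial>(N \<Otimes>\<^sub>M N)) \<le> (\<integral>p. D * \<beta> (fst p) \<partial>(N \<Otimes>\<^sub>M N))"
          by (rule integral_mono[OF integrable_abs[OF i[OF w]] integrable_mult_right[OF \<beta>NN] h_le])
        then show "norm (\<integral>p. norm (case (\<omega>, p) of (\<omega>, p) \<Rightarrow> h \<omega> p) \<partial>(N \<Otimes>\<^sub>M N)) \<le> (\<integral>p. D * \<beta> (fst p) \<partial>(N \<Otimes>\<^sub>M N))"
          by simp
      qed
    qed measurable
  qed measurable
  have int3: "integrable (N \<Otimes>\<^sub>M N) (\<lambda>(r, q). \<integral>\<omega>. h \<omega> (r, q) \<partial>M)"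
    using wp.integrable_snd[OF int2] by (simp add: split_beta')
  have "(\<integral>\<^sup>+\<omega>. (\<integral>\<^sup>+x. ennreal ((\<integral>r. f r (x + B r \<omega>) \<partial>N)\<^sup>2) \<partial>lborel) \<partial>M)
     = (\<integral>\<^sup>+\<omega>. ennreal (\<integral>p. h \<omega> p \<partial>(N \<Otimes>\<^sub>M N)) \<partial>M)"
    by (rule nn_integral_cong) (rule inner)
  also have "\<dots> = ennreal (\<integral>\<omega>. (\<integral>p. h \<omega> p \<partial>(N \<Otimes>\<^sub>M N)) \<partial>M)"
    by (rule nn_integral_eq_integral[OF wp.integrable_fst[OF int2] AE_I2[OF inner0]])
  also have "(\<integral>\<omega>. (\<integral>p. h \<omega> p \<partial>(N \<Otimes>\<^sub>M N)) \<partial>M) = (\<integral>p. (\<integral>\<omega>. h \<omega> p \<partial>M) \<partial>(N \<Otimes>\<^sub>M N))"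
    by (rule wp.Fubini_integral[OF int2, symmetric])
  also have "(\<integral>p. (\<integral>\<omega>. h \<omega> p \<partial>M) \<partial>(N \<Otimes>\<^sub>M N)) = (\<integral>r. (\<integral>q. (\<integral>\<omega>. h \<omega> (r, q) \<partial>M) \<partial>N) \<partial>N)"
    using NN.integral_fst[OF int3] by (simp add: split_beta')
  finally show "(\<integral>\<^sup>+\<omega>. (\<integral>\<^sup>+x. ennreal ((\<integral>r. f r (x + B r \<omega>) \<partial>N)\<^sup>2) \<partial>lborel) \<partial>M)
     = ennreal (\<integral>r. (\<integral>q. (\<integral>\<omega>. (\<integral>x. f r (x + B r \<omega>) * f q (x + B q \<omega>) \<partial>lborel) \<partial>M) \<partial>N) \<partial>N)"
    by (simp add: h_def F_def)
  show "integrable N (\<lambda>r. (\<integral>q. (\<integral>\<omega>. (\<integral>x. f r (x + B r \<omega>) * f q (x + B q \<omega>) \<partial>lborel) \<partial>M) \<partial>N))"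
    using NN.integrable_fst[OF int3] by (simp add: h_def F_def)
  show "AE r in N. integrable N (\<lambda>q. (\<integral>\<omega>. (\<integral>x. f r (x + B r \<omega>) * f q (x + B q \<omega>) \<partial>lborel) \<partial>M))"
    using NN.AE_integrable_fst[OF int3] by (simp add: h_def F_def)
qed

end

text \<open>Enlarging the interval to one of length \<open>2 (t - s)\<close> centred at \<open>r\<close> makes the bound independent of
  the position of \<open>r\<close>.\<close>

lemma powr_singularity_integral:
  fixes s r t a :: real
  assumes a: "0 \<le> a" "a < 1" and r: "s \<le> r" "r \<le> t"
  shows "integrable lborel (\<lambda>q. indicator {s..<t} q * \<bar>q - r\<bar> powr - a)"
    and "(\<integral>q. indicator {s..<t} q * \<bar>q - r\<bar> powr - a \<partial>lborel) \<le> 2 * (t - s) powr (1 - a) / (1 - a)"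
proof -
  define L where "L = t - s"
  have L: "0 \<le> L" using r by (simp add: L_def)
  let ?h = "\<lambda>w::real. indicator {-L..L} w * \<bar>w\<bar> powr - a"
  have hi: "((\<lambda>x. x powr - a) has_integral (L powr (1 - a) / (1 - a))) {0..L}"
    using has_integral_powr_from_0[of "- a" L] a L by (simp add: add.commute)
  have ai: "(\<lambda>x. x powr - a) absolutely_integrable_on {0..L}"
    by (rule nonnegative_absolutely_integrable_1) (use hi in \<open>auto simp: integrable_on_def\<close>)
  have eq: "indicator {0..} x *\<^sub>R ?h x = indicator {0..L} x *\<^sub>R (x powr - a)" for x
    by (auto simp: indicator_def)
  have "set_lebesgue_integral lebesgue {0..L} (\<lambda>x. x powr - a) = L powr (1 - a) / (1 - a)"
    using set_lebesgue_integral_eq_integral(2)[OF ai] hi by (simp add: integral_unique)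
  then have "has_bochner_integral lebesgue (\<lambda>x. indicator {0..L} x *\<^sub>R (x powr - a)) (L powr (1 - a) / (1 - a))"
    using ai by (simp add: has_bochner_integral_iff set_integrable_def set_lebesgue_integral_def)
  then have "has_bochner_integral lborel (\<lambda>x. indicator {0..L} x *\<^sub>R (x powr - a)) (L powr (1 - a) / (1 - a))"
    by (simp add: has_bochner_integral_iff integrable_completion integral_completion)
  then have "has_bochner_integral lborel ?h (2 *\<^sub>R (L powr (1 - a) / (1 - a)))"
    by (intro has_bochner_integral_even_function) (simp only: eq, auto simp: indicator_def)
  then have hb: "has_bochner_integral lborel ?h (2 * (L powr (1 - a) / (1 - a)))" by simp
  have hb': "has_bochner_integral lborel (\<lambda>q. ?h (q - r)) (2 * (L powr (1 - a) / (1 - a)))"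
    using lborel_has_bochner_integral_real_affine_iff[of 1 ?h "2 * (L powr (1 - a) / (1 - a))" "-r"] hb
    by (simp add: add.commute)
  have le: "\<bar>indicator {s..<t} q * \<bar>q - r\<bar> powr - a\<bar> \<le> ?h (q - r)" for q
    using r by (auto simp: indicator_def L_def)
  show i: "integrable lborel (\<lambda>q. indicator {s..<t} q * \<bar>q - r\<bar> powr - a)"
    by (rule Bochner_Integration.integrable_bound[OF integrable.intros[OF hb']])
       (use le in \<open>auto intro!: AE_I2 intro: order_trans[OF _ abs_ge_self]\<close>)
  have "(\<integral>q. indicator {s..<t} q * \<bar>q - r\<bar> powr - a \<partial>lborel) \<le> (\<integral>q. ?h (q - r) \<partial>lborel)"
    by (rule integral_mono[OF i integrable.intros[OF hb']])
       (rule order_trans[OF abs_ge_self le])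
  also have "\<dots> = 2 * (t - s) powr (1 - a) / (1 - a)"
    using has_bochner_integral_integral_eq[OF hb'] by (simp add: L_def)
  finally show "(\<integral>q. indicator {s..<t} q * \<bar>q - r\<bar> powr - a \<partial>lborel) \<le> 2 * (t - s) powr (1 - a) / (1 - a)" .
qed

text \<open>The law of single increments is what the second moment method requires of the noise.\<close>

locale noisy_drift = measurable_process M B for M :: "'a measure" and B :: "real \<Rightarrow> 'a \<Rightarrow> real" +
  fixes H T Cb :: real and b :: "real \<Rightarrow> real \<Rightarrow> real"
  assumes T: "0 < T" and H: "0 < H" "H < 1 / 4"
    and increments: "\<And>r q. r \<in> {0..T} \<Longrightarrow> q \<in> {0..T} \<Longrightarrow> r \<noteq> q \<Longrightarrow>
      distributed M lborel (\<lambda>\<omega>. B q \<omega> - B r \<omega>) (\<lambda>x. ennreal (normal_density 0 (\<bar>q - r\<bar> powr H) x))"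
    and b_measurable [measurable]: "case_prod b \<in> borel_measurable (borel \<Otimes>\<^sub>M borel)"
    and b_bound: "\<And>r x. \<bar>b r x\<bar> \<le> Cb"
    and b_integrable: "\<And>r. integrable lborel (b r)"
    and b_L1: "integrable lborel (\<lambda>r. \<integral>x. \<bar>b r x\<bar> \<partial>lborel)"
begin

lemma b_measurable2: "b r \<in> borel_measurable borel"
  using b_integrable by auto

lemma smooth_b_measurable:
  "case_prod (\<lambda>r. gauss_smooth j \<epsilon> (b r)) \<in> borel_measurable (borel \<Otimes>\<^sub>M borel)"
  unfolding split_beta' by (rule gauss_smooth_measurable[OF b_measurable]) auto

text \<open>After the translation \<open>x \<mapsto> x - B\<^sub>r\<close> only \<open>B\<^sub>q - B\<^sub>r\<close> is left. Averaging over this Gaussian widens the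
  mollifier of the second factor, and by \<open>gauss_smooth_pairing\<close> all \<open>2j\<close> derivatives fall on a
  Gaussian at least as wide as the increment. Hence the bound is uniform in the mollification
  width \<open>\<epsilon>\<close>.\<close>

lemma two_time_correlation:
  assumes "\<epsilon> > 0" and rq: "r \<in> {0..T}" "q \<in> {0..T}" "r \<noteq> q"
  shows "\<bar>\<integral>\<omega>. (\<integral>x. gauss_smooth j \<epsilon> (b r) (x + B r \<omega>) * gauss_smooth j \<epsilon> (b q) (x + B q \<omega>) \<partial>lborel) \<partial>M\<bar>
     \<le> Cb * gauss_mass (j + j) * (\<integral>x. \<bar>b r x\<bar> \<partial>lborel) * \<bar>q - r\<bar> powr (- (2 * real j * H))"
proof -
  define \<sigma> where "\<sigma> = \<bar>q - r\<bar> powr H"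
  have \<sigma>: "\<sigma> > 0" using rq by (simp add: \<sigma>_def)
  let ?fr = "gauss_smooth j \<epsilon> (b r)" and ?fq = "gauss_smooth j \<epsilon> (b q)"
  define \<xi> where "\<xi> \<omega> = B q \<omega> - B r \<omega>" for \<omega>
  note b_measurable2 [measurable]
  have [measurable]: "?fr \<in> borel_measurable borel" "?fq \<in> borel_measurable borel"
    by (rule gauss_smooth_measurable', measurable)+
  have [measurable]: "\<xi> \<in> borel_measurable M" unfolding \<xi>_def by measurable
  define D where "D = Cb * gauss_mass j / \<epsilon> ^ j"
  have D: "\<bar>gauss_smooth j \<epsilon> (b s) x\<bar> \<le> D" for s x
    unfolding D_def by (rule gauss_smooth_bound[OF assms(1) b_measurable2 b_bound])
  have fr_int: "integrable lborel ?fr" by (rule gauss_smooth_L1(1)[OF assms(1) b_integrable])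
  interpret wx: pair_sigma_finite M lborel ..
  have 1: "(\<integral>x. ?fr (x + B r \<omega>) * ?fq (x + B q \<omega>) \<partial>lborel) = (\<integral>x. ?fr x * ?fq (x + \<xi> \<omega>) \<partial>lborel)" for \<omega>
    using lborel_integral_real_affine[of 1 "\<lambda>x. ?fr x * ?fq (x + \<xi> \<omega>)" "B r \<omega>"]
    by (simp add: \<xi>_def add.commute)
  have int: "integrable (M \<Otimes>\<^sub>M lborel) (\<lambda>(\<omega>, x). ?fr x * ?fq (x + \<xi> \<omega>))"
  proof (rule Bochner_Integration.integrable_bound)
    show "integrable (M \<Otimes>\<^sub>M lborel) (\<lambda>(\<omega>, x). D * ?fr x)"
    proof (rule wx.Fubini_integrable)
      show "(\<lambda>(\<omega>, x). D * ?fr x) \<in> borel_measurable (M \<Otimes>\<^sub>M lborel)" by measurable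
    qed (use fr_int in auto)
    show "AE p in M \<Otimes>\<^sub>M lborel. norm (case p of (\<omega>, x) \<Rightarrow> ?fr x * ?fq (x + \<xi> \<omega>)) \<le> norm (case p of (\<omega>, x) \<Rightarrow> D * ?fr x)"
    proof (rule AE_I2, clarify)
      fix \<omega> x
      have "\<bar>?fr x\<bar> * \<bar>?fq (x + \<xi> \<omega>)\<bar> \<le> \<bar>?fr x\<bar> * \<bar>D\<bar>"
        by (rule mult_left_mono[OF order_trans[OF D abs_ge_self] abs_ge_zero])
      then show "norm (?fr x * ?fq (x + \<xi> \<omega>)) \<le> norm (D * ?fr x)"
        by (simp add: abs_mult mult.commute)
    qed
  qed measurable
  have 2: "(\<integral>\<omega>. (\<integral>x. ?fr x * ?fq (x + \<xi> \<omega>) \<partial>lborel) \<partial>M) = (\<integral>x. (\<integral>\<omega>. ?fr x * ?fq (x + \<xi> \<omega>) \<partial>M) \<partial>lborel)"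
    by (rule wx.Fubini_integral[OF int, symmetric])
  have dist: "distributed M lborel \<xi> (\<lambda>x. ennreal (normal_density 0 \<sigma> x))"
    unfolding \<xi>_def \<sigma>_def by (rule increments[OF rq])
  have 3: "(\<integral>\<omega>. ?fq (x + \<xi> \<omega>) \<partial>M) = gauss_smooth j (sqrt (\<sigma>\<^sup>2 + \<epsilon>\<^sup>2)) (b q) x" for x
  proof -
    have "(\<integral>\<omega>. ?fq (x + \<xi> \<omega>) \<partial>M) = (\<integral>w. normal_density 0 \<sigma> w * ?fq (x + w) \<partial>lborel)"
      by (rule distributed_integral[OF dist, symmetric]) auto
    also have "\<dots> = (\<integral>y. normal_density 0 \<sigma> (x - y) * ?fq y \<partial>lborel)"
      using lborel_integral_real_affine[of 1 "\<lambda>y. normal_density 0 \<sigma> (x - y) * ?fq y" x, symmetric]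
      by (simp add: normal_density_def)
    also have "\<dots> = (\<integral>y. gauss 0 \<sigma> (x - y) * ?fq y \<partial>lborel)"
      by (simp only: gauss_0[OF \<sigma>])
    also have "\<dots> = gauss_smooth (0 + j) (sqrt (\<sigma>\<^sup>2 + \<epsilon>\<^sup>2)) (b q) x"
      by (rule gauss_smooth_gauss_conv[OF \<sigma> assms(1) b_measurable2 b_bound])
    finally show ?thesis by simp
  qed
  define \<tau> where "\<tau> = sqrt (\<epsilon>\<^sup>2 + (sqrt (\<sigma>\<^sup>2 + \<epsilon>\<^sup>2))\<^sup>2)"
  have \<tau>: "\<sigma> \<le> \<tau>" "0 < \<tau>"
    using \<sigma> assms(1) by (auto simp: \<tau>_def intro!: real_le_rsqrt add_nonneg_pos add_pos_nonneg)
  have s0: "sqrt (\<sigma>\<^sup>2 + \<epsilon>\<^sup>2) > 0" using \<sigma> by (simp add: add_pos_nonneg)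
  have "(\<integral>\<omega>. (\<integral>x. ?fr (x + B r \<omega>) * ?fq (x + B q \<omega>) \<partial>lborel) \<partial>M)
      = (\<integral>x. ?fr x * gauss_smooth j (sqrt (\<sigma>\<^sup>2 + \<epsilon>\<^sup>2)) (b q) x \<partial>lborel)"
    unfolding 1 2 by (simp only: integral_mult_right_zero 3)
  also have "\<dots> = (-1) ^ j * (\<integral>z. b r z * gauss_smooth (j + j) \<tau> (b q) z \<partial>lborel)"
    unfolding \<tau>_def by (rule gauss_smooth_pairing[OF assms(1) s0 b_integrable b_measurable2 b_bound])
  finally have eq: "\<bar>\<integral>\<omega>. (\<integral>x. ?fr (x + B r \<omega>) * ?fq (x + B q \<omega>) \<partial>lborel) \<partial>M\<bar>
      = \<bar>\<integral>z. b r z * gauss_smooth (j + j) \<tau> (b q) z \<partial>lborel\<bar>"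
    by (simp add: abs_mult)
  define K where "K = Cb * gauss_mass (j + j) / \<tau> ^ (j + j)"
  have K: "\<bar>gauss_smooth (j + j) \<tau> (b q) z\<bar> \<le> K" for z
    unfolding K_def by (rule gauss_smooth_bound[OF \<tau>(2) b_measurable2 b_bound])
  have le: "\<bar>b r z * gauss_smooth (j + j) \<tau> (b q) z\<bar> \<le> K * \<bar>b r z\<bar>" for z
    using mult_left_mono[OF K[of z] abs_ge_zero[of "b r z"]] by (simp add: abs_mult mult.commute)
  have [measurable]: "gauss_smooth (j + j) \<tau> (b q) \<in> borel_measurable borel"
    by (rule gauss_smooth_measurable') measurable
  have i: "integrable lborel (\<lambda>z. K * \<bar>b r z\<bar>)"
    by (rule integrable_mult_right[OF integrable_abs[OF b_integrable]])
  have "integrable lborel (\<lambda>z. b r z * gauss_smooth (j + j) \<tau> (b q) z)"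
  proof (rule Bochner_Integration.integrable_bound[OF i])
    show "AE z in lborel. norm (b r z * gauss_smooth (j + j) \<tau> (b q) z) \<le> norm (K * \<bar>b r z\<bar>)"
      by (rule AE_I2, unfold real_norm_def, rule order_trans[OF le abs_ge_self])
  qed measurable
  then have "(\<integral>z. \<bar>b r z * gauss_smooth (j + j) \<tau> (b q) z\<bar> \<partial>lborel) \<le> (\<integral>z. K * \<bar>b r z\<bar> \<partial>lborel)"
    by (rule integral_mono[OF integrable_abs i le])
  then have "\<bar>\<integral>z. b r z * gauss_smooth (j + j) \<tau> (b q) z \<partial>lborel\<bar> \<le> K * (\<integral>z. \<bar>b r z\<bar> \<partial>lborel)"
    using order_trans[OF integral_abs_bound] by simp
  also have "\<dots> \<le> Cb * gauss_mass (j + j) / \<sigma> ^ (j + j) * (\<integral>z. \<bar>b r z\<bar> \<partial>lborel)"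
  proof (rule mult_right_mono)
    have "0 \<le> Cb" using b_bound[of 0 0] by linarith
    then show "K \<le> Cb * gauss_mass (j + j) / \<sigma> ^ (j + j)"
      unfolding K_def using \<sigma> \<tau> gauss_mass_nonneg by (intro divide_left_mono power_mono) auto
  qed simp
  also have "Cb * gauss_mass (j + j) / \<sigma> ^ (j + j) = Cb * gauss_mass (j + j) * \<bar>q - r\<bar> powr (- (2 * real j * H))"
  proof -
    have "\<sigma> ^ (j + j) = \<bar>q - r\<bar> powr (H * real (j + j))"
      using rq by (simp add: \<sigma>_def powr_powr flip: powr_realpow)
    also have "H * real (j + j) = 2 * real j * H" by simp
    finally show ?thesis by (simp add: powr_minus divide_inverse)
  qed
  finally show ?thesis unfolding eq by (simp add: mult.commute mult.left_commute)
qed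

text \<open>Integrate \<open>two_time_correlation\<close> over the square of \<open>[s, t)\<close>: in \<open>q\<close> the singularity is integrable
  since \<open>2jH < 1\<close> and contributes the power of \<open>t - s\<close>, in \<open>r\<close> the \<open>L\<^sup>1\<close> norms of the drift remain. That
  the latter are additive in the interval is what keeps the sum over dyadic cells under control.\<close>

lemma energy_bound:
  assumes \<epsilon>: "\<epsilon> > 0" and st: "0 \<le> s" "s \<le> t" "t \<le> T" and j: "2 * real j * H < 1"
  shows "(\<integral>\<^sup>+\<omega>. (\<integral>\<^sup>+x. ennreal ((\<integral>r. indicator {s..<t} r * gauss_smooth j \<epsilon> (b r) (x + B r \<omega>) \<partial>lborel)\<^sup>2) \<partial>lborel) \<partial>M)
    \<le> ennreal (Cb * gauss_mass (j + j) * (2 * (t - s) powr (1 - 2 * real j * H) / (1 - 2 * real j * H))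
        * (\<integral>r. indicator {s..<t} r * (\<integral>x. \<bar>b r x\<bar> \<partial>lborel) \<partial>lborel))"
proof -
  define N where "N = density lborel (\<lambda>r. ennreal (indicator {s..<t} r))"
  have fin: "finite_measure N"
    unfolding N_def by (rule finite_measureI) (use st in \<open>simp add: emeasure_density ennreal_indicator\<close>)
  have sets_N [measurable_cong]: "sets N = sets borel" by (simp add: N_def)
  have intN: "(\<integral>r. g r \<partial>N) = (\<integral>r. indicator {s..<t} r * g r \<partial>lborel)" if "g \<in> borel_measurable borel" for g :: "real \<Rightarrow> real"
    unfolding N_def using that by (subst integral_density) auto
  have integrableN: "integrable N g \<longleftrightarrow> integrable lborel (\<lambda>r. indicator {s..<t} r * g r)" if "g \<in> borel_measurable borel" for g :: "real \<Rightarrow> real"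
    unfolding N_def using that by (subst integrable_density) auto
  have AEN: "AE r in N. r \<in> {s..<t}"
    unfolding N_def by (subst AE_density) (auto simp: indicator_def)
  let ?f = "\<lambda>r. gauss_smooth j \<epsilon> (b r)"
  define \<beta> where "\<beta> r = (\<integral>x. \<bar>b r x\<bar> \<partial>lborel)" for r
  have [measurable]: "\<beta> \<in> borel_measurable borel" unfolding \<beta>_def by measurable
  have \<beta>0: "0 \<le> \<beta> r" for r by (simp add: \<beta>_def)
  have \<beta>N: "integrable N \<beta>"
  proof (subst integrableN)
    have "integrable lborel \<beta>" using b_L1 by (simp add: \<beta>_def[abs_def])
    from integrable_mult_indicator[OF _ this, of "{s..<t}"]
    show "integrable lborel (\<lambda>r. indicator {s..<t} r * \<beta> r)" by simp
  qed measurable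
  have fb: "\<bar>?f r x\<bar> \<le> Cb * gauss_mass j / \<epsilon> ^ j" for r x
    by (rule gauss_smooth_bound[OF \<epsilon> b_measurable2 b_bound])
  have fL: "integrable lborel (?f r)" for r
    by (rule gauss_smooth_L1(1)[OF \<epsilon> b_integrable])
  have fL': "(\<integral>x. \<bar>?f r x\<bar> \<partial>lborel) \<le> gauss_mass j / \<epsilon> ^ j * \<beta> r" for r
    unfolding \<beta>_def by (rule gauss_smooth_L1(2)[OF \<epsilon> b_integrable])
  note SM = second_moment_exchange[OF fin sets_N smooth_b_measurable[of j \<epsilon>] fb fL fL' integrable_mult_right[OF \<beta>N]]
  define k where "k r q = (\<integral>\<omega>. (\<integral>x. ?f r (x + B r \<omega>) * ?f q (x + B q \<omega>) \<partial>lborel) \<partial>M)" for r q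
  note SM = SM[folded k_def]
  define K where "K = Cb * gauss_mass (j + j)"
  define P where "P = 2 * (t - s) powr (1 - 2 * real j * H) / (1 - 2 * real j * H)"
  have Cb: "0 \<le> Cb" using b_bound[of 0 0] by linarith
  have K0: "0 \<le> K" using Cb gauss_mass_nonneg by (simp add: K_def)
  have inner: "(\<integral>q. k r q \<partial>N) \<le> K * P * \<beta> r" if r: "r \<in> {s..<t}" and i: "integrable N (k r)" for r
  proof -
    let ?w = "\<lambda>q. \<bar>q - r\<bar> powr (- (2 * real j * H))"
    have pi: "integrable lborel (\<lambda>q. indicator {s..<t} q * ?w q)"
        "(\<integral>q. indicator {s..<t} q * ?w q \<partial>lborel) \<le> P"
      using powr_singularity_integral[of "2 * real j * H" s r t] j r H unfolding P_def by auto
    have wm: "?w \<in> borel_measurable borel" by measurable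
    have "(\<integral>q. k r q \<partial>N) \<le> (\<integral>q. K * \<beta> r * ?w q \<partial>N)"
    proof (rule integral_mono_AE[OF i])
      show "integrable N (\<lambda>q. K * \<beta> r * ?w q)"
        by (rule integrable_mult_right) (use pi integrableN[OF wm] in simp)
      have "AE q in N. q \<noteq> r"
        unfolding N_def by (subst AE_density) (use AE_lborel_singleton[of r] in auto)
      with AEN show "AE q in N. k r q \<le> K * \<beta> r * ?w q"
      proof eventually_elim
        case (elim q)
        have "\<bar>k r q\<bar> \<le> K * \<beta> r * ?w q"
          unfolding k_def K_def \<beta>_def by (rule two_time_correlation[OF \<epsilon>]) (use elim r st in auto)
        then show ?case by linarith
      qed
    qed
    also have "\<dots> = K * \<beta> r * (\<integral>q. indicator {s..<t} q * ?w q \<partial>lborel)"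
      by (simp add: intN[OF wm])
    also have "\<dots> \<le> K * \<beta> r * P"
      by (rule mult_left_mono[OF pi(2)]) (use K0 \<beta>0 in simp)
    finally show ?thesis by (simp add: mult_ac)
  qed
  have "(\<integral>r. (\<integral>q. k r q \<partial>N) \<partial>N) \<le> (\<integral>r. K * P * \<beta> r \<partial>N)"
  proof (rule integral_mono_AE[OF SM(2) integrable_mult_right[OF \<beta>N]])
    show "AE r in N. (\<integral>q. k r q \<partial>N) \<le> K * P * \<beta> r"
      using AEN SM(3) by eventually_elim (rule inner)
  qed
  also have "\<dots> = K * P * (\<integral>r. indicator {s..<t} r * \<beta> r \<partial>lborel)"
    by (simp add: intN)
  finally have fin: "(\<integral>r. (\<integral>q. k r q \<partial>N) \<partial>N) \<le> K * P * (\<integral>r. indicator {s..<t} r * \<beta> r \<partial>lborel)" .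
  have "(\<integral>\<^sup>+\<omega>. (\<integral>\<^sup>+x. ennreal ((\<integral>r. indicator {s..<t} r * ?f r (x + B r \<omega>) \<partial>lborel)\<^sup>2) \<partial>lborel) \<partial>M)
     = (\<integral>\<^sup>+\<omega>. (\<integral>\<^sup>+x. ennreal ((\<integral>r. ?f r (x + B r \<omega>) \<partial>N)\<^sup>2) \<partial>lborel) \<partial>M)"
  proof (rule nn_integral_cong)
    fix \<omega> assume [measurable]: "\<omega> \<in> space M"
    have m: "(\<lambda>r. ?f r (x + B r \<omega>)) \<in> borel_measurable borel" for x
      by (rule gauss_smooth_measurable[OF b_measurable]) measurable
    show "(\<integral>\<^sup>+x. ennreal ((\<integral>r. indicator {s..<t} r * ?f r (x + B r \<omega>) \<partial>lborel)\<^sup>2) \<partial>lborel)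
        = (\<integral>\<^sup>+x. ennreal ((\<integral>r. ?f r (x + B r \<omega>) \<partial>N)\<^sup>2) \<partial>lborel)"
      by (simp only: intN[OF m])
  qed
  also have "\<dots> \<le> ennreal (K * P * (\<integral>r. indicator {s..<t} r * \<beta> r \<partial>lborel))"
    unfolding SM(1) by (rule ennreal_leI[OF fin])
  finally show ?thesis unfolding K_def P_def \<beta>_def .
qed

end

section \<open>Almost sure decay of the dyadic energies\<close>

definition dyadic_cell :: "real \<Rightarrow> nat \<Rightarrow> nat \<Rightarrow> real set" where
  "dyadic_cell T m k = {T * real k / 2 ^ m ..< T * real (Suc k) / 2 ^ m}"

text \<open>By Fatou's lemma the lower limit of \<open>Z\<close> has finite expectation, so it is almost surely finite,
  and along a subsequence, which depends on the point, \<open>Z\<close> stays below any larger constant.\<close>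

lemma frequently_bounded_of_nn_integral_bounded:
  fixes Z :: "nat \<Rightarrow> 'a \<Rightarrow> ennreal"
  assumes [measurable]: "\<And>n. Z n \<in> borel_measurable M" and le: "\<And>n. (\<integral>\<^sup>+\<omega>. Z n \<omega> \<partial>M) \<le> ennreal C"
  shows "AE \<omega> in M. \<exists>K \<sigma>. 0 \<le> K \<and> strict_mono (\<sigma> :: nat \<Rightarrow> nat) \<and> (\<forall>i. Z (\<sigma> i) \<omega> \<le> ennreal K)"
proof -
  have "(\<integral>\<^sup>+\<omega>. liminf (\<lambda>n. Z n \<omega>) \<partial>M) \<le> liminf (\<lambda>n. \<integral>\<^sup>+\<omega>. Z n \<omega> \<partial>M)"
    by (rule nn_integral_liminf) measurable
  also have "\<dots> \<le> liminf (\<lambda>n. ennreal C)"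
    by (intro Liminf_mono always_eventually allI le)
  also have "\<dots> < \<infinity>" by (simp add: Liminf_const)
  finally have "AE \<omega> in M. liminf (\<lambda>n. Z n \<omega>) \<noteq> \<infinity>"
    by (intro nn_integral_noteq_infinite) auto
  then show ?thesis
  proof eventually_elim
    case (elim \<omega>)
    then obtain K where K: "0 \<le> K" "liminf (\<lambda>n. Z n \<omega>) = ennreal K"
      by (cases "liminf (\<lambda>n. Z n \<omega>)") auto
    then have "liminf (\<lambda>n. Z n \<omega>) < ennreal (K + 1)" by (simp add: ennreal_less_iff)
    then have "\<not> eventually (\<lambda>n. ennreal (K + 1) \<le> Z n \<omega>) sequentially"
      using Liminf_bounded[of "ennreal (K + 1)" "\<lambda>n. Z n \<omega>" sequentially] by (auto simp: not_less)
    then have inf: "infinite {n. Z n \<omega> < ennreal (K + 1)}"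
      by (simp add: not_eventually not_le frequently_cofinite flip: cofinite_eq_sequentially)
    show ?case
      by (rule exI[of _ "K + 1"], rule exI[of _ "enumerate {n. Z n \<omega> < ennreal (K + 1)}"])
         (use K inf enumerate_in_set[OF inf] in \<open>auto simp: strict_mono_enumerate less_imp_le\<close>)
  qed
qed

lemma sum_powr_cells:
  fixes c :: real
  assumes "0 < c"
  shows "(\<Sum>m\<le>n. (2 powr - c) ^ m) \<le> 1 / (1 - 2 powr - c)"
proof -
  have lt: "2 powr - c < (1::real)" using assms powr_less_one[of 2 "- c"] by (simp add: powr_minus_divide)
  have "(\<Sum>m\<le>n. (2 powr - c) ^ m) \<le> (\<Sum>m. (2 powr - c :: real) ^ m)"
    by (rule sum_le_suminf) (use lt in auto)
  also have "\<dots> = 1 / (1 - 2 powr - c)" by (rule suminf_geometric) (use lt in auto)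
  finally show ?thesis .
qed

context noisy_drift
begin

text \<open>The \<open>j\<close>-th spatial derivative of the drift mollified at width \<open>1/(n + 1)\<close>.\<close>

definition mollified :: "nat \<Rightarrow> nat \<Rightarrow> real \<Rightarrow> real \<Rightarrow> real" where
  "mollified j n r = gauss_smooth j (1 / real (Suc n)) (b r)"

definition cell_average :: "nat \<Rightarrow> nat \<Rightarrow> nat \<Rightarrow> nat \<Rightarrow> 'a \<Rightarrow> real \<Rightarrow> real" where
  "cell_average j n m k \<omega> x = (\<integral>r. indicator (dyadic_cell T m k) r * mollified j n r (x + B r \<omega>) \<partial>lborel)"

text \<open>The sum over the cells of level \<open>m\<close> of the squared \<open>H\<^sup>1\<close> norms in \<open>x\<close> of \<open>cell_average 1\<close>; its
  derivative is \<open>cell_average 2\<close>.\<close>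

definition level_energy :: "nat \<Rightarrow> nat \<Rightarrow> 'a \<Rightarrow> ennreal" where
  "level_energy n m \<omega> = (\<Sum>k<2 ^ m. (\<integral>\<^sup>+x. ennreal ((cell_average 1 n m k \<omega> x)\<^sup>2) \<partial>lborel)
     + (\<integral>\<^sup>+x. ennreal ((cell_average 2 n m k \<omega> x)\<^sup>2) \<partial>lborel))"

lemma cell_average_measurable:
  "(\<lambda>(\<omega>, x). cell_average j n m k \<omega> x) \<in> borel_measurable (M \<Otimes>\<^sub>M borel)"
proof -
  have [measurable]: "(\<lambda>(p, r). gauss_smooth j (1 / real (Suc n)) (b r) (snd p + B r (fst p)))
      \<in> borel_measurable ((M \<Otimes>\<^sub>M borel) \<Otimes>\<^sub>M borel)"
    unfolding split_beta' by (rule gauss_smooth_measurable[OF b_measurable]) measurable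
  have [measurable]: "dyadic_cell T m k \<in> sets borel" by (simp add: dyadic_cell_def)
  show ?thesis unfolding cell_average_def split_beta' mollified_def by measurable
qed

lemma level_energy_measurable [measurable]: "level_energy n m \<in> borel_measurable M"
proof -
  note cell_average_measurable [measurable]
  show ?thesis unfolding level_energy_def by measurable
qed

text \<open>The power of the cell length in \<open>energy_bound\<close> gives at least the decay \<open>2\<^sup>-\<^sup>(\<^sup>1\<^sup>-\<^sup>4\<^sup>H\<^sup>)\<^sup>m\<close> for \<open>j = 1, 2\<close>,
  and the remaining time integrals of the \<open>L\<^sup>1\<close> norm over the cells of one level add up to at most
  its total integral.\<close>

lemma level_energy_expectation:
  "\<exists>C\<ge>0. \<forall>n m. (\<integral>\<^sup>+\<omega>. level_energy n m \<omega> \<partial>M) \<le> ennreal (C * (2 powr (- (1 - 4 * H))) ^ m)"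
proof -
  define \<beta> where "\<beta> r = (\<integral>x. \<bar>b r x\<bar> \<partial>lborel)" for r
  have \<beta>0: "0 \<le> \<beta> r" for r by (simp add: \<beta>_def)
  have \<beta>i: "integrable lborel \<beta>" using b_L1 by (simp add: \<beta>_def[abs_def])
  have [measurable]: "\<beta> \<in> borel_measurable borel" using \<beta>i by auto
  define I where "I m k = (\<integral>r. indicator (dyadic_cell T m k) r * \<beta> r \<partial>lborel)" for m k
  have I0: "0 \<le> I m k" for m k unfolding I_def using \<beta>0 by simp
  have Iint: "integrable lborel (\<lambda>r. indicator (dyadic_cell T m k) r * \<beta> r)" for m k
    using integrable_mult_indicator[OF _ \<beta>i, of "dyadic_cell T m k"] by (simp add: dyadic_cell_def)
  have Isum: "(\<Sum>k<2 ^ m. I m k) \<le> (\<integral>r. \<beta> r \<partial>lborel)" for m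
  proof -
    have "(\<Sum>k<2 ^ m. I m k) = (\<integral>r. (\<Sum>k<2 ^ m. indicator (dyadic_cell T m k) r * \<beta> r) \<partial>lborel)"
      unfolding I_def by (rule Bochner_Integration.integral_sum[symmetric]) (rule Iint)
    also have "\<dots> \<le> (\<integral>r. \<beta> r \<partial>lborel)"
    proof (rule integral_mono[OF _ \<beta>i])
      show "integrable lborel (\<lambda>r. \<Sum>k<2 ^ m. indicator (dyadic_cell T m k) r * \<beta> r)"
        by (rule Bochner_Integration.integrable_sum) (rule Iint)
      fix r
      have dis: "disjoint_family_on (dyadic_cell T m) {..<2 ^ m}"
        unfolding disjoint_family_on_def
      proof safe
        fix k l x assume kl: "k \<noteq> l" and x: "x \<in> dyadic_cell T m k" "x \<in> dyadic_cell T m l"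
        have "\<lfloor>x * 2 ^ m / T\<rfloor> = int j" if "x \<in> dyadic_cell T m j" for j
          using that T unfolding dyadic_cell_def by (intro floor_unique) (auto simp: field_simps)
        from this[OF x(1)] this[OF x(2)] kl show "x \<in> {}" by simp
      qed
      have "(\<Sum>k<2 ^ m. indicator (dyadic_cell T m k) r * \<beta> r)
          = indicator (\<Union>k<2 ^ m. dyadic_cell T m k) r * \<beta> r"
        by (simp only: indicator_UN_disjoint[OF finite_lessThan dis] sum_distrib_right)
      also have "\<dots> \<le> \<beta> r" using \<beta>0[of r] by (simp add: indicator_def)
      finally show "(\<Sum>k<2 ^ m. indicator (dyadic_cell T m k) r * \<beta> r) \<le> \<beta> r" .
    qed
    finally show ?thesis .
  qed
  define A where "A j = Cb * gauss_mass (j + j) * (2 * T powr (1 - 2 * real j * H) / (1 - 2 * real j * H))" for j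
  have Cb: "0 \<le> Cb" using b_bound[of 0 0] by linarith
  have A0: "0 \<le> A j" if "2 * real j * H < 1" for j
    unfolding A_def using that Cb gauss_mass_nonneg by (intro mult_nonneg_nonneg divide_nonneg_nonneg) auto
  have jb: "2 * real j * H < 1" "2 * real j * H \<le> 4 * H" if "j \<in> {1, 2}" for j
    using that H by auto
  define \<kappa> where "\<kappa> = 1 - 4 * H"
  have one: "(\<integral>\<^sup>+\<omega>. (\<integral>\<^sup>+x. ennreal ((cell_average j n m k \<omega> x)\<^sup>2) \<partial>lborel) \<partial>M)
      \<le> ennreal (A j * (2 powr - \<kappa>) ^ m * I m k)"
    if j: "j \<in> {1, 2}" and k: "k < 2 ^ m" for j n m k
  proof -
    let ?s = "T * real k / 2 ^ m" and ?t = "T * real (Suc k) / 2 ^ m"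
    have "real (Suc k) \<le> 2 ^ m" using k by (metis Suc_leI of_nat_le_iff of_nat_numeral of_nat_power)
    then have st: "0 \<le> ?s" "?s \<le> ?t" "?t \<le> T"
      using T by (auto simp: divide_right_mono mult_left_mono divide_le_eq)
    have len: "?t - ?s = T * (1 / 2 ^ m)" by (simp add: field_simps)
    have "(?t - ?s) powr (1 - 2 * real j * H) = T powr (1 - 2 * real j * H) * (1 / 2 ^ m) powr (1 - 2 * real j * H)"
      unfolding len by (rule powr_mult)
    also have "(1 / 2 ^ m :: real) powr (1 - 2 * real j * H) \<le> (1 / 2 ^ m) powr \<kappa>"
      using jb[OF j] by (intro powr_mono') (auto simp: \<kappa>_def)
    also have "(1 / 2 ^ m :: real) powr \<kappa> = (2 powr - \<kappa>) ^ m"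
    proof -
      have "(1 / 2 ^ m :: real) = 2 powr - real m" by (simp add: powr_minus_divide powr_realpow)
      moreover have "(2 powr - \<kappa>) ^ m = (2 powr - \<kappa>) powr real m" by (simp add: powr_realpow)
      ultimately show ?thesis by (simp only: powr_powr mult_minus_left mult_minus_right mult.commute)
    qed
    finally have le: "(?t - ?s) powr (1 - 2 * real j * H) \<le> T powr (1 - 2 * real j * H) * (2 powr - \<kappa>) ^ m"
      using T by simp
    have "(\<integral>\<^sup>+\<omega>. (\<integral>\<^sup>+x. ennreal ((cell_average j n m k \<omega> x)\<^sup>2) \<partial>lborel) \<partial>M)
      \<le> ennreal (Cb * gauss_mass (j + j) * (2 * (?t - ?s) powr (1 - 2 * real j * H) / (1 - 2 * real j * H)) * I m k)"
      unfolding cell_average_def mollified_def I_def \<beta>_def dyadic_cell_def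
      by (rule energy_bound[OF _ st jb(1)[OF j]]) simp
    also have "\<dots> \<le> ennreal (A j * (2 powr - \<kappa>) ^ m * I m k)"
    proof (rule ennreal_leI, rule mult_right_mono[OF _ I0])
      have "(2 * (?t - ?s) powr (1 - 2 * real j * H) / (1 - 2 * real j * H))
         \<le> 2 * (T powr (1 - 2 * real j * H) * (2 powr - \<kappa>) ^ m) / (1 - 2 * real j * H)"
        using le jb(1)[OF j] by (intro divide_right_mono mult_left_mono) auto
      from mult_left_mono[OF this, of "Cb * gauss_mass (j + j)"]
      show "Cb * gauss_mass (j + j) * (2 * (?t - ?s) powr (1 - 2 * real j * H) / (1 - 2 * real j * H))
         \<le> A j * (2 powr - \<kappa>) ^ m"
        unfolding A_def using Cb gauss_mass_nonneg by (simp add: mult_ac)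
    qed
    finally show ?thesis .
  qed
  define C where "C = (A 1 + A 2) * (\<integral>r. \<beta> r \<partial>lborel)"
  have A12: "0 \<le> A 1" "0 \<le> A 2" using A0[OF jb(1)] by auto
  have "(\<integral>\<^sup>+\<omega>. level_energy n m \<omega> \<partial>M) \<le> ennreal (C * (2 powr - \<kappa>) ^ m)" for n m
  proof -
    note cell_average_measurable [measurable]
    have "(\<integral>\<^sup>+\<omega>. level_energy n m \<omega> \<partial>M) = (\<Sum>k<2 ^ m. (\<integral>\<^sup>+\<omega>. (\<integral>\<^sup>+x. ennreal ((cell_average 1 n m k \<omega> x)\<^sup>2) \<partial>lborel) \<partial>M)
       + (\<integral>\<^sup>+\<omega>. (\<integral>\<^sup>+x. ennreal ((cell_average 2 n m k \<omega> x)\<^sup>2) \<partial>lborel) \<partial>M))"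
      unfolding level_energy_def by (subst nn_integral_sum) (auto simp: nn_integral_add)
    also have "\<dots> \<le> (\<Sum>k<2 ^ m. ennreal (A 1 * (2 powr - \<kappa>) ^ m * I m k) + ennreal (A 2 * (2 powr - \<kappa>) ^ m * I m k))"
      by (intro sum_mono add_mono one) auto
    also have "\<dots> = ennreal (\<Sum>k<2 ^ m. (A 1 + A 2) * (2 powr - \<kappa>) ^ m * I m k)"
      using A12 I0 by (simp add: sum_ennreal ring_distribs flip: ennreal_plus)
    also have "(\<Sum>k<2 ^ m. (A 1 + A 2) * (2 powr - \<kappa>) ^ m * I m k) = (A 1 + A 2) * (2 powr - \<kappa>) ^ m * (\<Sum>k<2 ^ m. I m k)"
      by (simp add: sum_distrib_left)
    also have "\<dots> \<le> (A 1 + A 2) * (2 powr - \<kappa>) ^ m * (\<integral>r. \<beta> r \<partial>lborel)"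
      using A12 by (intro mult_left_mono Isum) auto
    finally show ?thesis by (simp add: C_def mult_ac ennreal_leI)
  qed
  moreover have "0 \<le> C" unfolding C_def using A12 \<beta>0 by simp
  ultimately show ?thesis unfolding \<kappa>_def by blast
qed

text \<open>The expected energies decay like \<open>2\<^sup>-\<^sup>\<kappa>\<^sup>m\<close>. Half of the exponent is spent to make the weighted sum
  over all levels \<open>m \<le> n\<close> have bounded expectation, so that Fatou applies to one sequence in \<open>n\<close>; the
  other half is the decay that survives. Only levels up to the mollification index are needed,
  because the Euler scheme for that mollification runs on the grid of this level.\<close>

lemma energy_decay_subsequence:
  "\<exists>\<theta>. 0 < \<theta> \<and> \<theta> < 1 \<and> (AE \<omega> in M. \<exists>K \<sigma>. 0 \<le> K \<and> strict_mono (\<sigma> :: nat \<Rightarrow> nat) \<and>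
     (\<forall>i. \<forall>m\<le>\<sigma> i. level_energy (\<sigma> i) m \<omega> \<le> ennreal ((K * \<theta> ^ m)\<^sup>2)))"
proof -
  define \<kappa> where "\<kappa> = 1 - 4 * H"
  have \<kappa>: "0 < \<kappa>" using H by (simp add: \<kappa>_def)
  define \<rho> :: real where "\<rho> = 2 powr - (\<kappa> / 2)"
  define \<theta> where "\<theta> = sqrt \<rho>"
  have \<rho>: "0 < \<rho>" "\<rho> < 1" using \<kappa> powr_less_one[of 2 "- (\<kappa> / 2)"] by (auto simp: \<rho>_def powr_minus_divide)
  have \<rho>2: "2 powr - \<kappa> = \<rho> * \<rho>" by (simp add: \<rho>_def flip: powr_add)
  obtain C where C: "0 \<le> C" "\<And>n m. (\<integral>\<^sup>+\<omega>. level_energy n m \<omega> \<partial>M) \<le> ennreal (C * (2 powr - \<kappa>) ^ m)"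
    using level_energy_expectation unfolding \<kappa>_def by blast
  \<comment> \<open>The weight \<open>\<rho>\<^sup>-\<^sup>m\<close> grows half as fast as the expected energies decay.\<close>
  define Z where "Z n \<omega> = (\<Sum>m\<le>n. ennreal ((1 / \<rho>) ^ m) * level_energy n m \<omega>)" for n \<omega>
  have "(\<integral>\<^sup>+\<omega>. Z n \<omega> \<partial>M) \<le> ennreal (C * (1 / (1 - \<rho>)))" for n
  proof -
    have "(\<integral>\<^sup>+\<omega>. Z n \<omega> \<partial>M) = (\<Sum>m\<le>n. ennreal ((1 / \<rho>) ^ m) * (\<integral>\<^sup>+\<omega>. level_energy n m \<omega> \<partial>M))"
      unfolding Z_def by (simp add: nn_integral_sum nn_integral_cmult)
    also have "\<dots> \<le> (\<Sum>m\<le>n. ennreal ((1 / \<rho>) ^ m) * ennreal (C * (2 powr - \<kappa>) ^ m))"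
      by (intro sum_mono mult_left_mono C) auto
    also have "\<dots> = (\<Sum>m\<le>n. ennreal (C * \<rho> ^ m))"
    proof (rule sum.cong[OF refl])
      fix m
      have "(1 / \<rho>) ^ m * (C * (2 powr - \<kappa>) ^ m) = C * \<rho> ^ m"
        using \<rho> by (simp add: \<rho>2 power_mult_distrib power_one_over)
      then show "ennreal ((1 / \<rho>) ^ m) * ennreal (C * (2 powr - \<kappa>) ^ m) = ennreal (C * \<rho> ^ m)"
        using \<rho> by (simp only: ennreal_mult'[symmetric] zero_le_power zero_le_divide_1_iff less_imp_le)
    qed
    also have "\<dots> = ennreal (C * (\<Sum>m\<le>n. \<rho> ^ m))"
      using C \<rho> by (simp add: sum_ennreal sum_distrib_left)
    also have "\<dots> \<le> ennreal (C * (1 / (1 - \<rho>)))"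
      unfolding \<rho>_def using \<kappa> C by (intro ennreal_leI mult_left_mono sum_powr_cells) auto
    finally show ?thesis .
  qed
  moreover have "Z n \<in> borel_measurable M" for n
    unfolding Z_def by measurable
  ultimately have "AE \<omega> in M. \<exists>K \<sigma>. 0 \<le> K \<and> strict_mono (\<sigma> :: nat \<Rightarrow> nat) \<and> (\<forall>i. Z (\<sigma> i) \<omega> \<le> ennreal K)"
    by (intro frequently_bounded_of_nn_integral_bounded)
  then have "AE \<omega> in M. \<exists>K \<sigma>. 0 \<le> K \<and> strict_mono (\<sigma> :: nat \<Rightarrow> nat) \<and>
     (\<forall>i. \<forall>m\<le>\<sigma> i. level_energy (\<sigma> i) m \<omega> \<le> ennreal ((K * \<theta> ^ m)\<^sup>2))"
  proof eventually_elim
    case (elim \<omega>)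
    then obtain K \<sigma> where K: "0 \<le> K" "strict_mono (\<sigma> :: nat \<Rightarrow> nat)" "\<And>i. Z (\<sigma> i) \<omega> \<le> ennreal K" by blast
    have "level_energy n m \<omega> \<le> ennreal ((sqrt K * \<theta> ^ m)\<^sup>2)" if "m \<le> n" "Z n \<omega> \<le> ennreal K" for n m
    proof -
      have "ennreal ((1 / \<rho>) ^ m) * level_energy n m \<omega> \<le> Z n \<omega>"
        unfolding Z_def using that by (intro member_le_sum[of m "{..n}"]) auto
      then have "ennreal (\<rho> ^ m) * (ennreal ((1 / \<rho>) ^ m) * level_energy n m \<omega>) \<le> ennreal (\<rho> ^ m) * ennreal K"
        using that(2) by (intro mult_left_mono) auto
      moreover have "\<rho> ^ m * (1 / \<rho>) ^ m = 1" using \<rho> by (simp add: power_one_over)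
      then have "ennreal (\<rho> ^ m) * ennreal ((1 / \<rho>) ^ m) = 1"
        using \<rho> by (simp flip: ennreal_mult')
      ultimately have "level_energy n m \<omega> \<le> ennreal (\<rho> ^ m) * ennreal K"
        by (simp flip: mult.assoc)
      also have "\<dots> = ennreal (\<rho> ^ m * K)" using \<rho> K by (simp add: ennreal_mult')
      also have "\<rho> ^ m * K = (sqrt K * \<theta> ^ m)\<^sup>2"
      proof -
        have "(\<theta> ^ m)\<^sup>2 = (\<theta>\<^sup>2) ^ m" by (simp add: power_mult[symmetric] mult.commute)
        then show ?thesis using \<rho> K by (simp add: power_mult_distrib \<theta>_def)
      qed
      finally show ?thesis .
    qed
    then show ?case
      using K by (intro exI[of _ "sqrt K"] exI[of _ \<sigma>]) auto
  qed
  moreover have "0 < \<theta>" "\<theta> < 1" using \<rho> by (auto simp: \<theta>_def)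
  ultimately show ?thesis by blast
qed

end

section \<open>A discrete sewing estimate\<close>

text \<open>Optimising over \<open>c\<close> at \<open>c = sqrt (L/A)\<close>; the degenerate cases need an arbitrarily large or small \<open>c\<close>.\<close>

lemma le_sqrt_of_weighted_mean:
  fixes a A L :: real
  assumes "\<And>c. c > 0 \<Longrightarrow> a \<le> c * A / 2 + L / (2 * c)" "0 \<le> A" "0 \<le> L"
  shows "a \<le> sqrt A * sqrt L"
proof (cases "A = 0 \<or> L = 0")
  case True
  have "a \<le> 0"
  proof (rule ccontr)
    assume "\<not> a \<le> 0"
    then have a: "a > 0" by simp
    show False
    proof (cases "A = 0")
      case True
      have "a \<le> L / (2 * ((L + 1) / a))" using assms(1)[of "(L + 1) / a"] assms(3) a True by simp
      also have "\<dots> < a" using a assms(3) by (simp add: field_simps) (simp add: add_nonneg_pos)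
      finally show False by simp
    next
      case False
      then have "L = 0" "A > 0" using \<open>A = 0 \<or> L = 0\<close> assms by auto
      then show False using assms(1)[of "a / A"] a by simp
    qed
  qed
  also have "0 = sqrt A * sqrt L" using True by auto
  finally show ?thesis .
next
  case False
  then have AL: "0 < sqrt A" "0 < sqrt L" using assms by auto
  have "a \<le> sqrt L / sqrt A * A / 2 + L / (2 * (sqrt L / sqrt A))"
    using AL by (intro assms(1)) simp
  also have "sqrt L / sqrt A * A / 2 + L / (2 * (sqrt L / sqrt A)) = sqrt L * (A / sqrt A) / 2 + (L / sqrt L) * sqrt A / 2"
    by simp
  also have "\<dots> = sqrt L * sqrt A" using assms by (simp add: real_div_sqrt)
  finally show ?thesis by (simp add: mult.commute)
qed

text \<open>The one-dimensional Sobolev embedding \<open>H\<^sup>1 \<subseteq> C\<^sup>1\<^sup>/\<^sup>2\<close>: Cauchy-Schwarz for \<open>\<integral> g'\<close> over \<open>[x, y]\<close>, obtained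
  here from weighted means. The sup bound follows by comparing \<open>g x\<close> with the minimum of \<open>\<bar>g\<bar>\<close> on \<open>[x,
  x + 1]\<close>, which the \<open>L\<^sup>2\<close> norm controls.\<close>

lemma sobolev_half_holder:
  fixes g g' :: "real \<Rightarrow> real"
  assumes der: "\<And>x. (g has_real_derivative g' x) (at x)" and cont: "\<And>x. isCont g' x" and N: "0 \<le> N"
    and e: "(\<integral>\<^sup>+x. ennreal ((g x)\<^sup>2) \<partial>lborel) + (\<integral>\<^sup>+x. ennreal ((g' x)\<^sup>2) \<partial>lborel) \<le> ennreal (N\<^sup>2)"
  shows "\<bar>g x - g y\<bar> \<le> N * sqrt \<bar>x - y\<bar>" and "\<bar>g x\<bar> \<le> 2 * N"
proof -
  have cg: "continuous_on UNIV g" using der by (intro continuous_at_imp_continuous_on ballI DERIV_isCont)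
  have cg': "continuous_on UNIV g'" using cont by (simp add: continuous_at_imp_continuous_on)
  have [measurable]: "g \<in> borel_measurable borel" "g' \<in> borel_measurable borel"
    using cg cg' by (auto intro: borel_measurable_continuous_onI)
  have e1: "(\<integral>\<^sup>+x. ennreal ((g x)\<^sup>2) \<partial>lborel) \<le> ennreal (N\<^sup>2)" and e2: "(\<integral>\<^sup>+x. ennreal ((g' x)\<^sup>2) \<partial>lborel) \<le> ennreal (N\<^sup>2)"
    by (rule order_trans[OF _ e], simp)+
  have sq: "integrable lborel (\<lambda>x. (f x)\<^sup>2) \<and> (\<integral>x. (f x)\<^sup>2 \<partial>lborel) \<le> N\<^sup>2"
    if [measurable]: "f \<in> borel_measurable borel" and "(\<integral>\<^sup>+x. ennreal ((f x)\<^sup>2) \<partial>lborel) \<le> ennreal (N\<^sup>2)" for f :: "real \<Rightarrow> real"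
  proof
    show i: "integrable lborel (\<lambda>x. (f x)\<^sup>2)"
      by (rule integrableI_bounded) (use that(2) in \<open>auto simp: le_less_trans\<close>)
    show "(\<integral>x. (f x)\<^sup>2 \<partial>lborel) \<le> N\<^sup>2"
      using that(2) nn_integral_eq_integral[OF i] by simp
  qed
  note G = sq[OF _ e1] and G' = sq[OF _ e2]
  have le: "\<bar>g y - g x\<bar> \<le> N * sqrt (y - x)" if xy: "x \<le> y" for x y
  proof -
    let ?i = "indicator {x..y} :: real \<Rightarrow> real"
    have ftc: "(\<integral>z. g' z * ?i z \<partial>lborel) = g y - g x"
      by (rule integral_FTC_Icc_real[OF xy]) (use der cont in auto)
    have i': "integrable lborel (\<lambda>z. g' z * ?i z)"
      by (rule borel_integrable_atLeastAtMost) (use cont in auto)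
    have "\<bar>g y - g x\<bar> \<le> c * N\<^sup>2 / 2 + (y - x) / (2 * c)" if c: "c > 0" for c
    proof -
      have pt: "\<bar>g' z * ?i z\<bar> \<le> c / 2 * (g' z)\<^sup>2 + 1 / (2 * c) * ?i z" for z
      proof -
        have "0 \<le> (c * \<bar>g' z\<bar> - 1)\<^sup>2" by simp
        then have "2 * c * \<bar>g' z\<bar> \<le> c * c * (g' z)\<^sup>2 + 1"
          unfolding power2_diff power_mult_distrib power2_abs by (simp add: power2_eq_square[of c])
        then have "(2 * c * \<bar>g' z\<bar>) / (2 * c) \<le> (c * c * (g' z)\<^sup>2 + 1) / (2 * c)"
          using c by (intro divide_right_mono) auto
        also have "(c * c * (g' z)\<^sup>2 + 1) / (2 * c) = c / 2 * (g' z)\<^sup>2 + 1 / (2 * c)"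
          using c by (simp add: add_divide_distrib)
        finally have "\<bar>g' z\<bar> \<le> c / 2 * (g' z)\<^sup>2 + 1 / (2 * c)"
          using c by simp
        then show ?thesis using c by (cases "z \<in> {x..y}") (simp_all del: times_divide_eq_left)
      qed
      have ii: "integrable lborel (\<lambda>z. c / 2 * (g' z)\<^sup>2 + 1 / (2 * c) * ?i z)"
        using G' xy by (intro Bochner_Integration.integrable_add integrable_mult_right) auto
      have "\<bar>g y - g x\<bar> \<le> (\<integral>z. \<bar>g' z * ?i z\<bar> \<partial>lborel)"
        unfolding ftc[symmetric] by (rule integral_abs_bound)
      also have "\<dots> \<le> (\<integral>z. c / 2 * (g' z)\<^sup>2 + 1 / (2 * c) * ?i z \<partial>lborel)"
        by (rule integral_mono[OF integrable_abs[OF i'] ii pt])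
      also have "\<dots> = c / 2 * (\<integral>z. (g' z)\<^sup>2 \<partial>lborel) + 1 / (2 * c) * (y - x)"
        using G' xy by (subst Bochner_Integration.integral_add) auto
      also have "\<dots> \<le> c / 2 * N\<^sup>2 + 1 / (2 * c) * (y - x)"
        using G' c by (intro add_right_mono mult_left_mono) auto
      finally show ?thesis by simp
    qed
    from le_sqrt_of_weighted_mean[OF this] xy N show ?thesis by simp
  qed
  show half: "\<bar>g x - g y\<bar> \<le> N * sqrt \<bar>x - y\<bar>" for x y
    using le[of x y] le[of y x] by (cases "x \<le> y") (simp_all add: abs_minus_commute)
  have "continuous_on {x..x + 1} (\<lambda>w. \<bar>g w\<bar>)"
    by (intro continuous_on_rabs continuous_on_subset[OF cg]) auto
  from continuous_attains_inf[OF _ _ this]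
  obtain z where z: "z \<in> {x..x + 1}" "\<And>w. w \<in> {x..x + 1} \<Longrightarrow> \<bar>g z\<bar> \<le> \<bar>g w\<bar>"
    by auto
  have "(\<integral>w. (g z)\<^sup>2 * indicator {x..x + 1} w \<partial>lborel) \<le> (\<integral>w. (g w)\<^sup>2 \<partial>lborel)"
  proof (rule integral_mono)
    show "(g z)\<^sup>2 * indicator {x..x + 1} w \<le> (g w)\<^sup>2" for w
      using z(2)[of w] abs_le_square_iff[of "g z" "g w"] by (auto simp: indicator_def)
  qed (use G in auto)
  then have "(g z)\<^sup>2 \<le> N\<^sup>2" using G by simp
  then have "\<bar>g z\<bar> \<le> N" using N abs_le_square_iff[of "g z" N] by simp
  moreover have "\<bar>g x - g z\<bar> \<le> N * 1"
    by (rule order_trans[OF half mult_left_mono]) (use z N in auto)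
  ultimately show "\<bar>g x\<bar> \<le> 2 * N" by linarith
qed

lemma sum_pairs: "(\<Sum>k<2 * J. f k) = (\<Sum>k<J. f (2 * k) + f (Suc (2 * k)))" for f :: "nat \<Rightarrow> real"
  by (induction J) auto

text \<open>\<open>G m k\<close> stands for the increment over the \<open>k\<close>-th cell of level \<open>m\<close> of a function of time and space.
  The constants \<open>N m k\<close> may be large on single cells; only their square sums over a level are under
  control.\<close>

locale dyadic_increments =
  fixes n :: nat and G :: "nat \<Rightarrow> nat \<Rightarrow> real \<Rightarrow> real" and N :: "nat \<Rightarrow> nat \<Rightarrow> real" and K \<theta> L :: real
  assumes additive: "\<And>m k x. m < n \<Longrightarrow> k < 2 ^ m \<Longrightarrow> G m k x = G (Suc m) (2 * k) x + G (Suc m) (Suc (2 * k)) x"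
    and half_holder: "\<And>m k x y. m \<le> n \<Longrightarrow> k < 2 ^ m \<Longrightarrow> \<bar>G m k x - G m k y\<bar> \<le> N m k * sqrt \<bar>x - y\<bar>"
    and sup_bound: "\<And>m k x. m \<le> n \<Longrightarrow> k < 2 ^ m \<Longrightarrow> \<bar>G m k x\<bar> \<le> 2 * N m k"
    and N_nonneg: "\<And>m k. 0 \<le> N m k"
    and energy: "\<And>m. m \<le> n \<Longrightarrow> (\<Sum>k<2 ^ m. (N m k)\<^sup>2) \<le> (K * \<theta> ^ m)\<^sup>2"
    and K: "0 \<le> K" and \<theta>: "0 < \<theta>" "\<theta> < 1" and L: "0 \<le> L"
begin

text \<open>The Riemann-type sum on level \<open>m\<close> along a path \<open>y\<close> that is given on the finest grid, with the
  argument at the right end of each cell. Its index \<open>j\<close> counts cells of the finest level, and only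
  coarse cells that fit into the first \<open>j\<close> of them count.\<close>

definition level_sum :: "nat \<Rightarrow> nat \<Rightarrow> (nat \<Rightarrow> real) \<Rightarrow> real" where
  "level_sum m j y = (\<Sum>k<j div 2 ^ (n - m). G m k (y (Suc k * 2 ^ (n - m))))"

definition slow_path :: "(nat \<Rightarrow> real) \<Rightarrow> bool" where
  "slow_path y \<longleftrightarrow> (\<forall>i. \<bar>y (Suc i) - y i\<bar> \<le> L / 2 ^ n)"

lemma slow_path_diff:
  assumes "slow_path y" shows "\<bar>y (i + p) - y i\<bar> \<le> real p * (L / 2 ^ n)"
proof (induction p)
  case (Suc p)
  have "\<bar>y (Suc (i + p)) - y (i + p)\<bar> \<le> L / 2 ^ n" using assms by (simp add: slow_path_def)
  then have "\<bar>y (i + Suc p) - y i\<bar> \<le> L / 2 ^ n + real p * (L / 2 ^ n)" using Suc by simp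
  also have "\<dots> = real (Suc p) * (L / 2 ^ n)" by (simp add: distrib_right add_divide_distrib)
  finally show ?case .
qed simp

lemma N_le: assumes "m \<le> n" "k < 2 ^ m" shows "N m k \<le> K * \<theta> ^ m"
proof -
  have "(N m k)\<^sup>2 \<le> (\<Sum>k<2 ^ m. (N m k)\<^sup>2)" using assms by (intro member_le_sum) auto
  also have "\<dots> \<le> (K * \<theta> ^ m)\<^sup>2" by (rule energy[OF assms(1)])
  finally show ?thesis by (rule power2_le_imp_le) (use K \<theta> in simp)
qed

text \<open>Splitting a cell changes the argument of the left half by at most \<open>L/2\<^sup>m\<^sup>+\<^sup>1\<close>, hence, by the
  \<open>1/2\<close>-Hoelder bound, its term by at most \<open>N sqrt (L/2\<^sup>m\<^sup>+\<^sup>1)\<close>. Cauchy-Schwarz bounds the sum of the at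
  most \<open>2\<^sup>m\<^sup>+\<^sup>1\<close> constants \<open>N\<close> by \<open>K \<theta>\<^sup>m\<^sup>+\<^sup>1 sqrt (2\<^sup>m\<^sup>+\<^sup>1)\<close>, and the powers of \<open>2\<close> cancel. At most one new cell
  appears at the right end; it is estimated by its sup norm.\<close>

lemma level_sum_step:
  assumes m: "m < n" and j: "j \<le> 2 ^ n" and y: "slow_path y"
  shows "\<bar>level_sum (Suc m) j y - level_sum m j y\<bar> \<le> (sqrt L + 2) * K * \<theta> ^ Suc m"
proof -
  define P where "P = (2::nat) ^ (n - Suc m)"
  have P: "2 ^ (n - m) = 2 * P" "P > 0"
  proof -
    have "n - m = Suc (n - Suc m)" using m by linarith
    then show "2 ^ (n - m) = 2 * P" unfolding P_def by (simp only: power_Suc)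
    show "P > 0" by (simp add: P_def)
  qed
  have n2: "(2::nat) ^ n = 2 ^ m * (2 * P)" using m unfolding P(1)[symmetric] by (simp flip: power_add)
  define J where "J = j div (2 * P)"
  have J: "J \<le> 2 ^ m" unfolding J_def using div_le_mono[OF j, of "2 * P"] P(2) by (simp only: n2) simp
  have "j div P = 2 * J + (j div P) mod 2" unfolding J_def by (simp add: div_mult2_eq mult.commute)
  moreover have "x = 2 * J + x mod 2 \<Longrightarrow> x = 2 * J \<or> x = Suc (2 * J)" for x by presburger
  ultimately have J': "j div P = 2 * J \<or> j div P = Suc (2 * J)" by blast
  define f where "f k = G (Suc m) k (y (Suc k * P))" for k
  define h where "h k = G (Suc m) (2 * k) (y (Suc (2 * k) * P)) - G (Suc m) (2 * k) (y (Suc (Suc (2 * k)) * P))" for k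
  have klt: "2 * k < 2 ^ Suc m" "Suc (2 * k) < 2 ^ Suc m" if "k < J" for k
    using that J by auto
  have S0: "level_sum m j y = (\<Sum>k<J. G (Suc m) (2 * k) (y (Suc (Suc (2 * k)) * P)) + f (Suc (2 * k)))"
    unfolding level_sum_def P(1) J_def[symmetric] f_def
  proof (rule sum.cong[OF refl])
    fix k assume "k \<in> {..<J}"
    then have "k < 2 ^ m" using J by auto
    have e: "Suc k * (2 * P) = Suc (Suc (2 * k)) * P" by simp
    show "G m k (y (Suc k * (2 * P))) = G (Suc m) (2 * k) (y (Suc (Suc (2 * k)) * P)) + G (Suc m) (Suc (2 * k)) (y (Suc (Suc (2 * k)) * P))"
      unfolding e by (rule additive[OF m \<open>k < 2 ^ m\<close>])
  qed
  have S1: "level_sum (Suc m) j y = (\<Sum>k<j div P. f k)"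
    unfolding level_sum_def f_def P_def by simp
  have fJ: "\<bar>f (2 * J)\<bar> \<le> 2 * (K * \<theta> ^ Suc m)" if "j div P = Suc (2 * J)"
  proof -
    have "j div P \<le> 2 ^ Suc m"
    proof -
      have "2 ^ n = 2 ^ Suc m * P" using n2 by simp
      then show ?thesis using div_le_mono[OF j, of P] P(2) by simp
    qed
    then have "2 * J < 2 ^ Suc m" using that by simp
    then have "\<bar>f (2 * J)\<bar> \<le> 2 * N (Suc m) (2 * J)" unfolding f_def using m by (intro sup_bound) auto
    also have "\<dots> \<le> 2 * (K * \<theta> ^ Suc m)" using N_le[of "Suc m" "2 * J"] m \<open>2 * J < 2 ^ Suc m\<close> by simp
    finally show ?thesis .
  qed
  have hb: "\<bar>h k\<bar> \<le> N (Suc m) (2 * k) * sqrt (L / 2 ^ Suc m)" if "k < J" for k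
  proof -
    have "\<bar>y (Suc (2 * k) * P) - y (Suc (Suc (2 * k)) * P)\<bar> \<le> real P * (L / 2 ^ n)"
      using slow_path_diff[OF y, of "Suc (2 * k) * P" P] by (simp add: abs_minus_commute add.commute)
    also have "real P * (L / 2 ^ n) = L / 2 ^ Suc m"
    proof -
      have "(2::real) ^ n = 2 ^ m * (2 * real P)" using arg_cong[OF n2, of real] by simp
      then show ?thesis using P by simp
    qed
    finally have "sqrt \<bar>y (Suc (2 * k) * P) - y (Suc (Suc (2 * k)) * P)\<bar> \<le> sqrt (L / 2 ^ Suc m)" by simp
    moreover have "\<bar>h k\<bar> \<le> N (Suc m) (2 * k) * sqrt \<bar>y (Suc (2 * k) * P) - y (Suc (Suc (2 * k)) * P)\<bar>"
      unfolding h_def using m klt[OF that] by (intro half_holder) auto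
    ultimately show ?thesis using N_nonneg by (meson mult_left_mono order_trans)
  qed
  have "(\<Sum>k<J. N (Suc m) (2 * k))\<^sup>2 \<le> (\<Sum>k<J. (N (Suc m) (2 * k))\<^sup>2) * (\<Sum>k<J. 1\<^sup>2)"
    using Cauchy_Schwarz_ineq_sum[of "\<lambda>k. N (Suc m) (2 * k)" "\<lambda>_. 1" "{..<J}"] by simp
  also have "\<dots> \<le> (K * \<theta> ^ Suc m)\<^sup>2 * 2 ^ Suc m"
  proof (rule mult_mono)
    have "(\<Sum>k<J. (N (Suc m) (2 * k))\<^sup>2) = (\<Sum>k\<in>(*) 2 ` {..<J}. (N (Suc m) k)\<^sup>2)"
      by (subst sum.reindex) (auto simp: inj_on_def)
    also have "\<dots> \<le> (\<Sum>k<2 ^ Suc m. (N (Suc m) k)\<^sup>2)"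
      using klt by (intro sum_mono2) auto
    also have "\<dots> \<le> (K * \<theta> ^ Suc m)\<^sup>2" using m by (intro energy) auto
    finally show "(\<Sum>k<J. (N (Suc m) (2 * k))\<^sup>2) \<le> (K * \<theta> ^ Suc m)\<^sup>2" .
    have "real J \<le> 2 ^ m" using of_nat_mono[OF J, where 'a = real] by simp
    also have "\<dots> \<le> 2 ^ Suc m" by simp
    finally show "(\<Sum>k<J. 1\<^sup>2) \<le> (2::real) ^ Suc m" by simp
  qed auto
  finally have "(\<Sum>k<J. N (Suc m) (2 * k))\<^sup>2 \<le> (K * \<theta> ^ Suc m * sqrt (2 ^ Suc m))\<^sup>2"
    by (simp only: power_mult_distrib real_sqrt_pow2 zero_le_power zero_le_numeral)
  then have CS: "(\<Sum>k<J. N (Suc m) (2 * k)) \<le> K * \<theta> ^ Suc m * sqrt (2 ^ Suc m)"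
    by (rule power2_le_imp_le) (use K \<theta> in simp)
  have "\<bar>\<Sum>k<J. h k\<bar> \<le> (\<Sum>k<J. N (Suc m) (2 * k) * sqrt (L / 2 ^ Suc m))"
    by (rule order_trans[OF sum_abs]) (use hb in \<open>auto intro: sum_mono\<close>)
  also have "\<dots> = (\<Sum>k<J. N (Suc m) (2 * k)) * sqrt (L / 2 ^ Suc m)" by (rule sum_distrib_right[symmetric])
  also have "\<dots> \<le> K * \<theta> ^ Suc m * sqrt (2 ^ Suc m) * sqrt (L / 2 ^ Suc m)"
    using CS L by (intro mult_right_mono) auto
  also have "\<dots> = K * \<theta> ^ Suc m * sqrt L"
    by (simp only: mult.assoc real_sqrt_mult[symmetric], simp)
  finally have H: "\<bar>\<Sum>k<J. h k\<bar> \<le> K * \<theta> ^ Suc m * sqrt L" .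
  have eq: "(\<Sum>k<2 * J. f k) - level_sum m j y = (\<Sum>k<J. h k)"
    unfolding S0 sum_pairs sum_subtractf[symmetric] by (simp add: h_def f_def)
  have "\<bar>level_sum (Suc m) j y - level_sum m j y\<bar> \<le> K * \<theta> ^ Suc m * sqrt L + 2 * (K * \<theta> ^ Suc m)"
    using J'
  proof
    assume "j div P = 2 * J"
    then have "level_sum (Suc m) j y - level_sum m j y = (\<Sum>k<J. h k)" using S1 eq by simp
    moreover have "0 \<le> 2 * (K * \<theta> ^ Suc m)" using K \<theta> by simp
    ultimately show ?thesis using H by linarith
  next
    assume *: "j div P = Suc (2 * J)"
    then have "level_sum (Suc m) j y - level_sum m j y = (\<Sum>k<J. h k) + f (2 * J)" using S1 eq by simp
    then show ?thesis using H fJ[OF *] by linarith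
  qed
  also have "\<dots> = (sqrt L + 2) * K * \<theta> ^ Suc m" by (simp add: algebra_simps)
  finally show ?thesis .
qed

lemma level_sum_tail:
  assumes m: "m \<le> n" and j: "j \<le> 2 ^ n" and y: "slow_path y"
  shows "\<bar>level_sum n j y - level_sum m j y\<bar> \<le> (sqrt L + 2) * K / (1 - \<theta>) * \<theta> ^ m"
proof -
  define c where "c = (sqrt L + 2) * K"
  have c: "0 \<le> c" unfolding c_def using K L by simp
  have "\<bar>level_sum (m + p) j y - level_sum m j y\<bar> \<le> c / (1 - \<theta>) * (\<theta> ^ m - \<theta> ^ (m + p))" if "m + p \<le> n" for p
    using that
  proof (induction p)
    case (Suc p)
    have "\<bar>level_sum (Suc (m + p)) j y - level_sum (m + p) j y\<bar> \<le> c * \<theta> ^ Suc (m + p)"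
      unfolding c_def using Suc by (intro level_sum_step j y) auto
    also have "c * \<theta> ^ Suc (m + p) \<le> c * \<theta> ^ (m + p)"
      using c \<theta> by (intro mult_left_mono power_decreasing) auto
    also have "c * \<theta> ^ (m + p) = c / (1 - \<theta>) * (\<theta> ^ (m + p) - \<theta> ^ (m + Suc p))"
      using \<theta> by (simp add: divide_simps) (simp add: algebra_simps)
    finally have "\<bar>level_sum (Suc (m + p)) j y - level_sum (m + p) j y\<bar> \<le> c / (1 - \<theta>) * (\<theta> ^ (m + p) - \<theta> ^ (m + Suc p))" .
    moreover have "\<bar>level_sum (m + p) j y - level_sum m j y\<bar> \<le> c / (1 - \<theta>) * (\<theta> ^ m - \<theta> ^ (m + p))"
      using Suc by auto
    ultimately have "\<bar>level_sum (m + Suc p) j y - level_sum m j y\<bar>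
       \<le> c / (1 - \<theta>) * (\<theta> ^ (m + p) - \<theta> ^ (m + Suc p)) + c / (1 - \<theta>) * (\<theta> ^ m - \<theta> ^ (m + p))" by simp
    also have "\<dots> = c / (1 - \<theta>) * (\<theta> ^ m - \<theta> ^ (m + Suc p))" by (simp only: distrib_left[symmetric]) simp
    finally show ?case .
  qed simp
  from this[of "n - m"] m have "\<bar>level_sum n j y - level_sum m j y\<bar> \<le> c / (1 - \<theta>) * (\<theta> ^ m - \<theta> ^ n)" by simp
  also have "\<dots> \<le> c / (1 - \<theta>) * \<theta> ^ m" using c \<theta> by (intro mult_left_mono) auto
  finally show ?thesis unfolding c_def .
qed

lemma level_sum_finest: "level_sum n j y = (\<Sum>i<j. G n i (y (Suc i)))"
  by (simp add: level_sum_def)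

lemma level_sum_coarsest:
  assumes "j \<le> 2 ^ n" shows "\<bar>level_sum 0 j y\<bar> \<le> 2 * K"
proof -
  have "j div 2 ^ n \<le> 1" using div_le_mono[OF assms, of "2 ^ n"] by simp
  then consider "j div 2 ^ n = 0" | "j div 2 ^ n = 1" by linarith
  then show ?thesis
  proof cases
    case 2
    then have "level_sum 0 j y = G 0 0 (y (2 ^ n))" by (simp add: level_sum_def)
    then show ?thesis using sup_bound[of 0 0 "y (2 ^ n)"] N_le[of 0 0] by simp
  qed (use K in \<open>simp add: level_sum_def\<close>)
qed

definition sum_bound :: real where
  "sum_bound = 2 * K + (sqrt L + 2) * K / (1 - \<theta>)"

lemma finest_sum_bound:
  assumes "j \<le> 2 ^ n" "slow_path y" shows "\<bar>\<Sum>i<j. G n i (y (Suc i))\<bar> \<le> sum_bound"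
proof -
  have "\<bar>level_sum n j y - level_sum 0 j y\<bar> \<le> (sqrt L + 2) * K / (1 - \<theta>)"
    using level_sum_tail[OF _ assms, of 0] by (simp only: le0 power_0 mult_1_right)
  with level_sum_coarsest[OF assms(1), of y] show ?thesis
    unfolding level_sum_finest[symmetric] sum_bound_def by linarith
qed

text \<open>Replace both sums by those on a coarse level \<open>m\<close>, with a geometrically small error; there the
  dependence on the path is Hoelder continuous with a constant depending on \<open>m\<close>. Choosing \<open>m\<close> first
  and then \<open>d\<close> yields equicontinuity in the path.\<close>

lemma finest_sum_equicontinuous:
  assumes m: "m \<le> n" and j: "j \<le> 2 ^ n" and y: "slow_path y" "slow_path z" and d: "\<And>i. \<bar>y i - z i\<bar> \<le> d"
  shows "\<bar>(\<Sum>i<j. G n i (y (Suc i))) - (\<Sum>i<j. G n i (z (Suc i)))\<bar>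
     \<le> 2 * ((sqrt L + 2) * K / (1 - \<theta>)) * \<theta> ^ m + 2 ^ m * K * sqrt d"
proof -
  let ?P = "2 ^ (n - m)"
  have J: "j div ?P \<le> 2 ^ m"
  proof -
    have "(2::nat) ^ n = 2 ^ m * ?P" using m by (simp flip: power_add)
    then show ?thesis using div_le_mono[OF j, of ?P] by simp
  qed
  have "\<bar>level_sum m j y - level_sum m j z\<bar> \<le> (\<Sum>k<j div ?P. K * sqrt d)"
    unfolding level_sum_def sum_subtractf[symmetric]
  proof (rule order_trans[OF sum_abs], rule sum_mono)
    fix k assume "k \<in> {..<j div ?P}"
    then have k: "k < 2 ^ m" using J by auto
    have "\<bar>G m k (y (Suc k * ?P)) - G m k (z (Suc k * ?P))\<bar> \<le> N m k * sqrt \<bar>y (Suc k * ?P) - z (Suc k * ?P)\<bar>"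
      by (rule half_holder[OF m k])
    also have "\<dots> \<le> K * sqrt d"
    proof (rule mult_mono)
      have "N m k \<le> K * \<theta> ^ m" by (rule N_le[OF m k])
      also have "\<dots> \<le> K * 1" using K \<theta> by (intro mult_left_mono power_le_one) auto
      finally show "N m k \<le> K" by simp
    qed (use d K in auto)
    finally show "\<bar>G m k (y (Suc k * ?P)) - G m k (z (Suc k * ?P))\<bar> \<le> K * sqrt d" .
  qed
  also have "\<dots> = real (j div ?P) * (K * sqrt d)" by simp
  also have "\<dots> \<le> 2 ^ m * (K * sqrt d)"
  proof (rule mult_right_mono)
    show "real (j div ?P) \<le> 2 ^ m" using of_nat_mono[OF J, where 'a = real] by simp
    show "0 \<le> K * sqrt d" using K order_trans[OF abs_ge_zero d] by simp
  qed
  finally have mid: "\<bar>level_sum m j y - level_sum m j z\<bar> \<le> 2 ^ m * (K * sqrt d)" .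
  define c where "c = (sqrt L + 2) * K / (1 - \<theta>) * \<theta> ^ m"
  have "\<bar>level_sum n j y - level_sum m j y\<bar> \<le> c" "\<bar>level_sum n j z - level_sum m j z\<bar> \<le> c"
    unfolding c_def by (intro level_sum_tail m j y)+
  with mid have "\<bar>level_sum n j y - level_sum n j z\<bar> \<le> 2 * c + 2 ^ m * (K * sqrt d)"
    by linarith
  then show ?thesis unfolding level_sum_finest c_def by (simp only: mult.assoc)
qed

end

section \<open>The Euler scheme and its spatial derivative\<close>

text \<open>Backward characteristics: \<open>euler a j y i\<close> is the position at grid time \<open>i\<close> of the discrete
  characteristic that is at \<open>y\<close> at grid time \<open>j\<close>, where \<open>a i\<close> is the displacement over the \<open>i\<close>-th step.
  It is constant for \<open>i \<ge> j\<close>. The recursion is on the final time, so that the scheme solves the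
  transport equation step by step.\<close>

fun euler :: "(nat \<Rightarrow> real \<Rightarrow> real) \<Rightarrow> nat \<Rightarrow> real \<Rightarrow> nat \<Rightarrow> real" where
  "euler a 0 y i = y"
| "euler a (Suc j) y i = (if j < i then y else euler a j (y - a j y) i)"

lemma euler_stopped: "j \<le> i \<Longrightarrow> euler a j y i = y"
  by (cases j) auto

lemma euler_step: "i < j \<Longrightarrow> euler a j y i = euler a j y (Suc i) - a i (euler a j y (Suc i))"
proof (induction j arbitrary: y)
  case (Suc j)
  show ?case
  proof (cases "i = j")
    case True
    then show ?thesis by (simp add: euler_stopped)
  next
    case False
    then have "i < j" using Suc.prems by simp
    with Suc.IH[OF this] show ?thesis by simp
  qed
qed simp

lemma euler_increment:
  assumes "\<And>i x. i < j \<Longrightarrow> \<bar>a i x\<bar> \<le> \<delta>" "0 \<le> \<delta>"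
  shows "\<bar>euler a j y (Suc i) - euler a j y i\<bar> \<le> \<delta>"
proof (cases "i < j")
  case True
  then show ?thesis using euler_step[OF True, of a y] assms(1)[OF True] by simp
qed (use assms euler_stopped[of j] in simp)

lemma euler_has_deriv:
  assumes g: "\<And>i x. (a i has_real_derivative g i x) (at x)"
  shows "i \<le> j \<Longrightarrow> ((\<lambda>y. euler a j y i) has_real_derivative (\<Prod>l\<in>{i..<j}. 1 - g l (euler a j y (Suc l)))) (at y)"
proof (induction j arbitrary: y)
  case (Suc j)
  show ?case
  proof (cases "i \<le> j")
    case True
    have in_: "((\<lambda>y. y - a j y) has_real_derivative (1 - g j y)) (at y)"
      by (auto intro!: derivative_eq_intros g)
    have "((\<lambda>y. euler a j (y - a j y) i) has_real_derivative
       (\<Prod>l\<in>{i..<j}. 1 - g l (euler a j (y - a j y) (Suc l))) * (1 - g j y)) (at y)"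
      by (rule DERIV_chain2[OF Suc.IH[OF True] in_])
    moreover have "(\<Prod>l\<in>{i..<Suc j}. 1 - g l (euler a (Suc j) y (Suc l)))
        = (\<Prod>l\<in>{i..<j}. 1 - g l (euler a j (y - a j y) (Suc l))) * (1 - g j y)"
      using True by (simp add: prod.atLeastLessThan_Suc)
    moreover have "(\<lambda>y. euler a (Suc j) y i) = (\<lambda>y. euler a j (y - a j y) i)"
      using True by auto
    ultimately show ?thesis by simp
  next
    case False
    then have "i = Suc j" using Suc.prems by simp
    then show ?thesis by (simp add: euler_stopped)
  qed
qed simp

text \<open>\<open>ln (1 - g) = - g + O(g\<^sup>2)\<close>, termwise.\<close>

lemma prod_one_minus_exp:
  fixes g :: "'b \<Rightarrow> real"
  assumes "finite A" "\<And>l. l \<in> A \<Longrightarrow> \<bar>g l\<bar> \<le> 1 / 2"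
  shows "\<exists>E. (\<Prod>l\<in>A. 1 - g l) = exp (- (\<Sum>l\<in>A. g l) + E) \<and> \<bar>E\<bar> \<le> 2 * (\<Sum>l\<in>A. (g l)\<^sup>2)"
proof (intro exI conjI)
  let ?E = "\<Sum>l\<in>A. ln (1 - g l) + g l"
  have "1 - g l > 0" if "l \<in> A" for l using assms(2)[OF that] by linarith
  then have "(\<Prod>l\<in>A. 1 - g l) = (\<Prod>l\<in>A. exp (ln (1 - g l)))" by (intro prod.cong) auto
  also have "\<dots> = exp (\<Sum>l\<in>A. ln (1 - g l))" by (rule exp_sum[OF assms(1), symmetric])
  also have "(\<Sum>l\<in>A. ln (1 - g l)) = - (\<Sum>l\<in>A. g l) + ?E"
    by (simp add: sum.distrib)
  finally show "(\<Prod>l\<in>A. 1 - g l) = exp (- (\<Sum>l\<in>A. g l) + ?E)" .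
  have "\<bar>ln (1 - g l) + g l\<bar> \<le> 2 * (g l)\<^sup>2" if "l \<in> A" for l
    using abs_ln_one_plus_x_minus_x_bound[of "- g l"] assms(2)[OF that] by simp
  then have "\<bar>?E\<bar> \<le> (\<Sum>l\<in>A. 2 * (g l)\<^sup>2)"
    by (intro order_trans[OF sum_abs] sum_mono)
  then show "\<bar>?E\<bar> \<le> 2 * (\<Sum>l\<in>A. (g l)\<^sup>2)" by (simp add: sum_distrib_left)
qed

text \<open>The last assumption says that the finest increments of the derivative are below \<open>1/2\<close>, which
  keeps all factors of the derivative of the scheme positive.\<close>

locale euler_flow = dyadic_increments n G N K \<theta> L
  for n :: nat and G :: "nat \<Rightarrow> nat \<Rightarrow> real \<Rightarrow> real" and N :: "nat \<Rightarrow> nat \<Rightarrow> real" and K \<theta> L :: real +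
  fixes a :: "nat \<Rightarrow> real \<Rightarrow> real"
  assumes a_deriv: "\<And>i x. (a i has_real_derivative G n i x) (at x)"
    and a_bound: "\<And>i x. i < 2 ^ n \<Longrightarrow> \<bar>a i x\<bar> \<le> L / 2 ^ n"
    and fine: "2 * (K * \<theta> ^ n) \<le> 1 / 2"
begin

lemma euler_slow: assumes "j \<le> 2 ^ n" shows "slow_path (euler a j y)"
  unfolding slow_path_def
proof
  fix i show "\<bar>euler a j y (Suc i) - euler a j y i\<bar> \<le> L / 2 ^ n"
    by (rule euler_increment) (use a_bound assms L in auto)
qed

lemma euler_displacement: assumes "j \<le> 2 ^ n" shows "\<bar>euler a j y 0 - y\<bar> \<le> L"
proof -
  have "\<bar>euler a j y (0 + j) - euler a j y 0\<bar> \<le> real j * (L / 2 ^ n)"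
    by (rule slow_path_diff[OF euler_slow[OF assms]])
  also have "\<dots> \<le> 2 ^ n * (L / 2 ^ n)"
    using of_nat_mono[OF assms, where 'a = real] L by (intro mult_right_mono) auto
  finally show ?thesis by (simp add: euler_stopped abs_minus_commute)
qed

definition slope :: "nat \<Rightarrow> nat \<Rightarrow> real \<Rightarrow> real" where
  "slope i j y = (\<Prod>l\<in>{i..<j}. 1 - G n l (euler a j y (Suc l)))"

lemma slope_deriv: "i \<le> j \<Longrightarrow> ((\<lambda>y. euler a j y i) has_real_derivative slope i j y) (at y)"
  unfolding slope_def by (rule euler_has_deriv[where g = "G n", OF a_deriv])

lemma G_small: "l < 2 ^ n \<Longrightarrow> \<bar>G n l x\<bar> \<le> 1 / 2"
  using sup_bound[of n l x] N_le[of n l] fine by simp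

lemma slope_bound:
  assumes "i \<le> j" "j \<le> 2 ^ n" shows "0 \<le> slope i j y" "slope i j y \<le> exp (2 * sum_bound)"
proof -
  let ?g = "\<lambda>l. G n l (euler a j y (Suc l))"
  have pos: "0 \<le> 1 - ?g l" if "l \<in> {i..<j}" for l
    using G_small[of l "euler a j y (Suc l)"] that assms by simp
  then show "0 \<le> slope i j y" unfolding slope_def by (intro prod_nonneg) auto
  have "slope i j y \<le> (\<Prod>l\<in>{i..<j}. exp (- ?g l))"
    unfolding slope_def
  proof (intro prod_mono conjI pos)
    show "1 - ?g l \<le> exp (- ?g l)" for l using exp_ge_add_one_self[of "- ?g l"] by simp
  qed
  also have "\<dots> = exp (- (\<Sum>l\<in>{i..<j}. ?g l))" by (simp add: exp_sum flip: sum_negf)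
  also have "(\<Sum>l\<in>{i..<j}. ?g l) = (\<Sum>l<j. ?g l) - (\<Sum>l<i. ?g l)"
    using sum_diff_nat_ivl[of 0 i j ?g] assms by (simp add: atLeast0LessThan)
  also have "exp (- ((\<Sum>l<j. ?g l) - (\<Sum>l<i. ?g l))) \<le> exp (2 * sum_bound)"
    using finest_sum_bound[OF assms(2) euler_slow[OF assms(2), of y]]
      finest_sum_bound[of i, OF order_trans[OF assms] euler_slow[OF assms(2), of y]]
    unfolding exp_le_cancel_iff by linarith
  finally show "slope i j y \<le> exp (2 * sum_bound)" .
qed

lemma euler_lipschitz:
  assumes "j \<le> 2 ^ n" shows "\<bar>euler a j y i - euler a j z i\<bar> \<le> exp (2 * sum_bound) * \<bar>y - z\<bar>"
proof (cases "i \<le> j")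
  case True
  have "norm (euler a j y i - euler a j z i) \<le> exp (2 * sum_bound) * norm (y - z)"
  proof (rule field_differentiable_bound[of UNIV "\<lambda>y. euler a j y i" "slope i j"])
    show "((\<lambda>y. euler a j y i) has_field_derivative slope i j x) (at x within UNIV)" for x
      using slope_deriv[OF True] by simp
    show "norm (slope i j x) \<le> exp (2 * sum_bound)" for x
      using slope_bound[OF True assms] by simp
  qed auto
  then show ?thesis by simp
next
  case False
  have "K / (1 - \<theta>) \<ge> 0" using K \<theta> by simp
  then have "0 \<le> sum_bound" unfolding sum_bound_def using K L \<theta> by simp
  then have "1 \<le> exp (2 * sum_bound)" by simp
  with False show ?thesis using mult_right_mono[of 1 "exp (2 * sum_bound)" "\<bar>y - z\<bar>"]
    by (simp add: euler_stopped)
qed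

lemma slope_exp_form:
  assumes "j \<le> 2 ^ n"
  shows "\<exists>E. slope 0 j y = exp (- (\<Sum>l<j. G n l (euler a j y (Suc l))) + E) \<and> \<bar>E\<bar> \<le> 8 * (K * \<theta> ^ n)\<^sup>2"
proof -
  let ?g = "\<lambda>l. G n l (euler a j y (Suc l))"
  have "\<exists>E. (\<Prod>l<j. 1 - ?g l) = exp (- (\<Sum>l<j. ?g l) + E) \<and> \<bar>E\<bar> \<le> 2 * (\<Sum>l<j. (?g l)\<^sup>2)"
    by (rule prod_one_minus_exp) (use G_small assms in auto)
  moreover have "(\<Sum>l<j. (?g l)\<^sup>2) \<le> 4 * (K * \<theta> ^ n)\<^sup>2"
  proof -
    have "(\<Sum>l<j. (?g l)\<^sup>2) \<le> (\<Sum>l<j. 4 * (N n l)\<^sup>2)"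
    proof (rule sum_mono)
      fix l assume "l \<in> {..<j}"
      then have "\<bar>?g l\<bar> \<le> \<bar>2 * N n l\<bar>" using sup_bound[of n l] assms N_nonneg[of n l] by simp
      then have "(?g l)\<^sup>2 \<le> (2 * N n l)\<^sup>2" by (simp only: abs_le_square_iff)
      then show "(?g l)\<^sup>2 \<le> 4 * (N n l)\<^sup>2" by (simp add: power_mult_distrib)
    qed
    also have "\<dots> = 4 * (\<Sum>l<j. (N n l)\<^sup>2)" by (simp add: sum_distrib_left)
    also have "(\<Sum>l<j. (N n l)\<^sup>2) \<le> (\<Sum>l<2 ^ n. (N n l)\<^sup>2)" using assms by (intro sum_mono2) auto
    also have "\<dots> \<le> (K * \<theta> ^ n)\<^sup>2" by (rule energy) simp
    finally show ?thesis by simp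
  qed
  ultimately show ?thesis unfolding slope_def atLeast0LessThan by fastforce
qed

text \<open>By \<open>slope_exp_form\<close> the logarithm of the derivative is, up to the square sum of the finest
  increments, a sum of the form treated by \<open>finest_sum_equicontinuous\<close> along an Euler path, and
  Euler paths depend on their end point in a Lipschitz way.\<close>

lemma slope_log_modulus:
  assumes m: "m \<le> n" and j: "j \<le> 2 ^ n"
  shows "\<exists>e. slope 0 j y = slope 0 j z * exp e \<and>
    \<bar>e\<bar> \<le> 2 * ((sqrt L + 2) * K / (1 - \<theta>)) * \<theta> ^ m + 2 ^ m * K * sqrt (exp (2 * sum_bound) * \<bar>y - z\<bar>) + 16 * (K * \<theta> ^ n)\<^sup>2"
proof -
  obtain E where E: "slope 0 j y = exp (- (\<Sum>l<j. G n l (euler a j y (Suc l))) + E)" "\<bar>E\<bar> \<le> 8 * (K * \<theta> ^ n)\<^sup>2"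
    using slope_exp_form[OF j] by blast
  obtain F where F: "slope 0 j z = exp (- (\<Sum>l<j. G n l (euler a j z (Suc l))) + F)" "\<bar>F\<bar> \<le> 8 * (K * \<theta> ^ n)\<^sup>2"
    using slope_exp_form[OF j] by blast
  let ?Y = "\<Sum>l<j. G n l (euler a j y (Suc l))" and ?Z = "\<Sum>l<j. G n l (euler a j z (Suc l))"
  have "\<bar>?Y - ?Z\<bar> \<le> 2 * ((sqrt L + 2) * K / (1 - \<theta>)) * \<theta> ^ m + 2 ^ m * K * sqrt (exp (2 * sum_bound) * \<bar>y - z\<bar>)"
    by (rule finest_sum_equicontinuous[OF m j euler_slow[OF j] euler_slow[OF j] euler_lipschitz[OF j]])
  then have "\<bar>?Z - ?Y + E - F\<bar> \<le> 2 * ((sqrt L + 2) * K / (1 - \<theta>)) * \<theta> ^ m + 2 ^ m * K * sqrt (exp (2 * sum_bound) * \<bar>y - z\<bar>) + 16 * (K * \<theta> ^ n)\<^sup>2"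
    using E(2) F(2) by linarith
  moreover have "slope 0 j y = slope 0 j z * exp (?Z - ?Y + E - F)"
    unfolding E(1) F(1) mult_exp_exp by simp
  ultimately show ?thesis by blast
qed

end

section \<open>Passage to the limit\<close>

text \<open>The Arzela-Ascoli argument: a diagonal subsequence converges on a countable dense set, and
  equicontinuity extends this to all points. Equicontinuity is only asked for large \<open>n\<close>, because
  the Euler schemes have it only up to an error that vanishes with the grid size.\<close>

lemma pointwise_convergent_subsequence:
  fixes F :: "nat \<Rightarrow> 'b::{metric_space, second_countable_topology} \<Rightarrow> real"
  assumes bdd: "\<And>x. x \<in> S \<Longrightarrow> \<exists>M. \<forall>n. \<bar>F n x\<bar> \<le> M"
    and equi: "\<And>x e. x \<in> S \<Longrightarrow> e > 0 \<Longrightarrow> \<exists>d>0. \<exists>n0. \<forall>n\<ge>n0. \<forall>y\<in>S. dist x y < d \<longrightarrow> \<bar>F n x - F n y\<bar> < e"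
  shows "\<exists>r l. strict_mono (r :: nat \<Rightarrow> nat) \<and> (\<forall>x\<in>S. (\<lambda>n. F (r n) x) \<longlonglongrightarrow> l x)"
proof -
  obtain D where D: "countable D" "D \<subseteq> S" "S \<subseteq> closure D" using separable[of S] by metis
  obtain M where M: "\<And>x n. x \<in> S \<Longrightarrow> \<bar>F n x\<bar> \<le> M x" using bdd by metis
  \<comment> \<open>Normalised, to have one bound for all points.\<close>
  define F' where "F' n x = F n x / (1 + \<bar>M x\<bar>)" for n x
  have "norm (F' n x) \<le> 1" if "x \<in> D" for n x
    using M[of x n] D(2) that by (auto simp: F'_def divide_le_eq_1)
  then obtain r where r: "strict_mono (r :: nat \<Rightarrow> nat)" "\<And>x. x \<in> D \<Longrightarrow> \<exists>l. (\<lambda>n. F' (r n) x) \<longlonglongrightarrow> l"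
    using function_convergent_subsequence[of D F' 1] D(1) by metis
  have conv: "Cauchy (\<lambda>n. F (r n) x)" if x: "x \<in> D" for x
  proof -
    obtain l where "(\<lambda>n. F' (r n) x) \<longlonglongrightarrow> l" using r(2)[OF x] by blast
    then have "(\<lambda>n. F' (r n) x * (1 + \<bar>M x\<bar>)) \<longlonglongrightarrow> l * (1 + \<bar>M x\<bar>)" by (intro tendsto_mult_right)
    moreover have "F' (r n) x * (1 + \<bar>M x\<bar>) = F (r n) x" for n
      unfolding F'_def by (simp add: add_nonneg_eq_0_iff)
    ultimately show ?thesis using LIMSEQ_imp_Cauchy by auto
  qed
  have "convergent (\<lambda>n. F (r n) x)" if x: "x \<in> S" for x
  proof (rule Cauchy_convergent, rule metric_CauchyI)
    fix e :: real assume e: "e > 0"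
    then obtain d n0 where d: "d > 0" "\<And>n y. n \<ge> n0 \<Longrightarrow> y \<in> S \<Longrightarrow> dist x y < d \<Longrightarrow> \<bar>F n x - F n y\<bar> < e / 3"
      using equi[OF x, of "e / 3"] by auto
    obtain y where y: "y \<in> D" "dist y x < d" using closure_approachable[of x D] D(3) x d(1) by auto
    obtain n1 where n1: "\<And>m n. m \<ge> n1 \<Longrightarrow> n \<ge> n1 \<Longrightarrow> dist (F (r m) y) (F (r n) y) < e / 3"
      using metric_CauchyD[OF conv[OF y(1)], of "e / 3"] e by auto
    have "dist (F (r m) x) (F (r n) x) < e" if "m \<ge> max n0 n1" "n \<ge> max n0 n1" for m n
    proof -
      have "r m \<ge> n0" "r n \<ge> n0" using seq_suble[OF r(1)] that by (meson max.bounded_iff order_trans)+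
      then have "\<bar>F (r m) x - F (r m) y\<bar> < e / 3" "\<bar>F (r n) x - F (r n) y\<bar> < e / 3"
        using d(2) y D(2) by (auto simp: dist_commute)
      moreover have "\<bar>F (r m) y - F (r n) y\<bar> < e / 3" using n1[of m n] that by (auto simp: dist_real_def)
      ultimately show ?thesis unfolding dist_real_def by linarith
    qed
    then show "\<exists>M. \<forall>m\<ge>M. \<forall>n\<ge>M. dist (F (r m) x) (F (r n) x) < e" by blast
  qed
  then have "\<forall>x\<in>S. (\<lambda>n. F (r n) x) \<longlonglongrightarrow> lim (\<lambda>n. F (r n) x)" by (simp add: convergent_LIMSEQ_iff)
  with r(1) show ?thesis by (intro exI[of _ r] exI[of _ "\<lambda>x. lim (\<lambda>n. F (r n) x)"]) simp
qed

text \<open>Equicontinuity of the derivatives makes the difference quotients close to the derivatives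
  uniformly in \<open>i\<close>, and the former converge; so the derivatives converge without passing to a
  further subsequence.\<close>

lemma derivatives_converge_if_equicontinuous:
  fixes V W :: "nat \<Rightarrow> real \<Rightarrow> real"
  assumes der: "\<And>i y. i \<ge> i0 \<Longrightarrow> (V i has_real_derivative W i y) (at y)"
    and lim: "\<And>y. (\<lambda>i. V i y) \<longlonglongrightarrow> v y"
    and equi: "\<And>y e. e > 0 \<Longrightarrow> \<exists>d>0. \<exists>i1. \<forall>i\<ge>i1. \<forall>z. \<bar>z - y\<bar> < d \<longrightarrow> \<bar>W i z - W i y\<bar> < e"
  shows "\<exists>w. (\<forall>y. (\<lambda>i. W i y) \<longlonglongrightarrow> w y) \<and> (\<forall>y. (v has_real_derivative w y) (at y)) \<and> continuous_on UNIV w"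
proof -
  have close: "\<exists>d>0. \<exists>i1. (\<forall>i\<ge>i1. \<forall>z. \<bar>z - y\<bar> < d \<longrightarrow> \<bar>W i z - W i y\<bar> < e) \<and>
     (\<forall>i\<ge>i1. \<forall>h. h \<noteq> 0 \<and> \<bar>h\<bar> < d \<longrightarrow> \<bar>(V i (y + h) - V i y) / h - W i y\<bar> \<le> e)"
    if e: "e > 0" for y e
  proof -
    obtain d i1 where d: "d > 0" "\<And>i z. i \<ge> i1 \<Longrightarrow> \<bar>z - y\<bar> < d \<Longrightarrow> \<bar>W i z - W i y\<bar> < e"
      using equi[OF e, of y] by blast
    have "\<bar>(V i (y + h) - V i y) / h - W i y\<bar> \<le> e" if i: "i \<ge> max i0 i1" and h: "h \<noteq> 0" "\<bar>h\<bar> < d" for i h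
    proof -
      have "\<exists>z. \<bar>z - y\<bar> < d \<and> V i (y + h) - V i y = h * W i z"
      proof (cases "h > 0")
        case True
        then obtain z where "y < z" "z < y + h" "V i (y + h) - V i y = (y + h - y) * W i z"
          using MVT2[of y "y + h" "V i" "W i"] der i by auto
        then show ?thesis using h by (intro exI[of _ z]) auto
      next
        case False
        then have "y + h < y" using h by simp
        then obtain z where "y + h < z" "z < y" "V i y - V i (y + h) = (y - (y + h)) * W i z"
          using MVT2[of "y + h" y "V i" "W i"] der i by auto
        then show ?thesis using h by (intro exI[of _ z]) auto
      qed
      then obtain z where z: "\<bar>z - y\<bar> < d" "V i (y + h) - V i y = h * W i z" by blast
      then have "(V i (y + h) - V i y) / h = W i z" using h by simp
      then show ?thesis using d(2)[of i z] z i by simp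
    qed
    then show ?thesis using d by (intro exI[of _ d] conjI exI[of _ "max i0 i1"]) auto
  qed
  have "convergent (\<lambda>i. W i y)" for y
  proof (rule Cauchy_convergent, rule metric_CauchyI)
    fix e :: real assume e: "e > 0"
    then obtain d i1 where d: "d > 0" "\<And>i h. i \<ge> i1 \<Longrightarrow> h \<noteq> 0 \<Longrightarrow> \<bar>h\<bar> < d \<Longrightarrow> \<bar>(V i (y + h) - V i y) / h - W i y\<bar> \<le> e / 4"
    proof -
      have "e / 4 > 0" using e by simp
      from close[OF this, of y] show ?thesis using that by blast
    qed
    have "(\<lambda>i. (V i (y + d / 2) - V i y) / (d / 2)) \<longlonglongrightarrow> (v (y + d / 2) - v y) / (d / 2)"
      using d(1) by (intro tendsto_intros lim) auto
    from metric_LIMSEQ_D[OF this, of "e / 4"] e obtain i2 where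
      i2: "\<And>i. i \<ge> i2 \<Longrightarrow> \<bar>(V i (y + d / 2) - V i y) / (d / 2) - (v (y + d / 2) - v y) / (d / 2)\<bar> < e / 4"
      unfolding dist_real_def by auto
    have W: "\<bar>W i y - (v (y + d / 2) - v y) / (d / 2)\<bar> < e / 2" if "i \<ge> max i1 i2" for i
    proof -
      have "\<bar>(V i (y + d / 2) - V i y) / (d / 2) - W i y\<bar> \<le> e / 4"
        by (rule d(2)) (use that d(1) in auto)
      moreover have "i \<ge> i2" using that by simp
      ultimately show ?thesis using i2[of i] by linarith
    qed
    have "dist (W i y) (W j y) < e" if "i \<ge> max i1 i2" "j \<ge> max i1 i2" for i j
      using W[OF that(1)] W[OF that(2)] unfolding dist_real_def by linarith
    then show "\<exists>M. \<forall>m\<ge>M. \<forall>n\<ge>M. dist (W m y) (W n y) < e" by blast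
  qed
  then obtain w where w: "\<And>y. (\<lambda>i. W i y) \<longlonglongrightarrow> w y" unfolding convergent_def by metis
  have wv: "\<exists>d>0. (\<forall>z. \<bar>z - y\<bar> < d \<longrightarrow> \<bar>w z - w y\<bar> \<le> e) \<and> (\<forall>h. h \<noteq> 0 \<and> \<bar>h\<bar> < d \<longrightarrow> \<bar>(v (y + h) - v y) / h - w y\<bar> \<le> e)"
    if e: "e > 0" for y e
  proof -
    obtain d i1 where d: "d > 0" "\<And>i z. i \<ge> i1 \<Longrightarrow> \<bar>z - y\<bar> < d \<Longrightarrow> \<bar>W i z - W i y\<bar> < e"
      "\<And>i h. i \<ge> i1 \<Longrightarrow> h \<noteq> 0 \<Longrightarrow> \<bar>h\<bar> < d \<Longrightarrow> \<bar>(V i (y + h) - V i y) / h - W i y\<bar> \<le> e"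
      using close[OF e, of y] by blast
    have "\<bar>w z - w y\<bar> \<le> e" if "\<bar>z - y\<bar> < d" for z
    proof (rule LIMSEQ_le_const2)
      show "(\<lambda>i. \<bar>W i z - W i y\<bar>) \<longlonglongrightarrow> \<bar>w z - w y\<bar>" by (intro tendsto_intros w)
      show "\<exists>N. \<forall>i\<ge>N. \<bar>W i z - W i y\<bar> \<le> e" using d(2) that by (meson less_imp_le)
    qed
    moreover have "\<bar>(v (y + h) - v y) / h - w y\<bar> \<le> e" if "h \<noteq> 0" "\<bar>h\<bar> < d" for h
    proof (rule LIMSEQ_le_const2)
      show "(\<lambda>i. \<bar>(V i (y + h) - V i y) / h - W i y\<bar>) \<longlonglongrightarrow> \<bar>(v (y + h) - v y) / h - w y\<bar>"
        using that by (intro tendsto_intros w lim)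
      show "\<exists>N. \<forall>i\<ge>N. \<bar>(V i (y + h) - V i y) / h - W i y\<bar> \<le> e" using d(3) that by blast
    qed
    ultimately show ?thesis using d(1) by blast
  qed
  have "(v has_real_derivative w y) (at y)" for y
    unfolding DERIV_def
  proof (rule LIM_I)
    fix e :: real assume "e > 0"
    then obtain d where "d > 0" "\<And>h. h \<noteq> 0 \<Longrightarrow> \<bar>h\<bar> < d \<Longrightarrow> \<bar>(v (y + h) - v y) / h - w y\<bar> \<le> e / 2"
      using wv[of "e / 2" y] by auto
    then show "\<exists>d>0. \<forall>h. h \<noteq> 0 \<and> norm (h - 0) < d \<longrightarrow> norm ((v (y + h) - v y) / h - w y) < e"
      using \<open>e > 0\<close> by (intro exI[of _ d]) fastforce
  qed
  moreover have "continuous_on UNIV w"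
    unfolding continuous_on_iff
  proof (intro ballI allI impI)
    fix y e :: real assume "e > 0"
    then obtain d where "d > 0" "\<And>z. \<bar>z - y\<bar> < d \<Longrightarrow> \<bar>w z - w y\<bar> \<le> e / 2"
      using wv[of "e / 2" y] by auto
    then show "\<exists>d>0. \<forall>x'\<in>UNIV. dist x' y < d \<longrightarrow> dist (w x') (w y) < e"
      using \<open>e > 0\<close> unfolding dist_real_def by (intro exI[of _ d]) fastforce
  qed
  ultimately show ?thesis using w by blast
qed

text \<open>The deterministic setting for one path of the noise: the smooth drifts \<open>f i\<close>, with spatial
  derivatives \<open>f1 i\<close>, converge weakly to \<open>c\<close>, and the cell integrals of \<open>f1 i\<close> satisfy the
  estimates of \<open>dyadic_increments\<close> down to level \<open>lev i\<close>. The bound \<open>D i\<close> on \<open>f1 i\<close> is qualitative: it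
  may explode with \<open>i\<close>.\<close>

locale transport_approximation =
  fixes T C K \<theta> :: real and u0 u0' :: "real \<Rightarrow> real" and lev :: "nat \<Rightarrow> nat"
    and f f1 :: "nat \<Rightarrow> real \<Rightarrow> real \<Rightarrow> real" and D :: "nat \<Rightarrow> real" and c :: "real \<Rightarrow> real \<Rightarrow> real"
    and N :: "nat \<Rightarrow> nat \<Rightarrow> nat \<Rightarrow> real"
  assumes T: "0 < T" and C: "0 \<le> C" and K: "0 \<le> K" and \<theta>: "0 < \<theta>" "\<theta> < 1"
    and lev: "strict_mono lev"
    and u0: "\<And>x. (u0 has_real_derivative u0' x) (at x)" and u0': "continuous_on UNIV u0'"
    and f_measurable [measurable]: "\<And>i. case_prod (f i) \<in> borel_measurable (borel \<Otimes>\<^sub>M borel)"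
    and f_bound: "\<And>i r y. \<bar>f i r y\<bar> \<le> C"
    and f_deriv: "\<And>i r y. (f i r has_real_derivative f1 i r y) (at y)"
    and f1_measurable [measurable]: "\<And>i. case_prod (f1 i) \<in> borel_measurable (borel \<Otimes>\<^sub>M borel)"
    and f1_bound: "\<And>i r y. \<bar>f1 i r y\<bar> \<le> D i"
    and c_measurable [measurable]: "case_prod c \<in> borel_measurable (borel \<Otimes>\<^sub>M borel)"
    and c_bound: "\<And>r y. \<bar>c r y\<bar> \<le> C"
    and N_nonneg: "\<And>i m k. 0 \<le> N i m k"
    and half_holder: "\<And>i m k x y. m \<le> lev i \<Longrightarrow> k < 2 ^ m \<Longrightarrow>
       \<bar>(\<integral>r. indicator (dyadic_cell T m k) r * f1 i r x \<partial>lborel) - (\<integral>r. indicator (dyadic_cell T m k) r * f1 i r y \<partial>lborel)\<bar>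
         \<le> N i m k * sqrt \<bar>x - y\<bar>"
    and sup_bound: "\<And>i m k x. m \<le> lev i \<Longrightarrow> k < 2 ^ m \<Longrightarrow>
       \<bar>\<integral>r. indicator (dyadic_cell T m k) r * f1 i r x \<partial>lborel\<bar> \<le> 2 * N i m k"
    and energy: "\<And>i m. m \<le> lev i \<Longrightarrow> (\<Sum>k<2 ^ m. (N i m k)\<^sup>2) \<le> (K * \<theta> ^ m)\<^sup>2"
    and weak_limit: "\<And>\<phi> Z R. case_prod \<phi> \<in> borel_measurable (borel \<Otimes>\<^sub>M borel) \<Longrightarrow>
       (\<And>r y. \<bar>\<phi> r y\<bar> \<le> Z * indicator ({0..T} \<times> {-R..R}) (r, y)) \<Longrightarrow> (\<And>r. continuous_on UNIV (\<phi> r)) \<Longrightarrow>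
       (\<lambda>i. \<integral>r. (\<integral>y. f i r y * \<phi> r y \<partial>lborel) \<partial>lborel) \<longlonglongrightarrow> (\<integral>r. (\<integral>y. c r y * \<phi> r y \<partial>lborel) \<partial>lborel)"
begin

definition vel_avg :: "nat \<Rightarrow> nat \<Rightarrow> real \<Rightarrow> real" where
  "vel_avg i k y = (\<integral>r. indicator (dyadic_cell T (lev i) k) r * f i r y \<partial>lborel)"

definition slope_avg :: "nat \<Rightarrow> nat \<Rightarrow> nat \<Rightarrow> real \<Rightarrow> real" where
  "slope_avg i m k y = (\<integral>r. indicator (dyadic_cell T m k) r * f1 i r y \<partial>lborel)"

text \<open>The constant \<open>sum_bound\<close> for Euler paths, which move by at most \<open>C * T\<close>.\<close>

definition path_sum_bound :: real where
  "path_sum_bound = 2 * K + (sqrt (C * T) + 2) * K / (1 - \<theta>)"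

lemma cell_sets [measurable]: "dyadic_cell T m k \<in> sets borel" by (simp add: dyadic_cell_def)

lemma cell_integrable:
  fixes g :: "real \<Rightarrow> real"
  assumes "g \<in> borel_measurable borel" "\<And>r. \<bar>g r\<bar> \<le> Z"
  shows "integrable lborel (\<lambda>r. indicator (dyadic_cell T m k) r * g r)"
proof (rule Bochner_Integration.integrable_bound)
  have le: "T * real k / 2 ^ m \<le> T * real (Suc k) / 2 ^ m"
    using T by (intro divide_right_mono mult_left_mono) auto
  show "integrable lborel (\<lambda>r. Z * indicator (dyadic_cell T m k) r)"
    using le by (intro integrable_mult_right) (simp add: dyadic_cell_def)
  show "(\<lambda>r. indicator (dyadic_cell T m k) r * g r) \<in> borel_measurable lborel" using assms(1) by measurable
  show "AE r in lborel. norm (indicator (dyadic_cell T m k) r * g r) \<le> norm (Z * indicator (dyadic_cell T m k) r)"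
    using order_trans[OF assms(2) abs_ge_self] by (intro AE_I2) (auto simp: indicator_def)
qed

lemma cell_measure: "(\<integral>r. indicator (dyadic_cell T m k) r \<partial>lborel) = T / 2 ^ m"
proof -
  have le: "T * real k / 2 ^ m \<le> T * real (Suc k) / 2 ^ m"
    using T by (intro divide_right_mono mult_left_mono) auto
  then have "(\<integral>r. indicator (dyadic_cell T m k) r \<partial>lborel) = T * real (Suc k) / 2 ^ m - T * real k / 2 ^ m"
    unfolding dyadic_cell_def by simp
  then show ?thesis by (simp add: field_simps)
qed

lemma f_meas1: "(\<lambda>r. f i r y) \<in> borel_measurable borel" by measurable
lemma f1_meas1: "(\<lambda>r. f1 i r y) \<in> borel_measurable borel" by measurable

lemma vel_avg_deriv: "(vel_avg i k has_real_derivative slope_avg i (lev i) k y) (at y)"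
  unfolding vel_avg_def[abs_def] slope_avg_def
proof (rule has_real_derivative_lebesgue_integral(1)[where D = "\<lambda>r. indicator (dyadic_cell T (lev i) k) r * D i"])
  show "((\<lambda>y. indicator (dyadic_cell T (lev i) k) r * f i r y) has_real_derivative
      indicator (dyadic_cell T (lev i) k) r * f1 i r y) (at y)" for y r
    by (rule DERIV_cmult[OF f_deriv])
  show "\<bar>indicator (dyadic_cell T (lev i) k) r * f1 i r y\<bar> \<le> indicator (dyadic_cell T (lev i) k) r * D i" for y r
    using f1_bound[of i r y] by (auto simp: indicator_def)
  show "integrable lborel (\<lambda>r. indicator (dyadic_cell T (lev i) k) r * D i)"
    by (rule cell_integrable[of _ "\<bar>D i\<bar>"]) auto
qed (rule cell_integrable[OF f_meas1 f_bound])

lemma vel_avg_bound: "\<bar>vel_avg i k y\<bar> \<le> C * T / 2 ^ lev i"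
proof -
  have "\<bar>vel_avg i k y\<bar> \<le> (\<integral>r. \<bar>indicator (dyadic_cell T (lev i) k) r * f i r y\<bar> \<partial>lborel)"
    unfolding vel_avg_def by (rule integral_abs_bound)
  also have "\<dots> \<le> (\<integral>r. indicator (dyadic_cell T (lev i) k) r * C \<partial>lborel)"
    by (rule integral_mono[OF integrable_abs[OF cell_integrable[OF f_meas1 f_bound]] cell_integrable[of _ C]])
       (use f_bound C in \<open>auto simp: indicator_def\<close>)
  also have "\<dots> = C * T / 2 ^ lev i"
    by (subst integral_mult_left_zero, subst cell_measure) simp
  finally show ?thesis .
qed

lemma slope_avg_additive:
  "slope_avg i m k y = slope_avg i (Suc m) (2 * k) y + slope_avg i (Suc m) (Suc (2 * k)) y"
proof -
  have 1: "T * real k / 2 ^ m = T * real (2 * k) / 2 ^ Suc m" by simp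
  have 2: "T * real (Suc k) / 2 ^ m = T * real (Suc (Suc (2 * k))) / 2 ^ Suc m" by (simp add: field_simps)
  have le: "T * real (2 * k) / 2 ^ Suc m \<le> T * real (Suc (2 * k)) / 2 ^ Suc m"
     "T * real (Suc (2 * k)) / 2 ^ Suc m \<le> T * real (Suc (Suc (2 * k))) / 2 ^ Suc m"
    using T by (intro divide_right_mono mult_left_mono; simp)+
  have "indicator (dyadic_cell T m k) r = indicator (dyadic_cell T (Suc m) (2 * k)) r + (indicator (dyadic_cell T (Suc m) (Suc (2 * k))) r :: real)" for r
    unfolding dyadic_cell_def 1 2 using le by (auto simp: indicator_def simp del: of_nat_Suc of_nat_mult power_Suc)
  then show ?thesis
    unfolding slope_avg_def distrib_right
    by (simp only: distrib_right Bochner_Integration.integral_add[OF cell_integrable[OF f1_meas1 f1_bound] cell_integrable[OF f1_meas1 f1_bound]])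
qed

lemma euler_flow_of_level:
  assumes "2 * (K * \<theta> ^ lev i) \<le> 1 / 2"
  shows "euler_flow (lev i) (slope_avg i) (N i) K \<theta> (C * T) (vel_avg i)"
proof unfold_locales
  show "slope_avg i m k x = slope_avg i (Suc m) (2 * k) x + slope_avg i (Suc m) (Suc (2 * k)) x" for m k x
    by (rule slope_avg_additive)
  show "\<bar>slope_avg i m k x - slope_avg i m k y\<bar> \<le> N i m k * sqrt \<bar>x - y\<bar>" if "m \<le> lev i" "k < 2 ^ m" for m k x y
    unfolding slope_avg_def by (rule half_holder[OF that])
  show "\<bar>slope_avg i m k x\<bar> \<le> 2 * N i m k" if "m \<le> lev i" "k < 2 ^ m" for m k x
    unfolding slope_avg_def by (rule sup_bound[OF that])
qed (use N_nonneg energy K \<theta> C T vel_avg_deriv vel_avg_bound assms in auto)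

lemma eventually_fine: "\<exists>i0. \<forall>i\<ge>i0. 2 * (K * \<theta> ^ lev i) \<le> 1 / 2"
proof -
  have "(\<lambda>n. 2 * (K * \<theta> ^ n)) \<longlonglongrightarrow> 2 * (K * 0)"
    using \<theta> by (intro tendsto_intros LIMSEQ_realpow_zero) auto
  then have "eventually (\<lambda>n. 2 * (K * \<theta> ^ n) < 1 / 2) sequentially"
    by (rule order_tendstoD) simp
  then obtain n0 where "\<And>n. n \<ge> n0 \<Longrightarrow> 2 * (K * \<theta> ^ n) < 1 / 2" by (auto simp: eventually_sequentially)
  then show ?thesis using seq_suble[OF lev] by (meson less_imp_le order_trans)
qed

end

lemma continuous_bounded_on_ball:
  fixes g :: "real \<Rightarrow> real"
  assumes "continuous_on UNIV g" shows "\<exists>M\<ge>0. \<forall>x. \<bar>x\<bar> \<le> R \<longrightarrow> \<bar>g x\<bar> \<le> M"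
proof -
  have "bounded (g ` {-R..R})"
    by (intro compact_imp_bounded compact_continuous_image continuous_on_subset[OF assms]) auto
  then obtain M where M: "\<forall>z\<in>g ` {-R..R}. norm z \<le> M" unfolding bounded_iff by blast
  have "\<bar>g x\<bar> \<le> \<bar>M\<bar>" if "\<bar>x\<bar> \<le> R" for x
  proof -
    have "g x \<in> g ` {-R..R}" using that by (intro imageI) auto
    then have "\<bar>g x\<bar> \<le> M" using M by auto
    then show ?thesis by linarith
  qed
  then show ?thesis by (intro exI[of _ "\<bar>M\<bar>"]) simp
qed

lemma box_integrable:
  fixes g :: "real \<times> real \<Rightarrow> real"
  assumes "g \<in> borel_measurable (borel \<Otimes>\<^sub>M borel)" "\<And>p. \<bar>g p\<bar> \<le> Z * indicator ({a..b} \<times> {c..d}) p"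
  shows "integrable (lborel \<Otimes>\<^sub>M lborel) g"
proof (rule Bochner_Integration.integrable_bound)
  show "integrable (lborel \<Otimes>\<^sub>M lborel) (\<lambda>p. Z * indicator ({a..b} \<times> {c..d}) p :: real)"
    by (intro integrable_mult_right integrable_real_indicator)
       (auto simp: lborel.emeasure_pair_measure_Times ennreal_mult_less_top emeasure_lborel_Icc_eq)
  show "g \<in> borel_measurable (lborel \<Otimes>\<^sub>M lborel)"
  proof -
    have "sets (lborel \<Otimes>\<^sub>M lborel) = sets (borel \<Otimes>\<^sub>M borel :: (real \<times> real) measure)"
      by (intro sets_pair_measure_cong) simp_all
    then show ?thesis using assms(1) measurable_cong_sets[OF _ refl] by blast
  qed
  show "AE p in lborel \<Otimes>\<^sub>M lborel. norm (g p) \<le> norm (Z * indicator ({a..b} \<times> {c..d}) p :: real)"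
    using order_trans[OF assms(2) abs_ge_self] by (intro AE_I2) simp
qed

context transport_approximation
begin

text \<open>The approximate solution at the \<open>j\<close>-th grid time of the \<open>i\<close>-th scheme, transported along backward
  characteristics, and its spatial derivative. In between grid times \<open>V\<close> and \<open>W\<close> are kept constant.\<close>

definition grid_value :: "nat \<Rightarrow> nat \<Rightarrow> real \<Rightarrow> real" where
  "grid_value i j y = u0 (euler (vel_avg i) j y 0)"

definition grid_slope :: "nat \<Rightarrow> nat \<Rightarrow> real \<Rightarrow> real" where
  "grid_slope i j y = u0' (euler (vel_avg i) j y 0) * (\<Prod>l\<in>{0..<j}. 1 - slope_avg i (lev i) l (euler (vel_avg i) j y (Suc l)))"

definition grid_index :: "nat \<Rightarrow> real \<Rightarrow> nat" where
  "grid_index i t = nat \<lfloor>t * 2 ^ lev i / T\<rfloor>"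

definition V :: "nat \<Rightarrow> real \<Rightarrow> real \<Rightarrow> real" where "V i t = grid_value i (grid_index i t)"
definition W :: "nat \<Rightarrow> real \<Rightarrow> real \<Rightarrow> real" where "W i t = grid_slope i (grid_index i t)"

definition fine_grid :: "nat \<Rightarrow> bool" where "fine_grid i \<longleftrightarrow> 2 * (K * \<theta> ^ lev i) \<le> 1 / 2"

lemma euler_deriv:
  "k \<le> j \<Longrightarrow> ((\<lambda>y. euler (vel_avg i) j y k) has_real_derivative
     (\<Prod>l\<in>{k..<j}. 1 - slope_avg i (lev i) l (euler (vel_avg i) j y (Suc l)))) (at y)"
  by (rule euler_has_deriv[where g = "slope_avg i (lev i)", OF vel_avg_deriv])

lemma grid_value_deriv: "(grid_value i j has_real_derivative grid_slope i j y) (at y)"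
  unfolding grid_value_def[abs_def] grid_slope_def by (rule DERIV_chain2[OF u0 euler_deriv]) simp

lemma u0_continuous: "continuous_on UNIV u0"
  using u0 by (intro continuous_at_imp_continuous_on ballI DERIV_isCont)

lemma grid_index_le: "t \<le> T \<Longrightarrow> grid_index i t \<le> 2 ^ lev i"
proof -
  assume "t \<le> T"
  then have "t * 2 ^ lev i / T \<le> 2 ^ lev i" using T by (simp add: divide_le_eq mult_right_mono)
  then have "\<lfloor>t * 2 ^ lev i / T\<rfloor> \<le> \<lfloor>2 ^ lev i :: real\<rfloor>" by (rule floor_mono)
  also have "\<lfloor>2 ^ lev i :: real\<rfloor> = 2 ^ lev i"
    using floor_of_int[of "2 ^ lev i", where 'a = real] by simp
  finally show ?thesis unfolding grid_index_def by (simp add: nat_le_iff)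
qed

lemma grid_index_time: assumes "0 \<le> t" shows "T * real (grid_index i t) / 2 ^ lev i \<le> t" "t < T * real (Suc (grid_index i t)) / 2 ^ lev i"
proof -
  let ?x = "t * 2 ^ lev i / T"
  have "real (grid_index i t) = of_int \<lfloor>?x\<rfloor>" using assms T unfolding grid_index_def by simp
  then have "real (grid_index i t) \<le> ?x" "?x < real (Suc (grid_index i t))" by linarith+
  then show "T * real (grid_index i t) / 2 ^ lev i \<le> t" "t < T * real (Suc (grid_index i t)) / 2 ^ lev i"
    using T by (simp_all add: field_simps)
qed

lemma grid_index_cell: "r \<in> dyadic_cell T (lev i) k \<Longrightarrow> grid_index i r = k"
proof -
  assume "r \<in> dyadic_cell T (lev i) k"
  then have "real k \<le> r * 2 ^ lev i / T" "r * 2 ^ lev i / T < real k + 1"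
    using T by (auto simp: dyadic_cell_def field_simps)
  then have "\<lfloor>r * 2 ^ lev i / T\<rfloor> = int k" by (intro floor_unique) auto
  then show ?thesis by (simp add: grid_index_def)
qed

lemma slope_avg_measurable: "slope_avg i m k \<in> borel_measurable borel"
  unfolding slope_avg_def[abs_def] by measurable

lemma euler_measurable: "(\<lambda>y. euler (vel_avg i) j y k) \<in> borel_measurable borel"
proof (cases "k \<le> j")
  case True
  then show ?thesis
    by (intro borel_measurable_continuous_onI continuous_at_imp_continuous_on ballI DERIV_isCont[OF euler_deriv])
qed (simp add: euler_stopped)

lemma grid_slope_measurable: "grid_slope i j \<in> borel_measurable borel"
proof -
  note slope_avg_measurable [measurable] euler_measurable [measurable]
  have [measurable]: "u0' \<in> borel_measurable borel" by (rule borel_measurable_continuous_onI[OF u0'])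
  show ?thesis unfolding grid_slope_def[abs_def] by measurable
qed

lemma W_measurable: "case_prod (W i) \<in> borel_measurable (borel \<Otimes>\<^sub>M borel)"
  unfolding split_beta' W_def
proof (rule measurable_compose_countable)
  show "(\<lambda>p. grid_index i (fst p)) \<in> borel \<Otimes>\<^sub>M borel \<rightarrow>\<^sub>M count_space UNIV"
    unfolding grid_index_def by measurable
  show "(\<lambda>p. grid_slope i j (snd p)) \<in> borel_measurable (borel \<Otimes>\<^sub>M borel)" for j
    using measurable_compose[OF measurable_snd grid_slope_measurable] .
qed

lemma grid_value_bound:
  assumes i: "fine_grid i" and j: "j \<le> 2 ^ lev i" and M: "\<And>x. \<bar>x\<bar> \<le> R + C * T \<Longrightarrow> \<bar>u0 x\<bar> \<le> M" and y: "\<bar>y\<bar> \<le> R"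
  shows "\<bar>grid_value i j y\<bar> \<le> M"
proof -
  interpret F: euler_flow "lev i" "slope_avg i" "N i" K \<theta> "C * T" "vel_avg i"
    by (rule euler_flow_of_level[OF i[unfolded fine_grid_def]])
  show ?thesis unfolding grid_value_def by (rule M) (use F.euler_displacement[OF j, of y] y in linarith)
qed

lemma grid_slope_bound:
  assumes i: "fine_grid i" and j: "j \<le> 2 ^ lev i" and M: "\<And>x. \<bar>x\<bar> \<le> R + C * T \<Longrightarrow> \<bar>u0' x\<bar> \<le> M" and y: "\<bar>y\<bar> \<le> R"
  shows "\<bar>grid_slope i j y\<bar> \<le> M * exp (2 * path_sum_bound)"
proof -
  interpret F: euler_flow "lev i" "slope_avg i" "N i" K \<theta> "C * T" "vel_avg i"
    by (rule euler_flow_of_level[OF i[unfolded fine_grid_def]])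
  have e: "\<bar>euler (vel_avg i) j y 0\<bar> \<le> R + C * T" using F.euler_displacement[OF j, of y] y by linarith
  have "\<bar>F.slope 0 j y\<bar> \<le> exp (2 * path_sum_bound)"
    using F.slope_bound[OF le0 j, of y] unfolding F.sum_bound_def path_sum_bound_def by simp
  then show ?thesis
    unfolding grid_slope_def F.slope_def[symmetric] abs_mult using M[OF e] by (intro mult_mono) auto
qed

text \<open>The three terms of \<open>slope_log_modulus\<close> are made small in this order: first a coarse level \<open>m\<close>, then
  the distance of \<open>y\<close> and \<open>z\<close>, then the index \<open>i\<close>.\<close>

lemma grid_slope_equicontinuous:
  assumes e: "e > 0"
  shows "\<exists>d>0. \<exists>i1. \<forall>i\<ge>i1. \<forall>j\<le>2 ^ lev i. \<forall>y z. \<bar>y\<bar> \<le> R \<and> \<bar>z\<bar> \<le> R \<and> \<bar>y - z\<bar> < d \<longrightarrow> \<bar>grid_slope i j y - grid_slope i j z\<bar> < e"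
proof -
  define E where "E = exp (2 * path_sum_bound)"
  have E: "E > 0" by (simp add: E_def)
  obtain M where M: "0 \<le> M" "\<And>x. \<bar>x\<bar> \<le> R + C * T \<Longrightarrow> \<bar>u0' x\<bar> \<le> M"
    using continuous_bounded_on_ball[OF u0', of "R + C * T"] by blast
  have "uniformly_continuous_on {-(R + C * T)..R + C * T} u0'"
    by (intro compact_uniformly_continuous continuous_on_subset[OF u0']) auto
  then obtain d1 where d1: "d1 > 0" "\<And>x x'. \<bar>x\<bar> \<le> R + C * T \<Longrightarrow> \<bar>x'\<bar> \<le> R + C * T \<Longrightarrow> \<bar>x - x'\<bar> < d1 \<Longrightarrow> \<bar>u0' x - u0' x'\<bar> < e / (2 * E)"
    unfolding uniformly_continuous_on_def dist_real_def using e E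
    by (auto simp: abs_le_iff elim!: allE[of _ "e / (2 * E)"])
  have "isCont exp (0::real)" by simp
  then obtain q where q: "q > 0" "\<And>x::real. \<bar>x\<bar> < q \<Longrightarrow> \<bar>exp x - 1\<bar> < e / (2 * (M * E + 1))"
  proof -
    have "0 < e / (2 * (M * E + 1))" using e E M by (simp add: add_nonneg_pos)
    with \<open>isCont exp (0::real)\<close> obtain q where "q > 0" "\<forall>x::real. dist x 0 < q \<longrightarrow> dist (exp x) (exp 0) < e / (2 * (M * E + 1))"
      unfolding continuous_at_eps_delta by blast
    then show ?thesis using that[of q] by (simp add: dist_real_def)
  qed
  define c0 where "c0 = (sqrt (C * T) + 2) * K / (1 - \<theta>)"
  have "(\<lambda>m. 2 * c0 * \<theta> ^ m) \<longlonglongrightarrow> 2 * c0 * 0"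
    using \<theta> by (intro tendsto_intros LIMSEQ_realpow_zero) auto
  then have "eventually (\<lambda>m. 2 * c0 * \<theta> ^ m < q / 3) sequentially"
    by (rule order_tendstoD) (use q in simp)
  then obtain m where m: "2 * c0 * \<theta> ^ m < q / 3" by (auto simp: eventually_sequentially)
  have "((\<lambda>d. 2 ^ m * K * sqrt (E * d)) \<longlongrightarrow> 2 ^ m * K * sqrt (E * 0)) (at_right 0)"
    by (intro tendsto_intros)
  then have "eventually (\<lambda>d. 2 ^ m * K * sqrt (E * d) < q / 3) (at_right 0)"
    by (rule order_tendstoD) (use q in simp)
  then obtain d2 where d2: "d2 > 0" "\<And>d. 0 < d \<Longrightarrow> d < d2 \<Longrightarrow> 2 ^ m * K * sqrt (E * d) < q / 3"
    unfolding eventually_at_right_field by blast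
  have "(\<lambda>n. 16 * (K * \<theta> ^ n)\<^sup>2) \<longlonglongrightarrow> 16 * (K * 0)\<^sup>2"
    using \<theta> by (intro tendsto_intros LIMSEQ_realpow_zero) auto
  then have "eventually (\<lambda>n. 16 * (K * \<theta> ^ n)\<^sup>2 < q / 3) sequentially"
    by (rule order_tendstoD) (use q in simp)
  then obtain n1 where n1: "\<And>n. n \<ge> n1 \<Longrightarrow> 16 * (K * \<theta> ^ n)\<^sup>2 < q / 3"
    unfolding eventually_sequentially by blast
  obtain i0 where i0: "\<And>i. i \<ge> i0 \<Longrightarrow> fine_grid i" using eventually_fine unfolding fine_grid_def by blast
  define d where "d = min (d1 / E) (d2 / 2)"
  have d: "d > 0" using d1 d2 E by (simp add: d_def)
  have main: "\<bar>grid_slope i j y - grid_slope i j z\<bar> < e"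
    if i: "i \<ge> max i0 (max m n1)" and j: "j \<le> 2 ^ lev i" and y: "\<bar>y\<bar> \<le> R" and z: "\<bar>z\<bar> \<le> R" and yz: "\<bar>y - z\<bar> < d" for i j y z
  proof -
    have li: "lev i \<ge> m" "lev i \<ge> n1" using seq_suble[OF lev, of i] i by linarith+
    interpret F: euler_flow "lev i" "slope_avg i" "N i" K \<theta> "C * T" "vel_avg i"
      by (rule euler_flow_of_level[OF i0[unfolded fine_grid_def]]) (use i in simp)
    have path_sum_bound: "F.sum_bound = path_sum_bound" unfolding F.sum_bound_def path_sum_bound_def ..
    let ?Y = "euler (vel_avg i) j y 0" and ?Z = "euler (vel_avg i) j z 0"
    have Y: "\<bar>?Y\<bar> \<le> R + C * T" and Z: "\<bar>?Z\<bar> \<le> R + C * T"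
      using F.euler_displacement[OF j, of y] F.euler_displacement[OF j, of z] y z by linarith+
    have "\<bar>?Y - ?Z\<bar> \<le> E * \<bar>y - z\<bar>" unfolding E_def path_sum_bound[symmetric] by (rule F.euler_lipschitz[OF j])
    also have "\<dots> < E * (d1 / E)" using yz E by (intro mult_strict_left_mono) (auto simp: d_def)
    finally have "\<bar>?Y - ?Z\<bar> < d1" using E by simp
    then have 1: "\<bar>u0' ?Y - u0' ?Z\<bar> < e / (2 * E)" by (rule d1(2)[OF Y Z])
    obtain \<eta> where \<eta>: "F.slope 0 j y = F.slope 0 j z * exp \<eta>"
      "\<bar>\<eta>\<bar> \<le> 2 * c0 * \<theta> ^ m + 2 ^ m * K * sqrt (E * \<bar>y - z\<bar>) + 16 * (K * \<theta> ^ lev i)\<^sup>2"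
      using F.slope_log_modulus[OF li(1) j, of y z] unfolding path_sum_bound E_def c0_def by blast
    have "2 ^ m * K * sqrt (E * \<bar>y - z\<bar>) < q / 3"
    proof (cases "y = z")
      case False
      then show ?thesis using yz d2(1) by (intro d2(2)) (auto simp: d_def)
    qed (use q in simp)
    then have "\<bar>\<eta>\<bar> < q" using \<eta>(2) m n1[OF li(2)] by linarith
    then have 2: "\<bar>exp \<eta> - 1\<bar> < e / (2 * (M * E + 1))" by (rule q(2))
    let ?Py = "F.slope 0 j y" and ?Pz = "F.slope 0 j z"
    have P: "\<bar>?Py\<bar> \<le> E" "\<bar>?Pz\<bar> \<le> E"
      using F.slope_bound[OF le0 j] unfolding path_sum_bound E_def by simp_all
    have eq: "grid_slope i j y - grid_slope i j z = (u0' ?Y - u0' ?Z) * ?Py + u0' ?Z * ?Pz * (exp \<eta> - 1)"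
      unfolding grid_slope_def F.slope_def[symmetric] \<eta>(1) by (simp add: algebra_simps)
    have "\<bar>(u0' ?Y - u0' ?Z) * ?Py\<bar> \<le> e / (2 * E) * E"
      unfolding abs_mult using 1 P e E by (intro mult_mono) auto
    moreover have "\<bar>u0' ?Z * ?Pz * (exp \<eta> - 1)\<bar> \<le> M * E * (e / (2 * (M * E + 1)))"
      unfolding abs_mult using 2 P M(2)[OF Z] M(1) E by (intro mult_mono) auto
    moreover have "M * E * (e / (2 * (M * E + 1))) < e / 2"
    proof -
      have "M * E / (M * E + 1) < 1" using M(1) E by (simp add: add_nonneg_pos)
      then have "M * E / (M * E + 1) * (e / 2) < 1 * (e / 2)" using e by (intro mult_strict_right_mono) auto
      then show ?thesis by (simp add: mult.commute)
    qed
    moreover have "e / (2 * E) * E = e / 2" using E by simp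
    ultimately show ?thesis unfolding eq by linarith
  qed
  then show ?thesis using d by blast
qed

definition drift_integral :: "nat \<Rightarrow> real \<Rightarrow> real \<Rightarrow> real" where
  "drift_integral i t y = (\<integral>r. indicator {0..<t} r * (f i r y * W i r y) \<partial>lborel)"

lemma W_meas1: "(\<lambda>r. W i r y) \<in> borel_measurable borel"
proof -
  note W_measurable [measurable]
  show ?thesis by measurable
qed

lemma fW_bound:
  assumes i: "fine_grid i" and M: "\<And>x. \<bar>x\<bar> \<le> R + C * T \<Longrightarrow> \<bar>u0' x\<bar> \<le> M" and y: "\<bar>y\<bar> \<le> R" and r: "r \<le> T"
  shows "\<bar>W i r y\<bar> \<le> M * exp (2 * path_sum_bound)" "\<bar>f i r y * W i r y\<bar> \<le> C * (M * exp (2 * path_sum_bound))"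
proof -
  show *: "\<bar>W i r y\<bar> \<le> M * exp (2 * path_sum_bound)"
    unfolding W_def by (rule grid_slope_bound[OF i grid_index_le[OF r] M y])
  show "\<bar>f i r y * W i r y\<bar> \<le> C * (M * exp (2 * path_sum_bound))"
    unfolding abs_mult by (rule mult_mono[OF f_bound *]) (use C in auto)
qed

lemma fW_integrable:
  assumes i: "fine_grid i" and M: "\<And>x. \<bar>x\<bar> \<le> R + C * T \<Longrightarrow> \<bar>u0' x\<bar> \<le> M" and y: "\<bar>y\<bar> \<le> R" and t: "t \<le> T"
  shows "integrable lborel (\<lambda>r. indicator {s..<t} r * (f i r y * W i r y))"
    and "s \<le> t \<Longrightarrow> \<bar>\<integral>r. indicator {s..<t} r * (f i r y * W i r y) \<partial>lborel\<bar> \<le> C * (M * exp (2 * path_sum_bound)) * (t - s)"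
proof -
  let ?Z = "C * (M * exp (2 * path_sum_bound))"
  note W_meas1 [measurable]
  have Z: "integrable lborel (\<lambda>r. ?Z * indicator {s..<t} r)"
    by (cases "s \<le> t") (auto intro!: integrable_mult_right)
  have le: "\<bar>indicator {s..<t} r * (f i r y * W i r y)\<bar> \<le> ?Z * indicator {s..<t} r" for r
    using fW_bound(2)[OF i M y, of r] t by (auto simp: indicator_def)
  show int: "integrable lborel (\<lambda>r. indicator {s..<t} r * (f i r y * W i r y))"
  proof (rule Bochner_Integration.integrable_bound[OF Z])
    show "AE r in lborel. norm (indicator {s..<t} r * (f i r y * W i r y)) \<le> norm (?Z * indicator {s..<t} r)"
      using order_trans[OF le abs_ge_self] by (intro AE_I2) (simp only: real_norm_def)
  qed measurable
  assume st: "s \<le> t"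
  have "\<bar>\<integral>r. indicator {s..<t} r * (f i r y * W i r y) \<partial>lborel\<bar> \<le> (\<integral>r. \<bar>indicator {s..<t} r * (f i r y * W i r y)\<bar> \<partial>lborel)"
    by (rule integral_abs_bound)
  also have "\<dots> \<le> (\<integral>r. ?Z * indicator {s..<t} r \<partial>lborel)"
    by (rule integral_mono[OF integrable_abs[OF int] Z le])
  also have "\<dots> = ?Z * (t - s)" using st by (subst integral_mult_right_zero) simp
  finally show "\<bar>\<integral>r. indicator {s..<t} r * (f i r y * W i r y) \<partial>lborel\<bar> \<le> ?Z * (t - s)" .
qed

lemma drift_integral_split:
  assumes i: "fine_grid i" and M: "\<And>x. \<bar>x\<bar> \<le> R + C * T \<Longrightarrow> \<bar>u0' x\<bar> \<le> M" and y: "\<bar>y\<bar> \<le> R"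
    and st: "0 \<le> s" "s \<le> t" "t \<le> T"
  shows "drift_integral i t y = drift_integral i s y + (\<integral>r. indicator {s..<t} r * (f i r y * W i r y) \<partial>lborel)"
proof -
  have sT: "s \<le> T" using st by simp
  have "drift_integral i t y = (\<integral>r. indicator {0..<s} r * (f i r y * W i r y) + indicator {s..<t} r * (f i r y * W i r y) \<partial>lborel)"
    unfolding drift_integral_def using st by (intro Bochner_Integration.integral_cong) (auto simp: indicator_def)
  also have "\<dots> = drift_integral i s y + (\<integral>r. indicator {s..<t} r * (f i r y * W i r y) \<partial>lborel)"
    unfolding drift_integral_def by (rule Bochner_Integration.integral_add[OF fW_integrable(1)[OF i M y sT] fW_integrable(1)[OF i M y st(3)]])
  finally show ?thesis .
qed

lemma drift_integral_grid_step:
  assumes i: "fine_grid i" and M: "\<And>x. \<bar>x\<bar> \<le> R + C * T \<Longrightarrow> \<bar>u0' x\<bar> \<le> M" and y: "\<bar>y\<bar> \<le> R" and j: "Suc j \<le> 2 ^ lev i"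
  shows "drift_integral i (T * real (Suc j) / 2 ^ lev i) y = drift_integral i (T * real j / 2 ^ lev i) y + vel_avg i j y * grid_slope i j y"
proof -
  have "real (Suc j) \<le> 2 ^ lev i" using of_nat_mono[OF j, where 'a = real] by simp
  then have "T * real (Suc j) / 2 ^ lev i \<le> T" using T by (simp add: divide_le_eq)
  moreover have "T * real j / 2 ^ lev i \<le> T * real (Suc j) / 2 ^ lev i"
    using T by (intro divide_right_mono mult_left_mono) auto
  ultimately have "drift_integral i (T * real (Suc j) / 2 ^ lev i) y = drift_integral i (T * real j / 2 ^ lev i) y
     + (\<integral>r. indicator (dyadic_cell T (lev i) j) r * (f i r y * W i r y) \<partial>lborel)"
    unfolding dyadic_cell_def using T by (intro drift_integral_split[OF i M y]) auto
  also have "(\<integral>r. indicator (dyadic_cell T (lev i) j) r * (f i r y * W i r y) \<partial>lborel)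
     = (\<integral>r. indicator (dyadic_cell T (lev i) j) r * f i r y * grid_slope i j y \<partial>lborel)"
    by (rule Bochner_Integration.integral_cong[OF refl]) (auto simp: indicator_def W_def grid_index_cell)
  also have "\<dots> = vel_avg i j y * grid_slope i j y" unfolding vel_avg_def by (rule integral_mult_left_zero)
  finally show ?thesis .
qed

text \<open>In one Euler step the value changes by \<open>- vel_avg * grid_slope\<close> at an intermediate point, while
  the drift integral changes by \<open>vel_avg * grid_slope\<close> at \<open>y\<close> itself. By equicontinuity of the
  derivatives the difference is small compared with the step, so the errors of all steps add up
  to a small quantity.\<close>

lemma approximate_equation:
  assumes e: "e > 0"
  shows "\<exists>i1. \<forall>i\<ge>i1. fine_grid i \<and> (\<forall>t\<in>{0..T}. \<forall>y. \<bar>y\<bar> \<le> R \<longrightarrow> \<bar>V i t y - u0 y + drift_integral i t y\<bar> \<le> e)"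
proof -
  obtain M where M: "0 \<le> M" "\<And>x. \<bar>x\<bar> \<le> R + C * T \<Longrightarrow> \<bar>u0' x\<bar> \<le> M"
    using continuous_bounded_on_ball[OF u0', of "R + C * T"] by blast
  define e1 where "e1 = e / (2 * (C * T + 1))"
  have CT: "0 \<le> C * T" using C T by simp
  have e1: "e1 > 0" using e CT by (simp add: e1_def)
  obtain d i2 where d: "d > 0" "\<And>i j y z. i \<ge> i2 \<Longrightarrow> j \<le> 2 ^ lev i \<Longrightarrow> \<bar>y\<bar> \<le> R + C * T \<Longrightarrow> \<bar>z\<bar> \<le> R + C * T \<Longrightarrow> \<bar>y - z\<bar> < d \<Longrightarrow> \<bar>grid_slope i j y - grid_slope i j z\<bar> < e1"
    using grid_slope_equicontinuous[OF e1, of "R + C * T"] by blast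
  define Q where "Q = C * (M * exp (2 * path_sum_bound)) * T"
  have half: "(\<lambda>n. (1/2::real) ^ n) \<longlonglongrightarrow> 0" by (rule LIMSEQ_realpow_zero) auto
  have "(\<lambda>n. Q * (1/2) ^ n) \<longlonglongrightarrow> Q * 0" by (intro tendsto_intros half)
  then have "eventually (\<lambda>n. Q * (1/2) ^ n < e / 2) sequentially"
    by (rule order_tendstoD(2)) (use e in simp)
  moreover have "(\<lambda>n. (C * T) * (1/2) ^ n) \<longlonglongrightarrow> (C * T) * 0" by (intro tendsto_intros half)
  then have "eventually (\<lambda>n. (C * T) * (1/2) ^ n < d) sequentially"
    by (rule order_tendstoD(2)) (use d in simp)
  ultimately have "eventually (\<lambda>n. Q * (1/2) ^ n < e / 2 \<and> (C * T) * (1/2) ^ n < d) sequentially"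
    by (rule eventually_conj)
  then obtain n1 where n1: "\<And>n. n \<ge> n1 \<Longrightarrow> Q * (1/2) ^ n < e / 2 \<and> (C * T) * (1/2) ^ n < d"
    unfolding eventually_sequentially by blast
  obtain i0 where i0: "\<And>i. i \<ge> i0 \<Longrightarrow> fine_grid i" using eventually_fine unfolding fine_grid_def by blast
  have "\<bar>V i t y - u0 y + drift_integral i t y\<bar> \<le> e" if i: "i \<ge> max i0 (max i2 n1)" and t: "t \<in> {0..T}" and y: "\<bar>y\<bar> \<le> R" for i t y
  proof -
    have fi: "fine_grid i" using i0 i by simp
    have li: "lev i \<ge> n1" using seq_suble[OF lev, of i] i by linarith
    have small: "Q / 2 ^ lev i < e / 2" "C * T / 2 ^ lev i < d" using n1[OF li] by (simp_all add: power_one_over)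
    have "C * T * 1 \<le> C * T * 2 ^ lev i" using CT by (intro mult_left_mono) auto
    then have aL: "C * T / 2 ^ lev i \<le> C * T" using CT by (simp add: divide_le_eq)
    have grid: "\<bar>grid_value i j y - u0 y + drift_integral i (T * real j / 2 ^ lev i) y\<bar> \<le> real j * (C * T / 2 ^ lev i * e1)" if "j \<le> 2 ^ lev i" for j
      using that
    proof (induction j)
      case 0
      then show ?case by (simp add: grid_value_def drift_integral_def)
    next
      case (Suc j)
      then have j: "j \<le> 2 ^ lev i" by simp
      let ?a = "vel_avg i j y"
      have a: "\<bar>?a\<bar> \<le> C * T / 2 ^ lev i" by (rule vel_avg_bound)
      have VS: "grid_value i (Suc j) y = grid_value i j (y - ?a)" unfolding grid_value_def by simp
      have "\<exists>z. \<bar>z - y\<bar> \<le> \<bar>?a\<bar> \<and> grid_value i j (y - ?a) - grid_value i j y = - ?a * grid_slope i j z"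
      proof (cases "?a = 0")
        case False
        then consider "?a > 0" | "?a < 0" by linarith
        then show ?thesis
        proof cases
          case 1
          then obtain z where "y - ?a < z" "z < y" "grid_value i j y - grid_value i j (y - ?a) = (y - (y - ?a)) * grid_slope i j z"
            using MVT2[of "y - ?a" y "grid_value i j" "grid_slope i j"] grid_value_deriv by auto
          then show ?thesis by (intro exI[of _ z]) auto
        next
          case 2
          then obtain z where "y < z" "z < y - ?a" "grid_value i j (y - ?a) - grid_value i j y = (y - ?a - y) * grid_slope i j z"
            using MVT2[of y "y - ?a" "grid_value i j" "grid_slope i j"] grid_value_deriv by auto
          then show ?thesis by (intro exI[of _ z]) auto
        qed
      qed (intro exI[of _ y], simp)
      then obtain z where z: "\<bar>z - y\<bar> \<le> \<bar>?a\<bar>" "grid_value i j (y - ?a) - grid_value i j y = - ?a * grid_slope i j z" by blast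
      have "\<bar>grid_slope i j z - grid_slope i j y\<bar> < e1"
      proof (rule d(2)[OF _ j])
        show "i \<ge> i2" using i by simp
        show "\<bar>z\<bar> \<le> R + C * T" "\<bar>y\<bar> \<le> R + C * T" "\<bar>z - y\<bar> < d" using z(1) a aL small y CT by linarith+
      qed
      then have "\<bar>?a\<bar> * \<bar>grid_slope i j z - grid_slope i j y\<bar> \<le> C * T / 2 ^ lev i * e1"
        using a CT by (intro mult_mono) auto
      then have step: "\<bar>?a * (grid_slope i j z - grid_slope i j y)\<bar> \<le> C * T / 2 ^ lev i * e1" by (simp only: abs_mult)
      have "grid_value i (Suc j) y - u0 y + drift_integral i (T * real (Suc j) / 2 ^ lev i) y
         = (grid_value i j y - u0 y + drift_integral i (T * real j / 2 ^ lev i) y) - ?a * (grid_slope i j z - grid_slope i j y)"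
      proof -
        have "?a * (grid_slope i j z - grid_slope i j y) = ?a * grid_slope i j z - ?a * grid_slope i j y" by (rule right_diff_distrib)
        moreover have "grid_value i (Suc j) y - grid_value i j y = - (?a * grid_slope i j z)" unfolding VS using z(2) by simp
        ultimately show ?thesis using drift_integral_grid_step[OF fi M(2) y Suc.prems] by linarith
      qed
      then have "\<bar>grid_value i (Suc j) y - u0 y + drift_integral i (T * real (Suc j) / 2 ^ lev i) y\<bar>
         \<le> real j * (C * T / 2 ^ lev i * e1) + C * T / 2 ^ lev i * e1"
        using Suc.IH[OF j] step by linarith
      also have "\<dots> = real (Suc j) * (C * T / 2 ^ lev i * e1)" by (simp add: distrib_right add_divide_distrib)
      finally show ?case .
    qed
    let ?j = "grid_index i t" and ?s = "T * real (grid_index i t) / 2 ^ lev i"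
    have j: "?j \<le> 2 ^ lev i" using t by (intro grid_index_le) auto
    have "T * real (Suc ?j) / 2 ^ lev i = ?s + T / 2 ^ lev i"
      by (simp add: distrib_left add_divide_distrib)
    then have s: "0 \<le> ?s" "?s \<le> t" "t - ?s \<le> T / 2 ^ lev i"
      using grid_index_time[of t i] t T by auto
    have "\<bar>grid_value i ?j y - u0 y + drift_integral i ?s y\<bar> \<le> real ?j * (C * T / 2 ^ lev i * e1)" by (rule grid[OF j])
    also have "\<dots> \<le> 2 ^ lev i * (C * T / 2 ^ lev i * e1)"
      using of_nat_mono[OF j, where 'a = real] CT e1 by (intro mult_right_mono) auto
    also have "\<dots> = C * T * e1" by simp
    also have "\<dots> \<le> e / 2"
    proof -
      have "C * T / (C * T + 1) \<le> 1" using CT by (simp add: divide_le_eq_1)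
      then have "C * T / (C * T + 1) * (e / 2) \<le> 1 * (e / 2)" using e by (intro mult_right_mono) auto
      then show ?thesis by (simp add: e1_def mult.commute)
    qed
    finally have 1: "\<bar>grid_value i ?j y - u0 y + drift_integral i ?s y\<bar> \<le> e / 2" .
    have tT: "t \<le> T" using t by simp
    have "\<bar>\<integral>r. indicator {?s..<t} r * (f i r y * W i r y) \<partial>lborel\<bar> \<le> C * (M * exp (2 * path_sum_bound)) * (t - ?s)"
      by (rule fW_integrable(2)[OF fi M(2) y tT s(2)])
    also have "\<dots> \<le> C * (M * exp (2 * path_sum_bound)) * (T / 2 ^ lev i)"
      using s(3) C M(1) by (intro mult_left_mono) auto
    also have "\<dots> = Q / 2 ^ lev i" by (simp add: Q_def)
    finally have "\<bar>drift_integral i t y - drift_integral i ?s y\<bar> < e / 2"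
      using small drift_integral_split[OF fi M(2) y s(1,2) tT] by linarith
    with 1 show ?thesis unfolding V_def by linarith
  qed
  then show ?thesis using i0 by (intro exI[of _ "max i0 (max i2 n1)"]) auto
qed

end

lemma box_iterated_integral:
  fixes g :: "real \<Rightarrow> real \<Rightarrow> real"
  assumes "case_prod g \<in> borel_measurable (borel \<Otimes>\<^sub>M borel)" "\<And>r y. \<bar>g r y\<bar> \<le> Z * indicator ({a..b} \<times> {c..d}) (r, y)"
  shows "(\<integral>r. (\<integral>y. g r y \<partial>lborel) \<partial>lborel) = (\<integral>p. g (fst p) (snd p) \<partial>(lborel \<Otimes>\<^sub>M lborel))"
    and "(\<integral>y. (\<integral>r. g r y \<partial>lborel) \<partial>lborel) = (\<integral>p. g (fst p) (snd p) \<partial>(lborel \<Otimes>\<^sub>M lborel))"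
    and "integrable (lborel \<Otimes>\<^sub>M lborel) (\<lambda>p. g (fst p) (snd p))"
proof -
  have i: "integrable (lborel \<Otimes>\<^sub>M lborel) (case_prod g)"
    by (rule box_integrable[OF assms(1)]) (use assms(2) in auto)
  show "(\<integral>r. (\<integral>y. g r y \<partial>lborel) \<partial>lborel) = (\<integral>p. g (fst p) (snd p) \<partial>(lborel \<Otimes>\<^sub>M lborel))"
    using lborel_pair.integral_fst[OF i] by (simp only: split_beta')
  show "(\<integral>y. (\<integral>r. g r y \<partial>lborel) \<partial>lborel) = (\<integral>p. g (fst p) (snd p) \<partial>(lborel \<Otimes>\<^sub>M lborel))"
    using lborel_pair.integral_snd[OF i] by (simp only: split_beta')
  show "integrable (lborel \<Otimes>\<^sub>M lborel) (\<lambda>p. g (fst p) (snd p))" using i by (simp only: split_beta')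
qed

context transport_approximation
begin

lemma drift_integral_lipschitz:
  assumes i: "fine_grid i" and M: "0 \<le> M" "\<And>x. \<bar>x\<bar> \<le> R + C * T \<Longrightarrow> \<bar>u0' x\<bar> \<le> M" and y: "\<bar>y\<bar> \<le> R"
    and st: "s \<in> {0..T}" "t \<in> {0..T}"
  shows "\<bar>drift_integral i t y - drift_integral i s y\<bar> \<le> C * (M * exp (2 * path_sum_bound)) * \<bar>t - s\<bar>"
proof -
  have *: "\<bar>drift_integral i t y - drift_integral i s y\<bar> \<le> C * (M * exp (2 * path_sum_bound)) * (t - s)" if "0 \<le> s" "s \<le> t" "t \<le> T" for s t
    using drift_integral_split[OF i M(2) y that] fW_integrable(2)[OF i M(2) y that(3,2)] by simp
  show ?thesis
  proof (cases "s \<le> t")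
    case True
    then show ?thesis using *[of s t] st by simp
  next
    case False
    then show ?thesis using *[of t s] st by (simp add: abs_minus_commute)
  qed
qed

lemma V_equicontinuous:
  assumes t: "t \<in> {0..T}" and e: "e > 0"
  shows "\<exists>d>0. \<exists>i1. \<forall>i\<ge>i1. \<forall>s\<in>{0..T}. \<forall>z. \<bar>t - s\<bar> < d \<longrightarrow> \<bar>y - z\<bar> < d \<longrightarrow> \<bar>V i t y - V i s z\<bar> < e"
proof -
  define R where "R = \<bar>y\<bar> + 1"
  obtain M where M: "0 \<le> M" "\<And>x. \<bar>x\<bar> \<le> R + C * T \<Longrightarrow> \<bar>u0' x\<bar> \<le> M"
    using continuous_bounded_on_ball[OF u0', of "R + C * T"] by blast
  define A where "A = M * exp (2 * path_sum_bound)"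
  have A: "0 \<le> A" using M by (simp add: A_def)
  have "e / 4 > 0" using e by simp
  from approximate_equation[OF this, of R] obtain i1 where i1: "\<And>i. i \<ge> i1 \<Longrightarrow> fine_grid i"
    "\<And>i t y. i \<ge> i1 \<Longrightarrow> t \<in> {0..T} \<Longrightarrow> \<bar>y\<bar> \<le> R \<Longrightarrow> \<bar>V i t y - u0 y + drift_integral i t y\<bar> \<le> e / 4" by blast
  define d where "d = min 1 (e / (4 * (C * A + A + 1)))"
  have CA: "0 \<le> C * A" using C A by simp
  then have pos: "0 < C * A + A + 1" using A by linarith
  have d: "d > 0" using e pos by (simp add: d_def)
  have "\<bar>V i t y - V i s z\<bar> < e" if i: "i \<ge> i1" and s: "s \<in> {0..T}" and ts: "\<bar>t - s\<bar> < d" and yz: "\<bar>y - z\<bar> < d" for i s z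
  proof -
    have y: "\<bar>y\<bar> \<le> R" and z: "\<bar>z\<bar> \<le> R" using yz by (auto simp: R_def d_def)
    have "\<bar>drift_integral i t y - drift_integral i s y\<bar> \<le> C * A * \<bar>t - s\<bar>"
      unfolding A_def by (rule drift_integral_lipschitz[OF i1(1)[OF i] M y s t])
    also have "\<dots> \<le> C * A * d" using ts CA by (intro mult_left_mono) auto
    finally have 1: "\<bar>V i t y - V i s y\<bar> \<le> e / 2 + C * A * d"
      using i1(2)[OF i t y] i1(2)[OF i s y] by linarith
    have sT: "s \<le> T" using s by simp
    have "norm (V i s y - V i s z) \<le> A * norm (y - z)"
    proof (rule field_differentiable_bound[of "{-R..R}" "V i s" "W i s"])
      show "(V i s has_field_derivative W i s x) (at x within {-R..R})" for x
        unfolding V_def W_def by (rule has_field_derivative_at_within[OF grid_value_deriv])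
      show "norm (W i s x) \<le> A" if "x \<in> {-R..R}" for x
        unfolding A_def real_norm_def by (rule fW_bound(1)[OF i1(1)[OF i] M(2) _ sT]) (use that in auto)
    qed (use y z in auto)
    also have "A * norm (y - z) \<le> A * d" using yz A by (intro mult_left_mono) auto
    finally have 2: "\<bar>V i s y - V i s z\<bar> \<le> A * d" by simp
    have "(C * A + A) * d \<le> (C * A + A + 1) * (e / (4 * (C * A + A + 1)))"
      using CA A d by (intro mult_mono) (auto simp: d_def)
    also have "\<dots> = e / 4"
    proof -
      have "X * (e / (4 * X)) = e / 4" if "X > 0" for X using that by simp
      then show ?thesis using pos by blast
    qed
    finally have "C * A * d + A * d \<le> e / 4" by (simp only: distrib_right)
    with 1 2 e show ?thesis by linarith
  qed
  then show ?thesis using d by blast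
qed

text \<open>In the product of drift and derivative the first factor converges only weakly but the second
  one pointwise and boundedly, on the bounded support of \<open>\<zeta>\<close>. So the derivative may be replaced by
  its limit (\<open>S2\<close>), after which the weak convergence of the drift applies (\<open>S1\<close>).\<close>

lemma limit_solution:
  "\<exists>v w. (\<forall>y. v 0 y = u0 y) \<and> (\<forall>t\<in>{0..T}. \<forall>y. (v t has_real_derivative w t y) (at y)) \<and>
     (\<forall>t. continuous_on UNIV (w t)) \<and> case_prod w \<in> borel_measurable (borel \<Otimes>\<^sub>M borel) \<and>
     (\<forall>R. \<exists>M\<ge>0. \<forall>t\<in>{0..T}. \<forall>y. \<bar>y\<bar> \<le> R \<longrightarrow> \<bar>v t y\<bar> \<le> M \<and> \<bar>w t y\<bar> \<le> M) \<and>
     (\<forall>t\<in>{0..T}. \<forall>\<zeta> R. continuous_on UNIV \<zeta> \<longrightarrow> (\<forall>y. R < \<bar>y\<bar> \<longrightarrow> \<zeta> y = 0) \<longrightarrow>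
        (\<integral>y. (v t y - u0 y) * \<zeta> y \<partial>lborel)
          = - (\<integral>r. indicator {0..<t} r * (\<integral>y. c r y * w r y * \<zeta> y \<partial>lborel) \<partial>lborel))"
proof -
  obtain i0 where i0: "\<And>i. i \<ge> i0 \<Longrightarrow> fine_grid i" using eventually_fine unfolding fine_grid_def by blast
  define F where "F n p = V (n + i0) (fst p) (snd p)" for n and p :: "real \<times> real"
  have "\<exists>r l. strict_mono (r :: nat \<Rightarrow> nat) \<and> (\<forall>x\<in>{0..T} \<times> UNIV. (\<lambda>n. F (r n) x) \<longlonglongrightarrow> l x)"
  proof (rule pointwise_convergent_subsequence)
    fix p assume p: "p \<in> {0..T} \<times> (UNIV :: real set)"
    then obtain t y where ty: "p = (t, y)" "t \<in> {0..T}" by auto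
    obtain M where M: "\<And>x. \<bar>x\<bar> \<le> \<bar>y\<bar> + C * T \<Longrightarrow> \<bar>u0 x\<bar> \<le> M"
      using continuous_bounded_on_ball[OF u0_continuous, of "\<bar>y\<bar> + C * T"] by blast
    have "\<bar>F n p\<bar> \<le> M" for n
      unfolding F_def V_def ty(1) fst_conv snd_conv
      by (rule grid_value_bound[OF i0 grid_index_le M order_refl]) (use ty in auto)
    then show "\<exists>M. \<forall>n. \<bar>F n p\<bar> \<le> M" by blast
    fix e :: real assume e: "e > 0"
    obtain d i1 where d: "d > 0" "\<And>i s z. i \<ge> i1 \<Longrightarrow> s \<in> {0..T} \<Longrightarrow> \<bar>t - s\<bar> < d \<Longrightarrow> \<bar>y - z\<bar> < d \<Longrightarrow> \<bar>V i t y - V i s z\<bar> < e"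
      using V_equicontinuous[OF ty(2) e, of y] by blast
    have "\<bar>F n p - F n q\<bar> < e" if n: "n \<ge> i1" and q: "q \<in> {0..T} \<times> UNIV" and pq: "dist p q < d" for n q
    proof -
      obtain s z where sz: "q = (s, z)" "s \<in> {0..T}" using q by auto
      have "\<bar>t - s\<bar> < d" "\<bar>y - z\<bar> < d"
        using dist_fst_le[of p q] dist_snd_le[of p q] pq by (auto simp: ty(1) sz(1) dist_real_def)
      then show ?thesis unfolding F_def ty(1) sz(1) fst_conv snd_conv using n sz(2) by (intro d(2)) auto
    qed
    then show "\<exists>d>0. \<exists>n0. \<forall>n\<ge>n0. \<forall>q\<in>{0..T} \<times> UNIV. dist p q < d \<longrightarrow> \<bar>F n p - F n q\<bar> < e"
      using d(1) by blast
  qed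
  then obtain r l where r: "strict_mono (r :: nat \<Rightarrow> nat)" "\<And>x. x \<in> {0..T} \<times> UNIV \<Longrightarrow> (\<lambda>n. F (r n) x) \<longlonglongrightarrow> l x" by blast
  define \<rho> where "\<rho> n = r n + i0" for n
  define v where "v t y = l (t, y)" for t y
  have \<rho>: "n \<le> \<rho> n" "fine_grid (\<rho> n)" for n
    using seq_suble[OF r(1), of n] i0[of "\<rho> n"] by (auto simp: \<rho>_def)
  have \<rho>_mono: "strict_mono \<rho>" using r(1) by (simp add: \<rho>_def strict_mono_def)
  have V_lim: "(\<lambda>n. V (\<rho> n) t y) \<longlonglongrightarrow> v t y" if "t \<in> {0..T}" for t y
    using r(2)[of "(t, y)"] that by (simp add: F_def \<rho>_def v_def)
  have "\<forall>t\<in>{0..T}. \<exists>w. (\<forall>y. (\<lambda>n. W (\<rho> n) t y) \<longlonglongrightarrow> w y) \<and> (\<forall>y. (v t has_real_derivative w y) (at y)) \<and> continuous_on UNIV w"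
  proof
    fix t assume t: "t \<in> {0..T}"
    show "\<exists>w. (\<forall>y. (\<lambda>n. W (\<rho> n) t y) \<longlonglongrightarrow> w y) \<and> (\<forall>y. (v t has_real_derivative w y) (at y)) \<and> continuous_on UNIV w"
    proof (rule derivatives_converge_if_equicontinuous[where V = "\<lambda>n. V (\<rho> n) t" and ?i0.0 = 0])
      show "(V (\<rho> n) t has_real_derivative W (\<rho> n) t y) (at y)" for n y
        unfolding V_def W_def by (rule grid_value_deriv)
      show "(\<lambda>n. V (\<rho> n) t y) \<longlonglongrightarrow> v t y" for y by (rule V_lim[OF t])
      fix y e :: real assume e: "e > 0"
      obtain d i1 where d: "d > 0" "\<And>i j y' z. i \<ge> i1 \<Longrightarrow> j \<le> 2 ^ lev i \<Longrightarrow> \<bar>y'\<bar> \<le> \<bar>y\<bar> + 1 \<Longrightarrow> \<bar>z\<bar> \<le> \<bar>y\<bar> + 1 \<Longrightarrow> \<bar>y' - z\<bar> < d \<Longrightarrow> \<bar>grid_slope i j y' - grid_slope i j z\<bar> < e"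
        using grid_slope_equicontinuous[OF e, of "\<bar>y\<bar> + 1"] by blast
      have "\<bar>W (\<rho> n) t z - W (\<rho> n) t y\<bar> < e" if "n \<ge> i1" "\<bar>z - y\<bar> < min d 1" for n z
        unfolding W_def using t that \<rho>(1)[of n] by (intro d(2) grid_index_le) auto
      then show "\<exists>d>0. \<exists>i1. \<forall>n\<ge>i1. \<forall>z. \<bar>z - y\<bar> < d \<longrightarrow> \<bar>W (\<rho> n) t z - W (\<rho> n) t y\<bar> < e"
        using d(1) by (intro exI[of _ "min d 1"]) auto
    qed
  qed
  from bchoice[OF this] obtain wt where wt:
    "\<And>t y. t \<in> {0..T} \<Longrightarrow> (\<lambda>n. W (\<rho> n) t y) \<longlonglongrightarrow> wt t y"
    "\<And>t y. t \<in> {0..T} \<Longrightarrow> (v t has_real_derivative wt t y) (at y)"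
    "\<And>t. t \<in> {0..T} \<Longrightarrow> continuous_on UNIV (wt t)" by blast
  \<comment> \<open>Outside \<open>[0, T]\<close> nothing is known about \<open>wt\<close>; the value \<open>0\<close> there keeps \<open>w\<close> measurable and continuous.\<close>
  define w where "w t y = (if t \<in> {0..T} then wt t y else 0)" for t y
  have w_lim: "(\<lambda>n. W (\<rho> n) t y) \<longlonglongrightarrow> w t y" if "t \<in> {0..T}" for t y
    using wt(1)[OF that] that by (simp add: w_def)
  have w_meas [measurable]: "case_prod w \<in> borel_measurable (borel \<Otimes>\<^sub>M borel)"
  proof (rule borel_measurable_LIMSEQ_real[where u = "\<lambda>n p. indicator {0..T} (fst p) * W (\<rho> n) (fst p) (snd p)"])
    show "(\<lambda>n. indicator {0..T} (fst p) * W (\<rho> n) (fst p) (snd p)) \<longlonglongrightarrow> case_prod w p" for p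
      using w_lim[of "fst p" "snd p"] by (cases "fst p \<in> {0..T}") (auto simp: split_beta' w_def indicator_def)
    show "(\<lambda>p. indicator {0..T} (fst p) * W (\<rho> n) (fst p) (snd p)) \<in> borel_measurable (borel \<Otimes>\<^sub>M borel)" for n
      using W_measurable[of "\<rho> n"] by (auto simp: split_beta' intro!: borel_measurable_times)
  qed
  have w_cont: "continuous_on UNIV (w t)" for t
  proof (cases "t \<in> {0..T}")
    case True
    then have "w t = wt t" by (simp add: w_def fun_eq_iff)
    then show ?thesis using wt(3)[OF True] by simp
  next
    case False
    then have "w t = (\<lambda>_. 0)" by (auto simp: w_def)
    then show ?thesis by simp
  qed
  have v_deriv: "(v t has_real_derivative w t y) (at y)" if "t \<in> {0..T}" for t y
    using wt(2)[OF that] that by (simp add: w_def)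
  have bounds: "\<exists>M\<ge>0. (\<forall>t\<in>{0..T}. \<forall>y. \<bar>y\<bar> \<le> R \<longrightarrow> \<bar>v t y\<bar> \<le> M \<and> \<bar>w t y\<bar> \<le> M) \<and>
     (\<forall>n. \<forall>t\<in>{0..T}. \<forall>y. \<bar>y\<bar> \<le> R \<longrightarrow> \<bar>V (\<rho> n) t y\<bar> \<le> M \<and> \<bar>W (\<rho> n) t y\<bar> \<le> M)" for R
  proof -
    obtain M0 where M0: "0 \<le> M0" "\<And>x. \<bar>x\<bar> \<le> R + C * T \<Longrightarrow> \<bar>u0 x\<bar> \<le> M0"
      using continuous_bounded_on_ball[OF u0_continuous, of "R + C * T"] by blast
    obtain M1 where M1: "0 \<le> M1" "\<And>x. \<bar>x\<bar> \<le> R + C * T \<Longrightarrow> \<bar>u0' x\<bar> \<le> M1"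
      using continuous_bounded_on_ball[OF u0', of "R + C * T"] by blast
    define M where "M = max M0 (M1 * exp (2 * path_sum_bound))"
    have VW: "\<bar>V (\<rho> n) t y\<bar> \<le> M" "\<bar>W (\<rho> n) t y\<bar> \<le> M" if "t \<in> {0..T}" "\<bar>y\<bar> \<le> R" for n t y
    proof -
      have tT: "t \<le> T" using that by simp
      show "\<bar>V (\<rho> n) t y\<bar> \<le> M"
        using grid_value_bound[OF \<rho>(2) grid_index_le[OF tT] M0(2) that(2), of n] unfolding V_def M_def by simp
      show "\<bar>W (\<rho> n) t y\<bar> \<le> M"
        using fW_bound(1)[OF \<rho>(2) M1(2) that(2) tT, of n] unfolding M_def by simp
    qed
    have "\<bar>v t y\<bar> \<le> M" "\<bar>w t y\<bar> \<le> M" if "t \<in> {0..T}" "\<bar>y\<bar> \<le> R" for t y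
      using VW[OF that] by (auto intro!: LIMSEQ_le_const2[OF tendsto_rabs[OF V_lim[OF that(1)]]] LIMSEQ_le_const2[OF tendsto_rabs[OF w_lim[OF that(1)]]])
    moreover have "0 \<le> M" using M0 by (simp add: M_def)
    ultimately show ?thesis using VW by blast
  qed
  have v0: "v 0 y = u0 y" for y
  proof (rule LIMSEQ_unique[OF V_lim])
    show "0 \<in> {0..T}" using T by simp
    show "(\<lambda>n. V (\<rho> n) 0 y) \<longlonglongrightarrow> u0 y" by (simp add: V_def grid_index_def grid_value_def)
  qed
  have weak: "(\<integral>y. (v t y - u0 y) * \<zeta> y \<partial>lborel)
          = - (\<integral>r. indicator {0..<t} r * (\<integral>y. c r y * w r y * \<zeta> y \<partial>lborel) \<partial>lborel)"
    if t: "t \<in> {0..T}" and \<zeta>: "continuous_on UNIV \<zeta>" and supp: "\<And>y. R < \<bar>y\<bar> \<Longrightarrow> \<zeta> y = 0" for t \<zeta> R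
  proof -
    obtain Z where Z: "0 \<le> Z" "\<And>y. \<bar>y\<bar> \<le> R \<Longrightarrow> \<bar>\<zeta> y\<bar> \<le> Z"
      using continuous_bounded_on_ball[OF \<zeta>, of R] by blast
    have \<zeta>Z: "\<bar>\<zeta> y\<bar> \<le> Z * indicator {-R..R} y" for y
      using Z supp[of y] by (cases "\<bar>y\<bar> \<le> R") (auto simp: indicator_def)
    obtain M where M: "0 \<le> M" "\<And>t y. t \<in> {0..T} \<Longrightarrow> \<bar>y\<bar> \<le> R \<Longrightarrow> \<bar>v t y\<bar> \<le> M \<and> \<bar>w t y\<bar> \<le> M"
       "\<And>n t y. t \<in> {0..T} \<Longrightarrow> \<bar>y\<bar> \<le> R \<Longrightarrow> \<bar>V (\<rho> n) t y\<bar> \<le> M \<and> \<bar>W (\<rho> n) t y\<bar> \<le> M"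
      using bounds[of R] by blast
    have [measurable]: "\<zeta> \<in> borel_measurable borel" by (rule borel_measurable_continuous_onI[OF \<zeta>])
    define \<phi> where "\<phi> r y = indicator {0..<t} r * w r y * \<zeta> y" for r y
    define \<psi> where "\<psi> n r y = indicator {0..<t} r * W (\<rho> n) r y * \<zeta> y" for n r y
    have \<phi>_meas [measurable]: "case_prod \<phi> \<in> borel_measurable (borel \<Otimes>\<^sub>M borel)" unfolding \<phi>_def by measurable
    have \<psi>_meas [measurable]: "case_prod (\<psi> n) \<in> borel_measurable (borel \<Otimes>\<^sub>M borel)" for n
    proof -
      note W_measurable [measurable]
      show ?thesis unfolding \<psi>_def by measurable
    qed
    have prod_bound: "\<bar>indicator {0..<t} r * g * \<zeta> y\<bar> \<le> M * Z * indicator ({0..T} \<times> {-R..R}) (r, y)"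
      if "r \<in> {0..T} \<Longrightarrow> \<bar>y\<bar> \<le> R \<Longrightarrow> \<bar>g\<bar> \<le> M" for g r y
    proof (cases "r \<in> {0..<t} \<and> \<bar>y\<bar> \<le> R")
      case True
      then have "\<bar>g\<bar> \<le> M" "\<bar>\<zeta> y\<bar> \<le> Z" using that t Z by auto
      then have "\<bar>g * \<zeta> y\<bar> \<le> M * Z" unfolding abs_mult using M(1) by (intro mult_mono) auto
      then show ?thesis using True t by (auto simp: indicator_def)
    next
      case False
      then show ?thesis using supp[of y] M(1) Z(1) by (auto simp: indicator_def)
    qed
    have \<phi>_bound: "\<bar>\<phi> r y\<bar> \<le> M * Z * indicator ({0..T} \<times> {-R..R}) (r, y)" for r y
      unfolding \<phi>_def by (rule prod_bound) (use M(2) in auto)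
    have \<psi>_bound: "\<bar>\<psi> n r y\<bar> \<le> M * Z * indicator ({0..T} \<times> {-R..R}) (r, y)" for n r y
      unfolding \<psi>_def by (rule prod_bound) (use M(3) in auto)
    have mult_bound: "\<bar>x * a\<bar> \<le> C * (M * Z) * indicator ({0..T} \<times> {-R..R}) (r, y)"
      if "\<bar>x\<bar> \<le> C" "\<bar>a\<bar> \<le> M * Z * indicator ({0..T} \<times> {-R..R}) (r, y)" for x a r y
      using mult_mono[OF that C abs_ge_zero] unfolding abs_mult by (simp only: mult.assoc)
    have f\<psi>: "case_prod (\<lambda>r y. f (\<rho> n) r y * \<psi> n r y) \<in> borel_measurable (borel \<Otimes>\<^sub>M borel)"
       and f\<phi>: "case_prod (\<lambda>r y. f (\<rho> n) r y * \<phi> r y) \<in> borel_measurable (borel \<Otimes>\<^sub>M borel)" for n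
      by measurable
    note f\<psi>' = box_iterated_integral[OF f\<psi> mult_bound[OF f_bound \<psi>_bound]]
    note f\<phi>' = box_iterated_integral[OF f\<phi> mult_bound[OF f_bound \<phi>_bound]]
    have S1: "(\<lambda>n. \<integral>r. (\<integral>y. f (\<rho> n) r y * \<phi> r y \<partial>lborel) \<partial>lborel) \<longlonglongrightarrow> (\<integral>r. (\<integral>y. c r y * \<phi> r y \<partial>lborel) \<partial>lborel)"
    proof -
      have "continuous_on UNIV (\<phi> r)" for r
        unfolding \<phi>_def[abs_def] by (intro continuous_intros w_cont \<zeta>)
      from weak_limit[OF \<phi>_meas \<phi>_bound this]
      show ?thesis by (rule LIMSEQ_subseq_LIMSEQ[OF _ \<rho>_mono, unfolded o_def])
    qed
    let ?L = "lborel \<Otimes>\<^sub>M lborel :: (real \<times> real) measure"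
    have S2: "(\<lambda>n. \<integral>p. f (\<rho> n) (fst p) (snd p) * \<psi> n (fst p) (snd p) - f (\<rho> n) (fst p) (snd p) * \<phi> (fst p) (snd p) \<partial>?L) \<longlonglongrightarrow> (\<integral>p. 0 \<partial>?L)"
    proof (rule integral_dominated_convergence[where w = "\<lambda>p. 2 * (C * (M * Z)) * indicator ({0..T} \<times> {-R..R}) p"])
      show "integrable ?L (\<lambda>p. 2 * (C * (M * Z)) * indicator ({0..T} \<times> {-R..R}) p)"
        by (rule box_integrable[of _ "\<bar>2 * (C * (M * Z))\<bar>" 0 T "-R" R]) (auto simp: abs_mult indicator_def)
      show "(\<lambda>p. f (\<rho> n) (fst p) (snd p) * \<psi> n (fst p) (snd p) - f (\<rho> n) (fst p) (snd p) * \<phi> (fst p) (snd p)) \<in> borel_measurable ?L" for n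
        using f\<psi>'(3)[of n] f\<phi>'(3)[of n] by auto
      show "AE p in ?L. norm (f (\<rho> n) (fst p) (snd p) * \<psi> n (fst p) (snd p) - f (\<rho> n) (fst p) (snd p) * \<phi> (fst p) (snd p))
         \<le> 2 * (C * (M * Z)) * indicator ({0..T} \<times> {-R..R}) p" for n
      proof (rule AE_I2)
        fix p :: "real \<times> real"
        have "\<bar>f (\<rho> n) (fst p) (snd p) * \<psi> n (fst p) (snd p)\<bar> \<le> C * (M * Z) * indicator ({0..T} \<times> {-R..R}) p"
          "\<bar>f (\<rho> n) (fst p) (snd p) * \<phi> (fst p) (snd p)\<bar> \<le> C * (M * Z) * indicator ({0..T} \<times> {-R..R}) p"
          using mult_bound[OF f_bound \<psi>_bound, of "\<rho> n" "fst p" "snd p" n "fst p" "snd p"]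
            mult_bound[OF f_bound \<phi>_bound, of "\<rho> n" "fst p" "snd p" "fst p" "snd p"] by simp_all
        then show "norm (f (\<rho> n) (fst p) (snd p) * \<psi> n (fst p) (snd p) - f (\<rho> n) (fst p) (snd p) * \<phi> (fst p) (snd p))
         \<le> 2 * (C * (M * Z)) * indicator ({0..T} \<times> {-R..R}) p" by (simp only: real_norm_def mult.assoc)
      qed
      show "AE p in ?L. (\<lambda>n. f (\<rho> n) (fst p) (snd p) * \<psi> n (fst p) (snd p) - f (\<rho> n) (fst p) (snd p) * \<phi> (fst p) (snd p)) \<longlonglongrightarrow> 0"
      proof (rule AE_I2)
        fix p :: "real \<times> real"
        let ?r = "fst p" and ?y = "snd p"
        have "(\<lambda>n. \<psi> n ?r ?y) \<longlonglongrightarrow> \<phi> ?r ?y"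
        proof (cases "?r \<in> {0..<t}")
          case True
          then have "?r \<in> {0..T}" using t by auto
          then show ?thesis unfolding \<psi>_def \<phi>_def by (intro tendsto_intros w_lim)
        qed (simp add: \<psi>_def \<phi>_def)
        then have "(\<lambda>n. \<bar>\<psi> n ?r ?y - \<phi> ?r ?y\<bar>) \<longlonglongrightarrow> 0"
          by (simp add: tendsto_rabs_zero_iff LIM_zero_iff)
        from tendsto_mult_left[OF this, of C] have 0: "(\<lambda>n. C * \<bar>\<psi> n ?r ?y - \<phi> ?r ?y\<bar>) \<longlonglongrightarrow> 0" by simp
        show "(\<lambda>n. f (\<rho> n) ?r ?y * \<psi> n ?r ?y - f (\<rho> n) ?r ?y * \<phi> ?r ?y) \<longlonglongrightarrow> 0"
          by (rule Lim_null_comparison[OF _ 0])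
             (auto intro!: always_eventually mult_right_mono f_bound simp: abs_mult right_diff_distrib[symmetric])
      qed
    qed auto
    have S3: "(\<integral>p. f (\<rho> n) (fst p) (snd p) * \<psi> n (fst p) (snd p) \<partial>?L) = (\<integral>y. \<zeta> y * drift_integral (\<rho> n) t y \<partial>lborel)" for n
    proof -
      have e: "(\<integral>r. f (\<rho> n) r y * \<psi> n r y \<partial>lborel) = \<zeta> y * drift_integral (\<rho> n) t y" for y
      proof -
        have "(\<integral>r. f (\<rho> n) r y * \<psi> n r y \<partial>lborel) = (\<integral>r. \<zeta> y * (indicator {0..<t} r * (f (\<rho> n) r y * W (\<rho> n) r y)) \<partial>lborel)"
          unfolding \<psi>_def by (rule Bochner_Integration.integral_cong) (simp_all only: mult_ac)
        also have "\<dots> = \<zeta> y * drift_integral (\<rho> n) t y" unfolding drift_integral_def by (rule integral_mult_right_zero)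
        finally show ?thesis .
      qed
      show ?thesis using f\<psi>'(2)[of n] unfolding e by simp
    qed
    have Iint: "integrable lborel (\<lambda>y. \<zeta> y * drift_integral (\<rho> n) t y)" for n
    proof -
      have "integrable ?L (case_prod (\<lambda>r y. f (\<rho> n) r y * \<psi> n r y))" using f\<psi>'(3)[of n] by (simp only: split_beta')
      from lborel_pair.integrable_snd[OF this]
      have "integrable lborel (\<lambda>y. \<integral>r. f (\<rho> n) r y * \<psi> n r y \<partial>lborel)" .
      moreover have "(\<integral>r. f (\<rho> n) r y * \<psi> n r y \<partial>lborel) = \<zeta> y * drift_integral (\<rho> n) t y" for y
      proof -
        have "(\<integral>r. f (\<rho> n) r y * \<psi> n r y \<partial>lborel) = (\<integral>r. \<zeta> y * (indicator {0..<t} r * (f (\<rho> n) r y * W (\<rho> n) r y)) \<partial>lborel)"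
          unfolding \<psi>_def by (rule Bochner_Integration.integral_cong) (simp_all only: mult_ac)
        also have "\<dots> = \<zeta> y * drift_integral (\<rho> n) t y" unfolding drift_integral_def by (rule integral_mult_right_zero)
        finally show ?thesis .
      qed
      ultimately show ?thesis by simp
    qed
    have V_cont: "continuous_on UNIV (V (\<rho> n) t)" for n
      unfolding V_def by (intro continuous_at_imp_continuous_on ballI DERIV_isCont[OF grid_value_deriv])
    note V_bm = borel_measurable_continuous_onI[OF V_cont]
    have v_cont: "continuous_on UNIV (v t)"
      by (intro continuous_at_imp_continuous_on ballI DERIV_isCont[OF v_deriv[OF t]])
    have [measurable]: "V (\<rho> n) t \<in> borel_measurable borel" "v t \<in> borel_measurable borel" "u0 \<in> borel_measurable borel" for n
      using V_bm v_cont u0_continuous by (auto intro: borel_measurable_continuous_onI)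
    obtain M0 where M0: "0 \<le> M0" "\<And>y. \<bar>y\<bar> \<le> R \<Longrightarrow> \<bar>u0 y\<bar> \<le> M0"
      using continuous_bounded_on_ball[OF u0_continuous, of R] by blast
    have dom: "integrable lborel (\<lambda>y. (M + M0) * Z * indicator {-R..R} y)"
        by (intro integrable_mult_right integrable_real_indicator) (auto simp: emeasure_lborel_Icc_eq)
    have Vb: "\<bar>(V (\<rho> n) t y - u0 y) * \<zeta> y\<bar> \<le> (M + M0) * Z * indicator {-R..R} y" for n y
    proof (cases "\<bar>y\<bar> \<le> R")
      case True
      then have "\<bar>V (\<rho> n) t y - u0 y\<bar> \<le> M + M0" using M(3)[OF t True, of n] M0(2)[OF True] by linarith
      then have "\<bar>(V (\<rho> n) t y - u0 y) * \<zeta> y\<bar> \<le> (M + M0) * Z"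
        unfolding abs_mult using Z True M M0 by (intro mult_mono) auto
      then show ?thesis using True by (auto simp: indicator_def)
    qed (use supp[of y] M(1) M0(1) Z(1) in \<open>auto simp: indicator_def\<close>)
    have Vint: "integrable lborel (\<lambda>y. (V (\<rho> n) t y - u0 y) * \<zeta> y)" for n
      by (rule Bochner_Integration.integrable_bound[OF dom])
         (use order_trans[OF Vb abs_ge_self] in \<open>auto intro!: AE_I2 simp del: abs_mult\<close>)
    have S5: "(\<lambda>n. \<integral>y. (V (\<rho> n) t y - u0 y) * \<zeta> y \<partial>lborel) \<longlonglongrightarrow> (\<integral>y. (v t y - u0 y) * \<zeta> y \<partial>lborel)"
    proof (rule integral_dominated_convergence[OF _ _ dom])
      show "AE y in lborel. (\<lambda>n. (V (\<rho> n) t y - u0 y) * \<zeta> y) \<longlonglongrightarrow> (v t y - u0 y) * \<zeta> y"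
        by (intro AE_I2 tendsto_intros V_lim[OF t])
      show "AE y in lborel. norm ((V (\<rho> n) t y - u0 y) * \<zeta> y) \<le> (M + M0) * Z * indicator {-R..R} y" for n
        using Vb by simp
    qed measurable
    have S4: "(\<lambda>n. (\<integral>y. (V (\<rho> n) t y - u0 y) * \<zeta> y \<partial>lborel) + (\<integral>y. \<zeta> y * drift_integral (\<rho> n) t y \<partial>lborel)) \<longlonglongrightarrow> 0"
    proof (rule LIMSEQ_I)
      fix e :: real assume e: "e > 0"
      define Q where "Q = Z * (2 * \<bar>R\<bar>) + 1"
      have Q: "Q > 0" using Z by (simp add: Q_def add_nonneg_pos)
      have "e / (2 * Q) > 0" using e Q by simp
      from approximate_equation[OF this, of R] obtain i1 where
        i1: "\<And>i t y. i \<ge> i1 \<Longrightarrow> t \<in> {0..T} \<Longrightarrow> \<bar>y\<bar> \<le> R \<Longrightarrow> \<bar>V i t y - u0 y + drift_integral i t y\<bar> \<le> e / (2 * Q)" by blast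
      have "norm ((\<integral>y. (V (\<rho> n) t y - u0 y) * \<zeta> y \<partial>lborel) + (\<integral>y. \<zeta> y * drift_integral (\<rho> n) t y \<partial>lborel)) < e" if n: "n \<ge> i1" for n
      proof -
        let ?g = "\<lambda>y. (V (\<rho> n) t y - u0 y) * \<zeta> y + \<zeta> y * drift_integral (\<rho> n) t y"
        have gi: "integrable lborel ?g" by (rule Bochner_Integration.integrable_add[OF Vint Iint])
        have di: "integrable lborel (\<lambda>y. e / (2 * Q) * Z * indicator {-R..R} y)"
        by (intro integrable_mult_right integrable_real_indicator) (auto simp: emeasure_lborel_Icc_eq)
        have gb: "\<bar>?g y\<bar> \<le> e / (2 * Q) * Z * indicator {-R..R} y" for y
        proof (cases "\<bar>y\<bar> \<le> R")
          case True
          have "?g y = (V (\<rho> n) t y - u0 y + drift_integral (\<rho> n) t y) * \<zeta> y" by (simp add: algebra_simps)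
          moreover have "\<bar>(V (\<rho> n) t y - u0 y + drift_integral (\<rho> n) t y) * \<zeta> y\<bar> \<le> e / (2 * Q) * Z"
            unfolding abs_mult using i1[OF order_trans[OF n \<rho>(1)] t True] Z True e Q by (intro mult_mono) auto
          ultimately show ?thesis using True by (auto simp: indicator_def)
        qed (use supp[of y] in \<open>auto simp: indicator_def\<close>)
        have "\<bar>\<integral>y. ?g y \<partial>lborel\<bar> \<le> (\<integral>y. \<bar>?g y\<bar> \<partial>lborel)" by (rule integral_abs_bound)
        also have "\<dots> \<le> (\<integral>y. e / (2 * Q) * Z * indicator {-R..R} y \<partial>lborel)"
          by (rule integral_mono[OF integrable_abs[OF gi] di gb])
        also have "\<dots> \<le> e / (2 * Q) * Z * (2 * \<bar>R\<bar>)"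
        proof (subst integral_mult_right_zero, rule mult_left_mono)
          show "(\<integral>y. indicator {-R..R} y \<partial>lborel) \<le> 2 * \<bar>R\<bar>" by (cases "0 \<le> R") auto
        qed (use e Q Z in simp)
        also have "\<dots> = e / (2 * Q) * (Q - 1)" by (simp add: Q_def)
        also have "\<dots> < e / (2 * Q) * (2 * Q)" using e Q by (intro mult_strict_left_mono) auto
        also have "\<dots> = e" using Q by simp
        finally show ?thesis by (simp add: Bochner_Integration.integral_add[OF Vint Iint])
      qed
      then show "\<exists>no. \<forall>n\<ge>no. norm ((\<integral>y. (V (\<rho> n) t y - u0 y) * \<zeta> y \<partial>lborel) + (\<integral>y. \<zeta> y * drift_integral (\<rho> n) t y \<partial>lborel) - 0) < e"
        by auto
    qed
    have "(\<lambda>n. (\<integral>p. f (\<rho> n) (fst p) (snd p) * \<psi> n (fst p) (snd p) \<partial>?L) - (\<integral>p. f (\<rho> n) (fst p) (snd p) * \<phi> (fst p) (snd p) \<partial>?L)) \<longlonglongrightarrow> 0"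
      using S2 by (simp add: Bochner_Integration.integral_diff[OF f\<psi>'(3) f\<phi>'(3)])
    from tendsto_diff[OF S4 this]
    have "(\<lambda>n. (\<integral>y. (V (\<rho> n) t y - u0 y) * \<zeta> y \<partial>lborel) + (\<integral>r. (\<integral>y. f (\<rho> n) r y * \<phi> r y \<partial>lborel) \<partial>lborel)) \<longlonglongrightarrow> 0"
      by (simp add: S3 f\<phi>'(1))
    moreover have "(\<lambda>n. (\<integral>y. (V (\<rho> n) t y - u0 y) * \<zeta> y \<partial>lborel) + (\<integral>r. (\<integral>y. f (\<rho> n) r y * \<phi> r y \<partial>lborel) \<partial>lborel))
       \<longlonglongrightarrow> (\<integral>y. (v t y - u0 y) * \<zeta> y \<partial>lborel) + (\<integral>r. (\<integral>y. c r y * \<phi> r y \<partial>lborel) \<partial>lborel)"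
      by (rule tendsto_add[OF S5 S1])
    ultimately have "(\<integral>y. (v t y - u0 y) * \<zeta> y \<partial>lborel) + (\<integral>r. (\<integral>y. c r y * \<phi> r y \<partial>lborel) \<partial>lborel) = 0"
      by (rule LIMSEQ_unique[symmetric])
    moreover have "(\<integral>y. c r y * \<phi> r y \<partial>lborel) = indicator {0..<t} r * (\<integral>y. c r y * w r y * \<zeta> y \<partial>lborel)" for r
    proof -
      have "(\<integral>y. c r y * \<phi> r y \<partial>lborel) = (\<integral>y. indicator {0..<t} r * (c r y * w r y * \<zeta> y) \<partial>lborel)"
        unfolding \<phi>_def by (rule Bochner_Integration.integral_cong) (simp_all only: mult_ac)
      then show ?thesis by (simp only: integral_mult_right_zero)
    qed
    ultimately show ?thesis by simp
  qed
  have bounds': "\<exists>M\<ge>0. \<forall>t\<in>{0..T}. \<forall>y. \<bar>y\<bar> \<le> R \<longrightarrow> \<bar>v t y\<bar> \<le> M \<and> \<bar>w t y\<bar> \<le> M" for R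
    using bounds[of R] by blast
  show ?thesis
  proof (rule exI[of _ v], rule exI[of _ w], intro conjI allI ballI impI)
    fix t R and \<zeta> :: "real \<Rightarrow> real" assume "t \<in> {0..T}" "continuous_on UNIV \<zeta>" "\<forall>y. R < \<bar>y\<bar> \<longrightarrow> \<zeta> y = 0"
    then show "(\<integral>y. (v t y - u0 y) * \<zeta> y \<partial>lborel)
          = - (\<integral>r. indicator {0..<t} r * (\<integral>y. c r y * w r y * \<zeta> y \<partial>lborel) \<partial>lborel)"
      by (intro weak) auto
  qed (rule v0 v_deriv w_cont w_meas bounds'; assumption)+
qed

end

section \<open>Test functions and weak derivatives\<close>

text \<open>A derivative may only fail to vanish where \<open>\<eta>\<close> is not locally zero, hence inside the closed
  support of \<open>\<eta>\<close>.\<close>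

lemma test_function_derivatives:
  assumes "test_function U \<eta>"
  shows "((deriv ^^ n) \<eta> has_real_derivative (deriv ^^ Suc n) \<eta> x) (at x)"
    and "continuous_on UNIV ((deriv ^^ n) \<eta>)"
    and "x \<notin> closure {x. \<eta> x \<noteq> 0} \<Longrightarrow> (deriv ^^ n) \<eta> x = 0"
proof -
  have d: "((deriv ^^ n) \<eta> has_real_derivative (deriv ^^ Suc n) \<eta> x) (at x)" for n x
    using assms unfolding test_function_def by (simp add: DERIV_deriv_iff_real_differentiable)
  show "((deriv ^^ n) \<eta> has_real_derivative (deriv ^^ Suc n) \<eta> x) (at x)" by (rule d)
  show "continuous_on UNIV ((deriv ^^ n) \<eta>)"
    by (intro continuous_at_imp_continuous_on ballI DERIV_isCont[OF d])
  have "x \<notin> closure {x. \<eta> x \<noteq> 0} \<longrightarrow> (deriv ^^ n) \<eta> x = 0" for x n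
  proof (induction n arbitrary: x)
    case 0
    then show ?case using closure_subset[of "{x. \<eta> x \<noteq> 0}"] by auto
  next
    case (Suc n)
    show ?case
    proof
      assume x: "x \<notin> closure {x. \<eta> x \<noteq> 0}"
      have "((\<lambda>_. 0) has_real_derivative (deriv ^^ Suc n) \<eta> x) (at x)"
        by (rule has_field_derivative_transform_within_open[OF d[of n x], of "- closure {x. \<eta> x \<noteq> 0}"])
           (use x Suc in auto)
      then show "(deriv ^^ Suc n) \<eta> x = 0" using DERIV_unique[OF _ DERIV_const] by blast
    qed
  qed
  then show "x \<notin> closure {x. \<eta> x \<noteq> 0} \<Longrightarrow> (deriv ^^ n) \<eta> x = 0" by blast
qed

lemma test_function_support:
  assumes "test_function U \<eta>"
  obtains R where "R \<ge> 0" "\<And>n x. R < \<bar>x\<bar> \<Longrightarrow> (deriv ^^ n) \<eta> x = 0"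
proof -
  have "bounded (closure {x. \<eta> x \<noteq> 0})"
    using assms unfolding test_function_def by (simp add: compact_imp_bounded)
  then obtain a where a: "\<forall>x\<in>closure {x. \<eta> x \<noteq> 0}. norm x \<le> a" unfolding bounded_iff by blast
  have "(deriv ^^ n) \<eta> x = 0" if "\<bar>a\<bar> < \<bar>x\<bar>" for n x
    using a that by (intro test_function_derivatives(3)[OF assms]) force
  then show ?thesis by (intro that[of "\<bar>a\<bar>"]) auto
qed

lemma test_function_bounded:
  assumes "test_function U \<eta>"
  obtains Z where "Z \<ge> 0" "\<And>x. \<bar>(deriv ^^ n) \<eta> x\<bar> \<le> Z"
proof -
  obtain R where R: "R \<ge> 0" "\<And>n x. R < \<bar>x\<bar> \<Longrightarrow> (deriv ^^ n) \<eta> x = 0"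
    by (rule test_function_support[OF assms]) blast
  obtain Z where Z: "Z \<ge> 0" "\<And>x. \<bar>x\<bar> \<le> R \<Longrightarrow> \<bar>(deriv ^^ n) \<eta> x\<bar> \<le> Z"
    using continuous_bounded_on_ball[OF test_function_derivatives(2)[OF assms], of R n] by blast
  have "\<bar>(deriv ^^ n) \<eta> x\<bar> \<le> Z" for x
    using Z R(2)[of x n] by (cases "\<bar>x\<bar> \<le> R") auto
  with Z(1) that show ?thesis by blast
qed

lemma test_function_taylor:
  assumes "test_function U \<eta>" and Z: "\<And>x. \<bar>(deriv ^^ (k + q)) \<eta> x\<bar> \<le> Z"
  shows "\<bar>(deriv ^^ k) \<eta> (x + h) - (\<Sum>m<q. (deriv ^^ (k + m)) \<eta> x * (h ^ m / fact m))\<bar> \<le> Z * \<bar>h\<bar> ^ q"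
proof -
  define df where "df m h = (deriv ^^ (k + m)) \<eta> (x + h)" for m h
  have "DERIV (df m) h :> df (Suc m) h" for m h
    unfolding df_def using DERIV_shift[of "(deriv ^^ (k + m)) \<eta>" "(deriv ^^ (k + Suc m)) \<eta> (x + h)" h x]
      test_function_derivatives(1)[OF assms(1), of "k + m" "x + h"] by (simp add: add.commute)
  then obtain t where t: "df 0 h = (\<Sum>m<q. df m 0 / fact m * h ^ m) + df q t / fact q * h ^ q"
    using Maclaurin_all_le[of df "df 0" h q] by blast
  have "(\<Sum>m<q. df m 0 / fact m * h ^ m) = (\<Sum>m<q. (deriv ^^ (k + m)) \<eta> x * (h ^ m / fact m))"
    by (simp add: df_def)
  then have "(deriv ^^ k) \<eta> (x + h) - (\<Sum>m<q. (deriv ^^ (k + m)) \<eta> x * (h ^ m / fact m)) = df q t / fact q * h ^ q"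
    using t by (simp add: df_def)
  moreover have "\<bar>df q t / fact q * h ^ q\<bar> \<le> Z * \<bar>h\<bar> ^ q"
  proof -
    have "\<bar>df q t\<bar> \<le> Z" unfolding df_def by (rule Z)
    moreover have "\<bar>df q t\<bar> / fact q \<le> \<bar>df q t\<bar>"
      using divide_left_mono[of 1 "fact q" "\<bar>df q t\<bar>"] by (simp add: fact_ge_1)
    ultimately show ?thesis unfolding abs_mult abs_divide power_abs[symmetric] by (intro mult_right_mono) auto
  qed
  ultimately show ?thesis by simp
qed

lemma bounded_support_integrable:
  fixes g :: "real \<Rightarrow> real"
  assumes "g \<in> borel_measurable borel" "\<And>x. \<bar>x\<bar> \<le> R \<Longrightarrow> \<bar>g x\<bar> \<le> Q" "\<And>x. R < \<bar>x\<bar> \<Longrightarrow> g x = 0" "0 \<le> R" "0 \<le> Q"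
  shows "integrable lborel g" "\<bar>\<integral>x. g x \<partial>lborel\<bar> \<le> Q * (2 * R)"
proof -
  have le: "\<bar>g x\<bar> \<le> Q * indicator {-R..R} x" for x
    using assms(2)[of x] assms(3)[of x] by (cases "\<bar>x\<bar> \<le> R") (auto simp: indicator_def)
  have i: "integrable lborel (\<lambda>x. Q * indicator {-R..R} x)"
    by (intro integrable_mult_right integrable_real_indicator) (auto simp: emeasure_lborel_Icc_eq)
  show gi: "integrable lborel g"
    by (rule Bochner_Integration.integrable_bound[OF i])
       (use assms(1) order_trans[OF le abs_ge_self] in \<open>auto intro!: AE_I2\<close>)
  have "\<bar>\<integral>x. g x \<partial>lborel\<bar> \<le> (\<integral>x. \<bar>g x\<bar> \<partial>lborel)" by (rule integral_abs_bound)
  also have "\<dots> \<le> (\<integral>x. Q * indicator {-R..R} x \<partial>lborel)" by (rule integral_mono[OF integrable_abs[OF gi] i le])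
  also have "\<dots> = Q * (2 * R)" using assms(4) by (subst integral_mult_right_zero) simp
  finally show "\<bar>\<integral>x. g x \<partial>lborel\<bar> \<le> Q * (2 * R)" .
qed

lemma integration_by_parts_compact_support:
  fixes f f' g g' :: "real \<Rightarrow> real"
  assumes f: "\<And>x. (f has_real_derivative f' x) (at x)" "continuous_on UNIV f'"
    and g: "\<And>x. (g has_real_derivative g' x) (at x)" "continuous_on UNIV g'"
    and supp: "\<And>x. R < \<bar>x\<bar> \<Longrightarrow> g x = 0" "\<And>x. R < \<bar>x\<bar> \<Longrightarrow> g' x = 0" and R: "0 \<le> R"
  shows "(\<integral>x. f x * g' x \<partial>lborel) = - (\<integral>x. f' x * g x \<partial>lborel)"
proof -
  have cf: "continuous_on UNIV f" and cg: "continuous_on UNIV g"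
    using f(1) g(1) by (auto intro!: continuous_at_imp_continuous_on DERIV_isCont)
  have int: "integrable lborel (\<lambda>x. a x * b x)"
    if a: "continuous_on UNIV a" and b: "continuous_on UNIV b" "\<And>x. R < \<bar>x\<bar> \<Longrightarrow> b x = 0" for a b :: "real \<Rightarrow> real"
  proof -
    have c: "continuous_on UNIV (\<lambda>x. a x * b x)" by (intro continuous_intros a b(1))
    obtain M where "0 \<le> M" "\<And>x. \<bar>x\<bar> \<le> R \<Longrightarrow> \<bar>a x * b x\<bar> \<le> M"
      using continuous_bounded_on_ball[OF c, of R] by blast
    then show ?thesis
      by (intro bounded_support_integrable(1)[of _ R M] borel_measurable_continuous_onI c) (use b(2) R in auto)
  qed
  have "(\<integral>x. (f' x * g x + f x * g' x) * indicator {-(R + 1)..R + 1} x \<partial>lborel) = f (R + 1) * g (R + 1) - f (-(R + 1)) * g (-(R + 1))"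
  proof (rule integral_FTC_Icc_real)
    show "((\<lambda>x. f x * g x) has_real_derivative f' x * g x + f x * g' x) (at x)" for x
      using DERIV_mult[OF f(1) g(1), of x] by (simp add: mult.commute add.commute)
    show "isCont (\<lambda>x. f' x * g x + f x * g' x) x" for x
      using f(2) g(2) cf cg by (intro continuous_intros) (auto simp: continuous_on_eq_continuous_at)
  qed (use R in auto)
  moreover have "(f' x * g x + f x * g' x) * indicator {-(R + 1)..R + 1} x = f' x * g x + f x * g' x" for x
    using supp[of x] by (cases "R < \<bar>x\<bar>") (auto simp: indicator_def)
  moreover have "g (R + 1) = 0" "g (-(R + 1)) = 0" using supp R by auto
  ultimately have "(\<integral>x. f' x * g x + f x * g' x \<partial>lborel) = 0" by (simp only: mult_zero_right diff_zero)
  then show ?thesis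
    using int[OF f(2) cg supp(1)] int[OF cf g(2) supp(2)] by simp
qed

lemma integral_lebesgue_eq_lborel:
  fixes f :: "real \<Rightarrow> real"
  assumes "f \<in> borel_measurable borel"
  shows "(LINT x|lebesgue. f x) = (\<integral>x. f x \<partial>lborel)" "integrable lebesgue f \<longleftrightarrow> integrable lborel f"
  using assms by (simp_all add: integral_completion integrable_completion)

lemma continuous_locally_integrable:
  fixes f :: "real \<Rightarrow> real"
  assumes "continuous_on UNIV f"
  shows "locally_integrable_on U f"
  unfolding locally_integrable_on_def
proof (intro allI impI)
  fix K assume K: "compact K \<and> K \<subseteq> U"
  then obtain R where "K \<subseteq> {-R..R}" using compact_imp_bounded bounded_subset_cbox_symmetric[of K] by auto
  moreover have "f absolutely_integrable_on {-R..R}"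
    by (rule absolutely_integrable_continuous_real) (rule continuous_on_subset[OF assms], simp)
  moreover have "K \<in> sets lebesgue" using K by (simp add: compact_imp_closed borel_closed)
  ultimately show "f absolutely_integrable_on K" by (meson set_integrable_subset)
qed

lemma restricted_integral_of_supported:
  fixes f :: "real \<Rightarrow> real"
  assumes "open U" "f \<in> borel_measurable borel" "\<And>x. x \<notin> U \<Longrightarrow> f x = 0"
  shows "(LINT x|lebesgue_on U. f x) = (\<integral>x. f x \<partial>lborel)"
proof -
  have "(LINT x|lebesgue_on U. f x) = (LINT x|lebesgue. indicator U x *\<^sub>R f x)"
    using assms(1) by (intro integral_restrict_space) auto
  also have "(\<lambda>x. indicator U x *\<^sub>R f x) = f" using assms(3) by (auto simp: indicator_def fun_eq_iff)
  finally show ?thesis using integral_lebesgue_eq_lborel(1)[OF assms(2)] by simp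
qed

lemma C1_weak_derivative:
  assumes f: "\<And>x. (f has_real_derivative f' x) (at x)" "continuous_on UNIV f'" and U: "open U"
  shows "weak_derivative_on U f f'"
  unfolding weak_derivative_on_def
proof (intro conjI allI impI)
  have cf: "continuous_on UNIV f" using f(1) by (auto intro!: continuous_at_imp_continuous_on DERIV_isCont)
  show "locally_integrable_on U f" "locally_integrable_on U f'"
    using cf f(2) by (simp_all add: continuous_locally_integrable)
  fix \<eta> assume \<eta>: "test_function U \<eta>"
  obtain R where R: "R \<ge> 0" "\<And>n x. R < \<bar>x\<bar> \<Longrightarrow> (deriv ^^ n) \<eta> x = 0"
    by (rule test_function_support[OF \<eta>]) blast
  have d: "(\<eta> has_real_derivative deriv \<eta> x) (at x)" for x using test_function_derivatives(1)[OF \<eta>, of 0] by simp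
  have c: "continuous_on UNIV \<eta>" "continuous_on UNIV (deriv \<eta>)"
    using test_function_derivatives(2)[OF \<eta>, of 0] test_function_derivatives(2)[OF \<eta>, of 1] by simp_all
  have out: "\<eta> x = 0" "deriv \<eta> x = 0" if "x \<notin> U" for x
  proof -
    have x: "x \<notin> closure {x. \<eta> x \<noteq> 0}" using \<eta> that unfolding test_function_def by blast
    show "\<eta> x = 0" "deriv \<eta> x = 0"
      using test_function_derivatives(3)[OF \<eta> x, of 0] test_function_derivatives(3)[OF \<eta> x, of 1] by simp_all
  qed
  have [measurable]: "f \<in> borel_measurable borel" "f' \<in> borel_measurable borel" "\<eta> \<in> borel_measurable borel" "deriv \<eta> \<in> borel_measurable borel"
    using cf f(2) c by (auto intro: borel_measurable_continuous_onI)
  have "(LINT x|lebesgue_on U. f x * deriv \<eta> x) = (\<integral>x. f x * deriv \<eta> x \<partial>lborel)"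
    by (rule restricted_integral_of_supported[OF U]) (use out in auto)
  also have "\<dots> = - (\<integral>x. f' x * \<eta> x \<partial>lborel)"
    by (rule integration_by_parts_compact_support[OF f d c(2), of R]) (use R R(2)[of _ 0] R(2)[of _ 1] in auto)
  also have "(\<integral>x. f' x * \<eta> x \<partial>lborel) = (LINT x|lebesgue_on U. f' x * \<eta> x)"
    by (rule restricted_integral_of_supported[OF U, symmetric]) (use out in auto)
  finally show "(LINT x|lebesgue_on U. f x * deriv \<eta> x) = - (LINT x|lebesgue_on U. f' x * \<eta> x)" .
qed

lemma continuous_square_integrable_bounded:
  fixes f :: "real \<Rightarrow> real"
  assumes f: "continuous_on UNIV f" and U: "open U" "bounded U"
  shows "square_integrable_on U f"
  unfolding square_integrable_on_def
proof
  have [measurable]: "f \<in> borel_measurable borel" by (rule borel_measurable_continuous_onI[OF f])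
  show "f \<in> borel_measurable (lebesgue_on U)"
    by (intro measurable_restrict_space1 measurable_completion) simp
  obtain a where a: "\<forall>x\<in>U. norm x \<le> a" using U(2) unfolding bounded_iff by blast
  obtain M where M: "0 \<le> M" "\<And>x. \<bar>x\<bar> \<le> \<bar>a\<bar> \<Longrightarrow> \<bar>f x\<bar> \<le> M"
    using continuous_bounded_on_ball[OF f, of "\<bar>a\<bar>"] by blast
  have [measurable]: "U \<in> sets borel" using U(1) by simp
  have "integrable lborel (\<lambda>x. indicator U x *\<^sub>R (f x)\<^sup>2)"
  proof (rule bounded_support_integrable(1)[of _ "\<bar>a\<bar>" "M\<^sup>2"])
    show "\<bar>indicator U x *\<^sub>R (f x)\<^sup>2\<bar> \<le> M\<^sup>2" if "\<bar>x\<bar> \<le> \<bar>a\<bar>" for x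
      using M(2)[OF that] M(1) abs_le_square_iff[of "f x" M] by (auto simp: indicator_def)
    show "indicator U x *\<^sub>R (f x)\<^sup>2 = 0" if "\<bar>a\<bar> < \<bar>x\<bar>" for x
      using a that by (force simp: indicator_def)
  qed auto
  then have "integrable lebesgue (\<lambda>x. indicator U x *\<^sub>R (f x)\<^sup>2)"
    by (subst integral_lebesgue_eq_lborel(2)) auto
  then show "integrable (lebesgue_on U) (\<lambda>x. (f x)\<^sup>2)"
    using U(1) by (subst integrable_restrict_space) auto
qed

lemma C1_sobolev:
  assumes f: "\<And>x. (f has_real_derivative f' x) (at x)" "continuous_on UNIV f'" and U: "open U" "bounded U"
  shows "sobolev_W12 U f"
proof -
  have "continuous_on UNIV f" using f(1) by (auto intro!: continuous_at_imp_continuous_on DERIV_isCont)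
  then show ?thesis
    unfolding sobolev_W12_def
    using C1_weak_derivative[OF f U(1)] continuous_square_integrable_bounded[OF _ U] f(2) by blast
qed

section \<open>Translating back: the controlled path and its rough integral\<close>

text \<open>The second inequality is what makes errors of order \<open>p + 1\<close> negligible in partition sums.\<close>

lemma rough_level_bounds:
  assumes "0 < \<gamma>"
  shows "real (rough_level \<gamma>) * \<gamma> \<le> 1" "1 < (real (rough_level \<gamma>) + 1) * \<gamma>"
proof -
  have "real (rough_level \<gamma>) = of_int \<lfloor>1 / \<gamma>\<rfloor>" unfolding rough_level_def using assms by simp
  then have "real (rough_level \<gamma>) \<le> 1 / \<gamma>" "1 / \<gamma> < real (rough_level \<gamma>) + 1" by linarith+
  then show "real (rough_level \<gamma>) * \<gamma> \<le> 1" "1 < (real (rough_level \<gamma>) + 1) * \<gamma>"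
    using assms by (simp_all add: field_simps)
qed

lemma powr_le_on_bounded_interval:
  fixes x T p q :: real
  assumes "0 \<le> x" "x \<le> T" "0 < p" "p \<le> q" shows "x powr q \<le> T powr (q - p) * x powr p"
proof -
  have "x powr q = x powr (q - p) * x powr p" by (simp flip: powr_add)
  also have "\<dots> \<le> T powr (q - p) * x powr p" using assms by (intro mult_right_mono powr_mono2) auto
  finally show ?thesis .
qed

text \<open>If a germ \<open>J\<close> agrees with an additive function \<open>D\<close> up to a power above \<open>1\<close> of the interval length,
  its partition sums converge to \<open>D\<close>.\<close>

lemma partition_sum_estimate:
  fixes J D :: "real \<Rightarrow> real \<Rightarrow> real"
  assumes \<kappa>: "\<kappa> > 1" and A: "0 \<le> A" and t: "0 \<le> t"
    and close: "\<And>u v. 0 \<le> u \<Longrightarrow> u < v \<Longrightarrow> v \<le> t \<Longrightarrow> \<bar>J u v - D u v\<bar> \<le> A * (v - u) powr \<kappa>"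
    and add: "\<And>u v. 0 \<le> u \<Longrightarrow> u \<le> v \<Longrightarrow> v \<le> t \<Longrightarrow> D 0 v = D 0 u + D u v"
    and e: "0 < e"
  shows "\<exists>\<delta>>0. \<forall>ps. partition_of 0 t ps \<and> (\<forall>i < length ps - 1. ps ! Suc i - ps ! i < \<delta>) \<longrightarrow>
     \<bar>(\<Sum>i < length ps - 1. J (ps ! i) (ps ! Suc i)) - D 0 t\<bar> < e"
proof -
  define \<delta> where "\<delta> = (e / (A * t + 1)) powr (1 / (\<kappa> - 1))"
  have At: "0 < A * t + 1" using A t by (simp add: add_nonneg_pos)
  have \<delta>: "\<delta> > 0" using e At by (simp add: \<delta>_def)
  have \<delta>\<kappa>: "\<delta> powr (\<kappa> - 1) = e / (A * t + 1)" unfolding \<delta>_def using e At \<kappa> by (simp add: powr_powr)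
  have D00: "D 0 0 = 0" using add[of 0 0] t by simp
  have "\<bar>(\<Sum>i < length ps - 1. J (ps ! i) (ps ! Suc i)) - D 0 t\<bar> < e"
    if ps: "partition_of 0 t ps" and mesh: "\<And>i. i < length ps - 1 \<Longrightarrow> ps ! Suc i - ps ! i < \<delta>" for ps
  proof -
    have ne: "ps \<noteq> []" and sorted: "sorted_wrt (<) ps" and first: "ps ! 0 = 0" and last: "ps ! (length ps - 1) = t"
      using ps unfolding partition_of_def by (auto simp: hd_conv_nth last_conv_nth)
    have lt: "ps ! i < ps ! j" if "i < j" "j < length ps" for i j
      using sorted_wrt_nth_less[OF sorted that] .
    have rng: "0 \<le> ps ! i" "ps ! i \<le> t" if "i < length ps" for i
    proof -
      show "0 \<le> ps ! i" using lt[of 0 i] that first by (cases "i = 0") auto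
      show "ps ! i \<le> t"
      proof (cases "i = length ps - 1")
        case False
        then have "i < length ps - 1" "length ps - 1 < length ps" using that by linarith+
        from lt[OF this] show ?thesis using last by linarith
      qed (use last in simp)
    qed
    have "\<bar>(\<Sum>i<m. J (ps ! i) (ps ! Suc i)) - D 0 (ps ! m)\<bar> \<le> A * (e / (A * t + 1)) * (ps ! m)" if "m < length ps" for m
      using that
    proof (induction m)
      case 0
      then show ?case by (simp add: first D00)
    next
      case (Suc m)
      let ?u = "ps ! m" and ?v = "ps ! Suc m"
      have uv: "0 \<le> ?u" "?u < ?v" "?v \<le> t" using Suc.prems lt[of m "Suc m"] rng[of m] rng[of "Suc m"] by auto
      have "(?v - ?u) powr \<kappa> = (?v - ?u) powr (\<kappa> - 1) * (?v - ?u)"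
        using uv powr_add[of "?v - ?u" "\<kappa> - 1" 1] by simp
      also have "\<dots> \<le> \<delta> powr (\<kappa> - 1) * (?v - ?u)"
      proof (rule mult_right_mono, rule powr_mono2)
        have "m < length ps - 1" using Suc.prems by linarith
        from mesh[OF this] show "?v - ?u \<le> \<delta>" by simp
      qed (use uv \<kappa> in auto)
      finally have "A * (?v - ?u) powr \<kappa> \<le> A * (e / (A * t + 1) * (?v - ?u))"
        unfolding \<delta>\<kappa> using A by (rule mult_left_mono)
      then have "\<bar>J ?u ?v - D ?u ?v\<bar> \<le> A * (e / (A * t + 1)) * (?v - ?u)"
        using close[OF uv] by (simp only: mult.assoc)
      moreover have "D 0 ?v = D 0 ?u + D ?u ?v" using uv by (intro add) auto
      ultimately have "\<bar>(\<Sum>i<Suc m. J (ps ! i) (ps ! Suc i)) - D 0 ?v\<bar>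
         \<le> A * (e / (A * t + 1)) * ?u + A * (e / (A * t + 1)) * (?v - ?u)"
        using Suc by simp
      also have "\<dots> = A * (e / (A * t + 1)) * ?v" by (simp only: distrib_left[symmetric]) simp
      finally show ?case .
    qed
    from this[of "length ps - 1"] have "\<bar>(\<Sum>i < length ps - 1. J (ps ! i) (ps ! Suc i)) - D 0 t\<bar> \<le> A * (e / (A * t + 1)) * t"
      using ne last by simp
    also have "A * (e / (A * t + 1)) * t = e * (A * t / (A * t + 1))" by simp
    also have "\<dots> < e * 1" using e At by (intro mult_strict_left_mono) simp_all
    finally show ?thesis by simp
  qed
  then show ?thesis using \<delta> by blast
qed

text \<open>A solution \<open>v\<close>, with derivative \<open>w\<close>, of the transport equation in the frame that moves with the
  Hoelder path \<open>\<beta>\<close>.\<close>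

locale transported_solution =
  fixes T \<gamma> C L :: real and \<beta> :: "real \<Rightarrow> real" and u0 :: "real \<Rightarrow> real" and v w c :: "real \<Rightarrow> real \<Rightarrow> real"
  assumes T: "0 < T" and \<gamma>: "0 < \<gamma>" "\<gamma> < 1"
    and \<beta>_0: "\<beta> 0 = 0" and \<beta>_continuous: "continuous_on UNIV \<beta>"
    and \<beta>_holder: "\<And>s t. s \<in> {0..T} \<Longrightarrow> t \<in> {0..T} \<Longrightarrow> \<bar>\<beta> t - \<beta> s\<bar> \<le> L * \<bar>t - s\<bar> powr \<gamma>" and L: "0 \<le> L"
    and c_measurable [measurable]: "case_prod c \<in> borel_measurable (borel \<Otimes>\<^sub>M borel)"
    and c_bound: "\<And>r y. \<bar>c r y\<bar> \<le> C" and C: "0 \<le> C"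
    and v_0: "\<And>y. v 0 y = u0 y"
    and v_deriv: "\<And>t y. t \<in> {0..T} \<Longrightarrow> (v t has_real_derivative w t y) (at y)"
    and w_continuous: "\<And>t. continuous_on UNIV (w t)"
    and w_measurable [measurable]: "case_prod w \<in> borel_measurable (borel \<Otimes>\<^sub>M borel)"
    and vw_bound: "\<And>R. \<exists>M\<ge>0. \<forall>t\<in>{0..T}. \<forall>y. \<bar>y\<bar> \<le> R \<longrightarrow> \<bar>v t y\<bar> \<le> M \<and> \<bar>w t y\<bar> \<le> M"
    and weak_equation: "\<And>t \<zeta> R. t \<in> {0..T} \<Longrightarrow> continuous_on UNIV \<zeta> \<Longrightarrow> (\<And>y. R < \<bar>y\<bar> \<Longrightarrow> \<zeta> y = 0) \<Longrightarrow>
        (\<integral>y. (v t y - u0 y) * \<zeta> y \<partial>lborel) = - (\<integral>r. indicator {0..<t} r * (\<integral>y. c r y * w r y * \<zeta> y \<partial>lborel) \<partial>lborel)"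
begin

definition u :: "real \<Rightarrow> real \<Rightarrow> real" where "u t x = v t (x - \<beta> t)"
definition Du :: "real \<Rightarrow> real \<Rightarrow> real" where "Du t x = w t (x - \<beta> t)"

lemma u_deriv: "t \<in> {0..T} \<Longrightarrow> (u t has_real_derivative Du t x) (at x)"
  unfolding u_def[abs_def] Du_def
  by (rule DERIV_chain2[where g = "\<lambda>x. x - \<beta> t" and Db = 1, OF v_deriv, simplified])
     (auto intro!: derivative_eq_intros)

lemma Du_continuous: "continuous_on UNIV (Du t)"
  unfolding Du_def[abs_def]
  by (intro continuous_on_compose2[OF w_continuous] continuous_intros) auto

lemma v_continuous: "t \<in> {0..T} \<Longrightarrow> continuous_on UNIV (v t)"
  by (intro continuous_at_imp_continuous_on ballI DERIV_isCont[OF v_deriv])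

lemma \<beta>_measurable [measurable]: "\<beta> \<in> borel_measurable borel"
  by (rule borel_measurable_continuous_onI[OF \<beta>_continuous])

lemma shift_integral: "(\<integral>x. g x \<partial>lborel) = (\<integral>y. g (y + a) \<partial>lborel)" for g :: "real \<Rightarrow> real"
  using lborel_integral_real_affine[of 1 g a] by (simp add: add.commute)

context
  fixes \<eta> :: "real \<Rightarrow> real" assumes \<eta>: "test_function UNIV \<eta>"
begin

abbreviation "e n \<equiv> (deriv ^^ n) \<eta>"

text \<open>For \<open>n = 1\<close> integration by parts gives \<open>\<integral> \<nabla>u \<eta>\<close>; the higher components are the formal derivatives
  along \<open>\<beta>\<close>. Writing all of them in terms of \<open>v\<close> instead of \<open>w\<close> puts every derivative on the smooth
  function \<open>\<eta>\<close>.\<close>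

definition Y :: "nat \<Rightarrow> real \<Rightarrow> real" where
  "Y n t = - (\<integral>y. v t y * e n (y + \<beta> t) \<partial>lborel)"

definition drift_rate :: "real \<Rightarrow> real" where
  "drift_rate r = (\<integral>y. c r y * w r y * \<eta> (y + \<beta> r) \<partial>lborel)"

lemma e_measurable: "e n \<in> borel_measurable borel"
  by (rule borel_measurable_continuous_onI[OF test_function_derivatives(2)[OF \<eta>]])

text \<open>The path is bounded, so the shifted test functions share one bounded support.\<close>

lemma uniform_bounds:
  obtains R M where "0 \<le> R" "0 \<le> M"
    "\<And>n t y. t \<in> {0..T} \<Longrightarrow> R < \<bar>y\<bar> \<Longrightarrow> e n (y + \<beta> t) = 0"
    "\<And>t y. t \<in> {0..T} \<Longrightarrow> \<bar>y\<bar> \<le> R \<Longrightarrow> \<bar>v t y\<bar> \<le> M"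
    "\<And>t y. t \<in> {0..T} \<Longrightarrow> \<bar>y\<bar> \<le> R \<Longrightarrow> \<bar>w t y\<bar> \<le> M"
proof -
  obtain R0 where R0: "R0 \<ge> 0" "\<And>n x. R0 < \<bar>x\<bar> \<Longrightarrow> e n x = 0"
    by (rule test_function_support[OF \<eta>]) blast
  obtain Q where Q: "0 \<le> Q" "\<And>t. \<bar>t\<bar> \<le> T \<Longrightarrow> \<bar>\<beta> t\<bar> \<le> Q"
    using continuous_bounded_on_ball[OF \<beta>_continuous, of T] by blast
  obtain M where M: "M \<ge> 0" "\<forall>t\<in>{0..T}. \<forall>y. \<bar>y\<bar> \<le> R0 + Q \<longrightarrow> \<bar>v t y\<bar> \<le> M \<and> \<bar>w t y\<bar> \<le> M"
    using vw_bound[of "R0 + Q"] by blast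
  have "e n (y + \<beta> t) = 0" if "t \<in> {0..T}" "R0 + Q < \<bar>y\<bar>" for n t y
  proof (rule R0(2))
    have "\<bar>\<beta> t\<bar> \<le> Q" using that by (intro Q(2)) auto
    then show "R0 < \<bar>y + \<beta> t\<bar>" using that(2) by linarith
  qed
  then show ?thesis using that[of "R0 + Q" M] R0(1) Q(1) M by auto
qed

text \<open>The difference of two instances of the weak equation. For a test function that does not move
  with time, \<open>t \<mapsto> \<integral> v \<zeta>\<close> is even Lipschitz.\<close>

lemma increment_bound:
  assumes R: "0 \<le> R" and M: "0 \<le> M" and Z: "0 \<le> Z"
    and w: "\<And>t y. t \<in> {0..T} \<Longrightarrow> \<bar>y\<bar> \<le> R \<Longrightarrow> \<bar>w t y\<bar> \<le> M" and v: "\<And>t y. t \<in> {0..T} \<Longrightarrow> \<bar>y\<bar> \<le> R \<Longrightarrow> \<bar>v t y\<bar> \<le> M"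
    and \<zeta>: "continuous_on UNIV \<zeta>" "\<And>y. R < \<bar>y\<bar> \<Longrightarrow> \<zeta> y = 0" "\<And>y. \<bar>\<zeta> y\<bar> \<le> Z"
    and st: "0 \<le> s" "s \<le> t" "t \<le> T"
  shows "(\<integral>y. v t y * \<zeta> y \<partial>lborel) - (\<integral>y. v s y * \<zeta> y \<partial>lborel)
       = - (\<integral>r. indicator {s..<t} r * (\<integral>y. c r y * w r y * \<zeta> y \<partial>lborel) \<partial>lborel)"
    and "\<bar>(\<integral>y. v t y * \<zeta> y \<partial>lborel) - (\<integral>y. v s y * \<zeta> y \<partial>lborel)\<bar> \<le> C * M * Z * (2 * R) * (t - s)"
proof -
  have [measurable]: "\<zeta> \<in> borel_measurable borel" by (rule borel_measurable_continuous_onI[OF \<zeta>(1)])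
  define g where "g r = (\<integral>y. c r y * w r y * \<zeta> y \<partial>lborel)" for r
  have [measurable]: "g \<in> borel_measurable borel" unfolding g_def by measurable
  have gb: "\<bar>g r\<bar> \<le> C * M * Z * (2 * R)" if r: "r \<in> {0..T}" for r
    unfolding g_def
  proof (rule bounded_support_integrable(2))
    show "\<bar>c r y * w r y * \<zeta> y\<bar> \<le> C * M * Z" if "\<bar>y\<bar> \<le> R" for y
      unfolding abs_mult using w[OF r that] \<zeta>(3)[of y] c_bound[of r y] C M by (intro mult_mono) auto
  qed (use \<zeta> R M C Z in auto)
  have Q0: "0 \<le> C * M * Z * (2 * R)" using C M Z R by simp
  have gi: "integrable lborel (\<lambda>r. indicator {a..<b} r * g r)" if "0 \<le> a" "b \<le> T" for a b
    by (rule bounded_support_integrable(1)[of _ T "C * M * Z * (2 * R)"])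
       (use gb that T Q0 in \<open>auto simp: indicator_def\<close>)
  have vi: "integrable lborel (\<lambda>y. h y * \<zeta> y)" if "continuous_on UNIV h" "\<And>y. \<bar>y\<bar> \<le> R \<Longrightarrow> \<bar>h y\<bar> \<le> M" for h
  proof (rule bounded_support_integrable(1)[of _ R "M * Z"])
    have "h \<in> borel_measurable borel" by (rule borel_measurable_continuous_onI[OF that(1)])
    then show "(\<lambda>y. h y * \<zeta> y) \<in> borel_measurable borel" by measurable
    show "\<bar>h y * \<zeta> y\<bar> \<le> M * Z" if "\<bar>y\<bar> \<le> R" for y
      unfolding abs_mult using \<open>\<And>y. \<bar>y\<bar> \<le> R \<Longrightarrow> \<bar>h y\<bar> \<le> M\<close>[OF that] \<zeta>(3)[of y] M by (intro mult_mono) auto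
  qed (use \<zeta> R M Z in auto)
  have T0: "0 \<in> {0..T}" and sT: "s \<in> {0..T}" and tT: "t \<in> {0..T}" using st T by auto
  have u0: "u0 = v 0" using v_0 by auto
  have *: "(\<integral>y. v t y * \<zeta> y \<partial>lborel) - (\<integral>y. u0 y * \<zeta> y \<partial>lborel) = - (\<integral>r. indicator {0..<t} r * g r \<partial>lborel)" if t: "t \<in> {0..T}" for t
  proof -
    have "(\<integral>y. v t y * \<zeta> y - u0 y * \<zeta> y \<partial>lborel) = - (\<integral>r. indicator {0..<t} r * g r \<partial>lborel)"
      using weak_equation[OF t \<zeta>(1,2)] unfolding g_def by (simp only: left_diff_distrib)
    moreover have "(\<integral>y. v t y * \<zeta> y - u0 y * \<zeta> y \<partial>lborel) = (\<integral>y. v t y * \<zeta> y \<partial>lborel) - (\<integral>y. u0 y * \<zeta> y \<partial>lborel)"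
      unfolding u0 by (intro Bochner_Integration.integral_diff vi v_continuous t T0 v)
    ultimately show ?thesis by simp
  qed
  have "(\<integral>r. indicator {0..<t} r * g r \<partial>lborel) = (\<integral>r. indicator {0..<s} r * g r + indicator {s..<t} r * g r \<partial>lborel)"
    using st by (intro Bochner_Integration.integral_cong) (auto simp: indicator_def)
  also have "\<dots> = (\<integral>r. indicator {0..<s} r * g r \<partial>lborel) + (\<integral>r. indicator {s..<t} r * g r \<partial>lborel)"
    using st by (intro Bochner_Integration.integral_add gi) auto
  finally show eq: "(\<integral>y. v t y * \<zeta> y \<partial>lborel) - (\<integral>y. v s y * \<zeta> y \<partial>lborel)
       = - (\<integral>r. indicator {s..<t} r * (\<integral>y. c r y * w r y * \<zeta> y \<partial>lborel) \<partial>lborel)"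
    using *[OF sT] *[OF tT] unfolding g_def by linarith
  have "\<bar>\<integral>r. indicator {s..<t} r * g r \<partial>lborel\<bar> \<le> (\<integral>r. \<bar>indicator {s..<t} r * g r\<bar> \<partial>lborel)"
    by (rule integral_abs_bound)
  also have "\<dots> \<le> (\<integral>r. C * M * Z * (2 * R) * indicator {s..<t} r \<partial>lborel)"
  proof (rule integral_mono)
    show "integrable lborel (\<lambda>r. \<bar>indicator {s..<t} r * g r\<bar>)" by (rule integrable_abs[OF gi[OF st(1,3)]])
    show "integrable lborel (\<lambda>r. C * M * Z * (2 * R) * indicator {s..<t} r)"
      using st by (intro integrable_mult_right) simp
    show "\<bar>indicator {s..<t} r * g r\<bar> \<le> C * M * Z * (2 * R) * indicator {s..<t} r" for r
      using gb[of r] st by (auto simp: indicator_def)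
  qed
  also have "\<dots> = C * M * Z * (2 * R) * (t - s)" using st by (subst integral_mult_right_zero) simp
  finally show "\<bar>(\<integral>y. v t y * \<zeta> y \<partial>lborel) - (\<integral>y. v s y * \<zeta> y \<partial>lborel)\<bar> \<le> C * M * Z * (2 * R) * (t - s)"
    unfolding eq g_def by simp
qed

lemma shifted_e:
  shows "continuous_on UNIV (\<lambda>y. e n (y + a))" "(\<lambda>y. e n (y + a)) \<in> borel_measurable borel"
proof -
  show "continuous_on UNIV (\<lambda>y. e n (y + a))"
    by (intro continuous_on_compose2[OF test_function_derivatives(2)[OF \<eta>]] continuous_intros) auto
  then show "(\<lambda>y. e n (y + a)) \<in> borel_measurable borel" by (rule borel_measurable_continuous_onI)
qed

text \<open>Taylor's formula for the test function at \<open>y + \<beta> s\<close> with increment \<open>\<beta> t - \<beta> s\<close>: the monomials are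
  the entries of the geometric lift, and the remainder of order \<open>q\<close> is of size \<open>\<bar>\<beta> t - \<beta> s\<bar>\<^sup>q\<close>.\<close>

lemma taylor_pairing:
  assumes q: "0 < q"
  shows "\<exists>A\<ge>0. \<forall>s t. 0 \<le> s \<and> s \<le> t \<and> t \<le> T \<longrightarrow>
     \<bar>(\<integral>y. v s y * e k (y + \<beta> t) \<partial>lborel) - (\<Sum>m<q. (\<integral>y. v s y * e (k + m) (y + \<beta> s) \<partial>lborel) * geometric_lift \<beta> m s t)\<bar>
       \<le> A * (t - s) powr (real q * \<gamma>)"
proof -
  obtain R M where RM: "0 \<le> R" "0 \<le> M"
    "\<And>n t y. t \<in> {0..T} \<Longrightarrow> R < \<bar>y\<bar> \<Longrightarrow> e n (y + \<beta> t) = 0"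
    "\<And>t y. t \<in> {0..T} \<Longrightarrow> \<bar>y\<bar> \<le> R \<Longrightarrow> \<bar>v t y\<bar> \<le> M"
    by (rule uniform_bounds) blast
  obtain Z where Z: "Z \<ge> 0" "\<And>x. \<bar>e (k + q) x\<bar> \<le> Z" by (rule test_function_bounded[OF \<eta>]) blast
  define A where "A = M * (Z * L ^ q) * (2 * R)"
  have "\<bar>(\<integral>y. v s y * e k (y + \<beta> t) \<partial>lborel) - (\<Sum>m<q. (\<integral>y. v s y * e (k + m) (y + \<beta> s) \<partial>lborel) * geometric_lift \<beta> m s t)\<bar>
       \<le> A * (t - s) powr (real q * \<gamma>)" if st: "0 \<le> s" "s \<le> t" "t \<le> T" for s t
  proof -
    have s: "s \<in> {0..T}" and t: "t \<in> {0..T}" using st by auto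
    note shifted_e(2) [measurable]
    have [measurable]: "v s \<in> borel_measurable borel" by (rule borel_measurable_continuous_onI[OF v_continuous[OF s]])
    have ei: "integrable lborel (\<lambda>y. v s y * e n (y + \<beta> a))" if a: "a \<in> {0..T}" for n a
    proof -
      obtain Z where Z: "Z \<ge> 0" "\<And>x. \<bar>e n x\<bar> \<le> Z" by (rule test_function_bounded[OF \<eta>]) blast
      show ?thesis
      proof (rule bounded_support_integrable(1)[of _ R "M * Z"])
        show "\<bar>v s y * e n (y + \<beta> a)\<bar> \<le> M * Z" if "\<bar>y\<bar> \<le> R" for y
          unfolding abs_mult using RM(4)[OF s that] Z RM(2) by (intro mult_mono) auto
      qed (use RM a Z in auto)
    qed
    define h where "h = \<beta> t - \<beta> s"
    let ?rem = "\<lambda>y. v s y * (e k (y + \<beta> t) - (\<Sum>m<q. e (k + m) (y + \<beta> s) * (h ^ m / fact m)))"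
    have i1: "integrable lborel (\<lambda>y. v s y * e (k + m) (y + \<beta> s) * (h ^ m / fact m))" for m
      by (rule integrable_mult_left[OF ei[OF s]])
    have "(\<Sum>m<q. (\<integral>y. v s y * e (k + m) (y + \<beta> s) \<partial>lborel) * geometric_lift \<beta> m s t)
       = (\<Sum>m<q. \<integral>y. v s y * e (k + m) (y + \<beta> s) * (h ^ m / fact m) \<partial>lborel)"
      unfolding geometric_lift_def h_def[symmetric] by (simp only: integral_mult_left_zero)
    also have "\<dots> = (\<integral>y. (\<Sum>m<q. v s y * e (k + m) (y + \<beta> s) * (h ^ m / fact m)) \<partial>lborel)"
      by (rule Bochner_Integration.integral_sum[symmetric]) (rule i1)
    finally have "(\<integral>y. v s y * e k (y + \<beta> t) \<partial>lborel) - (\<Sum>m<q. (\<integral>y. v s y * e (k + m) (y + \<beta> s) \<partial>lborel) * geometric_lift \<beta> m s t)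
       = (\<integral>y. v s y * e k (y + \<beta> t) \<partial>lborel) - (\<integral>y. (\<Sum>m<q. v s y * e (k + m) (y + \<beta> s) * (h ^ m / fact m)) \<partial>lborel)"
      by simp
    also have "\<dots> = (\<integral>y. v s y * e k (y + \<beta> t) - (\<Sum>m<q. v s y * e (k + m) (y + \<beta> s) * (h ^ m / fact m)) \<partial>lborel)"
      by (rule Bochner_Integration.integral_diff[symmetric, OF ei[OF t] Bochner_Integration.integrable_sum[OF i1]])
    also have "\<dots> = (\<integral>y. ?rem y \<partial>lborel)"
      by (rule Bochner_Integration.integral_cong) (simp_all only: right_diff_distrib sum_distrib_left mult.assoc)
    finally have eq: "(\<integral>y. v s y * e k (y + \<beta> t) \<partial>lborel) - (\<Sum>m<q. (\<integral>y. v s y * e (k + m) (y + \<beta> s) \<partial>lborel) * geometric_lift \<beta> m s t)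
       = (\<integral>y. ?rem y \<partial>lborel)" .
    have "\<bar>h\<bar> \<le> L * (t - s) powr \<gamma>" unfolding h_def using \<beta>_holder[OF s t] st by simp
    then have "\<bar>h\<bar> ^ q \<le> (L * (t - s) powr \<gamma>) ^ q" by (rule power_mono) simp
    also have "\<dots> = L ^ q * (t - s) powr (real q * \<gamma>)"
    proof (cases "s = t")
      case False
      then have "((t - s) powr \<gamma>) ^ q = (t - s) powr (real q * \<gamma>)"
        using st by (simp add: powr_powr mult.commute flip: powr_realpow)
      then show ?thesis by (simp only: power_mult_distrib)
    qed (use q in simp)
    finally have hq: "\<bar>h\<bar> ^ q \<le> L ^ q * (t - s) powr (real q * \<gamma>)" .
    have "\<bar>\<integral>y. ?rem y \<partial>lborel\<bar> \<le> M * (Z * \<bar>h\<bar> ^ q) * (2 * R)"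
    proof (rule bounded_support_integrable(2))
      show "\<bar>?rem y\<bar> \<le> M * (Z * \<bar>h\<bar> ^ q)" if "\<bar>y\<bar> \<le> R" for y
      proof -
        have "y + \<beta> t = (y + \<beta> s) + h" by (simp add: h_def)
        then have "\<bar>e k (y + \<beta> t) - (\<Sum>m<q. e (k + m) (y + \<beta> s) * (h ^ m / fact m))\<bar> \<le> Z * \<bar>h\<bar> ^ q"
          using test_function_taylor[OF \<eta> Z(2), of "y + \<beta> s" h] by (simp only:)
        then show ?thesis unfolding abs_mult[of "v s y"] using RM(4)[OF s that] RM(2) by (intro mult_mono) auto
      qed
      show "?rem y = 0" if "R < \<bar>y\<bar>" for y using RM(3)[OF t that] RM(3)[OF s that] by simp
      show "?rem \<in> borel_measurable borel" by measurable
    qed (use RM Z in auto)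
    also have "\<dots> \<le> M * (Z * (L ^ q * (t - s) powr (real q * \<gamma>))) * (2 * R)"
      using hq RM Z by (intro mult_right_mono mult_left_mono) auto
    also have "\<dots> = A * (t - s) powr (real q * \<gamma>)" by (simp add: A_def)
    finally show ?thesis unfolding eq .
  qed
  moreover have "0 \<le> A" unfolding A_def using RM Z L by simp
  ultimately show ?thesis by blast
qed

text \<open>Split the increment of \<open>Y k\<close> into the change of the test function at fixed \<open>v\<close>, treated by
  \<open>taylor_pairing\<close>, and the change of \<open>v\<close> at a fixed test function, which is of order \<open>t - s\<close> and
  therefore small enough, since \<open>p \<gamma> \<le> 1\<close> and \<open>k \<ge> 1\<close>.\<close>

lemma Y_controlled: "controlled_path \<gamma> T (geometric_lift \<beta>) Y"
  unfolding controlled_path_def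
proof
  define p where "p = rough_level \<gamma>"
  fix k assume k: "k \<in> {1..rough_level \<gamma>}"
  define q where "q = p + 1 - k"
  have kq: "k \<le> p" "1 \<le> q" "real q * \<gamma> \<le> 1"
  proof -
    show "k \<le> p" "1 \<le> q" using k by (auto simp: p_def q_def)
    have "real q \<le> real p" using k by (auto simp: p_def q_def)
    then have "real q * \<gamma> \<le> real p * \<gamma>" using \<gamma> by (intro mult_right_mono) auto
    then show "real q * \<gamma> \<le> 1" using rough_level_bounds(1)[OF \<gamma>(1)] by (simp add: p_def)
  qed
  obtain A where A: "A \<ge> 0" "\<And>s t. 0 \<le> s \<Longrightarrow> s \<le> t \<Longrightarrow> t \<le> T \<Longrightarrow>
     \<bar>(\<integral>y. v s y * e k (y + \<beta> t) \<partial>lborel) - (\<Sum>m<q. (\<integral>y. v s y * e (k + m) (y + \<beta> s) \<partial>lborel) * geometric_lift \<beta> m s t)\<bar>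
       \<le> A * (t - s) powr (real q * \<gamma>)"
    using taylor_pairing[of q k] kq(2) by force
  obtain R M where RM: "0 \<le> R" "0 \<le> M"
    "\<And>n t y. t \<in> {0..T} \<Longrightarrow> R < \<bar>y\<bar> \<Longrightarrow> e n (y + \<beta> t) = 0"
    "\<And>t y. t \<in> {0..T} \<Longrightarrow> \<bar>y\<bar> \<le> R \<Longrightarrow> \<bar>v t y\<bar> \<le> M"
    "\<And>t y. t \<in> {0..T} \<Longrightarrow> \<bar>y\<bar> \<le> R \<Longrightarrow> \<bar>w t y\<bar> \<le> M"
    by (rule uniform_bounds) blast
  obtain Z where Z: "Z \<ge> 0" "\<And>x. \<bar>e k x\<bar> \<le> Z" by (rule test_function_bounded[OF \<eta>]) blast
  define A' where "A' = C * M * Z * (2 * R) * T powr (1 - real q * \<gamma>)"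
  have "\<bar>Y k t - (\<Sum>n=k..p. Y n s * geometric_lift \<beta> (n - k) s t)\<bar> \<le> (A' + A) * (t - s) powr (real q * \<gamma>)"
    if st: "0 \<le> s" "s < t" "t \<le> T" for s t
  proof -
    have s: "s \<in> {0..T}" and t: "t \<in> {0..T}" and le: "s \<le> t" using st by auto
    have sum: "(\<Sum>n=k..p. Y n s * geometric_lift \<beta> (n - k) s t)
        = - (\<Sum>m<q. (\<integral>y. v s y * e (k + m) (y + \<beta> s) \<partial>lborel) * geometric_lift \<beta> m s t)"
    proof -
      have "(\<Sum>n=k..p. Y n s * geometric_lift \<beta> (n - k) s t) = (\<Sum>m<q. Y (k + m) s * geometric_lift \<beta> m s t)"
        by (rule sum.reindex_bij_witness[of _ "\<lambda>m. k + m" "\<lambda>n. n - k"]) (use kq in \<open>auto simp: q_def\<close>)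
      then show ?thesis by (simp add: Y_def sum_negf)
    qed
    have "\<bar>(\<integral>y. v t y * e k (y + \<beta> t) \<partial>lborel) - (\<integral>y. v s y * e k (y + \<beta> t) \<partial>lborel)\<bar> \<le> C * M * Z * (2 * R) * (t - s)"
      by (rule increment_bound(2)[OF RM(1,2) Z(1) RM(5,4) shifted_e(1) RM(3)[OF t] Z(2) st(1) le st(3)])
    also have "\<dots> \<le> C * M * Z * (2 * R) * (T powr (1 - real q * \<gamma>) * (t - s) powr (real q * \<gamma>))"
    proof (rule mult_left_mono)
      show "t - s \<le> T powr (1 - real q * \<gamma>) * (t - s) powr (real q * \<gamma>)"
        using powr_le_on_bounded_interval[of "t - s" T "real q * \<gamma>" 1] st kq \<gamma> by simp
    qed (use C RM Z in simp)
    finally have "\<bar>(\<integral>y. v t y * e k (y + \<beta> t) \<partial>lborel) - (\<integral>y. v s y * e k (y + \<beta> t) \<partial>lborel)\<bar> \<le> A' * (t - s) powr (real q * \<gamma>)"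
      by (simp only: A'_def mult.assoc)
    then have "\<bar>Y k t - (\<Sum>n=k..p. Y n s * geometric_lift \<beta> (n - k) s t)\<bar> \<le> A' * (t - s) powr (real q * \<gamma>) + A * (t - s) powr (real q * \<gamma>)"
      using A(2)[OF st(1) le st(3)] unfolding sum unfolding Y_def by linarith
    then show ?thesis by (simp only: distrib_right)
  qed
  then show "\<exists>C. \<forall>s t. 0 \<le> s \<and> s < t \<and> t \<le> T \<longrightarrow>
     \<bar>Y k t - (\<Sum>n=k..rough_level \<gamma>. Y n s * geometric_lift \<beta> (n - k) s t)\<bar> \<le> C * (t - s) powr (real (rough_level \<gamma> + 1 - k) * \<gamma>)"
    unfolding p_def q_def by blast
qed

lemma Y_1: assumes "t \<in> {0..T}" shows "Y 1 t = (LINT x|lebesgue. Du t x * \<eta> x)"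
proof -
  obtain R where R: "R \<ge> 0" "\<And>n x. R < \<bar>x\<bar> \<Longrightarrow> e n x = 0"
    by (rule test_function_support[OF \<eta>]) blast
  have m: "(\<lambda>x. Du t x * \<eta> x) \<in> borel_measurable borel"
    using borel_measurable_continuous_onI[OF Du_continuous] e_measurable[of 0] by (intro borel_measurable_times) auto
  have "(\<integral>y. v t y * e 1 (y + \<beta> t) \<partial>lborel) = (\<integral>x. u t x * e 1 x \<partial>lborel)"
    by (subst shift_integral[of "\<lambda>x. u t x * e 1 x" "\<beta> t"]) (simp add: u_def)
  also have "\<dots> = - (\<integral>x. Du t x * e 0 x \<partial>lborel)"
    by (rule integration_by_parts_compact_support[OF u_deriv[OF assms] Du_continuous _ _ R(2) R(2) R(1)])
       (use test_function_derivatives(1)[OF \<eta>, of 0] test_function_derivatives(2)[OF \<eta>, of 1] in auto)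
  finally show ?thesis
    unfolding Y_def using integral_lebesgue_eq_lborel(1)[OF m] by simp
qed

lemma drift_rate_bounded: "\<exists>Q\<ge>0. \<forall>r\<in>{0..T}. \<bar>drift_rate r\<bar> \<le> Q"
  and drift_integrand_integrable: "r \<in> {0..T} \<Longrightarrow> integrable lborel (\<lambda>y. c r y * w r y * \<eta> (y + \<beta> r))"
  and drift_rate_measurable: "drift_rate \<in> borel_measurable borel"
proof -
  obtain R M where RM: "0 \<le> R" "0 \<le> M"
    "\<And>n t y. t \<in> {0..T} \<Longrightarrow> R < \<bar>y\<bar> \<Longrightarrow> e n (y + \<beta> t) = 0"
    "\<And>t y. t \<in> {0..T} \<Longrightarrow> \<bar>y\<bar> \<le> R \<Longrightarrow> \<bar>w t y\<bar> \<le> M"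
    by (rule uniform_bounds) blast
  obtain Z where Z: "Z \<ge> 0" "\<And>x. \<bar>e 0 x\<bar> \<le> Z" by (rule test_function_bounded[OF \<eta>]) blast
  have [measurable]: "\<eta> \<in> borel_measurable borel" using e_measurable[of 0] by simp
  show "drift_rate \<in> borel_measurable borel" unfolding drift_rate_def[abs_def] by measurable
  have b: "\<bar>c r y * w r y * \<eta> (y + \<beta> r)\<bar> \<le> C * M * Z" if "r \<in> {0..T}" "\<bar>y\<bar> \<le> R" for r y
    unfolding abs_mult using RM(4)[OF that] Z(2)[of "y + \<beta> r"] c_bound[of r y] C RM(2) by (intro mult_mono) auto
  have z: "c r y * w r y * \<eta> (y + \<beta> r) = 0" if "r \<in> {0..T}" "R < \<bar>y\<bar>" for r y
    using RM(3)[OF that, of 0] by simp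
  have Q: "0 \<le> C * M * Z" using C RM Z by simp
  have m: "(\<lambda>y. c r y * w r y * \<eta> (y + \<beta> r)) \<in> borel_measurable borel" for r by measurable
  show "r \<in> {0..T} \<Longrightarrow> integrable lborel (\<lambda>y. c r y * w r y * \<eta> (y + \<beta> r))"
    by (rule bounded_support_integrable(1)[OF m b z RM(1) Q])
  have "\<bar>drift_rate r\<bar> \<le> C * M * Z * (2 * R)" if "r \<in> {0..T}" for r
    unfolding drift_rate_def by (rule bounded_support_integrable(2)[OF m b[OF that] z[OF that] RM(1) Q])
  then show "\<exists>Q\<ge>0. \<forall>r\<in>{0..T}. \<bar>drift_rate r\<bar> \<le> Q" using Q RM(1) by (intro exI[of _ "C * M * Z * (2 * R)"]) auto
qed

lemma drift_rate_integrable: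
  assumes "0 \<le> a" "b \<le> T" shows "integrable lborel (\<lambda>r. indicator {a..<b} r * drift_rate r)"
proof -
  obtain Q where Q: "Q \<ge> 0" "\<And>r. r \<in> {0..T} \<Longrightarrow> \<bar>drift_rate r\<bar> \<le> Q" using drift_rate_bounded by blast
  note drift_rate_measurable [measurable]
  show ?thesis
    by (rule bounded_support_integrable(1)[of _ T Q]) (use Q assms T in \<open>auto simp: indicator_def\<close>)
qed

definition drift_part :: "real \<Rightarrow> real \<Rightarrow> real" where
  "drift_part s t = (\<integral>r. indicator {s..<t} r * drift_rate r \<partial>lborel)"

lemma drift_part_add:
  assumes "0 \<le> s" "s \<le> t" "t \<le> T" shows "drift_part 0 t = drift_part 0 s + drift_part s t"
proof -
  have "drift_part 0 t = (\<integral>r. indicator {0..<s} r * drift_rate r + indicator {s..<t} r * drift_rate r \<partial>lborel)"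
    unfolding drift_part_def using assms by (intro Bochner_Integration.integral_cong) (auto simp: indicator_def)
  also have "\<dots> = drift_part 0 s + drift_part s t"
    unfolding drift_part_def using assms by (intro Bochner_Integration.integral_add drift_rate_integrable) auto
  finally show ?thesis .
qed

text \<open>The pairing of \<open>u t\<close> with \<open>\<eta>\<close>, in the moving frame.\<close>

definition pairing :: "real \<Rightarrow> real" where
  "pairing t = (\<integral>y. v t y * \<eta> (y + \<beta> t) \<partial>lborel)"

text \<open>\<open>taylor_pairing\<close> with \<open>p + 1\<close> terms covers the change of the test function. In the change of \<open>v\<close> the
  test function is frozen at time \<open>t\<close>; replacing it by the moving one costs \<open>(t - s) \<bar>t - s\<bar>\<^sup>\<gamma>\<close>, and
  \<open>(p + 1) \<gamma> \<le> 1 + \<gamma>\<close>.\<close>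

lemma local_expansion:
  "\<exists>A\<ge>0. \<forall>s t. 0 \<le> s \<and> s < t \<and> t \<le> T \<longrightarrow>
     \<bar>(\<Sum>n=1..rough_level \<gamma>. Y n s * geometric_lift \<beta> n s t) - (pairing s - pairing t - drift_part s t)\<bar>
       \<le> A * (t - s) powr ((real (rough_level \<gamma>) + 1) * \<gamma>)"
proof -
  define p where "p = rough_level \<gamma>"
  define \<kappa> where "\<kappa> = (real p + 1) * \<gamma>"
  have \<kappa>: "1 < \<kappa>" "\<kappa> \<le> 1 + \<gamma>"
    using rough_level_bounds[OF \<gamma>(1)] by (auto simp: \<kappa>_def p_def algebra_simps)
  obtain A where A: "A \<ge> 0" "\<And>s t. 0 \<le> s \<Longrightarrow> s \<le> t \<Longrightarrow> t \<le> T \<Longrightarrow>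
     \<bar>(\<integral>y. v s y * e 0 (y + \<beta> t) \<partial>lborel) - (\<Sum>m<Suc p. (\<integral>y. v s y * e (0 + m) (y + \<beta> s) \<partial>lborel) * geometric_lift \<beta> m s t)\<bar>
       \<le> A * (t - s) powr (real (Suc p) * \<gamma>)"
    using taylor_pairing[of "Suc p" 0, OF zero_less_Suc] by blast
  obtain R M where RM: "0 \<le> R" "0 \<le> M"
    "\<And>n t y. t \<in> {0..T} \<Longrightarrow> R < \<bar>y\<bar> \<Longrightarrow> e n (y + \<beta> t) = 0"
    "\<And>t y. t \<in> {0..T} \<Longrightarrow> \<bar>y\<bar> \<le> R \<Longrightarrow> \<bar>v t y\<bar> \<le> M"
    "\<And>t y. t \<in> {0..T} \<Longrightarrow> \<bar>y\<bar> \<le> R \<Longrightarrow> \<bar>w t y\<bar> \<le> M"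
    by (rule uniform_bounds) blast
  obtain Z where Z: "Z \<ge> 0" "\<And>x. \<bar>e 0 x\<bar> \<le> Z" by (rule test_function_bounded[OF \<eta>]) blast
  obtain Z1 where Z1: "Z1 \<ge> 0" "\<And>x. \<bar>e 1 x\<bar> \<le> Z1" by (rule test_function_bounded[OF \<eta>]) blast
  define A' where "A' = C * M * (Z1 * L) * (2 * R) * T powr (1 + \<gamma> - \<kappa>)"
  have [measurable]: "\<eta> \<in> borel_measurable borel" using e_measurable[of 0] by simp
  note drift_rate_measurable [measurable]
  have "\<bar>(\<Sum>n=1..p. Y n s * geometric_lift \<beta> n s t) - (pairing s - pairing t - drift_part s t)\<bar> \<le> (A + A') * (t - s) powr \<kappa>"
    if st: "0 \<le> s" "s < t" "t \<le> T" for s t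
  proof -
    have s: "s \<in> {0..T}" and t: "t \<in> {0..T}" and le: "s \<le> t" using st by auto
    have "(\<Sum>m<Suc p. (\<integral>y. v s y * e (0 + m) (y + \<beta> s) \<partial>lborel) * geometric_lift \<beta> m s t)
       = pairing s - (\<Sum>n=1..p. Y n s * geometric_lift \<beta> n s t)"
    proof -
      have "(\<Sum>m<Suc p. (\<integral>y. v s y * e (0 + m) (y + \<beta> s) \<partial>lborel) * geometric_lift \<beta> m s t)
         = pairing s * geometric_lift \<beta> 0 s t + (\<Sum>m<p. (\<integral>y. v s y * e (Suc m) (y + \<beta> s) \<partial>lborel) * geometric_lift \<beta> (Suc m) s t)"
        by (subst sum.lessThan_Suc_shift) (simp add: pairing_def)
      also have "(\<Sum>m<p. (\<integral>y. v s y * e (Suc m) (y + \<beta> s) \<partial>lborel) * geometric_lift \<beta> (Suc m) s t)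
         = (\<Sum>n=1..p. (\<integral>y. v s y * e n (y + \<beta> s) \<partial>lborel) * geometric_lift \<beta> n s t)"
        by (rule sum.reindex_bij_witness[of _ "\<lambda>n. n - 1" Suc]) auto
      finally show ?thesis by (simp add: Y_def sum_negf geometric_lift_def)
    qed
    with A(2)[OF st(1) le st(3)]
    have 1: "\<bar>(\<integral>y. v s y * \<eta> (y + \<beta> t) \<partial>lborel) - (pairing s - (\<Sum>n=1..p. Y n s * geometric_lift \<beta> n s t))\<bar> \<le> A * (t - s) powr \<kappa>"
      by (simp add: \<kappa>_def add.commute)
    define g where "g r = (\<integral>y. c r y * w r y * \<eta> (y + \<beta> t) \<partial>lborel)" for r
    have [measurable]: "g \<in> borel_measurable borel" unfolding g_def by measurable
    have 2: "pairing t - (\<integral>y. v s y * \<eta> (y + \<beta> t) \<partial>lborel) = - (\<integral>r. indicator {s..<t} r * g r \<partial>lborel)"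
      unfolding g_def pairing_def
      using increment_bound(1)[OF RM(1,2) Z(1) RM(5,4) shifted_e(1)[of 0 "\<beta> t"] RM(3)[OF t, of _ 0] Z(2) st(1) le st(3)] by simp
    have gi: "integrable lborel (\<lambda>y. c r y * w r y * \<eta> (y + \<beta> t))" if r: "r \<in> {0..T}" for r
    proof (rule bounded_support_integrable(1)[of _ R "C * M * Z"])
      show "\<bar>c r y * w r y * \<eta> (y + \<beta> t)\<bar> \<le> C * M * Z" if "\<bar>y\<bar> \<le> R" for y
        unfolding abs_mult using RM(5)[OF r that] Z(2)[of "y + \<beta> t"] c_bound[of r y] C RM(2) by (intro mult_mono) auto
    qed (use RM(3)[OF t, of _ 0] RM C Z in auto)
    have diff: "\<bar>g r - drift_rate r\<bar> \<le> C * M * (Z1 * L) * (2 * R) * (t - s) powr \<gamma>" if r: "r \<in> {s..<t}" for r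
    proof -
      have rT: "r \<in> {0..T}" using r st by auto
      have "g r - drift_rate r = (\<integral>y. c r y * w r y * (\<eta> (y + \<beta> t) - \<eta> (y + \<beta> r)) \<partial>lborel)"
        unfolding g_def drift_rate_def
        by (subst Bochner_Integration.integral_diff[OF gi[OF rT] drift_integrand_integrable[OF rT], symmetric]) (simp only: right_diff_distrib)
      moreover have "\<bar>\<integral>y. c r y * w r y * (\<eta> (y + \<beta> t) - \<eta> (y + \<beta> r)) \<partial>lborel\<bar> \<le> C * M * (Z1 * (L * (t - s) powr \<gamma>)) * (2 * R)"
      proof (rule bounded_support_integrable(2))
        have "\<bar>\<beta> t - \<beta> r\<bar> \<le> L * \<bar>t - r\<bar> powr \<gamma>" by (rule \<beta>_holder[OF rT t])
        also have "\<dots> \<le> L * (t - s) powr \<gamma>" using r \<gamma> L by (intro mult_left_mono powr_mono2) auto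
        finally have h: "\<bar>\<beta> t - \<beta> r\<bar> \<le> L * (t - s) powr \<gamma>" .
        have lip: "\<bar>\<eta> (y + \<beta> t) - \<eta> (y + \<beta> r)\<bar> \<le> Z1 * \<bar>\<beta> t - \<beta> r\<bar>" for y
          using test_function_taylor[OF \<eta>, of 0 1 Z1 "y + \<beta> r" "\<beta> t - \<beta> r"] Z1(2) by simp
        show "\<bar>c r y * w r y * (\<eta> (y + \<beta> t) - \<eta> (y + \<beta> r))\<bar> \<le> C * M * (Z1 * (L * (t - s) powr \<gamma>))" if "\<bar>y\<bar> \<le> R" for y
          unfolding abs_mult[of "c r y * w r y"] abs_mult[of "c r y"]
          using c_bound[of r y] RM(5)[OF rT that] order_trans[OF lip[of y] mult_left_mono[OF h Z1(1)]] C RM(2)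
          by (intro mult_mono) auto
        show "(\<lambda>y. c r y * w r y * (\<eta> (y + \<beta> t) - \<eta> (y + \<beta> r))) \<in> borel_measurable borel" by measurable
        show "c r y * w r y * (\<eta> (y + \<beta> t) - \<eta> (y + \<beta> r)) = 0" if "R < \<bar>y\<bar>" for y
          using RM(3)[OF t that, of 0] RM(3)[OF rT that, of 0] by simp
      qed (use RM C Z1 L in auto)
      ultimately show ?thesis by (simp add: mult_ac)
    qed
    have gI: "integrable lborel (\<lambda>r. indicator {s..<t} r * g r)"
    proof (rule bounded_support_integrable(1)[of _ T "C * M * Z * (2 * R)"])
      have "\<bar>g r\<bar> \<le> C * M * Z * (2 * R)" if r: "r \<in> {0..T}" for r
        unfolding g_def
      proof (rule bounded_support_integrable(2))
        show "\<bar>c r y * w r y * \<eta> (y + \<beta> t)\<bar> \<le> C * M * Z" if "\<bar>y\<bar> \<le> R" for y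
          unfolding abs_mult using RM(5)[OF r that] Z(2)[of "y + \<beta> t"] c_bound[of r y] C RM(2) by (intro mult_mono) auto
      qed (use RM(3)[OF t, of _ 0] RM C Z in auto)
      then show "\<bar>indicator {s..<t} r * g r\<bar> \<le> C * M * Z * (2 * R)" if "\<bar>r\<bar> \<le> T" for r
        using that st C RM Z by (auto simp: indicator_def)
    qed (use st T C RM Z in \<open>auto simp: indicator_def\<close>)
    have dI: "integrable lborel (\<lambda>r. indicator {s..<t} r * drift_rate r)" by (rule drift_rate_integrable[OF st(1,3)])
    have "\<bar>(\<integral>r. indicator {s..<t} r * g r \<partial>lborel) - drift_part s t\<bar>
       = \<bar>\<integral>r. indicator {s..<t} r * g r - indicator {s..<t} r * drift_rate r \<partial>lborel\<bar>"
      unfolding drift_part_def by (simp only: Bochner_Integration.integral_diff[OF gI dI])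
    also have "\<dots> \<le> (\<integral>r. \<bar>indicator {s..<t} r * g r - indicator {s..<t} r * drift_rate r\<bar> \<partial>lborel)"
      by (rule integral_abs_bound)
    also have "\<dots> \<le> (\<integral>r. C * M * (Z1 * L) * (2 * R) * (t - s) powr \<gamma> * indicator {s..<t} r \<partial>lborel)"
    proof (rule integral_mono)
      show "integrable lborel (\<lambda>r. C * M * (Z1 * L) * (2 * R) * (t - s) powr \<gamma> * indicator {s..<t} r)"
        using le by (intro integrable_mult_right) simp
      show "\<bar>indicator {s..<t} r * g r - indicator {s..<t} r * drift_rate r\<bar> \<le> C * M * (Z1 * L) * (2 * R) * (t - s) powr \<gamma> * indicator {s..<t} r" for r
        using diff[of r] by (cases "r \<in> {s..<t}") auto
    qed (intro integrable_abs Bochner_Integration.integrable_diff gI dI)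
    also have "\<dots> = C * M * (Z1 * L) * (2 * R) * ((t - s) powr \<gamma> * (t - s))"
      using le by (subst integral_mult_right_zero) simp
    also have "(t - s) powr \<gamma> * (t - s) = (t - s) powr (1 + \<gamma>)"
      using st by (simp add: powr_add mult.commute)
    also have "C * M * (Z1 * L) * (2 * R) * (t - s) powr (1 + \<gamma>) \<le> C * M * (Z1 * L) * (2 * R) * (T powr (1 + \<gamma> - \<kappa>) * (t - s) powr \<kappa>)"
      using powr_le_on_bounded_interval[of "t - s" T \<kappa> "1 + \<gamma>"] st \<kappa> C RM Z1 L by (intro mult_left_mono) auto
    finally have 3: "\<bar>(\<integral>r. indicator {s..<t} r * g r \<partial>lborel) - drift_part s t\<bar> \<le> A' * (t - s) powr \<kappa>"
      by (simp only: A'_def mult.assoc)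
    have "\<bar>(\<Sum>n=1..p. Y n s * geometric_lift \<beta> n s t) - (pairing s - pairing t - drift_part s t)\<bar>
       \<le> A * (t - s) powr \<kappa> + A' * (t - s) powr \<kappa>"
      using 1 2 3 by linarith
    then show ?thesis by (simp only: distrib_right)
  qed
  moreover have "0 \<le> A + A'" unfolding A'_def using A C RM Z1 L by simp
  ultimately show ?thesis unfolding p_def \<kappa>_def by blast
qed

lemma Y_rough_integral:
  assumes t: "t \<in> {0..T}"
  shows "has_rough_integral \<gamma> (geometric_lift \<beta>) Y 0 t (pairing 0 - pairing t - drift_part 0 t)"
proof -
  obtain A where A: "A \<ge> 0" "\<And>u v. 0 \<le> u \<Longrightarrow> u < v \<Longrightarrow> v \<le> T \<Longrightarrow>
     \<bar>(\<Sum>n=1..rough_level \<gamma>. Y n u * geometric_lift \<beta> n u v) - (pairing u - pairing v - drift_part u v)\<bar>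
       \<le> A * (v - u) powr ((real (rough_level \<gamma>) + 1) * \<gamma>)"
    using local_expansion by blast
  show ?thesis
    unfolding has_rough_integral_def
  proof (intro allI impI)
    fix \<epsilon> :: real assume "\<epsilon> > 0"
    then show "\<exists>\<delta>>0. \<forall>ps. partition_of 0 t ps \<and> (\<forall>i<length ps - 1. ps ! Suc i - ps ! i < \<delta>) \<longrightarrow>
      \<bar>(\<Sum>i<length ps - 1. \<Sum>n=1..rough_level \<gamma>. Y n (ps ! i) * geometric_lift \<beta> n (ps ! i) (ps ! Suc i)) - (pairing 0 - pairing t - drift_part 0 t)\<bar> < \<epsilon>"
    proof (rule partition_sum_estimate[OF rough_level_bounds(2)[OF \<gamma>(1)] A(1),
        where D = "\<lambda>u v. pairing u - pairing v - drift_part u v"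
          and J = "\<lambda>u v. \<Sum>n=1..rough_level \<gamma>. Y n u * geometric_lift \<beta> n u v", rotated 3])
      fix u v assume uv: "0 \<le> u" "u \<le> v" "v \<le> t"
      then have "drift_part 0 v = drift_part 0 u + drift_part u v" using t by (intro drift_part_add) auto
      then show "pairing 0 - pairing v - drift_part 0 v = pairing 0 - pairing u - drift_part 0 u + (pairing u - pairing v - drift_part u v)"
        by simp
    next
      show "0 \<le> t" using t by simp
      show "\<bar>(\<Sum>n=1..rough_level \<gamma>. Y n u * geometric_lift \<beta> n u v) - (pairing u - pairing v - drift_part u v)\<bar>
         \<le> A * (v - u) powr ((real (rough_level \<gamma>) + 1) * \<gamma>)" if "0 \<le> u" "u < v" "v \<le> t" for u v
        using that t by (intro A(2)) auto
    qed
  qed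
qed

lemma pairing_0: "pairing 0 = (LINT x|lebesgue. u0 x * \<eta> x)"
proof -
  have T0: "0 \<in> {0..T}" using T by simp
  have "u0 = v 0" using v_0 by auto
  then have "u0 \<in> borel_measurable borel" using borel_measurable_continuous_onI[OF v_continuous[OF T0]] by simp
  then have "(\<lambda>x. u0 x * \<eta> x) \<in> borel_measurable borel" using e_measurable[of 0] by (intro borel_measurable_times) auto
  from integral_lebesgue_eq_lborel(1)[OF this] show ?thesis by (simp add: pairing_def \<beta>_0 v_0)
qed

lemma pairing_eq: assumes "t \<in> {0..T}" shows "pairing t = (LINT x|lebesgue. u t x * \<eta> x)"
proof -
  have "continuous_on UNIV (u t)" by (intro continuous_at_imp_continuous_on ballI DERIV_isCont[OF u_deriv[OF assms]])
  then have "(\<lambda>x. u t x * \<eta> x) \<in> borel_measurable borel"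
    using borel_measurable_continuous_onI e_measurable[of 0] by (intro borel_measurable_times) auto
  from integral_lebesgue_eq_lborel(1)[OF this] have "(LINT x|lebesgue. u t x * \<eta> x) = (\<integral>x. u t x * \<eta> x \<partial>lborel)" .
  also have "\<dots> = pairing t" unfolding pairing_def by (subst shift_integral[of _ "\<beta> t"]) (simp add: u_def)
  finally show ?thesis by simp
qed

end

end

context transported_solution
begin

text \<open>The drift in the moving frame agrees with \<open>b\<close> only almost everywhere, which all integrals
  tolerate; the remaining work is the passage between Borel and Lebesgue measurability.\<close>

lemma weak_controlled_solution_u:
  assumes b: "AE r in lborel. r \<in> {0..T} \<longrightarrow> (AE x in lborel. b r x = c r (x - \<beta> r))"
  shows "weak_controlled_solution \<gamma> T (geometric_lift \<beta>) b u0 u"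
  unfolding weak_controlled_solution_def
proof (intro conjI exI[of _ Du] ballI allI impI)
  fix t and U :: "real set" assume "t \<in> {0..T}" "open U \<and> bounded U"
  then show "sobolev_W12 U (u t)" by (intro C1_sobolev[OF u_deriv Du_continuous]) auto
next
  fix t :: real assume "t \<in> {0..T}"
  then show "weak_derivative_on UNIV (u t) (Du t)" by (intro C1_weak_derivative[OF u_deriv Du_continuous]) auto
next
  fix \<eta> :: "real \<Rightarrow> real" assume \<eta>: "test_function UNIV \<eta>"
  have \<eta>m [measurable]: "\<eta> \<in> borel_measurable borel" using e_measurable[OF \<eta>, of 0] by simp
  note dm [measurable] = drift_rate_measurable[OF \<eta>]
  define k where "k r = (LINT x|lebesgue. Du r x * b r x * \<eta> x)" for r
  have inner: "integrable lebesgue (\<lambda>x. Du r x * b r x * \<eta> x) \<and> k r = drift_rate \<eta> r"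
    if r: "r \<in> {0..T}" and ae: "AE x in lborel. b r x = c r (x - \<beta> r)" for r
  proof -
    let ?h = "\<lambda>x. Du r x * c r (x - \<beta> r) * \<eta> x"
    have hm: "?h \<in> borel_measurable borel" unfolding Du_def by measurable
    have hi: "integrable lborel ?h \<and> (\<integral>x. ?h x \<partial>lborel) = drift_rate \<eta> r"
    proof
      have "integrable lborel (\<lambda>y. ?h (\<beta> r + 1 * y))"
        using drift_integrand_integrable[OF \<eta> r] by (simp add: Du_def mult.commute mult.left_commute add.commute)
      then show "integrable lborel ?h" by (subst (asm) lborel_integrable_real_affine_iff) auto
      show "(\<integral>x. ?h x \<partial>lborel) = drift_rate \<eta> r"
        unfolding drift_rate_def[OF \<eta>] by (subst shift_integral[of ?h "\<beta> r"]) (simp add: Du_def mult_ac)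
    qed
    have ae': "AE x in lebesgue. ?h x = Du r x * b r x * \<eta> x"
      by (rule AE_completion) (use ae in \<open>eventually_elim, simp\<close>)
    have hl: "?h \<in> borel_measurable lebesgue" using hm by (intro measurable_completion) simp
    have bl: "(\<lambda>x. Du r x * b r x * \<eta> x) \<in> borel_measurable lebesgue"
      by (rule borel_measurable_AE[OF hl ae'])
    have "integrable lebesgue ?h" using hi integral_lebesgue_eq_lborel(2)[OF hm] by simp
    then have "integrable lebesgue (\<lambda>x. Du r x * b r x * \<eta> x)"
      using integrable_cong_AE[OF hl bl ae'] by simp
    moreover have "k r = (LINT x|lebesgue. ?h x)"
      unfolding k_def by (rule integral_cong_AE[OF hl bl ae', symmetric])
    ultimately show ?thesis using hi integral_lebesgue_eq_lborel(1)[OF hm] by simp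
  qed
  have AEl: "AE r in lebesgue. r \<in> {0..T} \<longrightarrow> integrable lebesgue (\<lambda>x. Du r x * b r x * \<eta> x) \<and> k r = drift_rate \<eta> r"
    by (rule AE_completion) (use b in \<open>eventually_elim, use inner in blast\<close>)
  have restr: "integrable (lebesgue_on {0..t}) k \<and> (LINT r|lebesgue_on {0..t}. k r) = drift_part \<eta> 0 t"
    if t: "t \<in> {0..T}" for t
  proof -
    let ?g = "\<lambda>r. indicator {0..<t} r * drift_rate \<eta> r"
    have gm: "?g \<in> borel_measurable borel" by measurable
    have gl: "?g \<in> borel_measurable lebesgue" using gm by (intro measurable_completion) simp
    have "AE r in lebesgue. r \<noteq> t" by (rule AE_completion) (rule AE_lborel_singleton)
    with AEl have ae: "AE r in lebesgue. ?g r = indicator {0..t} r *\<^sub>R k r"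
      by eventually_elim (use t in \<open>auto simp: indicator_def\<close>)
    have kl: "(\<lambda>r. indicator {0..t} r *\<^sub>R k r) \<in> borel_measurable lebesgue"
      by (rule borel_measurable_AE[OF gl ae])
    have gi: "integrable lebesgue ?g"
      using drift_rate_integrable[OF \<eta>, of 0 t] t integral_lebesgue_eq_lborel(2)[OF gm] by simp
    then have "integrable lebesgue (\<lambda>r. indicator {0..t} r *\<^sub>R k r)"
      using integrable_cong_AE[OF gl kl ae] by simp
    moreover have "(LINT r|lebesgue. indicator {0..t} r *\<^sub>R k r) = drift_part \<eta> 0 t"
      using integral_cong_AE[OF gl kl ae] integral_lebesgue_eq_lborel(1)[OF gm] by (simp add: drift_part_def[OF \<eta>])
    ultimately show ?thesis by (simp add: integrable_restrict_space integral_restrict_space)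
  qed
  have TT: "T \<in> {0..T}" using T by simp
  show "\<exists>Y. controlled_path \<gamma> T (geometric_lift \<beta>) Y \<and>
           (\<forall>t\<in>{0..T}. Y 1 t = (LINT x|lebesgue. Du t x * \<eta> x)) \<and>
           (AE r in lebesgue_on {0..T}. integrable lebesgue (\<lambda>x. Du r x * b r x * \<eta> x)) \<and>
           integrable (lebesgue_on {0..T}) (\<lambda>r. LINT x|lebesgue. Du r x * b r x * \<eta> x) \<and>
           (\<forall>t\<in>{0..T}. \<exists>I. has_rough_integral \<gamma> (geometric_lift \<beta>) Y 0 t I \<and>
              (LINT x|lebesgue. u t x * \<eta> x)
                + (LINT r|lebesgue_on {0..t}. LINT x|lebesgue. Du r x * b r x * \<eta> x) + I
              = (LINT x|lebesgue. u0 x * \<eta> x))"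
  proof (intro exI[of _ "Y \<eta>"] conjI ballI)
    show "controlled_path \<gamma> T (geometric_lift \<beta>) (Y \<eta>)" by (rule Y_controlled[OF \<eta>])
    show "Y \<eta> 1 t = (LINT x|lebesgue. Du t x * \<eta> x)" if "t \<in> {0..T}" for t by (rule Y_1[OF \<eta> that])
    have "AE r in lebesgue. r \<in> {0..T} \<longrightarrow> integrable lebesgue (\<lambda>x. Du r x * b r x * \<eta> x)"
      using AEl by eventually_elim blast
    then show "AE r in lebesgue_on {0..T}. integrable lebesgue (\<lambda>x. Du r x * b r x * \<eta> x)"
      by (subst AE_restrict_space_iff) auto
    show "integrable (lebesgue_on {0..T}) (\<lambda>r. LINT x|lebesgue. Du r x * b r x * \<eta> x)"
      using restr[OF TT] unfolding k_def[abs_def] by blast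
    fix t assume t: "t \<in> {0..T}"
    have "(LINT r|lebesgue_on {0..t}. LINT x|lebesgue. Du r x * b r x * \<eta> x) = drift_part \<eta> 0 t"
      using restr[OF t] unfolding k_def[abs_def] by blast
    then show "\<exists>I. has_rough_integral \<gamma> (geometric_lift \<beta>) (Y \<eta>) 0 t I \<and>
              (LINT x|lebesgue. u t x * \<eta> x)
                + (LINT r|lebesgue_on {0..t}. LINT x|lebesgue. Du r x * b r x * \<eta> x) + I
              = (LINT x|lebesgue. u0 x * \<eta> x)"
      using Y_rough_integral[OF \<eta> t] pairing_0[OF \<eta>] pairing_eq[OF \<eta> t]
      by (intro exI[of _ "pairing \<eta> 0 - pairing \<eta> t - drift_part \<eta> 0 t"]) simp
  qed
qed

end

section \<open>Hoelder paths lift to geometric rough paths\<close>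

text \<open>The chaining argument: the dyadic approximations of a point from below differ by at most one
  grid step between consecutive levels, so the errors form a geometric series; two points at
  distance comparable to \<open>T/2\<^sup>l\<close> are compared on level \<open>l\<close>.\<close>

lemma dyadic_holder:
  fixes B :: "real \<Rightarrow> real"
  assumes T: "0 < T" and \<alpha>: "0 < \<alpha>" and cont: "continuous_on {0..T} B" and K: "0 \<le> K"
    and inc: "\<And>l k. k < 2 ^ l \<Longrightarrow> \<bar>B (T * real (Suc k) / 2 ^ l) - B (T * real k / 2 ^ l)\<bar> \<le> K * (2 powr - \<alpha>) ^ l"
  shows "\<exists>L\<ge>0. \<forall>s\<in>{0..T}. \<forall>t\<in>{0..T}. \<bar>B t - B s\<bar> \<le> L * \<bar>t - s\<bar> powr \<alpha>"
proof -
  define \<rho> where "\<rho> = (2::real) powr - \<alpha>"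
  have \<rho>: "0 < \<rho>" "\<rho> < 1" using \<alpha> powr_less_one[of 2 "- \<alpha>"] by (auto simp: \<rho>_def powr_minus_divide)
  note inc = inc[folded \<rho>_def]
  define j where "j l x = nat \<lfloor>x * 2 ^ l / T\<rfloor>" for l x
  define d where "d l x = T * real (j l x) / 2 ^ l" for l x
  have j: "real (j l x) \<le> x * 2 ^ l / T" "x * 2 ^ l / T < real (j l x) + 1" "j l x \<le> 2 ^ l" if "x \<in> {0..T}" for l x
  proof -
    have "real (j l x) = of_int \<lfloor>x * 2 ^ l / T\<rfloor>" using that T unfolding j_def by simp
    then show 1: "real (j l x) \<le> x * 2 ^ l / T" "x * 2 ^ l / T < real (j l x) + 1" by linarith+
    have "x * 2 ^ l / T \<le> 2 ^ l" using that T by (simp add: divide_le_eq mult_right_mono)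
    then have "real (j l x) \<le> 2 ^ l" using 1(1) by linarith
    then have "real (j l x) \<le> real (2 ^ l)" by simp
    then show "j l x \<le> 2 ^ l" by (simp only: of_nat_le_iff)
  qed
  have d: "d l x \<le> x" "x < d l x + T / 2 ^ l" "d l x \<in> {0..T}" if "x \<in> {0..T}" for l x
  proof -
    have e: "x = T * (x * 2 ^ l / T) / 2 ^ l" using T by simp
    show 1: "d l x \<le> x" unfolding d_def using j(1)[OF that, of l] T
      by (subst (2) e) (intro divide_right_mono mult_left_mono; simp)
    have "T * (x * 2 ^ l / T) / 2 ^ l < T * (real (j l x) + 1) / 2 ^ l"
      using j(2)[OF that, of l] T by (intro divide_strict_right_mono mult_strict_left_mono) auto
    then show "x < d l x + T / 2 ^ l" using e unfolding d_def by (simp add: distrib_left add_divide_distrib)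
    show "d l x \<in> {0..T}" using 1 that T by (auto simp: d_def)
  qed
  have near: "\<bar>B (T * real a / 2 ^ l) - B (T * real b / 2 ^ l)\<bar> \<le> K * \<rho> ^ l"
    if "a \<le> 2 ^ l" "b \<le> a" "a \<le> Suc b" for a b l
  proof (cases "a = b")
    case False
    then have "a = Suc b" using that by linarith
    then show ?thesis using inc[of b l] that by simp
  qed (use K \<rho> in simp)
  have step: "\<bar>B (d (Suc l) x) - B (d l x)\<bar> \<le> K * \<rho> ^ Suc l" if x: "x \<in> {0..T}" for l x
  proof -
    have e: "d l x = T * real (2 * j l x) / 2 ^ Suc l" by (simp add: d_def)
    have "real (2 * j l x) \<le> x * 2 ^ Suc l / T" "x * 2 ^ Suc l / T < real (2 * j l x) + 2"
    proof -
      have "x * 2 ^ Suc l / T = 2 * (x * 2 ^ l / T)" by simp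
      then show "real (2 * j l x) \<le> x * 2 ^ Suc l / T" "x * 2 ^ Suc l / T < real (2 * j l x) + 2"
        using j(1,2)[OF x, of l] by linarith+
    qed
    then have "real (j (Suc l) x) < real (2 * j l x) + 2" "real (2 * j l x) < real (j (Suc l) x) + 1"
      using j(1,2)[OF x, of "Suc l"] by linarith+
    then have "2 * j l x \<le> j (Suc l) x" "j (Suc l) x \<le> Suc (2 * j l x)" by linarith+
    then show ?thesis unfolding e unfolding d_def using j(3)[OF x, of "Suc l"] by (intro near)
  qed
  have chain: "\<bar>B (d (l + m) x) - B (d l x)\<bar> \<le> K / (1 - \<rho>) * (\<rho> ^ l - \<rho> ^ (l + m))" if x: "x \<in> {0..T}" for l m x
  proof (induction m)
    case (Suc m)
    have "\<bar>B (d (Suc (l + m)) x) - B (d (l + m) x)\<bar> \<le> K * \<rho> ^ Suc (l + m)" by (rule step[OF x])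
    also have "\<dots> \<le> K * \<rho> ^ (l + m)" using K \<rho> by (intro mult_left_mono power_decreasing) auto
    also have "K * \<rho> ^ (l + m) = K / (1 - \<rho>) * (\<rho> ^ (l + m) - \<rho> ^ (l + Suc m))"
      using \<rho> by (simp add: divide_simps) (simp add: algebra_simps)
    finally have "\<bar>B (d (Suc (l + m)) x) - B (d (l + m) x)\<bar> \<le> K / (1 - \<rho>) * (\<rho> ^ (l + m) - \<rho> ^ (l + Suc m))" .
    then have "\<bar>B (d (l + Suc m) x) - B (d l x)\<bar> \<le> K / (1 - \<rho>) * (\<rho> ^ (l + m) - \<rho> ^ (l + Suc m)) + K / (1 - \<rho>) * (\<rho> ^ l - \<rho> ^ (l + m))"
      using Suc by simp
    also have "\<dots> = K / (1 - \<rho>) * (\<rho> ^ l - \<rho> ^ (l + Suc m))" by (simp only: distrib_left[symmetric]) simp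
    finally show ?case .
  qed simp
  have app: "\<bar>B x - B (d l x)\<bar> \<le> K / (1 - \<rho>) * \<rho> ^ l" if x: "x \<in> {0..T}" for l x
  proof (rule LIMSEQ_le_const2)
    have "(\<lambda>m. d (l + m) x) \<longlonglongrightarrow> x"
    proof (rule tendsto_sandwich)
      have "(\<lambda>m. x - T * ((1 / 2) ^ l * (1 / 2) ^ m)) \<longlonglongrightarrow> x - T * ((1 / 2) ^ l * 0)"
        by (intro tendsto_intros LIMSEQ_realpow_zero) auto
      then show "(\<lambda>m. x - T * (1 / 2) ^ (l + m)) \<longlonglongrightarrow> x" by (simp add: power_add)
      show "eventually (\<lambda>m. x - T * (1 / 2) ^ (l + m) \<le> d (l + m) x) sequentially"
      proof (rule always_eventually, rule allI)
        fix m show "x - T * (1 / 2) ^ (l + m) \<le> d (l + m) x"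
          using d(2)[OF x, of "l + m"] by (simp add: power_one_over)
      qed
      show "eventually (\<lambda>m. d (l + m) x \<le> x) sequentially" using d(1)[OF x] by simp
    qed simp
    then have "(\<lambda>m. B (d (l + m) x)) \<longlonglongrightarrow> B x"
      by (rule continuous_on_tendsto_compose[OF cont _ x]) (use d(3)[OF x] in simp)
    then show "(\<lambda>m. \<bar>B (d (l + m) x) - B (d l x)\<bar>) \<longlonglongrightarrow> \<bar>B x - B (d l x)\<bar>" by (intro tendsto_intros)
    have "K / (1 - \<rho>) * (\<rho> ^ l - \<rho> ^ (l + m)) \<le> K / (1 - \<rho>) * \<rho> ^ l" for m
      using K \<rho> by (intro mult_left_mono) auto
    then show "\<exists>N. \<forall>m\<ge>N. \<bar>B (d (l + m) x) - B (d l x)\<bar> \<le> K / (1 - \<rho>) * \<rho> ^ l"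
      using chain[OF x, of l] order_trans by blast
  qed
  define A where "A = K + 2 * (K / (1 - \<rho>))"
  have A: "0 \<le> A" using K \<rho> by (simp add: A_def)
  define L where "L = A * (2 / T) powr \<alpha>"
  have main: "\<bar>B t - B s\<bar> \<le> L * (t - s) powr \<alpha>" if s: "s \<in> {0..T}" and t: "t \<in> {0..T}" and st: "s < t" for s t
  proof -
    have "(\<lambda>l. T * (1 / 2) ^ Suc l) \<longlonglongrightarrow> T * 0"
      by (intro tendsto_intros LIMSEQ_Suc LIMSEQ_realpow_zero) auto
    then have "eventually (\<lambda>l. T * (1 / 2) ^ Suc l < t - s) sequentially"
      by (rule order_tendstoD(2)) (use st in simp)
    then have ex: "\<exists>l. T / 2 ^ Suc l < t - s" by (auto simp: eventually_sequentially power_one_over)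
    define l where "l = (LEAST l. T / 2 ^ Suc l < t - s)"
    have l1: "T / 2 ^ Suc l < t - s" unfolding l_def by (rule LeastI_ex[OF ex])
    have l2: "t - s \<le> T / 2 ^ l"
    proof (cases l)
      case 0
      then show ?thesis using s t by simp
    next
      case (Suc l')
      then have "\<not> T / 2 ^ Suc l' < t - s" using not_less_Least[of l' "\<lambda>l. T / 2 ^ Suc l < t - s"] unfolding l_def by simp
      then show ?thesis using Suc by simp
    qed
    have "t * 2 ^ l / T \<le> s * 2 ^ l / T + 1"
    proof -
      have "(t - s) * (2 ^ l / T) \<le> T / 2 ^ l * (2 ^ l / T)" using l2 T by (intro mult_right_mono) auto
      moreover have "T / 2 ^ l * (2 ^ l / T) = 1" using T by simp
      moreover have "(t - s) * (2 ^ l / T) = t * 2 ^ l / T - s * 2 ^ l / T"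
        by (simp add: left_diff_distrib diff_divide_distrib)
      ultimately show ?thesis by linarith
    qed
    then have "real (j l t) < real (j l s) + 2" using j(1)[OF t, of l] j(2)[OF s, of l] by linarith
    moreover have "s * 2 ^ l / T \<le> t * 2 ^ l / T" using st T by (intro divide_right_mono mult_right_mono) auto
    then have "real (j l s) < real (j l t) + 1" using j(1)[OF s, of l] j(2)[OF t, of l] by linarith
    ultimately have "j l s \<le> j l t" "j l t \<le> Suc (j l s)" by linarith+
    then have "\<bar>B (d l t) - B (d l s)\<bar> \<le> K * \<rho> ^ l" unfolding d_def using j(3)[OF t] by (intro near)
    then have "\<bar>B t - B s\<bar> \<le> K * \<rho> ^ l + 2 * (K / (1 - \<rho>) * \<rho> ^ l)"
      using app[OF s, of l] app[OF t, of l] by linarith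
    also have "\<dots> = A * \<rho> ^ l" by (simp add: A_def algebra_simps)
    also have "\<rho> ^ l \<le> (2 / T * (t - s)) powr \<alpha>"
    proof -
      have "\<rho> ^ l = (1 / 2 ^ l) powr \<alpha>"
      proof -
        have "(1 / 2 ^ l :: real) = 2 powr - real l" by (simp add: powr_minus_divide powr_realpow)
        moreover have "\<rho> ^ l = \<rho> powr real l" using \<rho> by (simp add: powr_realpow)
        ultimately show ?thesis by (simp only: \<rho>_def powr_powr mult_minus_left mult_minus_right mult.commute)
      qed
      also have "(1 / 2 ^ l :: real) \<le> 2 / T * (t - s)"
      proof -
        have "2 / T * (T / 2 ^ Suc l) \<le> 2 / T * (t - s)" using l1 T by (intro mult_left_mono) auto
        then show ?thesis using T by simp
      qed
      then have "(1 / 2 ^ l) powr \<alpha> \<le> (2 / T * (t - s)) powr \<alpha>" using \<alpha> by (intro powr_mono2) auto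
      finally show ?thesis .
    qed
    then have "A * \<rho> ^ l \<le> A * (2 / T * (t - s)) powr \<alpha>" using A by (intro mult_left_mono)
    also have "(2 / T * (t - s)) powr \<alpha> = (2 / T) powr \<alpha> * (t - s) powr \<alpha>"
      by (rule powr_mult)
    finally show ?thesis by (simp add: L_def)
  qed
  have "\<bar>B t - B s\<bar> \<le> L * \<bar>t - s\<bar> powr \<alpha>" if s: "s \<in> {0..T}" and t: "t \<in> {0..T}" for s t
    using main[of s t] main[of t s] s t by (cases s t rule: linorder_cases) (auto simp: abs_minus_commute)
  moreover have "0 \<le> L" using A by (simp add: L_def)
  ultimately show ?thesis by blast
qed

lemma geometric_lift_chen:
  "geometric_lift x n s t = (\<Sum>k\<le>n. geometric_lift x (n - k) s u * geometric_lift x k u t)"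
proof -
  have "geometric_lift x n s t = ((x t - x u) + (x u - x s)) ^ n / fact n"
    by (simp add: geometric_lift_def)
  also have "\<dots> = (\<Sum>k\<le>n. of_nat (n choose k) * (x t - x u) ^ k * (x u - x s) ^ (n - k) / fact n)"
    by (simp only: binomial_ring sum_divide_distrib)
  also have "\<dots> = (\<Sum>k\<le>n. geometric_lift x (n - k) s u * geometric_lift x k u t)"
  proof (rule sum.cong[OF refl])
    fix k assume "k \<in> {..n}"
    then have "real (n choose k) = fact n / (fact k * fact (n - k))" by (simp add: binomial_fact)
    then show "of_nat (n choose k) * (x t - x u) ^ k * (x u - x s) ^ (n - k) / fact n = geometric_lift x (n - k) s u * geometric_lift x k u t"
      by (simp add: geometric_lift_def mult_ac)
  qed
  finally show ?thesis .
qed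

text \<open>In dimension one the iterated integrals are powers of the increment, by the fundamental theorem
  of calculus.\<close>

lemma canonical_lift_C1:
  assumes x: "\<And>r. (x has_real_derivative x' r) (at r)" and st: "s \<le> t"
  shows "canonical_lift x n s t = geometric_lift x n s t"
  using st
proof (induction n arbitrary: t)
  case 0
  then show ?case by (simp add: geometric_lift_def)
next
  case (Suc n)
  have "((\<lambda>r. geometric_lift x n s r * deriv x r) has_integral (geometric_lift x (Suc n) s t - geometric_lift x (Suc n) s s)) {s..t}"
  proof (rule fundamental_theorem_of_calculus[OF Suc.prems])
    fix r assume "r \<in> {s..t}"
    have dx: "deriv x r = x' r" by (rule DERIV_imp_deriv[OF x])
    have "((\<lambda>r. x r - x s) has_real_derivative x' r) (at r)"
      using DERIV_diff[OF x[of r] DERIV_const[of "x s"]] by simp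
    from DERIV_cdivide[OF DERIV_power_Suc[OF this, of n], of "fact (Suc n)"]
    have "((\<lambda>r. (x r - x s) ^ Suc n / fact (Suc n)) has_real_derivative
        (1 + real n) * (x' r * (x r - x s) ^ n) / fact (Suc n)) (at r)" by simp
    moreover have "(1 + real n) * (x' r * (x r - x s) ^ n) / fact (Suc n) = geometric_lift x n s r * deriv x r"
      unfolding dx geometric_lift_def fact_Suc of_nat_Suc by (simp add: mult.commute)
    ultimately have "(geometric_lift x (Suc n) s has_real_derivative geometric_lift x n s r * deriv x r) (at r)"
      by (simp only: geometric_lift_def[abs_def])
    then show "(geometric_lift x (Suc n) s has_vector_derivative geometric_lift x n s r * deriv x r) (at r within {s..t})"
      by (simp add: has_field_derivative_at_within has_real_derivative_iff_has_vector_derivative[symmetric])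
  qed
  then have i: "((\<lambda>r. geometric_lift x n s r * deriv x r) has_integral geometric_lift x (Suc n) s t) {s..t}"
    by (simp add: geometric_lift_def)
  have "canonical_lift x (Suc n) s t = integral {s..t} (\<lambda>r. geometric_lift x n s r * deriv x r)"
    unfolding canonical_lift.simps by (rule integral_cong) (simp add: Suc.IH)
  then show ?case using integral_unique[OF i] by simp
qed

lemma power_diff_bound:
  fixes a b :: real
  assumes "\<bar>a\<bar> \<le> Q" "\<bar>b\<bar> \<le> Q"
  shows "\<bar>a ^ Suc n - b ^ Suc n\<bar> \<le> real (Suc n) * Q ^ n * \<bar>a - b\<bar>"
proof (induction n)
  case (Suc n)
  have Q: "0 \<le> Q" using assms by linarith
  have "a ^ Suc (Suc n) - b ^ Suc (Suc n) = a * (a ^ Suc n - b ^ Suc n) + (a - b) * b ^ Suc n" by (simp add: algebra_simps)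
  then have "\<bar>a ^ Suc (Suc n) - b ^ Suc (Suc n)\<bar> \<le> \<bar>a\<bar> * \<bar>a ^ Suc n - b ^ Suc n\<bar> + \<bar>a - b\<bar> * \<bar>b\<bar> ^ Suc n"
    by (simp add: abs_triangle_ineq[THEN order_trans] abs_mult power_abs del: power_Suc)
  also have "\<dots> \<le> Q * (real (Suc n) * Q ^ n * \<bar>a - b\<bar>) + \<bar>a - b\<bar> * Q ^ Suc n"
    using Suc assms Q by (intro add_mono mult_mono power_mono) auto
  also have "\<dots> = real (Suc (Suc n)) * Q ^ Suc n * \<bar>a - b\<bar>" by (simp add: algebra_simps)
  finally show ?case .
qed simp

text \<open>The moving average over \<open>[t, t + \<epsilon>]\<close> is \<open>C\<^sup>1\<close>, keeps the \<open>\<alpha>\<close>-Hoelder constant, and is uniformly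
  \<open>\<epsilon>\<^sup>\<alpha>\<close>-close to the path. Using the first bound on intervals shorter than \<open>\<epsilon>\<close> and the second one on
  longer intervals, the increments are \<open>\<epsilon>\<^sup>\<alpha>\<^sup>-\<^sup>\<gamma>\<close>-close in the \<open>\<gamma>\<close>-Hoelder norm, and so are their powers.\<close>

lemma holder_geometric_rough_path:
  fixes \<beta> :: "real \<Rightarrow> real"
  assumes T: "0 < T" and \<gamma>: "0 < \<gamma>" "\<gamma> < \<alpha>" and L: "0 \<le> L"
    and holder: "\<And>s t. \<bar>\<beta> t - \<beta> s\<bar> \<le> L * \<bar>t - s\<bar> powr \<alpha>" and cont: "continuous_on UNIV \<beta>"
  shows "geometric_rough_path \<gamma> T (geometric_lift \<beta>)"
proof -
  define Q where "Q = L * T powr (\<alpha> - \<gamma>)"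
  have Q: "0 \<le> Q" using L by (simp add: Q_def)
  have to_\<gamma>: "\<bar>x\<bar> \<le> Q * (t - s) powr \<gamma>" if "\<bar>x\<bar> \<le> L * (t - s) powr \<alpha>" "0 \<le> s" "s < t" "t \<le> T" for x s t
  proof -
    have "L * (t - s) powr \<alpha> \<le> L * (T powr (\<alpha> - \<gamma>) * (t - s) powr \<gamma>)"
      using that \<gamma> L by (intro mult_left_mono powr_le_on_bounded_interval) auto
    then show ?thesis using that(1) by (simp add: Q_def)
  qed
  have pw: "((t - s) powr \<gamma>) ^ n = (t - s) powr (real n * \<gamma>)" if "s < t" for s t n
    using that by (simp add: powr_powr mult.commute flip: powr_realpow)
  have \<beta>Q: "\<bar>\<beta> t - \<beta> s\<bar> \<le> Q * (t - s) powr \<gamma>" if "0 \<le> s" "s < t" "t \<le> T" for s t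
    using holder[of t s] that by (intro to_\<gamma>) auto
  have rp: "rough_path \<gamma> T (geometric_lift \<beta>)"
    unfolding rough_path_def
  proof (intro conjI allI impI ballI)
    show "geometric_lift \<beta> 0 s t = 1" for s t by (simp add: geometric_lift_def)
    show "geometric_lift \<beta> n s t = (\<Sum>k\<le>n. geometric_lift \<beta> (n - k) s u * geometric_lift \<beta> k u t)" for n s u t
      by (rule geometric_lift_chen)
    fix n assume "n \<in> {1..rough_level \<gamma>}"
    have "\<bar>geometric_lift \<beta> n s t\<bar> \<le> Q ^ n * (t - s) powr (real n * \<gamma>)" if st: "0 \<le> s" "s < t" "t \<le> T" for s t
    proof -
      have "\<bar>geometric_lift \<beta> n s t\<bar> = \<bar>\<beta> t - \<beta> s\<bar> ^ n / fact n" by (simp add: geometric_lift_def power_abs)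
      also have "\<dots> \<le> \<bar>\<beta> t - \<beta> s\<bar> ^ n / 1" by (rule divide_left_mono) (auto simp: fact_ge_1)
      also have "\<dots> \<le> (Q * (t - s) powr \<gamma>) ^ n / 1" using \<beta>Q[OF st] by (simp add: power_mono)
      finally show ?thesis by (simp add: power_mult_distrib pw[OF st(2)])
    qed
    then show "\<exists>C. \<forall>s t. 0 \<le> s \<and> s < t \<and> t \<le> T \<longrightarrow> \<bar>geometric_lift \<beta> n s t\<bar> \<le> C * (t - s) powr (real n * \<gamma>)"
      by blast
  qed
  have "\<exists>F. \<forall>x. -\<infinity> < ereal x \<longrightarrow> ereal x < \<infinity> \<longrightarrow> (F has_vector_derivative \<beta> x) (at x)"
    using einterval_antiderivative[of "-\<infinity>" "\<infinity>" \<beta>] cont by (auto simp: continuous_on_eq_continuous_at)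
  then obtain \<Phi> where \<Phi>: "\<And>x. (\<Phi> has_real_derivative \<beta> x) (at x)"
    by (auto simp: has_real_derivative_iff_has_vector_derivative)
  \<comment> \<open>The average of \<open>\<beta>\<close> over \<open>[t, t + \<epsilon>]\<close>, written with an antiderivative.\<close>
  define xe where "xe \<epsilon> t = (\<Phi> (t + \<epsilon>) - \<Phi> t) / \<epsilon>" for \<epsilon> t
  have xe_deriv: "(xe \<epsilon> has_real_derivative (\<beta> (t + \<epsilon>) - \<beta> t) / \<epsilon>) (at t)" for \<epsilon> t
    unfolding xe_def[abs_def] by (intro DERIV_cdivide DERIV_diff \<Phi> DERIV_shift[THEN iffD1, OF \<Phi>])
  have xe_inc: "\<bar>xe \<epsilon> t - xe \<epsilon> s\<bar> \<le> L * \<bar>t - s\<bar> powr \<alpha>" if \<epsilon>: "\<epsilon> > 0" for \<epsilon> s t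
  proof -
    let ?\<psi> = "\<lambda>r. \<Phi> (t + r) - \<Phi> (s + r)"
    have "(?\<psi> has_real_derivative \<beta> (t + r) - \<beta> (s + r)) (at r)" for r
      by (auto intro!: derivative_eq_intros DERIV_chain2[OF \<Phi>])
    then obtain z where "?\<psi> \<epsilon> - ?\<psi> 0 = (\<epsilon> - 0) * (\<beta> (t + z) - \<beta> (s + z))"
      using MVT2[OF \<epsilon>, of ?\<psi> "\<lambda>r. \<beta> (t + r) - \<beta> (s + r)"] by auto
    then have "xe \<epsilon> t - xe \<epsilon> s = \<beta> (t + z) - \<beta> (s + z)"
    proof -
      have "xe \<epsilon> t - xe \<epsilon> s = (?\<psi> \<epsilon> - ?\<psi> 0) / \<epsilon>" by (simp add: xe_def diff_divide_distrib)
      also have "\<dots> = \<beta> (t + z) - \<beta> (s + z)" unfolding \<open>?\<psi> \<epsilon> - ?\<psi> 0 = _\<close> using \<epsilon> by simp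
      finally show ?thesis .
    qed
    then show ?thesis using holder[of "t + z" "s + z"] by simp
  qed
  have xe_close: "\<bar>xe \<epsilon> t - \<beta> t\<bar> \<le> L * \<epsilon> powr \<alpha>" if \<epsilon>: "\<epsilon> > 0" for \<epsilon> t
  proof -
    obtain z where z: "t < z" "z < t + \<epsilon>" "\<Phi> (t + \<epsilon>) - \<Phi> t = (t + \<epsilon> - t) * \<beta> z"
      using MVT2[of t "t + \<epsilon>" \<Phi> \<beta>] \<Phi> \<epsilon> by auto
    then have "xe \<epsilon> t = \<beta> z" using \<epsilon> by (simp add: xe_def)
    then have "\<bar>xe \<epsilon> t - \<beta> t\<bar> \<le> L * \<bar>z - t\<bar> powr \<alpha>" using holder[of z t] by simp
    also have "\<dots> \<le> L * \<epsilon> powr \<alpha>" using z \<gamma> L by (intro mult_left_mono powr_mono2) auto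
    finally show ?thesis .
  qed
  have diff: "\<bar>(xe \<epsilon> t - xe \<epsilon> s) - (\<beta> t - \<beta> s)\<bar> \<le> 2 * L * \<epsilon> powr (\<alpha> - \<gamma>) * (t - s) powr \<gamma>"
    if \<epsilon>: "\<epsilon> > 0" and st: "s < t" for \<epsilon> s t
  proof (cases "t - s \<le> \<epsilon>")
    case True
    have "\<bar>(xe \<epsilon> t - xe \<epsilon> s) - (\<beta> t - \<beta> s)\<bar> \<le> 2 * L * (t - s) powr \<alpha>"
      using xe_inc[OF \<epsilon>, of t s] holder[of t s] st by simp
    also have "\<dots> \<le> 2 * L * (\<epsilon> powr (\<alpha> - \<gamma>) * (t - s) powr \<gamma>)"
      using True st \<gamma> L by (intro mult_left_mono powr_le_on_bounded_interval) auto
    finally show ?thesis by (simp add: mult.assoc)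
  next
    case False
    have "\<bar>(xe \<epsilon> t - xe \<epsilon> s) - (\<beta> t - \<beta> s)\<bar> \<le> 2 * L * \<epsilon> powr \<alpha>"
      using xe_close[OF \<epsilon>, of t] xe_close[OF \<epsilon>, of s] by linarith
    also have "\<epsilon> powr \<alpha> = \<epsilon> powr (\<alpha> - \<gamma>) * \<epsilon> powr \<gamma>" by (simp flip: powr_add)
    also have "2 * L * (\<epsilon> powr (\<alpha> - \<gamma>) * \<epsilon> powr \<gamma>) \<le> 2 * L * (\<epsilon> powr (\<alpha> - \<gamma>) * (t - s) powr \<gamma>)"
      using False \<epsilon> \<gamma> L by (intro mult_left_mono powr_mono2) auto
    finally show ?thesis by (simp add: mult.assoc)
  qed
  define p where "p = rough_level \<gamma>"
  define S where "S = (\<Sum>n=1..p. real n * Q ^ (n - 1) * (2 * L))"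
  have S: "0 \<le> S" unfolding S_def using Q L by (intro sum_nonneg) auto
  have dist: "rough_dist \<gamma> T (geometric_lift \<beta>) (canonical_lift (xe \<epsilon>)) \<le> ennreal (S * \<epsilon> powr (\<alpha> - \<gamma>))" if \<epsilon>: "\<epsilon> > 0" for \<epsilon>
  proof -
    have one: "\<bar>geometric_lift \<beta> n s t - canonical_lift (xe \<epsilon>) n s t\<bar> / (t - s) powr (real n * \<gamma>) \<le> real n * Q ^ (n - 1) * (2 * L) * \<epsilon> powr (\<alpha> - \<gamma>)"
      if n: "n \<in> {1..p}" and st: "0 \<le> s" "s < t" "t \<le> T" for n s t
    proof -
      obtain m where m: "n = Suc m" using n by (cases n) auto
      let ?a = "\<beta> t - \<beta> s" and ?b = "xe \<epsilon> t - xe \<epsilon> s"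
      have "geometric_lift \<beta> n s t - canonical_lift (xe \<epsilon>) n s t = (?a ^ n - ?b ^ n) / fact n"
        using canonical_lift_C1[OF xe_deriv, of s t \<epsilon> n] st by (simp add: geometric_lift_def diff_divide_distrib)
      then have "\<bar>geometric_lift \<beta> n s t - canonical_lift (xe \<epsilon>) n s t\<bar> = \<bar>?a ^ n - ?b ^ n\<bar> / fact n" by simp
      also have "\<dots> \<le> \<bar>?a ^ n - ?b ^ n\<bar> / 1" by (rule divide_left_mono) (auto simp: fact_ge_1)
      also have "\<bar>?a ^ n - ?b ^ n\<bar> / 1 \<le> real n * (Q * (t - s) powr \<gamma>) ^ m * \<bar>?a - ?b\<bar>"
        unfolding m div_by_1
        by (rule power_diff_bound[OF \<beta>Q[OF st] to_\<gamma>[OF _ st]]) (use xe_inc[OF \<epsilon>, of t s] st in simp)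
      also have "\<dots> \<le> real n * (Q * (t - s) powr \<gamma>) ^ m * (2 * L * \<epsilon> powr (\<alpha> - \<gamma>) * (t - s) powr \<gamma>)"
        using diff[OF \<epsilon> st(2)] Q by (intro mult_left_mono) (auto simp: abs_minus_commute)
      also have "\<dots> = real n * Q ^ (n - 1) * (2 * L) * \<epsilon> powr (\<alpha> - \<gamma>) * ((t - s) powr \<gamma>) ^ n"
        by (simp add: m power_mult_distrib mult_ac)
      finally show ?thesis using st by (simp add: pw[OF st(2)] divide_le_eq)
    qed
    have "rough_dist \<gamma> T (geometric_lift \<beta>) (canonical_lift (xe \<epsilon>)) \<le> (\<Sum>n=1..p. ennreal (real n * Q ^ (n - 1) * (2 * L) * \<epsilon> powr (\<alpha> - \<gamma>)))"
      unfolding rough_dist_def p_def[symmetric]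
      by (intro sum_mono SUP_least) (use one in \<open>auto intro!: ennreal_leI\<close>)
    also have "\<dots> = ennreal (S * \<epsilon> powr (\<alpha> - \<gamma>))"
      unfolding S_def using Q L by (subst sum_ennreal) (auto simp: sum_distrib_right)
    finally show ?thesis .
  qed
  show ?thesis
    unfolding geometric_rough_path_def
  proof (intro conjI rp allI impI)
    fix e :: ennreal assume e: "e > 0"
    obtain e0 :: real where e0: "0 < e0" "ennreal e0 < e"
    proof -
      obtain y where y: "0 < y" "y < e" using dense[OF e] by blast
      then have "y < \<top>" by (auto simp: top.not_eq_extremum order_less_le_trans)
      then have "y = ennreal (enn2real y)" "0 < enn2real y" using y(1) by (auto simp: enn2real_positive_iff)
      then show ?thesis using that[of "enn2real y"] y(2) by auto
    qed
    define \<epsilon> where "\<epsilon> = (e0 / (S + 1)) powr (1 / (\<alpha> - \<gamma>))"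
    have \<epsilon>: "\<epsilon> > 0" using e0 S by (simp add: \<epsilon>_def)
    have "\<epsilon> powr (\<alpha> - \<gamma>) = e0 / (S + 1)" unfolding \<epsilon>_def using e0 S \<gamma> by (simp add: powr_powr)
    then have "S * \<epsilon> powr (\<alpha> - \<gamma>) = e0 * (S / (S + 1))" by simp
    also have "\<dots> \<le> e0 * 1" using e0 S by (intro mult_left_mono) auto
    finally have "ennreal (S * \<epsilon> powr (\<alpha> - \<gamma>)) \<le> ennreal e0" by (simp add: ennreal_leI)
    then have "rough_dist \<gamma> T (geometric_lift \<beta>) (canonical_lift (xe \<epsilon>)) < e"
      using order_trans[OF dist[OF \<epsilon>]] e0(2) by (blast intro: le_less_trans)
    moreover have "xe \<epsilon> C1_differentiable_on {0..T}"
      unfolding C1_differentiable_on_def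
    proof (intro exI[of _ "\<lambda>t. (\<beta> (t + \<epsilon>) - \<beta> t) / \<epsilon>"] conjI ballI)
      show "(xe \<epsilon> has_vector_derivative (\<beta> (t + \<epsilon>) - \<beta> t) / \<epsilon>) (at t)" for t
        using xe_deriv by (simp add: has_real_derivative_iff_has_vector_derivative)
      show "continuous_on {0..T} (\<lambda>t. (\<beta> (t + \<epsilon>) - \<beta> t) / \<epsilon>)"
        using \<epsilon> by (intro continuous_intros continuous_on_compose2[OF cont] continuous_on_subset[OF cont]) auto
    qed
    ultimately show "\<exists>x. x C1_differentiable_on {0..T} \<and> rough_dist \<gamma> T (geometric_lift \<beta>) (canonical_lift x) < e" by blast
  qed
qed

section \<open>Regular versions of the drift and of the noise\<close>

text \<open>Modify \<open>b\<close> on a null set to a Borel function, cut it off at its essential bound and outside \<open>[0,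
  T]\<close>, and discard the null set of times at which it is not integrable in space. The mixed norm
  dominates the \<open>L\<^sup>1\<close> norm on \<open>[0, T] \<times> \<real>\<close> up to the factor \<open>T\<close>, so Fubini shows that these times are
  negligible.\<close>

lemma borel_version_of_drift:
  fixes b :: "real \<Rightarrow> real \<Rightarrow> real"
  assumes T: "0 < T" and Linf: "drift_Linf T b" and L1: "drift_L1_Linf T b"
  obtains bt :: "real \<Rightarrow> real \<Rightarrow> real" and Cb where
    "case_prod bt \<in> borel_measurable (borel \<Otimes>\<^sub>M borel)" "\<And>r x. \<bar>bt r x\<bar> \<le> Cb"
    "\<And>r. integrable lborel (bt r)" "integrable lborel (\<lambda>r. \<integral>x. \<bar>bt r x\<bar> \<partial>lborel)"
    "AE r in lborel. r \<in> {0..T} \<longrightarrow> (AE x in lborel. b r x = bt r x)"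
proof -
  define S where "S = {0..T} \<times> (UNIV :: real set)"
  have S_borel: "S \<in> sets borel" unfolding S_def by (intro borel_closed closed_Times) auto
  then have S_leb: "S \<in> sets lebesgue" by simp
  obtain C where C: "AE z in lebesgue_on S. \<bar>b (fst z) (snd z)\<bar> \<le> C"
    using Linf unfolding drift_Linf_def S_def by blast
  have "(\<lambda>z. indicator S z *\<^sub>R b (fst z) (snd z)) \<in> borel_measurable lebesgue"
    using Linf S_leb unfolding drift_Linf_def S_def[symmetric] by (subst (asm) borel_measurable_restrict_space_iff) auto
  then obtain g where g: "g \<in> borel_measurable lborel" "AE z in lborel. indicator S z *\<^sub>R b (fst z) (snd z) = g z"
    using completion_ex_borel_measurable_real by blast
  define g' where "g' z = indicator S z * max (- \<bar>C\<bar>) (min \<bar>C\<bar> (g z))" for z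
  have g'm: "g' \<in> borel_measurable borel"
    using g(1) S_borel unfolding g'_def by (intro borel_measurable_times borel_measurable_max borel_measurable_min borel_measurable_indicator) auto
  then have g'm2 [measurable]: "g' \<in> borel_measurable (borel \<Otimes>\<^sub>M borel)" by (simp add: borel_prod)
  have "AE z in lebesgue. z \<in> S \<longrightarrow> \<bar>b (fst z) (snd z)\<bar> \<le> C"
    using C S_leb by (subst (asm) AE_restrict_space_iff) auto
  then have "AE z in lborel. z \<in> S \<longrightarrow> \<bar>b (fst z) (snd z)\<bar> \<le> C" by (simp add: AE_completion_iff)
  with g(2) have "AE z in lborel. z \<in> S \<longrightarrow> b (fst z) (snd z) = g' z"
    by eventually_elim (auto simp: g'_def)
  then have "AE z in lborel \<Otimes>\<^sub>M lborel. z \<in> S \<longrightarrow> b (fst z) (snd z) = g' z" by (simp only: lborel_prod)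
  then have ae: "AE r in lborel. AE x in lborel. (r, x) \<in> S \<longrightarrow> b r x = g' (r, x)"
    using lborel_pair.AE_pair by fastforce
  have ae_swap: "AE x in lborel. AE r in lborel. (r, x) \<in> S \<longrightarrow> b r x = g' (r, x)"
  proof -
    have "AE z in lborel \<Otimes>\<^sub>M lborel. (\<lambda>(x, y). (y, x)) z \<in> S \<longrightarrow> b (fst ((\<lambda>(x, y). (y, x)) z)) (snd ((\<lambda>(x, y). (y, x)) z)) = g' ((\<lambda>(x, y). (y, x)) z)"
      using \<open>AE z in lborel \<Otimes>\<^sub>M lborel. z \<in> S \<longrightarrow> b (fst z) (snd z) = g' z\<close>
      by (subst (asm) lborel_pair.distr_pair_swap) (auto dest: AE_distrD[rotated])
    then show ?thesis using lborel_pair.AE_pair by fastforce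
  qed
  have g'b: "\<bar>g' z\<bar> \<le> \<bar>C\<bar>" for z by (auto simp: g'_def indicator_def)
  define F where "F x = esssup (lebesgue_on {0..T}) (\<lambda>t. ennreal \<bar>b t x\<bar>)" for x
  have F: "(\<integral>\<^sup>+x. F x \<partial>lebesgue) < \<infinity>" using L1 unfolding drift_L1_Linf_def F_def .
  define h where "h x = (\<integral>\<^sup>+r. ennreal \<bar>g' (r, x)\<bar> \<partial>lborel)" for x
  have hm [measurable]: "h \<in> borel_measurable borel" unfolding h_def by measurable
  have hF: "AE x in lborel. ennreal (1 / T) * h x \<le> F x"
    using ae_swap
  proof eventually_elim
    case (elim x)
    have "AE t in lebesgue_on {0..T}. ennreal \<bar>b t x\<bar> \<le> F x" unfolding F_def by (rule esssup_AE)
    then have "AE t in lebesgue. t \<in> {0..T} \<longrightarrow> ennreal \<bar>b t x\<bar> \<le> F x" by (subst (asm) AE_restrict_space_iff) auto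
    then have "AE t in lborel. t \<in> {0..T} \<longrightarrow> ennreal \<bar>b t x\<bar> \<le> F x" by (simp add: AE_completion_iff)
    with elim have "AE t in lborel. ennreal \<bar>g' (t, x)\<bar> \<le> F x * indicator {0..T} t"
      by eventually_elim (auto simp: S_def g'_def indicator_def)
    then have "h x \<le> (\<integral>\<^sup>+t. F x * indicator {0..T} t \<partial>lborel)" unfolding h_def by (rule nn_integral_mono_AE)
    also have "\<dots> = F x * ennreal T" using T by (subst nn_integral_cmult_indicator) auto
    finally have "ennreal (1 / T) * h x \<le> ennreal (1 / T) * (F x * ennreal T)" by (rule mult_left_mono) simp
    also have "\<dots> = F x * (ennreal (1 / T) * ennreal T)" by (simp only: mult_ac)
    also have "ennreal (1 / T) * ennreal T = 1" using T by (simp flip: ennreal_mult')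
    finally show ?case by simp
  qed
  have "(\<integral>\<^sup>+x. ennreal (1 / T) * h x \<partial>lebesgue) \<le> (\<integral>\<^sup>+x. F x \<partial>lebesgue)"
    by (rule nn_integral_mono_AE) (rule AE_completion[OF hF])
  also have "(\<integral>\<^sup>+x. ennreal (1 / T) * h x \<partial>lebesgue) = (\<integral>\<^sup>+x. ennreal (1 / T) * h x \<partial>lborel)"
    by (rule nn_integral_completion)
  also have "\<dots> = ennreal (1 / T) * (\<integral>\<^sup>+x. h x \<partial>lborel)" by (rule nn_integral_cmult) simp
  finally have "ennreal (1 / T) * (\<integral>\<^sup>+x. h x \<partial>lborel) < \<infinity>" using F by (rule le_less_trans)
  then have "(\<integral>\<^sup>+x. h x \<partial>lborel) < \<infinity>" using T by (auto simp: ennreal_mult_less_top)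
  moreover have "(\<integral>\<^sup>+x. h x \<partial>lborel) = (\<integral>\<^sup>+z. ennreal \<bar>g' z\<bar> \<partial>(lborel \<Otimes>\<^sub>M lborel))"
    unfolding h_def by (subst lborel_pair.nn_integral_snd[symmetric]) auto
  ultimately have g'i: "integrable (lborel \<Otimes>\<^sub>M lborel) (\<lambda>(r, x). g' (r, x))"
    by (intro integrableI_bounded) (auto simp: split_beta')
  have AEi: "AE r in lborel. integrable lborel (\<lambda>x. g' (r, x))"
    using lborel_pair.AE_integrable_fst[OF g'i] .
  define bt where "bt r x = (if integrable lborel (\<lambda>x. g' (r, x)) then g' (r, x) else 0)" for r x
  have "Measurable.pred borel (\<lambda>r. integrable lborel (\<lambda>x. g' (r, x)))" by measurable
  then have bt1: "case_prod bt \<in> borel_measurable (borel \<Otimes>\<^sub>M borel)" unfolding bt_def by measurable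
  have bt2: "\<bar>bt r x\<bar> \<le> \<bar>C\<bar>" for r x using g'b by (simp add: bt_def)
  have bt3: "integrable lborel (bt r)" for r
    by (cases "integrable lborel (\<lambda>x. g' (r, x))") (simp_all add: bt_def[abs_def])
  have "integrable (lborel \<Otimes>\<^sub>M lborel) (\<lambda>(r, x). \<bar>g' (r, x)\<bar>)" using integrable_abs[OF g'i] by (simp add: split_beta')
  from lborel_pair.integrable_fst[OF this] have i4: "integrable lborel (\<lambda>r. \<integral>x. \<bar>g' (r, x)\<bar> \<partial>lborel)" .
  have bt4: "integrable lborel (\<lambda>r. \<integral>x. \<bar>bt r x\<bar> \<partial>lborel)"
  proof (rule integrable_cong_AE_imp[OF i4])
    show "(\<lambda>r. \<integral>x. \<bar>bt r x\<bar> \<partial>lborel) \<in> borel_measurable lborel" using bt1 by measurable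
    show "AE r in lborel. (\<integral>x. \<bar>g' (r, x)\<bar> \<partial>lborel) = (\<integral>x. \<bar>bt r x\<bar> \<partial>lborel)"
      using AEi by eventually_elim (simp add: bt_def)
  qed
  have bt5: "AE r in lborel. r \<in> {0..T} \<longrightarrow> (AE x in lborel. b r x = bt r x)"
    using ae AEi by eventually_elim (auto simp: S_def bt_def)
  show ?thesis by (rule that[OF bt1 bt2 bt3 bt4 bt5])
qed

text \<open>Needed because the covariance is given by Bochner integrals, which carry information only for
  integrable functions.\<close>

lemma gaussian_rv_square_integrable:
  assumes "prob_space M" "gaussian_rv M Z"
  shows "integrable M (\<lambda>\<omega>. (Z \<omega>)\<^sup>2)" "Z \<in> borel_measurable M"
proof -
  interpret prob_space M by fact
  show Zm [measurable]: "Z \<in> borel_measurable M" using assms(2) by (simp add: gaussian_rv_def)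
  from assms(2) obtain \<mu> \<sigma> where "(\<sigma> = 0 \<and> (AE \<omega> in M. Z \<omega> = \<mu>)) \<or> (\<sigma> > 0 \<and> distributed M lborel Z (\<lambda>x. ennreal (normal_density \<mu> \<sigma> x)))"
    unfolding gaussian_rv_def by blast
  then show "integrable M (\<lambda>\<omega>. (Z \<omega>)\<^sup>2)"
  proof
    assume *: "\<sigma> = 0 \<and> (AE \<omega> in M. Z \<omega> = \<mu>)"
    then have "AE \<omega> in M. \<mu>\<^sup>2 = (Z \<omega>)\<^sup>2" by auto
    moreover have "(\<lambda>\<omega>. (Z \<omega>)\<^sup>2) \<in> borel_measurable M" by measurable
    ultimately show ?thesis by (rule integrable_cong_AE_imp[OF integrable_const, rotated])
  next
    assume *: "\<sigma> > 0 \<and> distributed M lborel Z (\<lambda>x. ennreal (normal_density \<mu> \<sigma> x))"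
    then have i: "integrable lborel (\<lambda>x. normal_density \<mu> \<sigma> x * (x - \<mu>) ^ (2 * 1))" "integrable lborel (normal_density \<mu> \<sigma>)"
      using normal_moment_even[of \<sigma> \<mu> 1] by (blast intro: integrable.intros integrable_normal_density)+
    have "integrable lborel (\<lambda>x. normal_density \<mu> \<sigma> x * (2 * (x - \<mu>)\<^sup>2 + 2 * \<mu>\<^sup>2))"
    proof -
      have "integrable lborel (\<lambda>x. 2 * (normal_density \<mu> \<sigma> x * (x - \<mu>) ^ (2 * 1)) + 2 * \<mu>\<^sup>2 * normal_density \<mu> \<sigma> x)"
        by (intro Bochner_Integration.integrable_add integrable_mult_right i)
      moreover have "2 * (normal_density \<mu> \<sigma> x * (x - \<mu>) ^ (2 * 1)) + 2 * \<mu>\<^sup>2 * normal_density \<mu> \<sigma> x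
        = normal_density \<mu> \<sigma> x * (2 * (x - \<mu>)\<^sup>2 + 2 * \<mu>\<^sup>2)" for x
        unfolding distrib_left by simp
      ultimately show ?thesis by (simp only:)
    qed
    then have "integrable lborel (\<lambda>x. normal_density \<mu> \<sigma> x * x\<^sup>2)"
    proof (rule Bochner_Integration.integrable_bound)
      show "AE x in lborel. norm (normal_density \<mu> \<sigma> x * x\<^sup>2) \<le> norm (normal_density \<mu> \<sigma> x * (2 * (x - \<mu>)\<^sup>2 + 2 * \<mu>\<^sup>2))"
      proof (rule AE_I2)
        fix x
        have "0 \<le> (x - 2 * \<mu>)\<^sup>2" by simp
        then have "x\<^sup>2 \<le> 2 * (x - \<mu>)\<^sup>2 + 2 * \<mu>\<^sup>2" by (simp add: power2_eq_square algebra_simps)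
        then have "normal_density \<mu> \<sigma> x * x\<^sup>2 \<le> normal_density \<mu> \<sigma> x * (2 * (x - \<mu>)\<^sup>2 + 2 * \<mu>\<^sup>2)" by (intro mult_left_mono) auto
        then show "norm (normal_density \<mu> \<sigma> x * x\<^sup>2) \<le> norm (normal_density \<mu> \<sigma> x * (2 * (x - \<mu>)\<^sup>2 + 2 * \<mu>\<^sup>2))" by simp
      qed
    qed measurable
    then show ?thesis
      using distributed_integrable[of M lborel Z "normal_density \<mu> \<sigma>" "\<lambda>x. x\<^sup>2"] * by simp
  qed
qed

text \<open>The increment is a linear combination of values of the process, hence Gaussian; its mean
  vanishes and its variance comes from the covariance. Since the variance is positive, the
  degenerate case is excluded.\<close>

lemma fbm_increment:
  assumes fbm: "fractional_brownian_motion M H T B" and H: "0 < H" and st: "s \<in> {0..T}" "t \<in> {0..T}" "s \<noteq> t"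
  shows "distributed M lborel (\<lambda>\<omega>. B t \<omega> - B s \<omega>) (\<lambda>x. ennreal (normal_density 0 (\<bar>t - s\<bar> powr H) x))"
proof -
  interpret prob_space M using fbm by (simp add: fractional_brownian_motion_def)
  have gp: "gaussian_process M {0..T} B" and mean: "\<And>t. t \<in> {0..T} \<Longrightarrow> expectation (B t) = 0"
    and cov: "\<And>s t. s \<in> {0..T} \<Longrightarrow> t \<in> {0..T} \<Longrightarrow> expectation (\<lambda>\<omega>. B s \<omega> * B t \<omega>) = (t powr (2 * H) + s powr (2 * H) - \<bar>t - s\<bar> powr (2 * H)) / 2"
    using fbm by (auto simp: fractional_brownian_motion_def)
  have "gaussian_rv M (\<lambda>\<omega>. \<Sum>r\<in>{t}. 1 * B r \<omega>)" if "t \<in> {0..T}" for t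
    using gp[unfolded gaussian_process_def, rule_format, of "{t}" "\<lambda>_. 1"] that by blast
  then have g1: "gaussian_rv M (B t)" if "t \<in> {0..T}" for t using that by simp
  have sq: "integrable M (\<lambda>\<omega>. (B t \<omega>)\<^sup>2)" and Bm: "B t \<in> borel_measurable M" if "t \<in> {0..T}" for t
    using gaussian_rv_square_integrable[OF prob_space_axioms g1[OF that]] by auto
  have i1: "integrable M (B t)" if "t \<in> {0..T}" for t
    by (rule square_integrable_imp_integrable[OF Bm[OF that] sq[OF that]])
  have prod: "integrable M (\<lambda>\<omega>. B s \<omega> * B t \<omega>)" if "s \<in> {0..T}" "t \<in> {0..T}" for s t
  proof (rule Bochner_Integration.integrable_bound[OF Bochner_Integration.integrable_add[OF sq[OF that(1)] sq[OF that(2)]]])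
    show "(\<lambda>\<omega>. B s \<omega> * B t \<omega>) \<in> borel_measurable M" using Bm that by (intro borel_measurable_times)
    show "AE \<omega> in M. norm (B s \<omega> * B t \<omega>) \<le> norm ((B s \<omega>)\<^sup>2 + (B t \<omega>)\<^sup>2)"
    proof (rule AE_I2)
      fix \<omega>
      have "0 \<le> (\<bar>B s \<omega>\<bar> - \<bar>B t \<omega>\<bar>)\<^sup>2" by simp
      then have "2 * (\<bar>B s \<omega>\<bar> * \<bar>B t \<omega>\<bar>) \<le> (B s \<omega>)\<^sup>2 + (B t \<omega>)\<^sup>2" unfolding power2_diff power2_abs by linarith
      moreover have "0 \<le> \<bar>B s \<omega>\<bar> * \<bar>B t \<omega>\<bar>" by simp
      ultimately show "norm (B s \<omega> * B t \<omega>) \<le> norm ((B s \<omega>)\<^sup>2 + (B t \<omega>)\<^sup>2)" unfolding real_norm_def abs_mult by linarith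
    qed
  qed
  define Z where "Z \<omega> = B t \<omega> - B s \<omega>" for \<omega>
  have "gaussian_rv M (\<lambda>\<omega>. \<Sum>r\<in>{s, t}. (if r = t then 1 else -1) * B r \<omega>)"
    using gp[unfolded gaussian_process_def, rule_format, of "{s, t}" "\<lambda>r. if r = t then 1 else -1"] st by blast
  then have gZ: "gaussian_rv M Z" using st(3) by (simp add: Z_def[abs_def])
  have EZ: "expectation Z = 0"
    unfolding Z_def[abs_def] using i1[OF st(1)] i1[OF st(2)] mean st by simp
  have EZ2: "expectation (\<lambda>\<omega>. (Z \<omega>)\<^sup>2) = \<bar>t - s\<bar> powr (2 * H)"
  proof -
    have "expectation (\<lambda>\<omega>. (Z \<omega>)\<^sup>2) = expectation (\<lambda>\<omega>. (B t \<omega> * B t \<omega> + B s \<omega> * B s \<omega>) - 2 * (B s \<omega> * B t \<omega>))"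
      by (rule Bochner_Integration.integral_cong) (simp_all add: Z_def power2_eq_square algebra_simps)
    also have "\<dots> = expectation (\<lambda>\<omega>. B t \<omega> * B t \<omega>) + expectation (\<lambda>\<omega>. B s \<omega> * B s \<omega>) - 2 * expectation (\<lambda>\<omega>. B s \<omega> * B t \<omega>)"
      using prod st by simp
    also have "\<dots> = \<bar>t - s\<bar> powr (2 * H)"
      unfolding cov[OF st(2) st(2)] cov[OF st(1) st(1)] cov[OF st(1) st(2)] abs_minus_commute[of s t] by (simp add: field_simps)
    finally show ?thesis .
  qed
  from gZ obtain \<mu> \<sigma> where Z: "(\<sigma> = 0 \<and> (AE \<omega> in M. Z \<omega> = \<mu>)) \<or> (\<sigma> > 0 \<and> distributed M lborel Z (\<lambda>x. ennreal (normal_density \<mu> \<sigma> x)))" and Zm [measurable]: "Z \<in> borel_measurable M"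
    unfolding gaussian_rv_def by blast
  from Z show ?thesis
  proof
    assume *: "\<sigma> = 0 \<and> (AE \<omega> in M. Z \<omega> = \<mu>)"
    then have "expectation Z = expectation (\<lambda>_. \<mu>)" by (intro integral_cong_AE) auto
    then have "\<mu> = 0" using EZ by (simp add: prob_space)
    have "AE \<omega> in M. (Z \<omega>)\<^sup>2 = \<mu>\<^sup>2" using * by auto
    then have "expectation (\<lambda>\<omega>. (Z \<omega>)\<^sup>2) = expectation (\<lambda>_. \<mu>\<^sup>2)" by (intro integral_cong_AE) auto
    then have "\<bar>t - s\<bar> powr (2 * H) = 0" using EZ2 \<open>\<mu> = 0\<close> by simp
    then show ?thesis using st(3) by simp
  next
    assume *: "\<sigma> > 0 \<and> distributed M lborel Z (\<lambda>x. ennreal (normal_density \<mu> \<sigma> x))"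
    then have "expectation Z = \<mu>" by (intro normal_distributed_expectation) auto
    then have \<mu>: "\<mu> = 0" using EZ by simp
    have "variance Z = \<sigma>\<^sup>2" using * by (intro normal_distributed_variance) auto
    then have "\<sigma>\<^sup>2 = \<bar>t - s\<bar> powr (2 * H)" using EZ EZ2 by simp
    also have "\<dots> = (\<bar>t - s\<bar> powr H)\<^sup>2" by (simp add: power2_eq_square flip: powr_add)
    finally have "\<sigma> = \<bar>t - s\<bar> powr H" using * by (intro power2_eq_imp_eq[of \<sigma>]) auto
    then show ?thesis using * \<mu> by (simp add: Z_def[abs_def])
  qed
qed

lemma fbm_initial_value:
  assumes fbm: "fractional_brownian_motion M H T B" and H: "0 < H" and T: "0 < T"
  shows "AE \<omega> in M. B 0 \<omega> = 0" and "t \<in> {0..T} \<Longrightarrow> B t \<in> borel_measurable M"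
proof -
  interpret prob_space M using fbm by (simp add: fractional_brownian_motion_def)
  have gp: "gaussian_process M {0..T} B"
    and cov: "\<And>s t. s \<in> {0..T} \<Longrightarrow> t \<in> {0..T} \<Longrightarrow> expectation (\<lambda>\<omega>. B s \<omega> * B t \<omega>) = (t powr (2 * H) + s powr (2 * H) - \<bar>t - s\<bar> powr (2 * H)) / 2"
    using fbm by (auto simp: fractional_brownian_motion_def)
  have "gaussian_rv M (\<lambda>\<omega>. \<Sum>r\<in>{t}. 1 * B r \<omega>)" if "t \<in> {0..T}" for t
    using gp[unfolded gaussian_process_def, rule_format, of "{t}" "\<lambda>_. 1"] that by blast
  then have g1: "gaussian_rv M (B t)" if "t \<in> {0..T}" for t using that by simp
  have 0: "0 \<in> {0..T}" using T by simp
  show "t \<in> {0..T} \<Longrightarrow> B t \<in> borel_measurable M"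
    using gaussian_rv_square_integrable(2)[OF prob_space_axioms g1] by blast
  have "integrable M (\<lambda>\<omega>. (B 0 \<omega>)\<^sup>2)" by (rule gaussian_rv_square_integrable(1)[OF prob_space_axioms g1[OF 0]])
  moreover have "expectation (\<lambda>\<omega>. (B 0 \<omega>)\<^sup>2) = 0" using cov[OF 0 0] H by (simp add: power2_eq_square)
  ultimately have "AE \<omega> in M. (B 0 \<omega>)\<^sup>2 = 0" by (subst (asm) integral_nonneg_eq_0_iff_AE) auto
  then show "AE \<omega> in M. B 0 \<omega> = 0" by simp
qed

lemma distributed_cong_AE:
  assumes X: "distributed M N X f" and ae: "AE \<omega> in M. X \<omega> = X' \<omega>" and X': "X' \<in> measurable M N"
  shows "distributed M N X' f"
proof -
  have "distr M N X = distr M N X'"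
    using X ae X' by (intro distr_cong_AE) (auto simp: distributed_def)
  with X X' show ?thesis by (simp add: distributed_def)
qed

text \<open>On a null set the path is replaced by \<open>0\<close>, and it is extended by constants beyond \<open>[0, T]\<close>. Joint
  measurability follows from continuity by approximation with step functions in time.\<close>

lemma fbm_regular_version:
  assumes fbm: "fractional_brownian_motion M H T B" and H: "0 < H" and T: "0 < T"
  obtains \<Omega>0 B' where "\<Omega>0 \<in> sets M" "measure M \<Omega>0 = 1"
    "case_prod B' \<in> borel_measurable (borel \<Otimes>\<^sub>M M)"
    "\<And>\<omega>. continuous_on UNIV (\<lambda>t. B' t \<omega>)" "\<And>\<omega>. B' 0 \<omega> = 0"
    "\<And>t \<omega>. B' t \<omega> = B' (max 0 (min T t)) \<omega>"
    "\<And>\<omega> t. \<omega> \<in> \<Omega>0 \<Longrightarrow> t \<in> {0..T} \<Longrightarrow> B' t \<omega> = B t \<omega>"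
    "\<And>s t. s \<in> {0..T} \<Longrightarrow> t \<in> {0..T} \<Longrightarrow> s \<noteq> t \<Longrightarrow>
       distributed M lborel (\<lambda>\<omega>. B' t \<omega> - B' s \<omega>) (\<lambda>x. ennreal (normal_density 0 (\<bar>t - s\<bar> powr H) x))"
proof -
  interpret prob_space M using fbm by (simp add: fractional_brownian_motion_def)
  note B_meas = fbm_initial_value(2)[OF fbm H T]
  have "AE \<omega> in M. continuous_on {0..T} (\<lambda>t. B t \<omega>)" using fbm by (simp add: fractional_brownian_motion_def)
  with fbm_initial_value(1)[OF fbm H T] have "AE \<omega> in M. continuous_on {0..T} (\<lambda>t. B t \<omega>) \<and> B 0 \<omega> = 0"
    by eventually_elim simp
  then obtain N where N: "{\<omega> \<in> space M. \<not> (continuous_on {0..T} (\<lambda>t. B t \<omega>) \<and> B 0 \<omega> = 0)} \<subseteq> N" "emeasure M N = 0" "N \<in> sets M"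
    by (rule AE_E)
  define \<Omega>0 where "\<Omega>0 = space M - N"
  have \<Omega>0 [measurable]: "\<Omega>0 \<in> sets M" using N(3) by (simp add: \<Omega>0_def)
  have "measure M N = 0" using N(2) by (simp add: measure_def)
  then have m1: "measure M \<Omega>0 = 1" unfolding \<Omega>0_def using N(3) by (subst prob_compl) auto
  have good: "continuous_on {0..T} (\<lambda>t. B t \<omega>)" "B 0 \<omega> = 0" if "\<omega> \<in> \<Omega>0" for \<omega>
    using that N(1) by (auto simp: \<Omega>0_def)
  define clamp where "clamp t = max 0 (min T t)" for t
  have clamp: "clamp t \<in> {0..T}" "t \<in> {0..T} \<Longrightarrow> clamp t = t" "clamp (clamp t) = clamp t" for t
    using T by (auto simp: clamp_def)
  define B' where "B' t \<omega> = (if \<omega> \<in> \<Omega>0 then B (clamp t) \<omega> else 0)" for t \<omega>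
  have cont: "continuous_on UNIV (\<lambda>t. B' t \<omega>)" for \<omega>
  proof (cases "\<omega> \<in> \<Omega>0")
    case True
    have "continuous_on UNIV clamp" unfolding clamp_def[abs_def] by (intro continuous_intros)
    then have "continuous_on UNIV (\<lambda>t. B (clamp t) \<omega>)"
      by (rule continuous_on_compose2[OF good(1)[OF True]]) (use clamp in auto)
    then show ?thesis using True by (simp add: B'_def)
  qed (simp add: B'_def)
  have B'_meas1 [measurable]: "B' t \<in> borel_measurable M" for t
  proof -
    have [measurable]: "B (clamp t) \<in> borel_measurable M" by (rule B_meas[OF clamp(1)])
    show ?thesis unfolding B'_def[abs_def] by measurable
  qed
  have joint: "case_prod B' \<in> borel_measurable (borel \<Otimes>\<^sub>M M)"
  proof (rule borel_measurable_LIMSEQ_real[where u = "\<lambda>n p. B' (real_of_int \<lfloor>real (Suc n) * fst p\<rfloor> / real (Suc n)) (snd p)"])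
    show "(\<lambda>p. B' (real_of_int \<lfloor>real (Suc n) * fst p\<rfloor> / real (Suc n)) (snd p)) \<in> borel_measurable (borel \<Otimes>\<^sub>M M)" for n
    proof (rule measurable_compose_countable[where f = "\<lambda>k p. B' (real_of_int k / real (Suc n)) (snd p)" and g = "\<lambda>p. \<lfloor>real (Suc n) * fst p\<rfloor>"])
      show "(\<lambda>p. B' (real_of_int k / real (Suc n)) (snd p)) \<in> borel_measurable (borel \<Otimes>\<^sub>M M)" for k
        by (rule measurable_compose[OF measurable_snd B'_meas1])
      show "(\<lambda>p. \<lfloor>real (Suc n) * fst p\<rfloor>) \<in> borel \<Otimes>\<^sub>M M \<rightarrow>\<^sub>M count_space UNIV" by measurable
    qed
    fix p :: "real \<times> 'a"
    obtain t \<omega> where p: "p = (t, \<omega>)" by (cases p)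
    have "(\<lambda>n. real_of_int \<lfloor>real (Suc n) * t\<rfloor> / real (Suc n)) \<longlonglongrightarrow> t"
    proof (rule tendsto_sandwich)
      have "(\<lambda>n. t - inverse (real (Suc n))) \<longlonglongrightarrow> t - 0"
        by (intro tendsto_intros LIMSEQ_inverse_real_of_nat)
      then show "(\<lambda>n. t - inverse (real (Suc n))) \<longlonglongrightarrow> t" by simp
      show "eventually (\<lambda>n. t - inverse (real (Suc n)) \<le> real_of_int \<lfloor>real (Suc n) * t\<rfloor> / real (Suc n)) sequentially"
      proof (rule always_eventually, rule allI)
        fix n
        have "real (Suc n) * t - 1 \<le> real_of_int \<lfloor>real (Suc n) * t\<rfloor>" by linarith
        then have "(real (Suc n) * t - 1) / real (Suc n) \<le> real_of_int \<lfloor>real (Suc n) * t\<rfloor> / real (Suc n)"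
          by (intro divide_right_mono) auto
        then show "t - inverse (real (Suc n)) \<le> real_of_int \<lfloor>real (Suc n) * t\<rfloor> / real (Suc n)"
          by (simp add: diff_divide_distrib inverse_eq_divide del: of_nat_Suc)
      qed
      show "eventually (\<lambda>n. real_of_int \<lfloor>real (Suc n) * t\<rfloor> / real (Suc n) \<le> t) sequentially"
      proof (rule always_eventually, rule allI)
        fix n
        have "real_of_int \<lfloor>real (Suc n) * t\<rfloor> \<le> t * real (Suc n)" using of_int_floor_le[of "real (Suc n) * t"] by (simp only: mult.commute)
        then show "real_of_int \<lfloor>real (Suc n) * t\<rfloor> / real (Suc n) \<le> t" by (simp add: divide_le_eq del: of_nat_Suc)
      qed
    qed simp
    then show "(\<lambda>n. B' (real_of_int \<lfloor>real (Suc n) * fst p\<rfloor> / real (Suc n)) (snd p)) \<longlonglongrightarrow> case_prod B' p"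
      unfolding p fst_conv snd_conv split by (rule continuous_on_tendsto_compose[OF cont]) auto
  qed
  have same: "B' t \<omega> = B t \<omega>" if "\<omega> \<in> \<Omega>0" "t \<in> {0..T}" for \<omega> t
    using that clamp(2) by (simp add: B'_def)
  have AE0: "AE \<omega> in M. \<omega> \<in> \<Omega>0" using m1 \<Omega>0 by (simp add: prob_eq_1)
  have B'0: "B' 0 \<omega> = 0" for \<omega> using good(2) T by (simp add: B'_def clamp_def)
  have B'c: "B' t \<omega> = B' (max 0 (min T t)) \<omega>" for t \<omega> using clamp(3)[of t] by (simp add: B'_def clamp_def)
  have incr: "distributed M lborel (\<lambda>\<omega>. B' t \<omega> - B' s \<omega>) (\<lambda>x. ennreal (normal_density 0 (\<bar>t - s\<bar> powr H) x))"
    if "s \<in> {0..T}" "t \<in> {0..T}" "s \<noteq> t" for s t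
  proof (rule distributed_cong_AE[OF fbm_increment[OF fbm H that]])
    show "AE \<omega> in M. B t \<omega> - B s \<omega> = B' t \<omega> - B' s \<omega>" using AE0 by eventually_elim (use same that in simp)
    show "(\<lambda>\<omega>. B' t \<omega> - B' s \<omega>) \<in> M \<rightarrow>\<^sub>M lborel" by simp
  qed
  show ?thesis by (rule that[OF \<Omega>0 m1 joint cont B'0 B'c same incr])
qed

context noisy_drift
begin

text \<open>Kolmogorov's argument: the moment of order \<open>2m\<close> of an increment over a cell of length \<open>T/2\<^sup>l\<close> is of
  order \<open>2\<^sup>-\<^sup>2\<^sup>m\<^sup>H\<^sup>l\<close>. Weighted with \<open>2\<^sup>2\<^sup>m\<^sup>\<alpha>\<^sup>l\<close> and summed over the \<open>2\<^sup>l\<close> cells and over \<open>l\<close>, these moments stay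
  finite as soon as \<open>2m (H - \<alpha>) > 1\<close>.\<close>

lemma path_holder_AE:
  assumes \<alpha>: "0 < \<alpha>" "\<alpha> < H" and cont: "\<And>\<omega>. continuous_on UNIV (\<lambda>t. B t \<omega>)"
  shows "AE \<omega> in M. \<exists>L\<ge>0. \<forall>s\<in>{0..T}. \<forall>t\<in>{0..T}. \<bar>B t \<omega> - B s \<omega>\<bar> \<le> L * \<bar>t - s\<bar> powr \<alpha>"
proof -
  obtain m :: nat where m: "1 / (2 * (H - \<alpha>)) < real m" using reals_Archimedean2 by blast
  have "0 < 1 / (2 * (H - \<alpha>))" using \<alpha> by simp
  then have m0: "0 < m" using m by (cases m) auto
  have m1: "1 < 2 * real m * (H - \<alpha>)" using m \<alpha> by (simp add: divide_less_eq mult.commute mult.left_commute)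
  define D where "D l k \<omega> = B (T * real (Suc k) / 2 ^ l) \<omega> - B (T * real k / 2 ^ l) \<omega>" for l k \<omega>
  have [measurable]: "D l k \<in> borel_measurable M" for l k unfolding D_def by measurable
  define cm where "cm = fact (2 * m) / (2 ^ m * fact m :: real)"
  have cm: "0 \<le> cm" by (simp add: cm_def)
  have moment: "(\<integral>\<^sup>+\<omega>. ennreal ((D l k \<omega>) ^ (2 * m)) \<partial>M) = ennreal (cm * ((T / 2 ^ l) powr H) ^ (2 * m))" if k: "k < 2 ^ l" for l k
  proof -
    define \<sigma> where "\<sigma> = (T / 2 ^ l) powr H"
    have \<sigma>: "0 < \<sigma>" using T by (simp add: \<sigma>_def)
    have "real (Suc k) \<le> real (2 ^ l)" using k by (simp only: of_nat_le_iff Suc_le_eq)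
    then have kk: "real (Suc k) \<le> 2 ^ l" by simp
    let ?s = "T * real k / 2 ^ l" and ?t = "T * real (Suc k) / 2 ^ l"
    have ts: "?t - ?s = T / 2 ^ l" by (simp add: distrib_left add_divide_distrib)
    have tT: "?t \<le> T" using kk T by (simp add: divide_le_eq)
    have pos: "0 < T / 2 ^ l" using T by simp
    have s0: "0 \<le> ?s" using T by simp
    have dist: "distributed M lborel (D l k) (\<lambda>x. ennreal (normal_density 0 (\<bar>?t - ?s\<bar> powr H) x))"
      unfolding D_def[abs_def] by (rule increments) (use s0 tT pos ts in auto)
    have absts: "\<bar>?t - ?s\<bar> powr H = \<sigma>" unfolding ts \<sigma>_def by (simp only: abs_of_pos[OF pos])
    have "(\<integral>\<^sup>+\<omega>. ennreal ((D l k \<omega>) ^ (2 * m)) \<partial>M) = (\<integral>\<^sup>+x. ennreal (normal_density 0 \<sigma> x) * ennreal (x ^ (2 * m)) \<partial>lborel)"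
      using distributed_nn_integral[OF dist[unfolded absts], of "\<lambda>x. ennreal (x ^ (2 * m))"] by simp
    also have "\<dots> = (\<integral>\<^sup>+x. ennreal (normal_density 0 \<sigma> x * (x - 0) ^ (2 * m)) \<partial>lborel)"
      by (intro nn_integral_cong) (simp add: ennreal_mult')
    also have "\<dots> = ennreal (fact (2 * m) / ((2 / \<sigma>\<^sup>2) ^ m * fact m))"
    proof (subst nn_integral_eq_integral)
      show "integrable lborel (\<lambda>x. normal_density 0 \<sigma> x * (x - 0) ^ (2 * m))"
        using normal_moment_even[OF \<sigma>, of 0 m] by (rule integrable.intros)
      show "AE x in lborel. 0 \<le> normal_density 0 \<sigma> x * (x - 0) ^ (2 * m)"
        by (simp add: power_mult)
      show "ennreal (\<integral>x. normal_density 0 \<sigma> x * (x - 0) ^ (2 * m) \<partial>lborel) = ennreal (fact (2 * m) / ((2 / \<sigma>\<^sup>2) ^ m * fact m))"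
        by (simp only: integral_normal_moment_even[OF \<sigma>])
    qed
    also have "fact (2 * m) / ((2 / \<sigma>\<^sup>2) ^ m * fact m) = cm * \<sigma> ^ (2 * m)"
      using \<sigma> by (simp add: cm_def power_divide power_mult)
    finally show ?thesis unfolding \<sigma>_def .
  qed
  define X where "X l \<omega> = ennreal (2 powr (2 * real m * \<alpha> * real l)) * (\<Sum>k<2 ^ l. ennreal ((D l k \<omega>) ^ (2 * m)))" for l \<omega>
  define r where "r = 2 powr (1 - 2 * real m * (H - \<alpha>))"
  have r: "0 < r" "r < 1" using m1 powr_less_one[of 2 "1 - 2 * real m * (H - \<alpha>)"] by (auto simp: r_def)
  define A where "A = cm * (T powr H) ^ (2 * m)"
  have A: "0 \<le> A" using cm by (simp add: A_def)
  have EX: "(\<integral>\<^sup>+\<omega>. X l \<omega> \<partial>M) = ennreal (A * r ^ l)" for l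
  proof -
    have "(\<integral>\<^sup>+\<omega>. X l \<omega> \<partial>M) = ennreal (2 powr (2 * real m * \<alpha> * real l)) * (\<Sum>k<2 ^ l. \<integral>\<^sup>+\<omega>. ennreal ((D l k \<omega>) ^ (2 * m)) \<partial>M)"
      unfolding X_def by (subst nn_integral_cmult, measurable, subst nn_integral_sum, auto)
    also have "(\<Sum>k<2 ^ l. \<integral>\<^sup>+\<omega>. ennreal ((D l k \<omega>) ^ (2 * m)) \<partial>M) = (\<Sum>k<(2::nat) ^ l. ennreal (cm * ((T / 2 ^ l) powr H) ^ (2 * m)))"
      by (rule sum.cong) (simp_all add: moment)
    also have "\<dots> = ennreal (\<Sum>k<(2::nat) ^ l. cm * ((T / 2 ^ l) powr H) ^ (2 * m))"
      by (rule sum_ennreal) (use cm in simp)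
    also have "(\<Sum>k<(2::nat) ^ l. cm * ((T / 2 ^ l) powr H) ^ (2 * m)) = 2 ^ l * (cm * ((T / 2 ^ l) powr H) ^ (2 * m))"
      by simp
    also have "ennreal (2 powr (2 * real m * \<alpha> * real l)) * ennreal (2 ^ l * (cm * ((T / 2 ^ l) powr H) ^ (2 * m)))
       = ennreal (2 powr (2 * real m * \<alpha> * real l) * (2 ^ l * (cm * ((T / 2 ^ l) powr H) ^ (2 * m))))"
      by (rule ennreal_mult'[symmetric]) simp
    also have "2 powr (2 * real m * \<alpha> * real l) * (2 ^ l * (cm * ((T / 2 ^ l) powr H) ^ (2 * m))) = A * r ^ l"
    proof -
      have "(T / 2 ^ l) powr H = T powr H * 2 powr (- real l * H)"
      proof -
        have "T / 2 ^ l = T * 2 powr - real l" by (simp add: powr_minus_divide powr_realpow)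
        then show ?thesis by (simp only: powr_mult powr_powr)
      qed
      then have "((T / 2 ^ l) powr H) ^ (2 * m) = (T powr H) ^ (2 * m) * (2 powr (- real l * H)) ^ (2 * m)"
        by (simp only: power_mult_distrib)
      also have "(2 powr (- real l * H)) ^ (2 * m) = (2 powr (- real l * H)) powr real (2 * m)"
        by (rule powr_realpow[symmetric]) simp
      also have "\<dots> = 2 powr (- real l * H * real (2 * m))" by (rule powr_powr)
      finally have e1: "((T / 2 ^ l) powr H) ^ (2 * m) = (T powr H) ^ (2 * m) * 2 powr (- real l * H * real (2 * m))" .
      have e2: "(2::real) ^ l = 2 powr real l" by (simp add: powr_realpow)
      have e3: "r ^ l = 2 powr ((1 - 2 * real m * (H - \<alpha>)) * real l)"
        unfolding r_def using powr_realpow[of "2 powr (1 - 2 * real m * (H - \<alpha>))" l] by (simp add: powr_powr)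
      have "2 powr (2 * real m * \<alpha> * real l) * (2 powr real l * 2 powr (- real l * H * real (2 * m))) = r ^ l"
        unfolding e3 powr_add[symmetric] by (rule arg_cong[where f = "(powr) 2"]) (simp add: algebra_simps)
      then have "A * r ^ l = cm * (T powr H) ^ (2 * m) * (2 powr (2 * real m * \<alpha> * real l) * (2 ^ l * 2 powr (- real l * H * real (2 * m))))"
        unfolding A_def e2 by simp
      then show ?thesis unfolding e1 by (simp only: mult.assoc mult.left_commute mult.commute)
    qed
    finally show ?thesis .
  qed
  have "(\<integral>\<^sup>+\<omega>. (\<Sum>l. X l \<omega>) \<partial>M) = (\<Sum>l. \<integral>\<^sup>+\<omega>. X l \<omega> \<partial>M)"
    unfolding X_def by (rule nn_integral_suminf) measurable
  also have "\<dots> = (\<Sum>l. ennreal (A * r ^ l))" by (simp only: EX)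
  also have "\<dots> = ennreal (\<Sum>l. A * r ^ l)"
    by (rule suminf_ennreal2) (use A r in \<open>auto intro!: summable_mult summable_geometric\<close>)
  finally have "(\<integral>\<^sup>+\<omega>. (\<Sum>l. X l \<omega>) \<partial>M) \<noteq> \<infinity>" by simp
  then have "AE \<omega> in M. (\<Sum>l. X l \<omega>) \<noteq> \<infinity>"
    by (rule nn_integral_noteq_infinite[rotated]) (unfold X_def, measurable)
  then show ?thesis
  proof eventually_elim
    case (elim \<omega>)
    define K where "K = max 1 (enn2real (\<Sum>l. X l \<omega>))"
    have K: "1 \<le> K" by (simp add: K_def)
    have XK: "(\<Sum>l. X l \<omega>) \<le> ennreal K"
    proof -
      have "(\<Sum>l. X l \<omega>) = ennreal (enn2real (\<Sum>l. X l \<omega>))" using elim by (simp add: less_top)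
      also have "\<dots> \<le> ennreal K" by (rule ennreal_leI) (simp add: K_def)
      finally show ?thesis .
    qed
    have "\<bar>D l k \<omega>\<bar> \<le> K * (2 powr - \<alpha>) ^ l" if k: "k < 2 ^ l" for l k
    proof -
      have "ennreal (2 powr (2 * real m * \<alpha> * real l)) * ennreal ((D l k \<omega>) ^ (2 * m)) \<le> X l \<omega>"
        unfolding X_def using k by (intro mult_left_mono member_le_sum) auto
      also have "X l \<omega> = sum (\<lambda>l. X l \<omega>) {l}" by simp
      also have "\<dots> \<le> (\<Sum>l. X l \<omega>)" by (rule sum_le_suminf) auto
      also note XK
      finally have "ennreal (2 powr (2 * real m * \<alpha> * real l) * (D l k \<omega>) ^ (2 * m)) \<le> ennreal K"
        by (simp add: ennreal_mult')
      then have "2 powr (2 * real m * \<alpha> * real l) * (D l k \<omega>) ^ (2 * m) \<le> K"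
        using K by (subst (asm) ennreal_le_iff) auto
      also have "K \<le> K ^ (2 * m)" using K m0 by (intro self_le_power) auto
      also have "2 powr (2 * real m * \<alpha> * real l) = (2 powr (\<alpha> * real l)) ^ (2 * m)"
        using powr_realpow[of "2 powr (\<alpha> * real l)" "2 * m"] by (simp add: powr_powr mult_ac)
      also have "(2 powr (\<alpha> * real l)) ^ (2 * m) * (D l k \<omega>) ^ (2 * m) = (2 powr (\<alpha> * real l) * \<bar>D l k \<omega>\<bar>) ^ (2 * m)"
        by (simp add: power_mult_distrib power_mult[of "D l k \<omega>" 2] power_mult[of "\<bar>D l k \<omega>\<bar>" 2])
      finally have "2 powr (\<alpha> * real l) * \<bar>D l k \<omega>\<bar> \<le> K"
        using m0 K by (subst (asm) power_mono_iff) auto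
      then have "(2 powr - \<alpha>) ^ l * (2 powr (\<alpha> * real l) * \<bar>D l k \<omega>\<bar>) \<le> (2 powr - \<alpha>) ^ l * K"
        by (intro mult_left_mono) auto
      moreover have "(2 powr - \<alpha>) ^ l * 2 powr (\<alpha> * real l) = 1"
      proof -
        have "(2 powr - \<alpha>) ^ l = 2 powr (- \<alpha> * real l)"
          using powr_realpow[of "2 powr - \<alpha>" l] by (simp add: powr_powr)
        then show ?thesis by (simp flip: powr_add)
      qed
      ultimately show ?thesis by (metis mult.assoc mult.commute mult_1)
    qed
    then show ?case
      by (intro dyadic_holder[where K = K and B = "\<lambda>t. B t \<omega>"] T \<alpha>(1) continuous_on_subset[OF cont])
        (use K in \<open>auto simp: D_def\<close>)
  qed
qed

end

section \<open>Solving the equation along a typical path\<close>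

text \<open>Moved onto \<open>\<phi>\<close>, mollification becomes the average of \<open>\<phi>\<close> over a Gaussian neighbourhood of size \<open>\<epsilon> n\<close>,
  which converges pointwise by continuity.\<close>

lemma gauss_smooth_weak_limit:
  fixes f \<phi> :: "real \<Rightarrow> real"
  assumes f: "integrable lborel f" and cont: "continuous_on UNIV \<phi>" and bound: "\<And>x. \<bar>\<phi> x\<bar> \<le> Z"
    and \<epsilon>: "\<And>n. 0 < \<epsilon> n" "\<epsilon> \<longlonglongrightarrow> 0"
  shows "(\<lambda>n. \<integral>x. gauss_smooth 0 (\<epsilon> n) f x * \<phi> x \<partial>lborel) \<longlonglongrightarrow> (\<integral>x. f x * \<phi> x \<partial>lborel)"
    and "\<bar>\<integral>x. gauss_smooth 0 (\<epsilon> n) f x * \<phi> x \<partial>lborel\<bar> \<le> Z * gauss_mass 0 * (\<integral>x. \<bar>f x\<bar> \<partial>lborel)"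
proof -
  have [measurable]: "f \<in> borel_measurable borel" using f by auto
  have [measurable]: "\<phi> \<in> borel_measurable borel" using cont by (rule borel_measurable_continuous_onI)
  have Z: "0 \<le> Z" using bound[of 0] by linarith
  define P where "P n z = (\<integral>\<xi>. gauss 0 1 \<xi> * \<phi> (z + \<epsilon> n * \<xi>) \<partial>lborel)" for n z
  have [measurable]: "P n \<in> borel_measurable borel" for n unfolding P_def by measurable
  have dom: "integrable lborel (\<lambda>\<xi>. Z * \<bar>gauss 0 1 \<xi>\<bar>)" using gauss_L1(1)[of 1 0] by simp
  have le: "\<bar>gauss 0 1 \<xi> * \<phi> x\<bar> \<le> Z * \<bar>gauss 0 1 \<xi>\<bar>" for \<xi> x
    using mult_right_mono[OF bound[of x], of "\<bar>gauss 0 1 \<xi>\<bar>"] by (simp add: abs_mult mult.commute)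
  have P_bound: "\<bar>P n z\<bar> \<le> Z * gauss_mass 0" for n z
  proof -
    have "\<bar>P n z\<bar> \<le> (\<integral>\<xi>. Z * \<bar>gauss 0 1 \<xi>\<bar> \<partial>lborel)"
      unfolding P_def by (rule order_trans[OF integral_abs_bound], rule integral_mono'[OF dom le]) (use Z in simp)
    then show ?thesis using gauss_L1(2)[of 1 0] by simp
  qed
  have P_lim: "(\<lambda>n. P n z) \<longlonglongrightarrow> \<phi> z" for z
  proof -
    have "(\<lambda>n. P n z) \<longlonglongrightarrow> (\<integral>\<xi>. gauss 0 1 \<xi> * \<phi> z \<partial>lborel)"
      unfolding P_def
    proof (rule integral_dominated_convergence[OF _ _ dom])
      show "AE \<xi> in lborel. (\<lambda>n. gauss 0 1 \<xi> * \<phi> (z + \<epsilon> n * \<xi>)) \<longlonglongrightarrow> gauss 0 1 \<xi> * \<phi> z"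
      proof (rule AE_I2)
        fix \<xi>
        have "(\<lambda>n. z + \<epsilon> n * \<xi>) \<longlonglongrightarrow> z + 0 * \<xi>" by (intro tendsto_intros \<epsilon>(2))
        then have "(\<lambda>n. z + \<epsilon> n * \<xi>) \<longlonglongrightarrow> z" by simp
        then show "(\<lambda>n. gauss 0 1 \<xi> * \<phi> (z + \<epsilon> n * \<xi>)) \<longlonglongrightarrow> gauss 0 1 \<xi> * \<phi> z"
          by (intro tendsto_mult_left continuous_on_tendsto_compose[OF cont]) auto
      qed
      show "AE \<xi> in lborel. norm (gauss 0 1 \<xi> * \<phi> (z + \<epsilon> n * \<xi>)) \<le> Z * \<bar>gauss 0 1 \<xi>\<bar>" for n
        using le by simp
    qed measurable
    also have "(\<integral>\<xi>. gauss 0 1 \<xi> * \<phi> z \<partial>lborel) = \<phi> z"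
      using integral_normal_density[of 1 0] by (simp add: gauss_0)
    finally show ?thesis .
  qed
  have eq: "(\<integral>x. gauss_smooth 0 (\<epsilon> n) f x * \<phi> x \<partial>lborel) = (\<integral>z. f z * P n z \<partial>lborel)" for n
  proof -
    let ?F = "\<lambda>z x. gauss 0 (\<epsilon> n) (x - z) * f z * \<phi> x"
    have int: "integrable (lborel \<Otimes>\<^sub>M lborel) (case_prod ?F)"
    proof (rule Bochner_Integration.integrable_bound[OF integrable_mult_right[OF gauss_smooth_L1(3)[OF \<epsilon>(1)[of n] f, of 0], of Z]])
      show "AE p in lborel \<Otimes>\<^sub>M lborel. norm (case_prod ?F p) \<le> norm (Z * (case p of (z, x) \<Rightarrow> gauss 0 (\<epsilon> n) (x - z) * f z))"
      proof (rule AE_I2, clarify)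
        fix z x
        show "norm (?F z x) \<le> norm (Z * (gauss 0 (\<epsilon> n) (x - z) * f z))"
          using mult_left_mono[OF bound[of x], of "\<bar>gauss 0 (\<epsilon> n) (x - z) * f z\<bar>"] Z
          by (simp add: abs_mult mult_ac)
      qed
    qed measurable
    have "(\<integral>x. gauss_smooth 0 (\<epsilon> n) f x * \<phi> x \<partial>lborel) = (\<integral>x. (\<integral>z. ?F z x \<partial>lborel) \<partial>lborel)"
      unfolding gauss_smooth_def by simp
    also have "\<dots> = (\<integral>z. (\<integral>x. ?F z x \<partial>lborel) \<partial>lborel)"
      by (rule lborel_pair.Fubini_integral[OF int])
    also have "\<dots> = (\<integral>z. f z * P n z \<partial>lborel)"
    proof (rule Bochner_Integration.integral_cong[OF refl])
      fix z
      have "(\<integral>x. ?F z x \<partial>lborel) = \<epsilon> n * (\<integral>\<xi>. ?F z (z + \<epsilon> n * \<xi>) \<partial>lborel)"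
        using lborel_integral_real_affine[of "\<epsilon> n" "?F z" z] \<epsilon>(1)[of n] by simp
      also have "\<dots> = (\<integral>\<xi>. \<epsilon> n * ?F z (z + \<epsilon> n * \<xi>) \<partial>lborel)" by simp
      also have "\<dots> = (\<integral>\<xi>. f z * (gauss 0 1 \<xi> * \<phi> (z + \<epsilon> n * \<xi>)) \<partial>lborel)"
      proof (rule Bochner_Integration.integral_cong[OF refl])
        fix \<xi>
        have "gauss 0 (\<epsilon> n) (z + \<epsilon> n * \<xi> - z) = gauss 0 1 \<xi> / \<epsilon> n"
          using gauss_scale[of 0 "\<epsilon> n" "\<epsilon> n * \<xi>"] \<epsilon>(1)[of n] by simp
        then show "\<epsilon> n * ?F z (z + \<epsilon> n * \<xi>) = f z * (gauss 0 1 \<xi> * \<phi> (z + \<epsilon> n * \<xi>))"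
          using \<epsilon>(1)[of n] by simp
      qed
      also have "\<dots> = f z * P n z" by (simp add: P_def)
      finally show "(\<integral>x. ?F z x \<partial>lborel) = f z * P n z" .
    qed
    finally show ?thesis .
  qed
  have leF: "\<bar>f z * P n z\<bar> \<le> Z * gauss_mass 0 * \<bar>f z\<bar>" for n z
    using mult_right_mono[OF P_bound[of n z], of "\<bar>f z\<bar>"] by (simp add: abs_mult mult_ac)
  have domF: "integrable lborel (\<lambda>z. Z * gauss_mass 0 * \<bar>f z\<bar>)" using f by simp
  show "(\<lambda>n. \<integral>x. gauss_smooth 0 (\<epsilon> n) f x * \<phi> x \<partial>lborel) \<longlonglongrightarrow> (\<integral>x. f x * \<phi> x \<partial>lborel)"
    unfolding eq
  proof (rule integral_dominated_convergence[OF _ _ domF])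
    show "AE z in lborel. (\<lambda>n. f z * P n z) \<longlonglongrightarrow> f z * \<phi> z" using P_lim by (intro AE_I2 tendsto_mult_left)
    show "AE z in lborel. norm (f z * P n z) \<le> Z * gauss_mass 0 * \<bar>f z\<bar>" for n using leF by simp
  qed measurable
  have "\<bar>\<integral>z. f z * P n z \<partial>lborel\<bar> \<le> (\<integral>z. Z * gauss_mass 0 * \<bar>f z\<bar> \<partial>lborel)"
    by (rule order_trans[OF integral_abs_bound], rule integral_mono'[OF domF leF]) (use Z gauss_mass_nonneg[of 0] in simp)
  then show "\<bar>\<integral>x. gauss_smooth 0 (\<epsilon> n) f x * \<phi> x \<partial>lborel\<bar> \<le> Z * gauss_mass 0 * (\<integral>x. \<bar>f x\<bar> \<partial>lborel)"
    unfolding eq by simp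
qed

context noisy_drift
begin

lemma mollified_bound: "\<bar>mollified j n r x\<bar> \<le> Cb * gauss_mass j * real (Suc n) ^ j"
proof -
  have "\<bar>gauss_smooth j (1 / real (Suc n)) (b r) x\<bar> \<le> Cb * gauss_mass j / (1 / real (Suc n)) ^ j"
    by (rule gauss_smooth_bound) (use b_bound b_measurable2 in auto)
  then show ?thesis unfolding mollified_def by (simp add: power_one_over field_simps)
qed

lemma mollified_has_deriv: "(mollified j n r has_real_derivative mollified (Suc j) n r x) (at x)"
  unfolding mollified_def by (rule gauss_smooth_has_deriv[OF _ b_integrable]) simp

lemma mollified_along_path_measurable:
  assumes [measurable]: "\<beta> \<in> borel_measurable borel"
  shows "(\<lambda>(r, y). mollified j n r (y + \<beta> r)) \<in> borel_measurable (borel \<Otimes>\<^sub>M borel)"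
  unfolding mollified_def split_beta' by (rule gauss_smooth_measurable[OF b_measurable]) measurable

lemma cell_average_has_deriv:
  assumes path: "(\<lambda>t. B t \<omega>) \<in> borel_measurable borel"
  shows "(cell_average j n m k \<omega> has_real_derivative cell_average (Suc j) n m k \<omega> x) (at x)"
proof -
  note mollified_along_path_measurable[OF path, measurable]
  have cell: "dyadic_cell T m k \<in> sets borel" "emeasure lborel (dyadic_cell T m k) < \<infinity>"
    using T by (auto simp: dyadic_cell_def divide_right_mono)
  have D: "integrable lborel (\<lambda>r. Cb * gauss_mass j * real (Suc n) ^ j * indicator (dyadic_cell T m k) r)" for j
    by (intro integrable_mult_right integrable_real_indicator) (use cell in auto)
  have le: "\<bar>indicator (dyadic_cell T m k) r * mollified j n r (x + B r \<omega>)\<bar>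
      \<le> Cb * gauss_mass j * real (Suc n) ^ j * indicator (dyadic_cell T m k) r" for j r x
    using mollified_bound[of j n r "x + B r \<omega>"] by (simp add: indicator_def)
  show ?thesis
    unfolding cell_average_def[abs_def]
  proof (rule has_real_derivative_lebesgue_integral(1)[OF _ _ le D])
    show "integrable lborel (\<lambda>r. indicator (dyadic_cell T m k) r * mollified j n r (x + B r \<omega>))" for x
    proof (rule Bochner_Integration.integrable_bound[OF D])
      have "(\<lambda>r. (\<lambda>(r, y). mollified j n r (y + B r \<omega>)) (r, x)) \<in> borel_measurable borel" by measurable
      then show "(\<lambda>r. indicator (dyadic_cell T m k) r * mollified j n r (x + B r \<omega>)) \<in> borel_measurable lborel"
        using cell(1) by simp
      show "AE r in lborel. norm (indicator (dyadic_cell T m k) r * mollified j n r (x + B r \<omega>))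
          \<le> norm (Cb * gauss_mass j * real (Suc n) ^ j * indicator (dyadic_cell T m k) r)"
        using le by (intro AE_I2) (simp only: real_norm_def, rule order_trans[OF _ abs_ge_self])
    qed
    show "((\<lambda>x. indicator (dyadic_cell T m k) r * mollified j n r (x + B r \<omega>)) has_real_derivative
        indicator (dyadic_cell T m k) r * mollified (Suc j) n r (x + B r \<omega>)) (at x)" for x r
      by (intro DERIV_cmult) (simp add: DERIV_shift[symmetric] mollified_has_deriv)
  qed
qed

text \<open>Translating \<open>y\<close> by the path at each fixed time reduces this to \<open>gauss_smooth_weak_limit\<close>; the \<open>L\<^sup>1\<close>
  norms of the drift dominate in time.\<close>

lemma mollified_drift_weak_limit:
  fixes \<phi> :: "real \<Rightarrow> real \<Rightarrow> real" and \<beta> :: "real \<Rightarrow> real"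
  assumes [measurable]: "\<beta> \<in> borel_measurable borel" and \<sigma>: "strict_mono (\<sigma> :: nat \<Rightarrow> nat)"
    and [measurable]: "case_prod \<phi> \<in> borel_measurable (borel \<Otimes>\<^sub>M borel)"
    and \<phi>_bound: "\<And>r y. \<bar>\<phi> r y\<bar> \<le> Z" and \<phi>_cont: "\<And>r. continuous_on UNIV (\<phi> r)"
  shows "(\<lambda>i. \<integral>r. (\<integral>y. mollified 0 (\<sigma> i) r (y + \<beta> r) * \<phi> r y \<partial>lborel) \<partial>lborel)
     \<longlonglongrightarrow> (\<integral>r. (\<integral>y. b r (y + \<beta> r) * \<phi> r y \<partial>lborel) \<partial>lborel)"
proof -
  note mollified_along_path_measurable[OF assms(1), measurable]
  let ?\<epsilon> = "\<lambda>i. 1 / real (Suc (\<sigma> i))"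
  have \<epsilon>: "?\<epsilon> \<longlonglongrightarrow> 0"
    using LIMSEQ_subseq_LIMSEQ[OF LIMSEQ_inverse_real_of_nat \<sigma>] by (simp add: o_def inverse_eq_divide)
  have shift: "(\<integral>y. g (y + \<beta> r) * \<phi> r y \<partial>lborel) = (\<integral>x. g x * \<phi> r (x - \<beta> r) \<partial>lborel)" for g r
    using lborel_integral_real_affine[of 1 "\<lambda>x. g x * \<phi> r (x - \<beta> r)" "\<beta> r"] by (simp add: add.commute)
  have \<phi>c: "continuous_on UNIV (\<lambda>x. \<phi> r (x - \<beta> r))" for r
    by (rule continuous_on_compose2[OF \<phi>_cont]) (auto intro!: continuous_intros)
  note lim = gauss_smooth_weak_limit[OF b_integrable \<phi>c \<phi>_bound, of ?\<epsilon>]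
  have [measurable]: "(\<lambda>(r, y). b r (y + \<beta> r)) \<in> borel_measurable (borel \<Otimes>\<^sub>M borel)" by measurable
  show ?thesis
  proof (rule integral_dominated_convergence)
    show "integrable lborel (\<lambda>r. Z * gauss_mass 0 * (\<integral>x. \<bar>b r x\<bar> \<partial>lborel))" using b_L1 by simp
    show "AE r in lborel. (\<lambda>i. \<integral>y. mollified 0 (\<sigma> i) r (y + \<beta> r) * \<phi> r y \<partial>lborel) \<longlonglongrightarrow> (\<integral>y. b r (y + \<beta> r) * \<phi> r y \<partial>lborel)"
      unfolding shift mollified_def by (intro AE_I2 lim(1) \<epsilon>) simp
    show "AE r in lborel. norm (\<integral>y. mollified 0 (\<sigma> i) r (y + \<beta> r) * \<phi> r y \<partial>lborel) \<le> Z * gauss_mass 0 * (\<integral>x. \<bar>b r x\<bar> \<partial>lborel)" for i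
      unfolding shift mollified_def real_norm_def by (intro AE_I2 lim(2) \<epsilon>) simp
    have "(\<lambda>(r, y). mollified 0 (\<sigma> i) r (y + \<beta> r) * \<phi> r y) \<in> borel_measurable (borel \<Otimes>\<^sub>M lborel)" for i
      unfolding split_beta' using mollified_along_path_measurable[OF assms(1), of 0 "\<sigma> i"] assms(3)
      by (intro borel_measurable_times) (auto simp: split_beta')
    then show "(\<lambda>r. \<integral>y. mollified 0 (\<sigma> i) r (y + \<beta> r) * \<phi> r y \<partial>lborel) \<in> borel_measurable lborel" for i
      by (intro lborel.borel_measurable_lebesgue_integral) simp
  qed measurable
qed

text \<open>The Hoelder constant \<open>N i m k\<close> is the \<open>H\<^sup>1\<close> norm of \<open>cell_average 1\<close> on the \<open>k\<close>-th cell, so the energy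
  condition is exactly the bound on \<open>level_energy\<close>.\<close>

lemma transport_approximation_along_path:
  assumes path: "continuous_on UNIV (\<lambda>t. B t \<omega>)" and K: "0 \<le> K" and \<theta>: "0 < \<theta>" "\<theta> < 1"
    and \<sigma>: "strict_mono (\<sigma> :: nat \<Rightarrow> nat)" and energy: "\<And>i m. m \<le> \<sigma> i \<Longrightarrow> level_energy (\<sigma> i) m \<omega> \<le> ennreal ((K * \<theta> ^ m)\<^sup>2)"
    and u0: "\<And>x. (u0 has_real_derivative u0' x) (at x)" "continuous_on UNIV u0'"
  shows "transport_approximation T (Cb * (1 + gauss_mass 0)) K \<theta> u0 u0' \<sigma>
     (\<lambda>i r y. mollified 0 (\<sigma> i) r (y + B r \<omega>)) (\<lambda>i r y. mollified 1 (\<sigma> i) r (y + B r \<omega>))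
     (\<lambda>i. Cb * gauss_mass 1 * real (Suc (\<sigma> i)) ^ 1) (\<lambda>r y. b r (y + B r \<omega>))
     (\<lambda>i m k. sqrt (enn2real ((\<integral>\<^sup>+x. ennreal ((cell_average 1 (\<sigma> i) m k \<omega> x)\<^sup>2) \<partial>lborel)
        + (\<integral>\<^sup>+x. ennreal ((cell_average 2 (\<sigma> i) m k \<omega> x)\<^sup>2) \<partial>lborel))))"
proof -
  have pm [measurable]: "(\<lambda>t. B t \<omega>) \<in> borel_measurable borel" using path by (rule borel_measurable_continuous_onI)
  have Cb: "0 \<le> Cb" using b_bound[of 0 0] by linarith
  define e where "e i m k = (\<integral>\<^sup>+x. ennreal ((cell_average 1 (\<sigma> i) m k \<omega> x)\<^sup>2) \<partial>lborel)
        + (\<integral>\<^sup>+x. ennreal ((cell_average 2 (\<sigma> i) m k \<omega> x)\<^sup>2) \<partial>lborel)" for i m k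
  have e_sum: "(\<Sum>k<2 ^ m. e i m k) \<le> ennreal ((K * \<theta> ^ m)\<^sup>2)" if "m \<le> \<sigma> i" for i m
    using energy[OF that] unfolding level_energy_def e_def .
  have e_fin: "ennreal (enn2real (e i m k)) = e i m k" if "m \<le> \<sigma> i" "k < 2 ^ m" for i m k
  proof -
    have "e i m k \<le> (\<Sum>k<2 ^ m. e i m k)" using that(2) by (intro member_le_sum) auto
    also have "\<dots> < \<infinity>" using e_sum[OF that(1)] by (rule le_less_trans) simp
    finally show ?thesis by simp
  qed
  have d1: "(cell_average 1 n m k \<omega> has_real_derivative cell_average 2 n m k \<omega> x) (at x)" for n m k x
    using cell_average_has_deriv[OF pm, of 1 n m k x] by (simp add: numeral_2_eq_2)
  have c2: "isCont (cell_average 2 n m k \<omega>) x" for n m k x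
    by (rule DERIV_isCont[OF cell_average_has_deriv[OF pm]])
  have e_le: "(\<integral>\<^sup>+x. ennreal ((cell_average 1 (\<sigma> i) m k \<omega> x)\<^sup>2) \<partial>lborel)
        + (\<integral>\<^sup>+x. ennreal ((cell_average 2 (\<sigma> i) m k \<omega> x)\<^sup>2) \<partial>lborel) \<le> ennreal ((sqrt (enn2real (e i m k)))\<^sup>2)"
    if "m \<le> \<sigma> i" "k < 2 ^ m" for i m k
    using e_fin[OF that] unfolding e_def by simp
  note half = sobolev_half_holder[OF d1 c2 _ e_le]
  show ?thesis
    unfolding e_def[symmetric]
  proof
    show "0 < T" by (rule T)
    show "0 \<le> Cb * (1 + gauss_mass 0)" using Cb gauss_mass_nonneg by simp
    show "0 \<le> K" "0 < \<theta>" "\<theta> < 1" "strict_mono \<sigma>" by fact+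
    show "(u0 has_real_derivative u0' x) (at x)" "continuous_on UNIV u0'" for x by fact+
    show "(\<lambda>(r, y). mollified 0 (\<sigma> i) r (y + B r \<omega>)) \<in> borel_measurable (borel \<Otimes>\<^sub>M borel)"
      "(\<lambda>(r, y). mollified 1 (\<sigma> i) r (y + B r \<omega>)) \<in> borel_measurable (borel \<Otimes>\<^sub>M borel)" for i
      by (rule mollified_along_path_measurable[OF pm])+
    show "\<bar>mollified 0 (\<sigma> i) r (y + B r \<omega>)\<bar> \<le> Cb * (1 + gauss_mass 0)" for i r y
      using mollified_bound[of 0 "\<sigma> i" r "y + B r \<omega>"] Cb by (simp add: distrib_left)
    show "((\<lambda>y. mollified 0 (\<sigma> i) r (y + B r \<omega>)) has_real_derivative mollified 1 (\<sigma> i) r (y + B r \<omega>)) (at y)" for i r y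
      using mollified_has_deriv[of 0 "\<sigma> i" r "y + B r \<omega>"] by (simp add: DERIV_shift[symmetric])
    show "\<bar>mollified 1 (\<sigma> i) r (y + B r \<omega>)\<bar> \<le> Cb * gauss_mass 1 * real (Suc (\<sigma> i)) ^ 1" for i r y
      by (rule mollified_bound)
    show "(\<lambda>(r, y). b r (y + B r \<omega>)) \<in> borel_measurable (borel \<Otimes>\<^sub>M borel)" by measurable
    show "\<bar>b r (y + B r \<omega>)\<bar> \<le> Cb * (1 + gauss_mass 0)" for r y
      using b_bound[of r "y + B r \<omega>"] Cb mult_nonneg_nonneg[OF Cb gauss_mass_nonneg[of 0]] by (simp add: distrib_left)
    show "0 \<le> sqrt (enn2real (e i m k))" for i m k by simp
    show "\<bar>(\<integral>r. indicator (dyadic_cell T m k) r * mollified 1 (\<sigma> i) r (x + B r \<omega>) \<partial>lborel)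
        - (\<integral>r. indicator (dyadic_cell T m k) r * mollified 1 (\<sigma> i) r (y + B r \<omega>) \<partial>lborel)\<bar>
        \<le> sqrt (enn2real (e i m k)) * sqrt \<bar>x - y\<bar>" if "m \<le> \<sigma> i" "k < 2 ^ m" for i m k x y
      using half(1)[OF _ that, of x y] by (simp add: cell_average_def)
    show "\<bar>\<integral>r. indicator (dyadic_cell T m k) r * mollified 1 (\<sigma> i) r (x + B r \<omega>) \<partial>lborel\<bar>
        \<le> 2 * sqrt (enn2real (e i m k))" if "m \<le> \<sigma> i" "k < 2 ^ m" for i m k x
      using half(2)[OF _ that, of x] by (simp add: cell_average_def)
    show "(\<Sum>k<2 ^ m. (sqrt (enn2real (e i m k)))\<^sup>2) \<le> (K * \<theta> ^ m)\<^sup>2" if "m \<le> \<sigma> i" for i m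
    proof -
      have "ennreal (\<Sum>k<2 ^ m. enn2real (e i m k)) = (\<Sum>k<2 ^ m. ennreal (enn2real (e i m k)))"
        by (rule sum_ennreal[symmetric]) simp
      also have "\<dots> = (\<Sum>k<2 ^ m. e i m k)" by (rule sum.cong) (use e_fin[OF that] in auto)
      also note e_sum[OF that]
      finally show ?thesis by simp
    qed
    show "(\<lambda>i. \<integral>r. (\<integral>y. mollified 0 (\<sigma> i) r (y + B r \<omega>) * \<phi> r y \<partial>lborel) \<partial>lborel)
       \<longlonglongrightarrow> (\<integral>r. (\<integral>y. b r (y + B r \<omega>) * \<phi> r y \<partial>lborel) \<partial>lborel)"
      if "case_prod \<phi> \<in> borel_measurable (borel \<Otimes>\<^sub>M borel)"
        and le: "\<And>r y. \<bar>\<phi> r y\<bar> \<le> Z * indicator ({0..T} \<times> {-R..R}) (r, y)" and "\<And>r. continuous_on UNIV (\<phi> r)" for \<phi> Z R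
    proof (rule mollified_drift_weak_limit[OF pm \<sigma> that(1) _ that(3), where Z = "\<bar>Z\<bar>"])
      show "\<bar>\<phi> r y\<bar> \<le> \<bar>Z\<bar>" for r y using le[of r y] by (cases "(r, y) \<in> {0..T} \<times> {-R..R}") auto
    qed
  qed
qed

lemma solution_along_path:
  assumes path: "continuous_on UNIV (\<lambda>t. B t \<omega>)" "B 0 \<omega> = 0" and \<gamma>: "0 < \<gamma>" "\<gamma> < 1" and L: "0 \<le> L"
    and holder: "\<And>s t. s \<in> {0..T} \<Longrightarrow> t \<in> {0..T} \<Longrightarrow> \<bar>B t \<omega> - B s \<omega>\<bar> \<le> L * \<bar>t - s\<bar> powr \<gamma>"
    and K: "0 \<le> K" and \<theta>: "0 < \<theta>" "\<theta> < 1" and \<sigma>: "strict_mono (\<sigma> :: nat \<Rightarrow> nat)"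
    and energy: "\<And>i m. m \<le> \<sigma> i \<Longrightarrow> level_energy (\<sigma> i) m \<omega> \<le> ennreal ((K * \<theta> ^ m)\<^sup>2)"
    and u0: "\<And>x. (u0 has_real_derivative u0' x) (at x)" "continuous_on UNIV u0'"
    and b': "AE r in lborel. r \<in> {0..T} \<longrightarrow> (AE x in lborel. b' r x = b r x)"
  shows "\<exists>u. weak_controlled_solution \<gamma> T (geometric_lift (\<lambda>t. B t \<omega>)) b' u0 u"
proof -
  define c where "c r y = b r (y + B r \<omega>)" for r y
  interpret approx: transport_approximation T "Cb * (1 + gauss_mass 0)" K \<theta> u0 u0' \<sigma>
     "\<lambda>i r y. mollified 0 (\<sigma> i) r (y + B r \<omega>)" "\<lambda>i r y. mollified 1 (\<sigma> i) r (y + B r \<omega>)"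
     "\<lambda>i. Cb * gauss_mass 1 * real (Suc (\<sigma> i)) ^ 1" c
     "\<lambda>i m k. sqrt (enn2real ((\<integral>\<^sup>+x. ennreal ((cell_average 1 (\<sigma> i) m k \<omega> x)\<^sup>2) \<partial>lborel)
        + (\<integral>\<^sup>+x. ennreal ((cell_average 2 (\<sigma> i) m k \<omega> x)\<^sup>2) \<partial>lborel)))"
    unfolding c_def[abs_def]
    by (rule transport_approximation_along_path) fact+
  obtain v w where vw: "\<forall>y. v 0 y = u0 y" "\<forall>t\<in>{0..T}. \<forall>y. (v t has_real_derivative w t y) (at y)"
     "\<forall>t. continuous_on UNIV (w t)" "case_prod w \<in> borel_measurable (borel \<Otimes>\<^sub>M borel)"
     "\<forall>R. \<exists>M\<ge>0. \<forall>t\<in>{0..T}. \<forall>y. \<bar>y\<bar> \<le> R \<longrightarrow> \<bar>v t y\<bar> \<le> M \<and> \<bar>w t y\<bar> \<le> M"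
     "\<forall>t\<in>{0..T}. \<forall>\<zeta> R. continuous_on UNIV \<zeta> \<longrightarrow> (\<forall>y. R < \<bar>y\<bar> \<longrightarrow> \<zeta> y = 0) \<longrightarrow>
        (\<integral>y. (v t y - u0 y) * \<zeta> y \<partial>lborel)
          = - (\<integral>r. indicator {0..<t} r * (\<integral>y. c r y * w r y * \<zeta> y \<partial>lborel) \<partial>lborel)"
    using approx.limit_solution by blast
  interpret transported_solution T \<gamma> "Cb * (1 + gauss_mass 0)" L "\<lambda>t. B t \<omega>" u0 v w c
  proof
    show "v 0 y = u0 y" "continuous_on UNIV (w t)" for y t using vw by blast+
    show "(v t has_real_derivative w t y) (at y)" if "t \<in> {0..T}" for t y using vw(2) that by blast
    show "case_prod w \<in> borel_measurable (borel \<Otimes>\<^sub>M borel)" by (rule vw(4))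
    show "\<exists>M\<ge>0. \<forall>t\<in>{0..T}. \<forall>y. \<bar>y\<bar> \<le> R \<longrightarrow> \<bar>v t y\<bar> \<le> M \<and> \<bar>w t y\<bar> \<le> M" for R using vw(5) by blast
    show "(\<integral>y. (v t y - u0 y) * \<zeta> y \<partial>lborel)
          = - (\<integral>r. indicator {0..<t} r * (\<integral>y. c r y * w r y * \<zeta> y \<partial>lborel) \<partial>lborel)"
      if "t \<in> {0..T}" "continuous_on UNIV \<zeta>" "\<And>y. R < \<bar>y\<bar> \<Longrightarrow> \<zeta> y = 0" for t \<zeta> R using vw(6) that by blast
  qed (fact T \<gamma> path holder L approx.c_measurable approx.c_bound approx.C)+
  have "AE r in lborel. r \<in> {0..T} \<longrightarrow> (AE x in lborel. b' r x = c r (x - B r \<omega>))"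
    using b' by (simp add: c_def)
  from weak_controlled_solution_u[OF this] show ?thesis by blast
qed

end

lemma partition_of_bounds:
  assumes "partition_of s t ps" "i < length ps"
  shows "s \<le> ps ! i" "ps ! i \<le> t"
proof -
  have ps: "ps \<noteq> []" "sorted_wrt (<) ps" "ps ! 0 = s" "ps ! (length ps - 1) = t"
    using assms(1) unfolding partition_of_def by (auto simp: hd_conv_nth last_conv_nth)
  show "s \<le> ps ! i" using sorted_wrt_nth_less[OF ps(2), of 0 i] assms(2) ps(3) by (cases "i = 0") auto
  show "ps ! i \<le> t"
  proof (cases "i = length ps - 1")
    case False
    then have "i < length ps - 1" "length ps - 1 < length ps" using assms(2) by linarith+
    from sorted_wrt_nth_less[OF ps(2) this] show ?thesis using ps(4) by simp
  qed (use ps(4) in simp)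
qed

lemma has_rough_integral_cong:
  assumes eq: "\<And>n u v. u \<in> {s..t} \<Longrightarrow> v \<in> {s..t} \<Longrightarrow> X n u v = X' n u v"
  shows "has_rough_integral \<gamma> X Y s t I = has_rough_integral \<gamma> X' Y s t I"
proof -
  have "(\<Sum>i < length ps - 1. \<Sum>n=1..rough_level \<gamma>. Y n (ps ! i) * X n (ps ! i) (ps ! Suc i))
      = (\<Sum>i < length ps - 1. \<Sum>n=1..rough_level \<gamma>. Y n (ps ! i) * X' n (ps ! i) (ps ! Suc i))"
    if "partition_of s t ps" for ps
  proof (intro sum.cong refl)
    fix i n assume "i \<in> {..<length ps - 1}"
    then have "X n (ps ! i) (ps ! Suc i) = X' n (ps ! i) (ps ! Suc i)"
      using partition_of_bounds[OF that, of i] partition_of_bounds[OF that, of "Suc i"] by (intro eq) auto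
    then show "Y n (ps ! i) * X n (ps ! i) (ps ! Suc i) = Y n (ps ! i) * X' n (ps ! i) (ps ! Suc i)" by simp
  qed
  then show ?thesis unfolding has_rough_integral_def by (simp only: cong: imp_cong conj_cong)
qed

text \<open>All notions look at a rough path on \<open>[0, T]\<close> only, whereas the given noise and its regular
  version may differ outside.\<close>

lemma rough_path_predicates_cong:
  assumes eq: "\<And>n s t. s \<in> {0..T} \<Longrightarrow> t \<in> {0..T} \<Longrightarrow> X n s t = X' n s t"
  shows "geometric_rough_path \<gamma> T X \<Longrightarrow> geometric_rough_path \<gamma> T X'"
    and "weak_controlled_solution \<gamma> T X b u0 u \<Longrightarrow> weak_controlled_solution \<gamma> T X' b u0 u"
proof -
  have e: "X' n s t = X n s t" if "0 \<le> s" "s < t" "t \<le> T" for n s t using eq[of s t n] that by simp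
  have d: "rough_dist \<gamma> T X' Z = rough_dist \<gamma> T X Z" for Z
    unfolding rough_dist_def by (intro sum.cong refl SUP_cong) (auto simp: e)
  have p: "rough_path \<gamma> T X' = rough_path \<gamma> T X"
  proof -
    have "(\<forall>s t. 0 \<le> s \<and> s < t \<and> t \<le> T \<longrightarrow> X' 0 s t = 1) = (\<forall>s t. 0 \<le> s \<and> s < t \<and> t \<le> T \<longrightarrow> X 0 s t = 1)"
      by (simp add: e cong: imp_cong conj_cong)
    moreover have "(\<forall>s u t. 0 \<le> s \<and> s < u \<and> u < t \<and> t \<le> T \<longrightarrow> X' n s t = (\<Sum>k\<le>n. X' (n - k) s u * X' k u t))
      = (\<forall>s u t. 0 \<le> s \<and> s < u \<and> u < t \<and> t \<le> T \<longrightarrow> X n s t = (\<Sum>k\<le>n. X (n - k) s u * X k u t))" for n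
    proof (intro iff_allI imp_cong refl)
      fix s u t assume "0 \<le> s \<and> s < u \<and> u < t \<and> t \<le> T"
      then have "X' n s t = X n s t" "X' k s u = X k s u" "X' k u t = X k u t" for k by (auto intro!: e)
      then show "(X' n s t = (\<Sum>k\<le>n. X' (n - k) s u * X' k u t)) = (X n s t = (\<Sum>k\<le>n. X (n - k) s u * X k u t))"
        by simp
    qed
    moreover have "(\<forall>s t. 0 \<le> s \<and> s < t \<and> t \<le> T \<longrightarrow> \<bar>X' n s t\<bar> \<le> C * (t - s) powr (real n * \<gamma>))
      = (\<forall>s t. 0 \<le> s \<and> s < t \<and> t \<le> T \<longrightarrow> \<bar>X n s t\<bar> \<le> C * (t - s) powr (real n * \<gamma>))" for n C
      by (intro iff_allI imp_cong refl) (simp add: e)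
    ultimately show ?thesis unfolding rough_path_def by simp
  qed
  show "geometric_rough_path \<gamma> T X \<Longrightarrow> geometric_rough_path \<gamma> T X'"
    unfolding geometric_rough_path_def p d .
  have c: "controlled_path \<gamma> T X' Y = controlled_path \<gamma> T X Y" for Y
    unfolding controlled_path_def
    by (intro ball_cong refl iff_exI iff_allI imp_cong) (simp add: e)
  have i: "has_rough_integral \<gamma> X' Y 0 t I = has_rough_integral \<gamma> X Y 0 t I" if "t \<in> {0..T}" for Y t I
    by (rule has_rough_integral_cong) (use that in \<open>auto intro!: eq[symmetric]\<close>)
  show "weak_controlled_solution \<gamma> T X b u0 u \<Longrightarrow> weak_controlled_solution \<gamma> T X' b u0 u"
    unfolding weak_controlled_solution_def c by (simp only: i simp_thms cong: ball_cong) (erule conjunct1)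
qed

theorem theorem6p6:
  fixes M :: "'a measure" and B :: "real \<Rightarrow> 'a \<Rightarrow> real"
    and T H \<gamma> :: real and b :: "real \<Rightarrow> real \<Rightarrow> real" and u0 :: "real \<Rightarrow> real"
  assumes "T > 0"
    and "0 < H" and "H < 1 / 6" and "1 / H \<notin> \<int>"
    and "fractional_brownian_motion M H T B"
    and "0 < \<gamma>" and "\<gamma> < H" and "\<lfloor>1 / \<gamma>\<rfloor> = \<lfloor>1 / H\<rfloor>"
    and "drift_Linf T b" and "drift_L1_Linf T b"
    and "u0 C1_differentiable_on UNIV" and "integrable lborel (deriv u0)"
  shows "\<exists>\<Omega>'\<in>sets M. measure M \<Omega>' = 1 \<and>
    (\<forall>\<omega>\<in>\<Omega>'. geometric_rough_path \<gamma> T (geometric_lift (\<lambda>t. B t \<omega>)) \<and>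
       (\<exists>u. weak_controlled_solution \<gamma> T (geometric_lift (\<lambda>t. B t \<omega>)) b u0 u))"
proof -
  obtain bt Cb where bt: "case_prod bt \<in> borel_measurable (borel \<Otimes>\<^sub>M borel)" "\<And>r x. \<bar>bt r x\<bar> \<le> Cb"
    "\<And>r. integrable lborel (bt r)" "integrable lborel (\<lambda>r. \<integral>x. \<bar>bt r x\<bar> \<partial>lborel)"
    and b_bt: "AE r in lborel. r \<in> {0..T} \<longrightarrow> (AE x in lborel. b r x = bt r x)"
    by (rule borel_version_of_drift[OF assms(1,9,10)]) blast
  obtain \<Omega>0 B' where \<Omega>0: "\<Omega>0 \<in> sets M" "measure M \<Omega>0 = 1"
    and B': "case_prod B' \<in> borel_measurable (borel \<Otimes>\<^sub>M M)"
    and B'_cont: "\<And>\<omega>. continuous_on UNIV (\<lambda>t. B' t \<omega>)" and B'_0: "\<And>\<omega>. B' 0 \<omega> = 0"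
    and B'_clamp: "\<And>t \<omega>. B' t \<omega> = B' (max 0 (min T t)) \<omega>"
    and B'_eq: "\<And>\<omega> t. \<omega> \<in> \<Omega>0 \<Longrightarrow> t \<in> {0..T} \<Longrightarrow> B' t \<omega> = B t \<omega>"
    and B'_incr: "\<And>s t. s \<in> {0..T} \<Longrightarrow> t \<in> {0..T} \<Longrightarrow> s \<noteq> t \<Longrightarrow>
       distributed M lborel (\<lambda>\<omega>. B' t \<omega> - B' s \<omega>) (\<lambda>x. ennreal (normal_density 0 (\<bar>t - s\<bar> powr H) x))"
    by (rule fbm_regular_version[OF assms(5,2,1)]) blast
  interpret prob_space M using assms(5) by (simp add: fractional_brownian_motion_def)
  interpret noise: noisy_drift M B' H T Cb bt
  proof
    show "H < 1 / 4" using assms(3) by simp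
  qed (fact assms(1,2) B' bt B'_incr)+
  \<comment> \<open>A Hoelder exponent strictly above \<open>\<gamma>\<close>, as the approximation of the lift by smooth paths requires.\<close>
  define \<alpha> where "\<alpha> = (\<gamma> + H) / 2"
  have \<alpha>: "0 < \<alpha>" "\<alpha> < H" "\<gamma> < \<alpha>" using assms(2,6,7) by (auto simp: \<alpha>_def)
  obtain \<theta> where \<theta>: "0 < \<theta>" "\<theta> < 1" and decay: "AE \<omega> in M. \<exists>K \<sigma>. 0 \<le> K \<and> strict_mono (\<sigma> :: nat \<Rightarrow> nat) \<and>
     (\<forall>i. \<forall>m\<le>\<sigma> i. noise.level_energy (\<sigma> i) m \<omega> \<le> ennreal ((K * \<theta> ^ m)\<^sup>2))"
    using noise.energy_decay_subsequence by blast
  define good where "good \<omega> \<longleftrightarrow> (\<exists>K \<sigma>. 0 \<le> K \<and> strict_mono (\<sigma> :: nat \<Rightarrow> nat) \<and>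
     (\<forall>i. \<forall>m\<le>\<sigma> i. noise.level_energy (\<sigma> i) m \<omega> \<le> ennreal ((K * \<theta> ^ m)\<^sup>2))) \<and>
     (\<exists>L\<ge>0. \<forall>s\<in>{0..T}. \<forall>t\<in>{0..T}. \<bar>B' t \<omega> - B' s \<omega>\<bar> \<le> L * \<bar>t - s\<bar> powr \<alpha>)" for \<omega>
  have "AE \<omega> in M. good \<omega>"
    using decay noise.path_holder_AE[OF \<alpha>(1,2) B'_cont] unfolding good_def by eventually_elim simp
  then obtain N where N: "{\<omega> \<in> space M. \<not> good \<omega>} \<subseteq> N" "emeasure M N = 0" "N \<in> sets M"
    by (rule AE_E)
  have u0': "(u0 has_real_derivative deriv u0 x) (at x)" "continuous_on UNIV (deriv u0)" for x
  proof -
    obtain D where D: "\<And>x. (u0 has_vector_derivative D x) (at x)" "continuous_on UNIV D"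
      using assms(11) unfolding C1_differentiable_on_def by blast
    then have d: "(u0 has_real_derivative D x) (at x)" for x by (simp add: has_real_derivative_iff_has_vector_derivative)
    then have "deriv u0 = D" by (intro ext DERIV_imp_deriv)
    with d D(2) show "(u0 has_real_derivative deriv u0 x) (at x)" "continuous_on UNIV (deriv u0)" by simp_all
  qed
  show ?thesis
  proof (rule bexI[of _ "\<Omega>0 - N"], intro conjI ballI)
    show "\<Omega>0 - N \<in> sets M" using \<Omega>0(1) N(3) by blast
    have "AE \<omega> in M. \<omega> \<in> \<Omega>0 - N"
    proof -
      have "AE \<omega> in M. \<omega> \<in> \<Omega>0" using \<Omega>0 by (simp add: prob_eq_1)
      moreover have "AE \<omega> in M. \<omega> \<notin> N" using N(2,3) by (intro AE_not_in) (auto simp: null_sets_def)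
      ultimately show ?thesis by eventually_elim simp
    qed
    then show "measure M (\<Omega>0 - N) = 1" using \<Omega>0(1) N(3) by (subst prob_eq_1) auto
  next
    fix \<omega> assume \<omega>: "\<omega> \<in> \<Omega>0 - N"
    have lift: "geometric_lift (\<lambda>t. B' t \<omega>) n s t = geometric_lift (\<lambda>t. B t \<omega>) n s t"
      if "s \<in> {0..T}" "t \<in> {0..T}" for n s t
      using B'_eq[of \<omega>] \<omega> that by (simp add: geometric_lift_def)
    have "\<omega> \<in> space M" using \<omega> sets.sets_into_space[OF \<Omega>0(1)] by blast
    then have "good \<omega>" using N(1) \<omega> by blast
    then obtain K \<sigma> L where K: "0 \<le> K" and \<sigma>: "strict_mono (\<sigma> :: nat \<Rightarrow> nat)"
      and energy: "\<And>i m. m \<le> \<sigma> i \<Longrightarrow> noise.level_energy (\<sigma> i) m \<omega> \<le> ennreal ((K * \<theta> ^ m)\<^sup>2)"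
      and L: "0 \<le> L" "\<And>s t. s \<in> {0..T} \<Longrightarrow> t \<in> {0..T} \<Longrightarrow> \<bar>B' t \<omega> - B' s \<omega>\<bar> \<le> L * \<bar>t - s\<bar> powr \<alpha>"
      unfolding good_def by blast
    have global: "\<bar>B' t \<omega> - B' s \<omega>\<bar> \<le> L * \<bar>t - s\<bar> powr \<alpha>" for s t
    proof -
      let ?c = "\<lambda>t. max 0 (min T t)"
      have "\<bar>B' t \<omega> - B' s \<omega>\<bar> = \<bar>B' (?c t) \<omega> - B' (?c s) \<omega>\<bar>" using B'_clamp by metis
      also have "\<dots> \<le> L * \<bar>?c t - ?c s\<bar> powr \<alpha>" by (rule L(2)) (use assms(1) in auto)
      also have "\<dots> \<le> L * \<bar>t - s\<bar> powr \<alpha>"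
        using \<alpha>(1) by (intro mult_left_mono powr_mono2 L(1)) (auto simp: max_def min_def abs_if)
      finally show ?thesis .
    qed
    have "geometric_rough_path \<gamma> T (geometric_lift (\<lambda>t. B' t \<omega>))"
      by (rule holder_geometric_rough_path[OF assms(1,6) \<alpha>(3) L(1) global B'_cont])
    then show "geometric_rough_path \<gamma> T (geometric_lift (\<lambda>t. B t \<omega>))"
      using rough_path_predicates_cong(1)[where X = "geometric_lift (\<lambda>t. B' t \<omega>)", OF lift] by blast
    have "\<exists>u. weak_controlled_solution \<gamma> T (geometric_lift (\<lambda>t. B' t \<omega>)) b u0 u"
    proof (rule noise.solution_along_path[OF B'_cont B'_0 assms(6) _ _ _ K \<theta> \<sigma> energy u0' b_bt])
      show "\<gamma> < 1" using assms(3,7) by simp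
      show "0 \<le> L * T powr (\<alpha> - \<gamma>)" using L(1) by simp
      fix s t assume "s \<in> {0..T}" "t \<in> {0..T}"
      then have "\<bar>t - s\<bar> powr \<alpha> \<le> T powr (\<alpha> - \<gamma>) * \<bar>t - s\<bar> powr \<gamma>"
        using assms(6) \<alpha>(3) by (intro powr_le_on_bounded_interval) auto
      then have "L * \<bar>t - s\<bar> powr \<alpha> \<le> L * (T powr (\<alpha> - \<gamma>) * \<bar>t - s\<bar> powr \<gamma>)" using L(1) by (rule mult_left_mono)
      with global[of t s] show "\<bar>B' t \<omega> - B' s \<omega>\<bar> \<le> L * T powr (\<alpha> - \<gamma>) * \<bar>t - s\<bar> powr \<gamma>"
        by (simp only: mult.assoc)
    qed
    then show "\<exists>u. weak_controlled_solution \<gamma> T (geometric_lift (\<lambda>t. B t \<omega>)) b u0 u"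
      using rough_path_predicates_cong(2)[where X = "geometric_lift (\<lambda>t. B' t \<omega>)", OF lift] by blast
  qed
qed

end
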